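(* Consider a three-dimensional periodic insulating system satisfying the standing assumptions of the context. As $N_{\mathbf k}\to\infty$, the finite-size error in MP2 calculations satisfies $$\left|E^{\rm TDL}_{\rm MP2}-E^{N_{\mathbf k}}_{\rm MP2}\right|=\mathcal O(N_{\mathbf k}^{-1}),$$ and the finite-size error in MP3 calculations satisfies $$\left|E^{\rm TDL}_{\rm MP3}-E^{N_{\mathbf k}}_{\rm MP3}\right|=\mathcal O(N_{\mathbf k}^{-1/3}).$$
   Context: **Setting.** $\Omega\subset\mathbb R^3$ is a unit cell with Bravais lattice $\mathbb L$; $\mathbb L^*$ is the reciprocal lattice and $\Omega^*$ the Brillouin zone (a unit cell of $\mathbb L^*$). $\mathcal K\subset\Omega^*$ is a uniform (Monkhorst-Pack) mesh of size $N_{\mathbf k}^{1/3}\times N_{\mathbf k}^{1/3}\times N_{\mathbf k}^{1/3}$. Orbitals are $\psi_{n\mathbf k}(\mathbf r)=N_{\mathbf k}^{-1/2}e^{\mathrm i\mathbf k\cdot\mathbf r}u_{n\mathbf k}(\mathbf r)$, where $u_{n\mathbf k}$ is periodic with respect to $\Omega$ and, for each $\mathbf k$, the $u_{n\mathbf k}$ are orthonormal in $L^2(\Omega)$; orbital energies are $\varepsilon_{n\mathbf k}$. Band indices $i,j,k,l$ run over $n_{\rm occ}$ occupied bands and $a,b,c,d$ over $n_{\rm vir}$ virtual bands, both finite. Standing assumptions: there is a direct gap between occupied and virtual bands; orbitals and orbital energies are known exactly at every $\mathbf k$ (independently of $N_{\mathbf k}$ apart from the normalization factor); and, in a suitable gauge,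 $\psi_{n\mathbf k}(\mathbf r)$ and $\varepsilon_{n\mathbf k}$ are smooth and $\mathbb L^*$-periodic in $\mathbf k$. **Electron repulsion integrals (ERIs).** For $\mathbf k_1+\mathbf k_2-\mathbf k_3-\mathbf k_4\in\mathbb L^*$ and $\mathbf q=\mathbf k_3-\mathbf k_1$, $$\langle n_1\mathbf k_1,n_2\mathbf k_2|n_3\mathbf k_3,n_4\mathbf k_4\rangle=\frac{4\pi}{|\Omega|}\sum_{\mathbf G\in\mathbb L^*}{}^{'}\frac{1}{|\mathbf q+\mathbf G|^2}\hat\varrho_{n_1\mathbf k_1,n_3(\mathbf k_1+\mathbf q)}(\mathbf G)\,\hat\varrho_{n_2\mathbf k_2,n_4(\mathbf k_2-\mathbf q)}(-\mathbf G),$$ with $\hat\varrho_{n'\mathbf k',n\mathbf k}(\mathbf G)=\langle\psi_{n'\mathbf k'}|e^{\mathrm i(\mathbf k'-\mathbf k-\mathbf G)\cdot\mathbf r}|\psi_{n\mathbf k}\rangle=\int_\Omega\overline{u_{n'\mathbf k'}(\mathbf r)}u_{n\mathbf k}(\mathbf r)e^{-\mathrm i\mathbf G\cdot\mathbf r}\mathrm d\mathbf r$; the prime means the term with $\mathbf q+\mathbf G=\mathbf 0$ is omitted. **Conventions.** A capital letter $P$ denotes the pair $(p,\mathbf k_p)$. Crystal momentum conservation always holds implicitly: $\mathbf k_p+\mathbf k_q-\mathbf k_r-\mathbf k_s\in\mathbb L^*$ in $\langle PQ|RS\rangle$ and $\mathbf k_i+\mathbf k_j-\mathbf k_a-\mathbf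 k_b\in\mathbb L^*$ in $t_{IJ}^{AB}$, $s_{IJ}^{AB}$. Amplitudes are written $t_{IJ}^{AB}=T_{ijab}(\mathbf k_i,\mathbf k_j,\mathbf k_a)$ ($\mathbf k_b$ is determined). A sum over capital letters is over the bands and over the momenta in $\mathcal K$ compatible with momentum conservation. $\varepsilon_{IJ}^{AB}=\varepsilon_I+\varepsilon_J-\varepsilon_A-\varepsilon_B$ and $\mathcal P(\cdots)_{IJ}^{AB}=(\cdots)_{IJ}^{AB}+(\cdots)_{JI}^{BA}$. $W_{ijab}(\mathbf k_i,\mathbf k_j,\mathbf k_a)=2\langle IJ|AB\rangle-\langle IJ|BA\rangle$. **MP2 amplitude.** $s_{IJ}^{AB}=T^{{\rm MP2},N_{\mathbf k}}_{ijab}(\mathbf k_i,\mathbf k_j,\mathbf k_a)=T^{\rm MP2,TDL}_{ijab}(\mathbf k_i,\mathbf k_j,\mathbf k_a)=\langle AB|IJ\rangle/\varepsilon_{IJ}^{AB}$. **MP3 amplitude.** In the finite case, for momenta in $\mathcal K$, $T^{{\rm MP3},N_{\mathbf k}}_{ijab}(\mathbf k_i,\mathbf k_j,\mathbf k_a)$ equals $$\begin{aligned}\frac1{\varepsilon_{IJ}^{AB}}\Big\{&\langle AB|IJ\rangle+\frac1{N_{\mathbf k}}\sum_{KL}\langle KL|IJ\rangle s_{KL}^{AB}+\frac1{N_{\mathbf k}}\sum_{CD}\langle AB|CD\rangle s_{IJ}^{CD}\\&+\mathcal P\Big(\frac1{N_{\mathbf k}}\sum_{KC}\big[(2\langle AK|IC\rangle-\langle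 AK|CI\rangle)s_{KJ}^{CB}-\langle AK|IC\rangle s_{KJ}^{BC}-\langle AK|CJ\rangle s_{KI}^{BC}\big]\Big)\Big\}.\end{aligned}$$ In the thermodynamic limit (TDL), $T^{\rm MP3,TDL}_{ijab}(\mathbf k_i,\mathbf k_j,\mathbf k_a)$, for momenta in $\Omega^*$, is given by the same formula with each average $\frac1{N_{\mathbf k}}\sum_{\mathbf k\in\mathcal K}$ over the free intermediate momentum replaced by $\frac1{|\Omega^*|}\int_{\Omega^*}\mathrm d\mathbf k$. **Energies.** For $\#\in\{\mathrm{MP2},\mathrm{MP3}\}$, $$E^{N_{\mathbf k}}_\#=\frac1{N_{\mathbf k}^3}\sum_{\mathbf k_i,\mathbf k_j,\mathbf k_a\in\mathcal K}\sum_{ijab}W_{ijab}T^{\#,N_{\mathbf k}}_{ijab}(\mathbf k_i,\mathbf k_j,\mathbf k_a),\qquad E^{\rm TDL}_\#=\frac1{|\Omega^*|^3}\int_{(\Omega^* )^3}\sum_{ijab}W_{ijab}T^{\#,\rm TDL}_{ijab}\,\mathrm d\mathbf k_i\mathrm d\mathbf k_j\mathrm d\mathbf k_a.$$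
   Formalization: Besides the direct gap, the energy denominators are assumed nonzero under momentum conservation, so that amplitudes are defined; smoothness in k includes that all k-derivatives of the orbitals are bounded for bounded k and r, so that the ERI series converge. *)

theory Defs
  imports "HOL-Analysis.Analysis" "HOL-Library.Landau_Symbols"
begin

section \<open>Lattices, unit cells and meshes\<close>

definition bravais_lattice :: "(real^3) set \<Rightarrow> bool" where
  "bravais_lattice L \<longleftrightarrow>
     (\<exists>a :: real^3^3. invertible a \<and>
        L = {(\<Sum>j\<in>UNIV. real_of_int (m j) *\<^sub>R a $ j) | m :: 3 \<Rightarrow> int. True})"

definition reciprocal_lattice :: "(real^3) set \<Rightarrow> (real^3) set" where
  "reciprocal_lattice L = {G. \<forall>R\<in>L. \<exists>m :: int. G \<bullet> R = 2 * pi * real_of_int m}"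

text \<open>Cells are exact fundamental domains (boundary points are not duplicated), so that a mesh
  point is never counted twice.\<close>

definition unit_cell :: "(real^3) set \<Rightarrow> (real^3) set \<Rightarrow> bool" where
  "unit_cell L S \<longleftrightarrow> S \<in> sets borel \<and> bounded S \<and> (\<forall>x. \<exists>!R. R \<in> L \<and> x - R \<in> S)"


section \<open>Smoothness\<close>

primrec iter_deriv ::
  "'a::real_normed_vector list \<Rightarrow> ('a \<Rightarrow> 'b::real_normed_vector) \<Rightarrow> 'a \<Rightarrow> 'b" where
  "iter_deriv [] f = f"
| "iter_deriv (v # vs) f = (\<lambda>x. frechet_derivative (iter_deriv vs f) (at x) v)"

definition smooth :: "('a::real_normed_vector \<Rightarrow> 'b::real_normed_vector) \<Rightarrow> bool" where
  "smooth f \<longleftrightarrow> (\<forall>vs x. iter_deriv vs f differentiable (at x))"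

text \<open>For a function of \<open>k\<close> and \<open>r\<close>: smooth in \<open>k\<close>, with \<open>k\<close>-derivatives bounded on bounded sets
  of \<open>(k, r)\<close>. Apart from measurability nothing is required of the dependence on \<open>r\<close>. Some such
  bound is indispensable: mere \<open>L\<^sup>2\<close> control in \<open>r\<close> does not make the electron repulsion integrals
  converge.\<close>

definition smooth_in_k :: "(real^3 \<Rightarrow> real^3 \<Rightarrow> complex) \<Rightarrow> bool" where
  "smooth_in_k f \<longleftrightarrow>
     (\<forall>k. f k \<in> borel_measurable borel) \<and>
     (\<forall>r. smooth (\<lambda>k. f k r)) \<and>
     (\<forall>vs \<rho>. \<exists>C. \<forall>k r. norm k \<le> \<rho> \<longrightarrow> norm r \<le> \<rho> \<longrightarrow>
        norm (iter_deriv vs (\<lambda>k. f k r) k) \<le> C)"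


section \<open>Periodic systems\<close>

text \<open>Bands \<open>0, \<dots>, n_occ - 1\<close> are occupied, the next \<open>n_vir\<close> ones virtual.\<close>

record crystal =
  lattice :: "(real^3) set"
  cell :: "(real^3) set"
  bz :: "(real^3) set"
  n_occ :: nat
  n_vir :: nat
  bloch_u :: "nat \<Rightarrow> real^3 \<Rightarrow> real^3 \<Rightarrow> complex"
  energy :: "nat \<Rightarrow> real^3 \<Rightarrow> real"

abbreviation rlattice :: "crystal \<Rightarrow> (real^3) set" where
  "rlattice X \<equiv> reciprocal_lattice (lattice X)"

definition occ :: "crystal \<Rightarrow> nat set" where
  "occ X = {..<n_occ X}"

definition vir :: "crystal \<Rightarrow> nat set" where
  "vir X = {n_occ X..<n_occ X + n_vir X}"

text \<open>The orbital without its normalization factor \<open>N\<^sub>k powr (-1/2)\<close>, the only part of it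
  depending on the mesh.\<close>

definition orbital :: "crystal \<Rightarrow> nat \<Rightarrow> real^3 \<Rightarrow> real^3 \<Rightarrow> complex" where
  "orbital X n k r = exp (\<i> * complex_of_real (k \<bullet> r)) * bloch_u X n k r"

text \<open>A band with a crystal momentum; written with capital letters.\<close>

type_synonym bandk = "nat \<times> (real^3)"

definition orb_energy :: "crystal \<Rightarrow> bandk \<Rightarrow> real" where
  "orb_energy X P = energy X (fst P) (snd P)"

definition denom :: "crystal \<Rightarrow> bandk \<Rightarrow> bandk \<Rightarrow> bandk \<Rightarrow> bandk \<Rightarrow> real" where
  "denom X I J A B = orb_energy X I + orb_energy X J - orb_energy X A - orb_energy X B"

text \<open>The last conjunct of the following definition says that the amplitudes are well-defined. It
  follows from a gap \<open>\<epsilon> i k < \<epsilon> a k'\<close> for all \<open>k\<close>, \<open>k'\<close>, but not from the direct gap (same \<open>k\<close>)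
  alone.\<close>

definition insulating_system :: "crystal \<Rightarrow> bool" where
  "insulating_system X \<longleftrightarrow>
     bravais_lattice (lattice X) \<and>
     unit_cell (lattice X) (cell X) \<and>
     unit_cell (rlattice X) (bz X) \<and>
     (\<forall>n\<in>occ X \<union> vir X. \<forall>k r. \<forall>R\<in>lattice X. bloch_u X n k (r + R) = bloch_u X n k r) \<and>
     (\<forall>m\<in>occ X \<union> vir X. \<forall>n\<in>occ X \<union> vir X. \<forall>k.
        (LINT r:cell X|lborel. cnj (bloch_u X m k r) * bloch_u X n k r) = (if m = n then 1 else 0)) \<and>
     (\<forall>n\<in>occ X \<union> vir X. smooth_in_k (orbital X n) \<and> smooth (energy X n)) \<and>
     (\<forall>n\<in>occ X \<union> vir X. \<forall>k. \<forall>G\<in>rlattice X.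
        (\<forall>r. orbital X n (k + G) r = orbital X n k r) \<and> energy X n (k + G) = energy X n k) \<and>
     (\<forall>i\<in>occ X. \<forall>a\<in>vir X. \<forall>k. energy X i k < energy X a k) \<and>
     (\<forall>i\<in>occ X. \<forall>j\<in>occ X. \<forall>a\<in>vir X. \<forall>b\<in>vir X. \<forall>ki kj ka kb.
        ki + kj - ka - kb \<in> rlattice X \<longrightarrow> denom X (i, ki) (j, kj) (a, ka) (b, kb) \<noteq> 0)"

text \<open>The uniform mesh with \<open>n\<close> points per direction, with an arbitrary offset \<open>s\<close> (which for
  Monkhorst-Pack meshes may depend on \<open>n\<close>). As \<open>bz X\<close> is a fundamental domain, it has
  \<open>N\<^sub>k = n ^ 3\<close> points for \<open>n > 0\<close>.\<close>

definition mesh :: "crystal \<Rightarrow> nat \<Rightarrow> real^3 \<Rightarrow> (real^3) set" where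
  "mesh X n s = {k \<in> bz X. \<exists>G\<in>rlattice X. k = s + (1 / real n) *\<^sub>R G}"


section \<open>Electron repulsion integrals\<close>

definition pair_density ::
  "crystal \<Rightarrow> bandk \<Rightarrow> bandk \<Rightarrow> real^3 \<Rightarrow> complex" where
  "pair_density X P Q G =
     (LINT r:cell X|lborel. cnj (bloch_u X (fst P) (snd P) r) * bloch_u X (fst Q) (snd Q) r
        * exp (- \<i> * complex_of_real (G \<bullet> r)))"

text \<open>By momentum conservation the momentum of the last argument is \<open>k2 - q\<close> up to a reciprocal
  lattice vector, and the value does not depend on that vector.\<close>

definition eri :: "crystal \<Rightarrow> bandk \<Rightarrow> bandk \<Rightarrow> bandk \<Rightarrow> bandk \<Rightarrow> complex" where
  "eri X P1 P2 P3 P4 =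
     (let k1 = snd P1; k2 = snd P2; k3 = snd P3; q = k3 - k1 in
       complex_of_real (4 * pi / measure lborel (cell X)) *
       (\<Sum>\<^sub>\<infinity>G\<in>{G \<in> rlattice X. q + G \<noteq> 0}.
          complex_of_real (1 / (norm (q + G))\<^sup>2)
          * pair_density X P1 (fst P3, k1 + q) G
          * pair_density X P2 (fst P4, k2 - q) (- G)))"


section \<open>Amplitudes\<close>

text \<open>The two averages over a free momentum. They are the only difference between the finite mesh
  and the thermodynamic limit.\<close>

definition mesh_avg :: "(real^3) set \<Rightarrow> (real^3 \<Rightarrow> complex) \<Rightarrow> complex" where
  "mesh_avg K f = (\<Sum>k\<in>K. f k) / of_nat (card K)"

definition bz_avg :: "crystal \<Rightarrow> (real^3 \<Rightarrow> complex) \<Rightarrow> complex" where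
  "bz_avg X f = (LINT k:bz X|lborel. f k) / complex_of_real (measure lborel (bz X))"

definition mp2_amp :: "crystal \<Rightarrow> bandk \<Rightarrow> bandk \<Rightarrow> bandk \<Rightarrow> bandk \<Rightarrow> complex" where
  "mp2_amp X I J A B = eri X A B I J / complex_of_real (denom X I J A B)"

text \<open>In the intermediate sums one momentum \<open>k\<close> is free, and momentum conservation determines the
  other one up to a reciprocal lattice vector, which is irrelevant by periodicity.\<close>

definition mp3_ring ::
  "crystal \<Rightarrow> ((real^3 \<Rightarrow> complex) \<Rightarrow> complex) \<Rightarrow> bandk \<Rightarrow> bandk \<Rightarrow> bandk \<Rightarrow> bandk \<Rightarrow> complex" where
  "mp3_ring X avg I J A B =
     avg (\<lambda>k. \<Sum>k'\<in>occ X. \<Sum>c\<in>vir X.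
       (let K = (k', k);
            C = (c, snd A + k - snd I);
            C' = (c, snd A + k - snd J)
        in (2 * eri X A K I C - eri X A K C I) * mp2_amp X K J C B
           - eri X A K I C * mp2_amp X K J B C
           - eri X A K C' J * mp2_amp X K I B C'))"

definition mp3_amp ::
  "crystal \<Rightarrow> ((real^3 \<Rightarrow> complex) \<Rightarrow> complex) \<Rightarrow> bandk \<Rightarrow> bandk \<Rightarrow> bandk \<Rightarrow> bandk \<Rightarrow> complex" where
  "mp3_amp X avg I J A B =
     (eri X A B I J
      + avg (\<lambda>k. \<Sum>k'\<in>occ X. \<Sum>l\<in>occ X.
          (let K = (k', k); L = (l, snd I + snd J - k)
           in eri X K L I J * mp2_amp X K L A B))
      + avg (\<lambda>k. \<Sum>c\<in>vir X. \<Sum>d\<in>vir X.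
          (let C = (c, k); D = (d, snd I + snd J - k)
           in eri X A B C D * mp2_amp X I J C D))
      + (mp3_ring X avg I J A B + mp3_ring X avg J I B A))
     / complex_of_real (denom X I J A B)"


section \<open>Energies\<close>

definition W :: "crystal \<Rightarrow> bandk \<Rightarrow> bandk \<Rightarrow> bandk \<Rightarrow> bandk \<Rightarrow> complex" where
  "W X I J A B = 2 * eri X I J A B - eri X I J B A"

definition energy_summand ::
  "crystal \<Rightarrow> (bandk \<Rightarrow> bandk \<Rightarrow> bandk \<Rightarrow> bandk \<Rightarrow> complex) \<Rightarrow> real^3 \<Rightarrow> real^3 \<Rightarrow> real^3 \<Rightarrow> complex"
where
  "energy_summand X T ki kj ka =
     (\<Sum>i\<in>occ X. \<Sum>j\<in>occ X. \<Sum>a\<in>vir X. \<Sum>b\<in>vir X.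
       (let I = (i, ki); J = (j, kj); A = (a, ka); B = (b, ki + kj - ka)
        in W X I J A B * T I J A B))"

definition mesh_energy ::
  "crystal \<Rightarrow> (real^3) set \<Rightarrow> (bandk \<Rightarrow> bandk \<Rightarrow> bandk \<Rightarrow> bandk \<Rightarrow> complex) \<Rightarrow> complex" where
  "mesh_energy X K T =
     (\<Sum>ki\<in>K. \<Sum>kj\<in>K. \<Sum>ka\<in>K. energy_summand X T ki kj ka) / of_nat (card K) ^ 3"

definition tdl_energy ::
  "crystal \<Rightarrow> (bandk \<Rightarrow> bandk \<Rightarrow> bandk \<Rightarrow> bandk \<Rightarrow> complex) \<Rightarrow> complex" where
  "tdl_energy X T =
     (LINT p:bz X \<times> bz X \<times> bz X|lborel. (case p of (ki, kj, ka) \<Rightarrow> energy_summand X T ki kj ka))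
     / complex_of_real (measure lborel (bz X)) ^ 3"

definition mp2_energy :: "crystal \<Rightarrow> (real^3) set \<Rightarrow> complex" where
  "mp2_energy X K = mesh_energy X K (mp2_amp X)"

definition mp2_energy_tdl :: "crystal \<Rightarrow> complex" where
  "mp2_energy_tdl X = tdl_energy X (mp2_amp X)"

definition mp3_energy :: "crystal \<Rightarrow> (real^3) set \<Rightarrow> complex" where
  "mp3_energy X K = mesh_energy X K (mp3_amp X (mesh_avg K))"

definition mp3_energy_tdl :: "crystal \<Rightarrow> complex" where
  "mp3_energy_tdl X = tdl_energy X (mp3_amp X (bz_avg X))"

end

theory Submission
  imports Defs
begin

text \<open>On the mesh and in the limit alike, each energy is the average of one fixed function \<open>P\<close> of four
momenta: the external \<open>k\<^sub>i\<close>, \<open>k\<^sub>j\<close>, \<open>k\<^sub>a\<close> and the free intermediate \<open>k\<close> (on which the MP2 integrand does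
not depend). \<open>P\<close> is periodic under the reciprocal lattice, so the theorem is a statement about the
quadrature error of mesh averages, and the rates are decided by the singularities of \<open>P\<close>.

\<^bold>\<open>Singularities.\<close> An electron repulsion integral with momentum transfer \<open>q\<close> is singular only where \<open>q\<close> is a
reciprocal lattice vector, because of the terms \<open>1 / |q + G|\<^sup>2\<close> with small \<open>q + G\<close>. If both pair densities
combine different bands, then they are \<open>O(|q + G|)\<close> by orthonormality (\<open>pairint_small\<close>) and cancel this
factor: the integral is bounded, but in general not continuous (order \<open>\<gamma> = 0\<close> below). Otherwise it may be of size
\<open>|q|\<close> to the power \<open>-2\<close> (order \<open>\<gamma> = 1\<close>). The integrals in the MP2 energy all pair occupied with virtual bands, so
its integrand has order 0. Each product in the MP3 energy contains at most one integral of order 1.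

\<^bold>\<open>Quadrature.\<close> The average over the mesh with \<open>2 n\<close> points per direction is the mean of the averages over
translates of the mesh with \<open>n\<close> points by half steps. Translating twice by the same half step gives the
mesh with \<open>n\<close> points back; therefore the difference of the averages over a mesh and its translate, though a
difference of first order, is controlled by mesh averages of differences of arbitrarily high order
(\<open>gavg_halve\<close>). With the step \<open>h = 1 / (2 n)\<close>, the differences of order six of \<open>P\<close> at a point of distance
\<open>d\<close> from the singularities are of size \<open>h\<close> to the power \<open>-2 \<gamma>\<close> times \<open>(h / max h d)^6\<close>; this is the content
of the notion \<open>tame\<close>. The mesh average of the latter factor is \<open>O(h^3)\<close>, because the sixth inverse powers of the norms of
lattice vectors are summable (\<open>proximity_average\<close>). So passing from \<open>n\<close> to \<open>2 n\<close> changes the average by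
\<open>O(n^(2 \<gamma> - 3))\<close>. Summing over \<open>n\<close>, \<open>2 n\<close>, \<open>4 n\<close>, \<dots> bounds the distance from the limit of the averages
(\<open>gavg_error\<close>), which is the integral by dominated convergence (\<open>tame_grid_limit\<close>). With \<open>N\<^sub>k = n^3\<close> this is
\<open>O(1 / N\<^sub>k)\<close> for MP2 and \<open>O(N\<^sub>k powr (- 1 / 3))\<close> for MP3.

\<^bold>\<open>Sums over \<open>G\<close>.\<close> The orbitals are smooth in the momentum but only measurable in the position, so pair
densities need not decay at any rate in \<open>G\<close>. Bessel's inequality, applied to all differences of their
amplitudes, still gives difference bounds with square summable constants (\<open>fourier_dbound\<close>), and the two
pair densities in an integral make them summable (\<open>eri_far\<close>). Within a few steps of a singularity the
sizes of the values on the mesh suffice (\<open>eri_lattice_steps\<close>).\<close>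

section \<open>Finite differences\<close>

definition fdiff :: "(nat \<Rightarrow> 'a::ab_group_add) \<Rightarrow> nat \<Rightarrow> 'a" where
  "fdiff f j = f (Suc j) - f j"

text \<open>The \<open>i\<close>-th differences of \<open>f\<close> within the window \<open>{0..m}\<close> are at most \<open>C * \<delta> ^ i\<close>: in units of the step,
\<open>1 / \<delta>\<close> plays the role of the distance from a singularity. Values and lower differences are
included so that products and inverses can be treated by induction on \<open>m\<close>.\<close>

definition dbound :: "nat \<Rightarrow> (nat \<Rightarrow> 'a::real_normed_vector) \<Rightarrow> real \<Rightarrow> real \<Rightarrow> bool" where
  "dbound m f C \<delta> \<longleftrightarrow> (\<forall>i j. i + j \<le> m \<longrightarrow> norm ((fdiff ^^ i) f j) \<le> C * \<delta> ^ i)"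

lemma dbound_0: "dbound 0 f C \<delta> \<longleftrightarrow> norm (f 0) \<le> C"
  by (simp add: dbound_def)

lemma dbound_Suc:
  "dbound (Suc m) f C \<delta> \<longleftrightarrow> (\<forall>j\<le>Suc m. norm (f j) \<le> C) \<and> dbound m (fdiff f) (C * \<delta>) \<delta>"
proof -
  have "dbound (Suc m) f C \<delta> \<longleftrightarrow>
      (\<forall>j\<le>Suc m. norm (f j) \<le> C) \<and> (\<forall>i j. Suc i + j \<le> Suc m \<longrightarrow> norm ((fdiff ^^ Suc i) f j) \<le> C * \<delta> ^ Suc i)"
    unfolding dbound_def
    apply (rule iffI)
    subgoal by (metis add_0 funpow_0 mult.right_neutral power_0)
    subgoal
      apply (intro allI impI)
      subgoal for i j by (cases i) auto
      done
    done
  then show ?thesis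
    by (simp add: dbound_def funpow_swap1 mult.assoc del: funpow.simps) (simp add: funpow_swap1 mult.assoc)
qed

lemma dboundD: "dbound m f C \<delta> \<Longrightarrow> i + j \<le> m \<Longrightarrow> norm ((fdiff ^^ i) f j) \<le> C * \<delta> ^ i"
  by (simp add: dbound_def)

lemma dbound_value: "dbound m f C \<delta> \<Longrightarrow> j \<le> m \<Longrightarrow> norm (f j) \<le> C"
  using dboundD[of m f C \<delta> 0 j] by simp

lemma dbound_nonneg: "dbound m f C \<delta> \<Longrightarrow> 0 \<le> C"
  using dbound_value[of m f C \<delta> 0] norm_ge_zero order_trans by blast

lemma dbound_le: "dbound m f C \<delta> \<Longrightarrow> k \<le> m \<Longrightarrow> dbound k f C \<delta>"
  by (simp add: dbound_def)

lemma fdiff_funpow_shift: "(fdiff ^^ i) (\<lambda>j. f (Suc j)) j = (fdiff ^^ i) f (Suc j)"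
  by (induction i arbitrary: j) (simp_all add: fdiff_def)

lemma fdiff_funpow_add: "(fdiff ^^ i) (\<lambda>j. f j + g j) j = (fdiff ^^ i) f j + (fdiff ^^ i) g j"
  by (induction i arbitrary: j) (simp_all add: fdiff_def)

lemma fdiff_funpow_sum: "(fdiff ^^ i) (\<lambda>j. \<Sum>x\<in>A. f x j) j = (\<Sum>x\<in>A. (fdiff ^^ i) (f x) j)"
  by (induction i arbitrary: j) (simp_all add: fdiff_def sum_subtractf)

lemma fdiff_funpow_mult:
  fixes c :: "'a::ring" shows "(fdiff ^^ i) (\<lambda>j. c * f j) j = c * (fdiff ^^ i) f j"
  by (induction i arbitrary: j) (simp_all add: fdiff_def algebra_simps)

lemma dbound_shift: "dbound (Suc m) f C \<delta> \<Longrightarrow> dbound m (\<lambda>j. f (Suc j)) C \<delta>"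
  by (simp add: dbound_def fdiff_funpow_shift)

lemma dbound_mono:
  assumes "dbound m f C \<delta>" "C \<le> C'" "0 \<le> \<delta>" "\<delta> \<le> \<delta>'"
  shows "dbound m f C' \<delta>'"
  unfolding dbound_def
proof (intro allI impI)
  fix i j assume "i + j \<le> m"
  then have "norm ((fdiff ^^ i) f j) \<le> C * \<delta> ^ i" using assms(1) by (rule dboundD[rotated])
  also have "\<dots> \<le> C' * \<delta>' ^ i"
    using assms dbound_nonneg[OF assms(1)] by (intro mult_mono power_mono) auto
  finally show "norm ((fdiff ^^ i) f j) \<le> C' * \<delta>' ^ i" .
qed

lemma dbound_rescale:
  assumes "dbound m f C (\<kappa> * \<delta>)" "1 \<le> \<kappa>" "0 \<le> \<delta>"
  shows "dbound m f (C * \<kappa> ^ m) \<delta>"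
  unfolding dbound_def
proof (intro allI impI)
  fix i j assume ij: "i + j \<le> m"
  then have "norm ((fdiff ^^ i) f j) \<le> C * (\<kappa> * \<delta>) ^ i" using assms(1) by (rule dboundD[rotated])
  also have "\<dots> = C * \<kappa> ^ i * \<delta> ^ i" by (simp add: power_mult_distrib)
  also have "\<dots> \<le> C * \<kappa> ^ m * \<delta> ^ i"
    using assms dbound_nonneg[OF assms(1)] ij by (intro mult_right_mono mult_left_mono power_increasing) auto
  finally show "norm ((fdiff ^^ i) f j) \<le> C * \<kappa> ^ m * \<delta> ^ i" .
qed

lemma dbound_add:
  "dbound m f A \<delta> \<Longrightarrow> dbound m g B \<delta> \<Longrightarrow> dbound m (\<lambda>j. f j + g j) (A + B) \<delta>"
  unfolding dbound_def fdiff_funpow_add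
  by (metis (no_types, lifting) add_mono distrib_right norm_triangle_le)

lemma dbound_cmult:
  fixes c :: complex
  assumes "dbound m f A \<delta>"
  shows "dbound m (\<lambda>j. c * f j) (norm c * A) \<delta>"
  using assms unfolding dbound_def fdiff_funpow_mult
  by (auto simp: norm_mult mult.assoc intro!: mult_left_mono)

lemma dbound_const: "norm c \<le> C \<Longrightarrow> 0 \<le> \<delta> \<Longrightarrow> dbound m (\<lambda>_. c) C \<delta>"
proof (induction m arbitrary: c C)
  case 0 then show ?case by (simp add: dbound_0)
next
  case (Suc m)
  have "0 \<le> C" using Suc.prems norm_ge_zero order_trans by blast
  moreover have "fdiff (\<lambda>_. c) = (\<lambda>_. 0)" by (auto simp: fdiff_def)
  ultimately show ?case using Suc.prems Suc.IH[of 0 "C * \<delta>"] by (simp add: dbound_Suc)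
qed

text \<open>The discrete Leibniz rule \<open>\<Delta> (f * g) = S f * \<Delta> g + \<Delta> f * g\<close> with the shift \<open>S\<close>; its two summands account
for the factor 2 per order.\<close>

lemma dbound_mult:
  fixes f g :: "nat \<Rightarrow> 'a::real_normed_algebra"
  assumes "dbound m f A \<delta>" "dbound m g B \<delta>" "0 \<le> \<delta>"
  shows "dbound m (\<lambda>j. f j * g j) (2 ^ m * A * B) \<delta>"
  using assms
proof (induction m arbitrary: f g A B)
  case 0
  then show ?case
    by (simp add: dbound_0) (meson mult_mono norm_ge_zero norm_mult_ineq order_trans)
next
  case (Suc m)
  have A: "0 \<le> A" and B: "0 \<le> B" using Suc.prems dbound_nonneg by blast+
  have f: "\<And>j. j \<le> Suc m \<Longrightarrow> norm (f j) \<le> A" "dbound m (fdiff f) (A * \<delta>) \<delta>"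
   and g: "\<And>j. j \<le> Suc m \<Longrightarrow> norm (g j) \<le> B" "dbound m (fdiff g) (B * \<delta>) \<delta>"
    using Suc.prems by (auto simp: dbound_Suc)
  have fs: "dbound m (\<lambda>j. f (Suc j)) A \<delta>" and gm: "dbound m g B \<delta>"
    using Suc.prems dbound_shift dbound_le by (blast, meson le_SucI order_refl dbound_le)
  have "fdiff (\<lambda>j. f j * g j) = (\<lambda>j. f (Suc j) * fdiff g j + fdiff f j * g j)"
    by (auto simp: fdiff_def algebra_simps)
  moreover have "dbound m (\<lambda>j. f (Suc j) * fdiff g j + fdiff f j * g j)
      (2 ^ m * A * (B * \<delta>) + 2 ^ m * (A * \<delta>) * B) \<delta>"
    by (intro dbound_add Suc.IH fs g f gm Suc.prems)
  moreover have "norm (f j * g j) \<le> 2 ^ Suc m * A * B" if "j \<le> Suc m" for j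
  proof -
    have "norm (f j * g j) \<le> A * B"
      using f(1)[OF that] g(1)[OF that] A by (meson mult_mono norm_ge_zero norm_mult_ineq order_trans)
    also have "\<dots> \<le> 2 ^ Suc m * (A * B)"
      using A B by (metis mult_nonneg_nonneg one_le_numeral one_le_power mult_le_cancel_right1 not_less)
    finally show ?thesis by (simp add: mult.assoc)
  qed
  ultimately show ?case by (simp add: dbound_Suc algebra_simps)
qed

text \<open>By induction through \<open>\<Delta> (1 / g) = - \<Delta> g / (g * S g)\<close> with the shift \<open>S\<close>. The constant is chosen before
\<open>g\<close> and \<open>\<delta>\<close>, because it has to serve all meshes at once.\<close>

lemma dbound_inverse:
  assumes "0 < c"
  shows "\<exists>K\<ge>0. \<forall>(g :: nat \<Rightarrow> 'a::real_normed_field) \<delta>. 0 \<le> \<delta> \<longrightarrow> dbound m g C \<delta> \<longrightarrow>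
           (\<forall>j\<le>m. c \<le> norm (g j)) \<longrightarrow> dbound m (\<lambda>j. inverse (g j)) K \<delta>"
proof (induction m)
  case 0
  show ?case
    by (rule exI[of _ "inverse c"])
       (use assms in \<open>auto simp: dbound_0 norm_inverse intro!: le_imp_inverse_le\<close>)
next
  case (Suc m)
  then obtain K where K: "0 \<le> K"
    "\<And>(g :: nat \<Rightarrow> 'a) \<delta>. 0 \<le> \<delta> \<Longrightarrow> dbound m g C \<delta> \<Longrightarrow> (\<forall>j\<le>m. c \<le> norm (g j)) \<Longrightarrow>
       dbound m (\<lambda>j. inverse (g j)) K \<delta>"
    by blast
  define K' where "K' = max (inverse c) (2 ^ m * (2 ^ m * \<bar>C\<bar> * K) * K)"
  show ?case
  proof (intro exI conjI allI impI)
    show "0 \<le> K'" using assms by (simp add: K'_def le_max_iff_disj)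
  next
    fix g :: "nat \<Rightarrow> 'a" and \<delta> :: real
    assume \<delta>: "0 \<le> \<delta>" and g: "dbound (Suc m) g C \<delta>" and c: "\<forall>j\<le>Suc m. c \<le> norm (g j)"
    have C: "0 \<le> C" using g dbound_nonneg by blast
    have 1: "dbound m (\<lambda>j. inverse (g j)) K \<delta>"
      using g c by (intro K \<delta>) (auto intro: dbound_le)
    have 2: "dbound m (\<lambda>j. inverse (g (Suc j))) K \<delta>"
      using dbound_shift[OF g] c by (intro K \<delta>) auto
    have 3: "dbound m (\<lambda>j. - fdiff g j) (C * \<delta>) \<delta>"
      using g unfolding dbound_Suc
      using dbound_def fdiff_funpow_mult[of _ "-1" "fdiff g"] by (simp add: dbound_def)
    have 4: "dbound m (\<lambda>j. (- fdiff g j * inverse (g j)) * inverse (g (Suc j)))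
        (2 ^ m * (2 ^ m * (C * \<delta>) * K) * K) \<delta>"
      by (intro dbound_mult 1 2 3 \<delta>)
    have "- fdiff g j * inverse (g j) * inverse (g (Suc j)) = fdiff (\<lambda>j. inverse (g j)) j" if "j \<le> m" for j
    proof -
      have "0 < norm (g j)" "0 < norm (g (Suc j))"
        using c that assms by (meson le_SucI less_le_trans Suc_le_mono)+
      then have "g j \<noteq> 0" "g (Suc j) \<noteq> 0" by auto
      then show ?thesis by (simp add: fdiff_def field_simps)
    qed
    then have 5: "(fdiff ^^ i) (fdiff (\<lambda>j. inverse (g j))) j = (fdiff ^^ i) (\<lambda>j. - fdiff g j * inverse (g j) * inverse (g (Suc j))) j"
      if "i + j \<le> m" for i j
      using that by (induction i arbitrary: j) (auto simp: fdiff_def)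
    have "dbound m (fdiff (\<lambda>j. inverse (g j))) (2 ^ m * (2 ^ m * (C * \<delta>) * K) * K) \<delta>"
      using 4 unfolding dbound_def by (auto simp: 5)
    then have "dbound m (fdiff (\<lambda>j. inverse (g j))) (K' * \<delta>) \<delta>"
    proof (rule dbound_mono)
      have "2 ^ m * (2 ^ m * (C * \<delta>) * K) * K = (2 ^ m * (2 ^ m * \<bar>C\<bar> * K) * K) * \<delta>"
        using C by simp
      also have "\<dots> \<le> K' * \<delta>" unfolding K'_def using \<delta> by (intro mult_right_mono) auto
      finally show "2 ^ m * (2 ^ m * (C * \<delta>) * K) * K \<le> K' * \<delta>" .
    qed (use \<delta> in auto)
    moreover have "norm (inverse (g j)) \<le> K'" if "j \<le> Suc m" for j
    proof -
      have "norm (inverse (g j)) \<le> inverse c"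
        using c that assms by (simp add: norm_inverse le_imp_inverse_le)
      then show ?thesis by (simp add: K'_def)
    qed
    ultimately show "dbound (Suc m) (\<lambda>j. inverse (g j)) K' \<delta>" by (simp add: dbound_Suc)
  qed
qed

text \<open>Where the ratio \<open>\<delta>\<close> is bounded below, a bound on the values is as good as one on differences. This
replaces smoothness close to singularities.\<close>

lemma dbound_crude:
  assumes "\<And>j. j \<le> m \<Longrightarrow> norm (f j) \<le> C" "0 < \<kappa>" "\<kappa> \<le> 1" "\<kappa> \<le> \<delta>"
  shows "dbound m f (2 ^ m * C / \<kappa> ^ m) \<delta>"
  unfolding dbound_def
proof (intro allI impI)
  have C: "0 \<le> C" using assms(1)[of 0] norm_ge_zero order_trans by blast
  fix i j assume ij: "i + j \<le> m"
  have "norm ((fdiff ^^ i) f j) \<le> 2 ^ i * C"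
    using ij
  proof (induction i arbitrary: j)
    case (Suc i)
    then have "norm ((fdiff ^^ i) f j) \<le> 2 ^ i * C" "norm ((fdiff ^^ i) f (Suc j)) \<le> 2 ^ i * C" by auto
    moreover have "(fdiff ^^ Suc i) f j = (fdiff ^^ i) f (Suc j) - (fdiff ^^ i) f j"
      by (simp add: fdiff_def)
    ultimately show ?case using norm_triangle_ineq4[of "(fdiff ^^ i) f (Suc j)" "(fdiff ^^ i) f j"]
      by simp
  qed (use assms in auto)
  also have "\<dots> \<le> 2 ^ m * C" using ij C by (intro mult_right_mono power_increasing) auto
  also have "\<dots> = 2 ^ m * C / \<kappa> ^ m * \<kappa> ^ m" using assms by simp
  also have "\<dots> \<le> 2 ^ m * C / \<kappa> ^ m * \<delta> ^ i"
  proof (rule mult_left_mono)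
    have "\<kappa> ^ m \<le> \<kappa> ^ i" using ij assms by (intro power_decreasing) auto
    also have "\<dots> \<le> \<delta> ^ i" using assms by (intro power_mono) auto
    finally show "\<kappa> ^ m \<le> \<delta> ^ i" .
  qed (use C assms in auto)
  finally show "norm ((fdiff ^^ i) f j) \<le> 2 ^ m * C / \<kappa> ^ m * \<delta> ^ i" .
qed

text \<open>Mean value theorem: the functions \<open>\<lambda>t. G i (t + h) - G i t\<close> are again the successive derivatives of one
function, and they are smaller by the factor \<open>h\<close>.\<close>

lemma dbound_smooth:
  fixes G :: "nat \<Rightarrow> real \<Rightarrow> 'a::real_normed_vector"
  assumes "\<And>i t. (G i has_vector_derivative G (Suc i) t) (at t)"
    and "\<And>i t. i \<le> m \<Longrightarrow> 0 \<le> t \<Longrightarrow> t \<le> real m * h \<Longrightarrow> norm (G i t) \<le> C" and h: "0 \<le> h"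
  shows "dbound m (\<lambda>j. G 0 (real j * h)) C h"
  using assms(1,2)
proof (induction m arbitrary: G C)
  case 0 then show ?case by (simp add: dbound_0)
next
  case (Suc m)
  have 1: "dbound m (\<lambda>j. G 0 (real j * h + h) - G 0 (real j * h)) (C * h) h"
  proof (rule Suc.IH[of "\<lambda>i t. G i (t + h) - G i t"])
    show "((\<lambda>t. G i (t + h) - G i t) has_vector_derivative G (Suc i) (t + h) - G (Suc i) t) (at t)" for i t
    proof (rule has_vector_derivative_diff)
      have "((G i \<circ> (\<lambda>t. t + h)) has_vector_derivative 1 *\<^sub>R G (Suc i) (t + h)) (at t)"
        by (rule vector_diff_chain_at) (auto intro!: derivative_eq_intros Suc.prems(1))
      then show "((\<lambda>t. G i (t + h)) has_vector_derivative G (Suc i) (t + h)) (at t)"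
        by (simp add: o_def)
    qed (rule Suc.prems)
    show "norm (G i (t + h) - G i t) \<le> C * h" if "i \<le> m" "0 \<le> t" "t \<le> real m * h" for i t
    proof -
      have "norm (G i (t + h) - G i t) \<le> C * norm (t + h - t)"
      proof (rule differentiable_bound)
        show "convex {t..t + h}" by simp
        show "(G i has_derivative (\<lambda>x. x *\<^sub>R G (Suc i) y)) (at y within {t..t + h})" if "y \<in> {t..t + h}" for y
          using Suc.prems(1) has_vector_derivative_at_within has_vector_derivative_def by blast
        show "onorm (\<lambda>x. x *\<^sub>R G (Suc i) y) \<le> C" if "y \<in> {t..t + h}" for y
        proof (rule onorm_bound)
          have "norm (G (Suc i) y) \<le> C"
            using that h \<open>i \<le> m\<close> \<open>0 \<le> t\<close> \<open>t \<le> real m * h\<close>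
            by (intro Suc.prems(2)) (auto simp: algebra_simps)
          then show "0 \<le> C" "norm (x *\<^sub>R G (Suc i) y) \<le> C * norm x" for x :: real
            using norm_ge_zero[of "G (Suc i) y"] by (linarith, simp add: mult.commute[of C] mult_left_mono)
        qed
      qed (use h in auto)
      then show ?thesis using h by simp
    qed
  qed
  have "fdiff (\<lambda>j. G 0 (real j * h)) = (\<lambda>j. G 0 (real j * h + h) - G 0 (real j * h))"
    by (auto simp: fdiff_def algebra_simps)
  moreover have "norm (G 0 (real j * h)) \<le> C" if "j \<le> Suc m" for j
    using that h by (intro Suc.prems) (auto intro!: mult_right_mono)
  ultimately show ?case using 1 by (simp add: dbound_Suc)
qed

section \<open>Lattices and their fundamental domains\<close>

text \<open>Discreteness and closure under differences are required instead of a basis; this makes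
products of lattices immediate.\<close>

locale lattice_cell =
  fixes \<Lambda> D :: "'a::euclidean_space set"
  assumes zero_in: "0 \<in> \<Lambda>"
    and diff_in: "\<And>x y. x \<in> \<Lambda> \<Longrightarrow> y \<in> \<Lambda> \<Longrightarrow> x - y \<in> \<Lambda>"
    and discrete: "\<And>r. finite (\<Lambda> \<inter> cball 0 r)"
    and cell_borel [measurable]: "D \<in> sets borel"
    and cell_bounded: "bounded D"
    and tiling: "\<And>x. \<exists>!R. R \<in> \<Lambda> \<and> x - R \<in> D"
begin

lemma neg_in: "x \<in> \<Lambda> \<Longrightarrow> - x \<in> \<Lambda>"
  using diff_in[OF zero_in] by force

lemma add_in: "x \<in> \<Lambda> \<Longrightarrow> y \<in> \<Lambda> \<Longrightarrow> x + y \<in> \<Lambda>"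
  using diff_in[of x "- y"] neg_in by force

lemma neg_in_iff: "- x \<in> \<Lambda> \<longleftrightarrow> x \<in> \<Lambda>"
  using neg_in[of x] neg_in[of "- x"] by auto

lemma scale_in: "x \<in> \<Lambda> \<Longrightarrow> real n *\<^sub>R x \<in> \<Lambda>"
  by (induction n) (auto simp: zero_in add_in algebra_simps)

lemma countable_lattice: "countable \<Lambda>"
proof -
  have "\<Lambda> \<subseteq> (\<Union>n::nat. \<Lambda> \<inter> cball 0 (real n))"
  proof
    fix x assume "x \<in> \<Lambda>"
    moreover obtain n :: nat where "norm x \<le> real n" using real_arch_simple by blast
    ultimately show "x \<in> (\<Union>n::nat. \<Lambda> \<inter> cball 0 (real n))" by auto
  qed
  moreover have "countable (\<Union>n::nat. \<Lambda> \<inter> cball 0 (real n))"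
    by (rule countable_UN[OF _ countable_finite[OF discrete]]) simp
  ultimately show ?thesis by (rule countable_subset)
qed

definition rep :: "'a \<Rightarrow> 'a" where
  "rep x = (THE R. R \<in> \<Lambda> \<and> x - R \<in> D)"

lemma rep_in: "rep x \<in> \<Lambda>" and rep_cell: "x - rep x \<in> D"
  using theI'[OF tiling[of x]] unfolding rep_def by auto

lemma rep_unique: "R \<in> \<Lambda> \<Longrightarrow> x - R \<in> D \<Longrightarrow> rep x = R"
  using tiling[of x] rep_in rep_cell by blast

lemma rep_add: "G \<in> \<Lambda> \<Longrightarrow> rep (x + G) = rep x + G"
  using rep_unique[of "rep x + G" "x + G"] add_in rep_in rep_cell by (simp add: algebra_simps)

lemma rep_eq_0: "x \<in> D \<Longrightarrow> rep x = 0"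
  using rep_unique[of 0 x] zero_in by simp

lemma rep_measurable [measurable]: "rep \<in> borel_measurable borel"
proof (rule borel_measurableI)
  fix S :: "'a set" assume "open S"
  have "rep -` S \<inter> space borel = (\<Union>R\<in>\<Lambda> \<inter> S. {x. x - R \<in> D})"
    using rep_in rep_cell rep_unique by auto
  also have "\<dots> \<in> sets borel"
    by (intro sets.countable_UN'' countable_Int1 countable_lattice; measurable)
  finally show "rep -` S \<inter> space borel \<in> sets borel" .
qed

definition periodic :: "('a \<Rightarrow> 'b) \<Rightarrow> bool" where
  "periodic f \<longleftrightarrow> (\<forall>x. \<forall>G\<in>\<Lambda>. f (x + G) = f x)"

lemma periodic_add: "periodic f \<Longrightarrow> G \<in> \<Lambda> \<Longrightarrow> f (x + G) = f x"
  by (simp add: periodic_def)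

lemma periodic_diff: "periodic f \<Longrightarrow> G \<in> \<Lambda> \<Longrightarrow> f (x - G) = f x"
  using periodic_add[of f "- G" x] neg_in by simp

lemma count_add: "(\<integral>\<^sup>+R. indicator D (x + R) \<partial>count_space \<Lambda>) = (1 :: ennreal)"
proof -
  have "x + R \<in> D \<longleftrightarrow> R = - rep x" if "R \<in> \<Lambda>" for R
    using rep_unique[of "- R" x] rep_cell[of x] neg_in[OF that] by auto
  then have "(\<integral>\<^sup>+R. indicator D (x + R) \<partial>count_space \<Lambda>) = (\<integral>\<^sup>+R. indicator {- rep x} R \<partial>count_space \<Lambda>)"
    by (intro nn_integral_cong) (auto simp: indicator_def)
  also have "\<dots> = 1"
    using rep_in[of x] neg_in by (subst nn_integral_indicator) auto
  finally show ?thesis .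
qed

lemma count_diff: "(\<integral>\<^sup>+R. indicator D (x - R) \<partial>count_space \<Lambda>) = (1 :: ennreal)"
proof -
  have "x - R \<in> D \<longleftrightarrow> R = rep x" if "R \<in> \<Lambda>" for R
    using rep_unique[of R x] rep_cell[of x] that by auto
  then have "(\<integral>\<^sup>+R. indicator D (x - R) \<partial>count_space \<Lambda>) = (\<integral>\<^sup>+R. indicator {rep x} R \<partial>count_space \<Lambda>)"
    by (intro nn_integral_cong) (auto simp: indicator_def)
  also have "\<dots> = 1"
    using rep_in[of x] by (subst nn_integral_indicator) auto
  finally show ?thesis .
qed

end

lemma nn_integral_lborel_translate:
  fixes f :: "'a::euclidean_space \<Rightarrow> ennreal"
  assumes [measurable]: "f \<in> borel_measurable borel"
  shows "(\<integral>\<^sup>+x. f (x + v) \<partial>lborel) = (\<integral>\<^sup>+x. f x \<partial>lborel)"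
  by (subst (2) lborel_distr_plus[of v, symmetric]) (simp add: nn_integral_distr add.commute)

text \<open>The translates of \<open>D'\<close> cut \<open>D\<close> into pieces, and translated back by the lattice these pieces fill \<open>D'\<close>.\<close>

lemma nn_integral_cell_eq:
  assumes "lattice_cell \<Lambda> D" "lattice_cell \<Lambda> D'"
    and [measurable]: "g \<in> borel_measurable borel" and per: "lattice_cell.periodic \<Lambda> g"
  shows "(\<integral>\<^sup>+x. g x * indicator D x \<partial>lborel) = (\<integral>\<^sup>+x. g x * indicator D' x \<partial>lborel)"
proof -
  interpret A: lattice_cell \<Lambda> D by fact
  interpret B: lattice_cell \<Lambda> D' by fact
  have "(\<integral>\<^sup>+x. g x * indicator D x \<partial>lborel)
      = (\<integral>\<^sup>+x. (\<integral>\<^sup>+R. g x * indicator D x * indicator D' (x - R) \<partial>count_space \<Lambda>) \<partial>lborel)"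
    by (subst nn_integral_cmult) (auto simp: B.count_diff)
  also have "\<dots> = (\<integral>\<^sup>+R. (\<integral>\<^sup>+x. g x * indicator D x * indicator D' (x - R) \<partial>lborel) \<partial>count_space \<Lambda>)"
    by (intro nn_integral_count_space_nn_integral A.countable_lattice) measurable
  also have "\<dots> = (\<integral>\<^sup>+R. (\<integral>\<^sup>+x. g x * indicator D' x * indicator D (x + R) \<partial>lborel) \<partial>count_space \<Lambda>)"
  proof (rule nn_integral_cong)
    fix R assume "R \<in> space (count_space \<Lambda>)"
    then have "R \<in> \<Lambda>" by simp
    have "(\<integral>\<^sup>+x. g x * indicator D x * indicator D' (x - R) \<partial>lborel)
        = (\<integral>\<^sup>+x. g (x + R) * indicator D (x + R) * indicator D' ((x + R) - R) \<partial>lborel)"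
      by (rule nn_integral_lborel_translate[symmetric]) measurable
    also have "\<dots> = (\<integral>\<^sup>+x. g x * indicator D' x * indicator D (x + R) \<partial>lborel)"
      using A.periodic_add[OF per \<open>R \<in> \<Lambda>\<close>] by (simp add: mult_ac)
    finally show "(\<integral>\<^sup>+x. g x * indicator D x * indicator D' (x - R) \<partial>lborel)
        = (\<integral>\<^sup>+x. g x * indicator D' x * indicator D (x + R) \<partial>lborel)" .
  qed
  also have "\<dots> = (\<integral>\<^sup>+x. (\<integral>\<^sup>+R. g x * indicator D' x * indicator D (x + R) \<partial>count_space \<Lambda>) \<partial>lborel)"
    by (intro nn_integral_count_space_nn_integral[symmetric] A.countable_lattice) measurable
  also have "\<dots> = (\<integral>\<^sup>+x. g x * indicator D' x \<partial>lborel)"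
    by (subst nn_integral_cmult) (auto simp: A.count_add)
  finally show ?thesis .
qed

text \<open>Reduction modulo the lattice carries the Lebesgue measure of one cell to that of another one. In
this form the preceding lemma applies to integrands with values in a Banach space.\<close>

lemma distr_cell:
  assumes "lattice_cell \<Lambda> D" "lattice_cell \<Lambda> D'"
  shows "distr (density lborel (indicator D)) borel (\<lambda>x. x - lattice_cell.rep \<Lambda> D' x)
       = density lborel (indicator D')"
proof (rule measure_eqI)
  interpret A: lattice_cell \<Lambda> D by fact
  interpret B: lattice_cell \<Lambda> D' by fact
  fix S assume "S \<in> sets (distr (density lborel (indicator D)) borel (\<lambda>x. x - B.rep x))"
  then have S [measurable]: "S \<in> sets borel" by simp
  have "emeasure (distr (density lborel (indicator D)) borel (\<lambda>x. x - B.rep x)) S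
      = (\<integral>\<^sup>+x. indicator S (x - B.rep x) * indicator D x \<partial>lborel)"
    by (subst emeasure_distr, simp, simp, subst emeasure_density, simp, simp add: measurable_sets_borel[OF _ S])
       (auto simp: mult.commute intro!: nn_integral_cong split: split_indicator)
  also have "\<dots> = (\<integral>\<^sup>+x. indicator S (x - B.rep x) * indicator D' x \<partial>lborel)"
    by (rule nn_integral_cell_eq[OF assms]) (auto simp: A.periodic_def B.rep_add)
  also have "\<dots> = emeasure (density lborel (indicator D')) S"
    by (auto simp: emeasure_density B.rep_eq_0 intro!: nn_integral_cong split: split_indicator)
  finally show "emeasure (distr (density lborel (indicator D)) borel (\<lambda>x. x - B.rep x)) S
      = emeasure (density lborel (indicator D')) S" .
qed simp

lemma set_integral_cell_eq:
  fixes f :: "'a::euclidean_space \<Rightarrow> 'b::{banach, second_countable_topology}"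
  assumes "lattice_cell \<Lambda> D" "lattice_cell \<Lambda> D'"
    and [measurable]: "f \<in> borel_measurable borel" and per: "lattice_cell.periodic \<Lambda> f"
  shows "(LINT x:D|lborel. f x) = (LINT x:D'|lborel. f x)"
proof -
  interpret A: lattice_cell \<Lambda> D by fact
  interpret B: lattice_cell \<Lambda> D' by fact
  have d: "density lborel (indicator S) = density lborel (\<lambda>x. ennreal (indicator S x))" for S :: "'a set"
    by (intro arg_cong2[where f = density]) (auto split: split_indicator)
  have per': "f (x - B.rep x) = f x" for x
    using A.periodic_diff[OF per B.rep_in] by simp
  have "(LINT x:D|lborel. f x) = integral\<^sup>L (density lborel (indicator D)) f"
    unfolding set_lebesgue_integral_def d by (subst integral_density) auto
  also have "\<dots> = integral\<^sup>L (density lborel (indicator D)) (\<lambda>x. f (x - B.rep x))"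
    by (simp add: per')
  also have "\<dots> = integral\<^sup>L (density lborel (indicator D')) f"
    unfolding distr_cell[OF assms(1,2), symmetric] by (subst integral_distr) auto
  also have "\<dots> = (LINT x:D'|lborel. f x)"
    unfolding set_lebesgue_integral_def d by (subst integral_density) auto
  finally show ?thesis .
qed

lemma eq_scaleR_iff: "m \<noteq> 0 \<Longrightarrow> x = (1 / m) *\<^sub>R y \<longleftrightarrow> m *\<^sub>R x = y"
  for x y :: "'a::real_vector"
  by auto

context lattice_cell
begin

lemma translate_cell: "lattice_cell \<Lambda> {x. x - v \<in> D}"
proof
  show "{x. x - v \<in> D} \<in> sets borel" by measurable
  have "{x. x - v \<in> D} = (+) v ` D"
    by (auto simp: image_iff) (metis add.commute diff_add_cancel)
  then show "bounded {x. x - v \<in> D}" using cell_bounded by (simp add: bounded_translation)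
  show "\<exists>!R. R \<in> \<Lambda> \<and> x - R \<in> {x. x - v \<in> D}" for x
    using tiling[of "x - v"] by (simp add: algebra_simps)
qed (use zero_in diff_in discrete in auto)

lemma set_integral_translate:
  fixes f :: "'a \<Rightarrow> 'b::{banach, second_countable_topology}"
  assumes [measurable]: "f \<in> borel_measurable borel" and "periodic f"
  shows "(LINT x:D|lborel. f (x + v)) = (LINT x:D|lborel. f x)"
proof -
  have "(LINT x:D|lborel. f x) = (LINT x:{x. x - v \<in> D}|lborel. f x)"
    using lattice_cell_axioms translate_cell assms by (rule set_integral_cell_eq)
  also have "\<dots> = (\<integral>x. indicator D (x - v) *\<^sub>R f x \<partial>distr lborel borel ((+) v))"
    by (simp add: set_lebesgue_integral_def lborel_distr_plus indicator_def)
  also have "\<dots> = (\<integral>x. indicator D x *\<^sub>R f (x + v) \<partial>lborel)"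
    by (subst integral_distr) (auto simp: add.commute)
  finally show ?thesis by (simp add: set_lebesgue_integral_def)
qed

lemma nn_integral_translate:
  assumes [measurable]: "f \<in> borel_measurable borel" and "periodic f"
  shows "(\<integral>\<^sup>+x. f (x + v) * indicator D x \<partial>lborel) = (\<integral>\<^sup>+x. f x * indicator D x \<partial>lborel)"
proof -
  have "(\<integral>\<^sup>+x. f x * indicator D x \<partial>lborel) = (\<integral>\<^sup>+x. f x * indicator {x. x - v \<in> D} x \<partial>lborel)"
    using lattice_cell_axioms translate_cell assms by (rule nn_integral_cell_eq)
  also have "\<dots> = (\<integral>\<^sup>+x. f (x + v) * indicator {x. x - v \<in> D} (x + v) \<partial>lborel)"
    by (rule nn_integral_lborel_translate[symmetric]) measurable
  finally show ?thesis by (simp add: indicator_def)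
qed

lemma cell_measure_finite: "emeasure lborel D < \<infinity>"
  using cell_bounded by (rule emeasure_bounded_finite)

text \<open>Countably many translates of the cell cover the space.\<close>

lemma cell_measure_pos: "0 < measure lborel D"
proof (rule ccontr)
  assume "\<not> 0 < measure lborel D"
  then have "emeasure lborel D = 0"
    using cell_measure_finite by (simp add: emeasure_eq_ennreal_measure zero_less_measure_iff)
  have "emeasure lborel {x. x - R \<in> D} = 0" for R
  proof -
    have "emeasure lborel {x. x - R \<in> D} = (\<integral>\<^sup>+x. indicator {x. x - R \<in> D} x \<partial>lborel)"
      by simp
    also have "\<dots> = (\<integral>\<^sup>+x. indicator D (x + (- R)) \<partial>lborel)"
      by (rule nn_integral_cong) (simp add: indicator_def)
    also have "\<dots> = emeasure lborel D"
      using nn_integral_lborel_translate[of "indicator D" "- R"] by simp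
    finally show ?thesis using \<open>emeasure lborel D = 0\<close> by simp
  qed
  then have "(\<Union>R\<in>\<Lambda>. {x. x - R \<in> D}) \<in> null_sets lborel"
    by (intro null_sets_UN' countable_lattice) auto
  then have "emeasure lborel (\<Union>R\<in>\<Lambda>. {x. x - R \<in> D}) = 0" by auto
  moreover have "(\<Union>R\<in>\<Lambda>. {x. x - R \<in> D}) = UNIV" using tiling by blast
  ultimately show False by simp
qed

section \<open>Averages over uniform meshes\<close>

definition grid :: "nat \<Rightarrow> 'a \<Rightarrow> 'a set" where
  "grid n s = {k \<in> D. \<exists>G\<in>\<Lambda>. k = s + (1 / real n) *\<^sub>R G}"

lemma grid_scaled: "k \<in> grid n s \<Longrightarrow> 0 < n \<Longrightarrow> real n *\<^sub>R (k - s) \<in> \<Lambda>"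
  by (auto simp: grid_def)

lemma finite_grid:
  assumes "0 < n" shows "finite (grid n s)"
proof -
  obtain B where B: "\<And>x. x \<in> D \<Longrightarrow> norm x \<le> B" using cell_bounded bounded_iff by blast
  have "(\<lambda>k. real n *\<^sub>R (k - s)) ` grid n s \<subseteq> \<Lambda> \<inter> cball 0 (real n * (B + norm s))"
  proof safe
    fix k assume k: "k \<in> grid n s"
    show "real n *\<^sub>R (k - s) \<in> \<Lambda>" using k assms by (rule grid_scaled)
    have "norm (k - s) \<le> B + norm s"
      using k B[of k] norm_triangle_ineq4[of k s] by (auto simp: grid_def)
    then show "real n *\<^sub>R (k - s) \<in> cball 0 (real n * (B + norm s))"
      by (simp add: mult_left_mono)
  qed
  moreover have "inj_on (\<lambda>k. real n *\<^sub>R (k - s)) (grid n s)"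
    using assms by (auto simp: inj_on_def)
  ultimately show ?thesis using discrete finite_imageD finite_subset by blast
qed

lemma grid_reduce: 
  assumes "0 < n" "real n *\<^sub>R (k - s) \<in> \<Lambda>" shows "k - rep k \<in> grid n s"
proof -
  have "k - rep k = s + (1 / real n) *\<^sub>R (real n *\<^sub>R (k - s) - real n *\<^sub>R rep k)"
    using assms by (simp flip: scaleR_diff_right)
  moreover have "real n *\<^sub>R (k - s) - real n *\<^sub>R rep k \<in> \<Lambda>"
    by (rule diff_in[OF assms(2) scale_in[OF rep_in]])
  ultimately show ?thesis using rep_cell[of k] unfolding grid_def by blast
qed

lemma grid_nonempty: "0 < n \<Longrightarrow> grid n s \<noteq> {}"
  using grid_reduce[of n s s] zero_in by auto

lemma card_grid_pos: "0 < n \<Longrightarrow> 0 < card (grid n s)"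
  using finite_grid grid_nonempty by (simp add: card_gt_0_iff)

text \<open>Reduction modulo the lattice is a bijection from the translated mesh to the mesh with the
translated offset.\<close>

lemma grid_sum_translate:
  assumes n: "0 < n" and f: "periodic f"
  shows "(\<Sum>k\<in>grid n s. f (k + v)) = (\<Sum>k\<in>grid n (s + v). f k)"
proof (rule sum.reindex_bij_witness
    [where j = "\<lambda>k. (k + v) - rep (k + v)" and i = "\<lambda>k. (k - v) - rep (k - v)"])
  fix k assume k: "k \<in> grid n s"
  then have kD: "k \<in> D" by (simp add: grid_def)
  show "(k + v) - rep (k + v) \<in> grid n (s + v)"
    using grid_scaled[OF k n] n by (intro grid_reduce) auto
  have "rep (k + v - rep (k + v) - v) = - rep (k + v)"
    using rep_add[of "- rep (k + v)" k] neg_in rep_in rep_eq_0[OF kD] by (simp add: algebra_simps)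
  then show "k + v - rep (k + v) - v - rep (k + v - rep (k + v) - v) = k" by simp
  show "f (k + v - rep (k + v)) = f (k + v)" using periodic_diff[OF f rep_in] .
next
  fix k assume k: "k \<in> grid n (s + v)"
  then have kD: "k \<in> D" by (simp add: grid_def)
  show "(k - v) - rep (k - v) \<in> grid n s"
    using grid_scaled[OF k n] n by (intro grid_reduce) (auto simp: algebra_simps)
  have "rep (k - v - rep (k - v) + v) = - rep (k - v)"
    using rep_add[of "- rep (k - v)" k] neg_in rep_in rep_eq_0[OF kD] by (simp add: algebra_simps)
  then show "k - v - rep (k - v) + v - rep (k - v - rep (k - v) + v) = k" by simp
qed

lemma grid_shift: "0 < n \<Longrightarrow> G \<in> \<Lambda> \<Longrightarrow> grid n (s + (1 / real n) *\<^sub>R G) = grid n s"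
proof -
  assume "G \<in> \<Lambda>"
  have "(\<exists>H\<in>\<Lambda>. k = s + (1 / real n) *\<^sub>R G + (1 / real n) *\<^sub>R H) \<longleftrightarrow> (\<exists>H\<in>\<Lambda>. k = s + (1 / real n) *\<^sub>R H)" for k
  proof
    assume "\<exists>H\<in>\<Lambda>. k = s + (1 / real n) *\<^sub>R G + (1 / real n) *\<^sub>R H"
    then show "\<exists>H\<in>\<Lambda>. k = s + (1 / real n) *\<^sub>R H"
      using add_in[OF \<open>G \<in> \<Lambda>\<close>] by (metis add.assoc scaleR_add_right)
  next
    assume "\<exists>H\<in>\<Lambda>. k = s + (1 / real n) *\<^sub>R H"
    then obtain H where "H \<in> \<Lambda>" "k = s + (1 / real n) *\<^sub>R G + (1 / real n) *\<^sub>R (H - G)"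
      by (auto simp: algebra_simps)
    then show "\<exists>H\<in>\<Lambda>. k = s + (1 / real n) *\<^sub>R G + (1 / real n) *\<^sub>R H"
      using diff_in[OF _ \<open>G \<in> \<Lambda>\<close>] by blast
  qed
  then show ?thesis by (auto simp: grid_def)
qed

lemma card_grid_translate: "0 < n \<Longrightarrow> card (grid n (s + v)) = card (grid n s)"
  using grid_sum_translate[of n "\<lambda>_. 1 :: nat" v s] by (simp add: periodic_def)

definition gavg :: "nat \<Rightarrow> 'a \<Rightarrow> ('a \<Rightarrow> 'b::real_vector) \<Rightarrow> 'b" where
  "gavg n s f = (1 / real (card (grid n s))) *\<^sub>R (\<Sum>k\<in>grid n s. f k)"

text \<open>Representatives of \<open>\<Lambda>\<close> modulo \<open>2 \<Lambda>\<close>: in units of half steps, these are the translations which produce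
the refined mesh from the given one.\<close>

definition halving :: "'a set \<Rightarrow> bool" where
  "halving E \<longleftrightarrow> finite E \<and> E \<subseteq> \<Lambda> \<and> (\<forall>G\<in>\<Lambda>. \<exists>!e. e \<in> E \<and> (\<exists>H\<in>\<Lambda>. G = e + 2 *\<^sub>R H))"

lemma grid_sum_halve:
  assumes n: "0 < n" and E: "halving E" and f: "periodic f"
  shows "(\<Sum>k\<in>grid (2 * n) s. f k) = (\<Sum>e\<in>E. \<Sum>k\<in>grid n s. f (k + (1 / real (2 * n)) *\<^sub>R e))"
proof -
  have mem: "k \<in> grid n (s + (1 / real (2 * n)) *\<^sub>R e) \<longleftrightarrow>
      k \<in> D \<and> (\<exists>H\<in>\<Lambda>. real (2 * n) *\<^sub>R (k - s) = e + 2 *\<^sub>R H)" for e k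
  proof -
    have "k = s + (1 / real (2 * n)) *\<^sub>R e + (1 / real n) *\<^sub>R H \<longleftrightarrow> real (2 * n) *\<^sub>R (k - s) = e + 2 *\<^sub>R H" for H
    proof -
      have "k = s + (1 / real (2 * n)) *\<^sub>R e + (1 / real n) *\<^sub>R H \<longleftrightarrow>
          k - s = (1 / real (2 * n)) *\<^sub>R (e + 2 *\<^sub>R H)" by (auto simp: algebra_simps)
      also have "\<dots> \<longleftrightarrow> real (2 * n) *\<^sub>R (k - s) = e + 2 *\<^sub>R H"
        using n by (intro eq_scaleR_iff) auto
      finally show ?thesis .
    qed
    then show ?thesis by (simp add: grid_def)
  qed
  have un: "grid (2 * n) s = (\<Union>e\<in>E. grid n (s + (1 / real (2 * n)) *\<^sub>R e))"
  proof (intro set_eqI iffI)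
    fix k assume k: "k \<in> grid (2 * n) s"
    then have "real (2 * n) *\<^sub>R (k - s) \<in> \<Lambda>" using n by (intro grid_scaled) auto
    then obtain e where "e \<in> E" "\<exists>H\<in>\<Lambda>. real (2 * n) *\<^sub>R (k - s) = e + 2 *\<^sub>R H"
      using E unfolding halving_def by meson
    then show "k \<in> (\<Union>e\<in>E. grid n (s + (1 / real (2 * n)) *\<^sub>R e))"
      using k mem by (auto simp: grid_def)
  next
    fix k assume "k \<in> (\<Union>e\<in>E. grid n (s + (1 / real (2 * n)) *\<^sub>R e))"
    then obtain e H where e: "e \<in> E" "k \<in> D" "H \<in> \<Lambda>" "real (2 * n) *\<^sub>R (k - s) = e + 2 *\<^sub>R H"
      using mem by blast
    then have "e + 2 *\<^sub>R H \<in> \<Lambda>" using E add_in scale_in[of H 2] by (auto simp: halving_def)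
    moreover have "k = s + (1 / real (2 * n)) *\<^sub>R (e + 2 *\<^sub>R H)"
      using e(4)[symmetric] n by simp
    ultimately show "k \<in> grid (2 * n) s" using e(2) unfolding grid_def by blast
  qed
  have "(\<Sum>k\<in>grid (2 * n) s. f k) = (\<Sum>e\<in>E. \<Sum>k\<in>grid n (s + (1 / real (2 * n)) *\<^sub>R e). f k)"
    unfolding un
  proof (rule sum.UNION_disjoint)
    show "\<forall>e\<in>E. \<forall>e'\<in>E. e \<noteq> e' \<longrightarrow>
       grid n (s + (1 / real (2 * n)) *\<^sub>R e) \<inter> grid n (s + (1 / real (2 * n)) *\<^sub>R e') = {}"
    proof (intro ballI impI, rule ccontr)
      fix e e' assume e: "e \<in> E" "e' \<in> E" "e \<noteq> e'"
        "grid n (s + (1 / real (2 * n)) *\<^sub>R e) \<inter> grid n (s + (1 / real (2 * n)) *\<^sub>R e') \<noteq> {}"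
      then obtain k H H' where H: "H \<in> \<Lambda>" "real (2 * n) *\<^sub>R (k - s) = e + 2 *\<^sub>R H"
        "H' \<in> \<Lambda>" "real (2 * n) *\<^sub>R (k - s) = e' + 2 *\<^sub>R H'"
        using mem by blast
      moreover have "e + 2 *\<^sub>R H \<in> \<Lambda>"
        using e E H(1) add_in scale_in[of H 2] by (auto simp: halving_def)
      ultimately show False using E e unfolding halving_def by metis
    qed
  qed (use E n in \<open>auto simp: halving_def finite_grid\<close>)
  then show ?thesis by (simp add: grid_sum_translate[OF n f])
qed

lemma card_grid_halve:
  "0 < n \<Longrightarrow> halving E \<Longrightarrow> card (grid (2 * n) s) = card E * card (grid n s)"
  using grid_sum_halve[of n E "\<lambda>_. 1 :: nat" s] by (simp add: periodic_def)

text \<open>Let \<open>a j\<close> be the mesh sum of \<open>f\<close> translated by \<open>j\<close> half steps along \<open>e\<close>. A full step along \<open>e\<close> permutes the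
mesh modulo the lattice, so \<open>a\<close> has period two, and taking a difference of \<open>\<Delta> a\<close> amounts to multiplying
it by \<open>- 2\<close>. Consequently the difference \<open>a 1 - a 0\<close> is dominated by the difference of order \<open>m + 1\<close>
for every \<open>m\<close>, and differences of \<open>a\<close> are mesh sums of differences of \<open>f\<close>. No cancellation between mesh
points is used, so singular points may be treated by a bound \<open>w\<close> of their own.\<close>

lemma gavg_halve:
  fixes f :: "'a \<Rightarrow> 'b::real_normed_vector"
  assumes n: "0 < n" and E: "halving E" and f: "periodic f"
    and w: "\<And>k e. k \<in> grid n s \<Longrightarrow> e \<in> E \<Longrightarrow>
       norm ((fdiff ^^ Suc m) (\<lambda>j. f (k + (real j / real (2 * n)) *\<^sub>R e)) 0) \<le> w k"
  shows "norm (gavg n s f - gavg (2 * n) s f) \<le> gavg n s w"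
proof -
  define a where "a e j = (\<Sum>k\<in>grid n s. f (k + (real j / real (2 * n)) *\<^sub>R e))" for e j
  have cE: "0 < card E"
    using card_grid_pos[of "2 * n" s] n E by (simp add: card_grid_halve card_gt_0_iff)
  have bound: "norm (a e 0 - a e 1) \<le> (\<Sum>k\<in>grid n s. w k)" if e: "e \<in> E" for e
  proof -
    have eL: "e \<in> \<Lambda>" using E e by (auto simp: halving_def)
    have per: "a e (Suc (Suc j)) = a e j" for j
    proof -
      have "a e j = (\<Sum>k\<in>grid n (s + (real j / real (2 * n)) *\<^sub>R e). f k)" for j
        unfolding a_def using n f by (rule grid_sum_translate)
      moreover have "s + (real (Suc (Suc j)) / real (2 * n)) *\<^sub>R e
          = s + (real j / real (2 * n)) *\<^sub>R e + (1 / real n) *\<^sub>R e"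
        using n by (simp add: algebra_simps add_divide_distrib flip: scaleR_add_left)
      ultimately show ?thesis using grid_shift[OF n eL] by metis
    qed
    \<comment> \<open>Period two turns \<open>a (j + 2) - 2 * a (j + 1) + a j\<close> into \<open>2 * (a j - a (j + 1))\<close>.\<close>
    have alt: "fdiff (fdiff (a e)) j = (- 2) *\<^sub>R fdiff (a e) j" for j
      by (simp add: fdiff_def per scaleR_diff_right) (simp add: scaleR_2)
    have "(fdiff ^^ Suc i) (a e) j = (- 2) ^ i *\<^sub>R fdiff (a e) j" for i j
    proof (induction i arbitrary: j)
      case (Suc i)
      have "(fdiff ^^ Suc (Suc i)) (a e) j = (- 2) ^ i *\<^sub>R fdiff (fdiff (a e)) j"
        unfolding funpow.simps(2)[of "Suc i"] o_def fdiff_def[of "(fdiff ^^ Suc i) (a e)"] Suc.IH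
        by (simp add: fdiff_def[of "fdiff (a e)"] scaleR_diff_right)
      then show ?case by (simp add: alt)
    qed simp
    then have "norm ((fdiff ^^ Suc m) (a e) 0) = 2 ^ m * norm (a e 0 - a e 1)"
      by (simp add: fdiff_def norm_minus_commute norm_power)
    then have "norm (a e 0 - a e 1) \<le> norm ((fdiff ^^ Suc m) (a e) 0)"
      by (metis mult_le_cancel_right1 norm_ge_zero not_le one_le_numeral one_le_power)
    also have "\<dots> = norm (\<Sum>k\<in>grid n s. (fdiff ^^ Suc m) (\<lambda>j. f (k + (real j / real (2 * n)) *\<^sub>R e)) 0)"
      unfolding a_def fdiff_funpow_sum ..
    also have "\<dots> \<le> (\<Sum>k\<in>grid n s. w k)"
      using w e by (intro sum_norm_le) auto
    finally show ?thesis .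
  qed
  have "gavg n s f = (1 / real (card (grid (2 * n) s))) *\<^sub>R (\<Sum>e\<in>E. a e 0)"
    using cE n E by (simp add: gavg_def a_def card_grid_halve divide_simps sum_constant_scaleR)
  moreover have "gavg (2 * n) s f = (1 / real (card (grid (2 * n) s))) *\<^sub>R (\<Sum>e\<in>E. a e 1)"
    unfolding gavg_def grid_sum_halve[OF n E f] a_def by simp
  ultimately have "norm (gavg n s f - gavg (2 * n) s f)
      = norm (\<Sum>e\<in>E. a e 0 - a e 1) / real (card (grid (2 * n) s))"
    by (simp add: sum_subtractf flip: scaleR_diff_right)
  also have "\<dots> \<le> (\<Sum>e\<in>E. \<Sum>k\<in>grid n s. w k) / real (card (grid (2 * n) s))"
    by (intro divide_right_mono sum_norm_le bound) auto
  also have "\<dots> = gavg n s w"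
    using cE n E by (simp add: gavg_def card_grid_halve)
  finally show ?thesis .
qed

text \<open>Telescoping over \<open>n\<close>, \<open>2 n\<close>, \<open>4 n\<close>, \<dots>: as \<open>p \<ge> 1\<close>, the errors decrease at least geometrically with
the factor one half, so that their sum is at most twice the first one.\<close>

lemma gavg_error:
  fixes f :: "'a \<Rightarrow> 'b::real_normed_vector"
  assumes halve: "\<And>n. 0 < n \<Longrightarrow> norm (gavg n s f - gavg (2 * n) s f) \<le> C / real n ^ p"
    and lim: "(\<lambda>n. gavg (Suc n) s f) \<longlonglongrightarrow> I" and p: "0 < p" and n: "0 < n"
  shows "norm (gavg n s f - I) \<le> 2 * C / real n ^ p"
proof -
  have C: "0 \<le> C / real n ^ p" using halve[OF n] norm_ge_zero order_trans by blast
  \<comment> \<open>The right-hand side is the partial sum of the geometric series with ratio one half.\<close>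
  have step: "norm (gavg n s f - gavg (n * 2 ^ J) s f) \<le> C / real n ^ p * (2 - 2 / 2 ^ J)" for J
  proof (induction J)
    case (Suc J)
    have "norm (gavg (n * 2 ^ J) s f - gavg (n * 2 ^ Suc J) s f) \<le> C / real (n * 2 ^ J) ^ p"
      using halve[of "n * 2 ^ J"] n by (simp add: mult_ac)
    also have "\<dots> = C / real n ^ p / 2 ^ (J * p)"
      by (simp add: power_mult_distrib power_mult)
    also have "\<dots> \<le> C / real n ^ p / 2 ^ J"
      using C p by (intro divide_left_mono power_increasing) auto
    finally have "norm ((gavg n s f - gavg (n * 2 ^ J) s f) + (gavg (n * 2 ^ J) s f - gavg (n * 2 ^ Suc J) s f))
        \<le> C / real n ^ p * (2 - 2 / 2 ^ J) + C / real n ^ p / 2 ^ J"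
      by (rule norm_triangle_mono[OF Suc.IH])
    then have "norm (gavg n s f - gavg (n * 2 ^ Suc J) s f)
        \<le> C / real n ^ p * (2 - 2 / 2 ^ J) + C / real n ^ p / 2 ^ J"
      by simp
    also have "\<dots> = C / real n ^ p * (2 - 2 / 2 ^ Suc J)" by (simp add: algebra_simps)
    finally show ?case .
  qed simp
  have "filterlim (\<lambda>J. n * 2 ^ J - 1) sequentially sequentially"
  proof (rule filterlim_at_top_mono[OF filterlim_ident], intro always_eventually allI)
    fix J :: nat
    have "J < 2 ^ J" by (rule less_exp)
    also have "2 ^ J \<le> n * 2 ^ J" using n by simp
    finally show "J \<le> n * 2 ^ J - 1" by simp
  qed
  from filterlim_compose[OF lim this] n have "(\<lambda>J. gavg (n * 2 ^ J) s f) \<longlonglongrightarrow> I"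
    by simp
  then have "(\<lambda>J. norm (gavg n s f - gavg (n * 2 ^ J) s f)) \<longlonglongrightarrow> norm (gavg n s f - I)"
    by (intro tendsto_intros)
  moreover have "norm (gavg n s f - gavg (n * 2 ^ J) s f) \<le> 2 * C / real n ^ p" for J
  proof -
    have "C / real n ^ p * (2 - 2 / 2 ^ J) \<le> C / real n ^ p * 2"
      using C by (intro mult_left_mono) auto
    then show ?thesis using step[of J] by simp
  qed
  ultimately show ?thesis by (intro LIMSEQ_le_const2) auto
qed

section \<open>Convergence of mesh averages\<close>

text \<open>Rounding to the infinite mesh. Composition with it turns mesh averages into integrals, to which
dominated convergence applies.\<close>

definition nearest :: "nat \<Rightarrow> 'a \<Rightarrow> 'a \<Rightarrow> 'a" where
  "nearest n s x = s + (1 / real n) *\<^sub>R rep (real n *\<^sub>R (x - s))"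

lemma nearest_scaled: "0 < n \<Longrightarrow> real n *\<^sub>R (nearest n s x - s) \<in> \<Lambda>"
  by (simp add: nearest_def rep_in)

lemma nearest_measurable [measurable]: "nearest n s \<in> borel_measurable borel"
  unfolding nearest_def by measurable

lemma nearest_dist:
  assumes "0 < n" "\<And>y. y \<in> D \<Longrightarrow> norm y \<le> B"
  shows "norm (x - nearest n s x) \<le> B / real n"
proof -
  have "x - nearest n s x = (1 / real n) *\<^sub>R (real n *\<^sub>R (x - s) - rep (real n *\<^sub>R (x - s)))"
    using assms by (simp add: nearest_def algebra_simps)
  then have "norm (x - nearest n s x) = norm (real n *\<^sub>R (x - s) - rep (real n *\<^sub>R (x - s))) / real n"
    by simp
  also have "\<dots> \<le> B / real n" using assms(2)[OF rep_cell] by (rule divide_right_mono) simp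
  finally show ?thesis .
qed

lemma nearest_add:
  assumes "0 < n" "G \<in> \<Lambda>" shows "nearest n s (x + G) = nearest n s x + G"
proof -
  have "real n *\<^sub>R (x + G - s) = real n *\<^sub>R (x - s) + real n *\<^sub>R G" by (simp add: algebra_simps)
  then show ?thesis using assms(1)
    unfolding nearest_def by (simp only: rep_add[OF scale_in[OF assms(2)]] scaleR_add_right) simp
qed

lemma nearest_cell:
  assumes n: "0 < n" shows "lattice_cell \<Lambda> {x. nearest n s x \<in> D}"
proof
  show "{x. nearest n s x \<in> D} \<in> sets borel" by measurable
  obtain B where B: "\<And>x. x \<in> D \<Longrightarrow> norm x \<le> B" using cell_bounded bounded_iff by blast
  have "norm x \<le> B + B / real n" if "nearest n s x \<in> D" for x
    using nearest_dist[OF n B, of x s] B[OF that] norm_triangle_sub[of x "nearest n s x"] by linarith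
  then show "bounded {x. nearest n s x \<in> D}" unfolding bounded_iff by blast
  show "\<exists>!R. R \<in> \<Lambda> \<and> x - R \<in> {x. nearest n s x \<in> D}" for x
  proof -
    have "R \<in> \<Lambda> \<Longrightarrow> nearest n s (x - R) = nearest n s x - R" for R
      using nearest_add[OF n, of "- R"] neg_in by simp
    then have "R \<in> \<Lambda> \<and> x - R \<in> {x. nearest n s x \<in> D} \<longleftrightarrow> R \<in> \<Lambda> \<and> nearest n s x - R \<in> D" for R
      by auto
    then show ?thesis using tiling[of "nearest n s x"] by simp
  qed
qed (use zero_in diff_in discrete in auto)

lemma nearest_in_grid_iff: "0 < n \<Longrightarrow> nearest n s x \<in> D \<longleftrightarrow> nearest n s x \<in> grid n s"
  using rep_in by (auto simp: grid_def nearest_def)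

text \<open>The sets on which \<open>nearest\<close> is constant are translates of each other, hence of equal volume. Those
belonging to the mesh points in \<open>D\<close> make up the set of all \<open>x\<close> with \<open>nearest n s x \<in> D\<close>, which is
another fundamental domain.\<close>

lemma integral_nearest:
  fixes f :: "'a \<Rightarrow> complex"
  assumes n: "0 < n" and [measurable]: "f \<in> borel_measurable borel" and f: "periodic f"
  shows "(LINT x:D|lborel. f (nearest n s x)) = measure lborel D *\<^sub>R gavg n s f"
proof -
  define D' where "D' = {x. nearest n s x \<in> D}"
  have D': "lattice_cell \<Lambda> D'" unfolding D'_def by (rule nearest_cell[OF n])
  define P where "P y = {x. nearest n s x = y}" for y
  have Pm [measurable]: "P y \<in> sets borel" for y unfolding P_def by measurable
  define \<mu> where "\<mu> = measure lborel (P s)"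
  \<comment> \<open>Translation by a difference of mesh points commutes with rounding.\<close>
  have P_trans: "emeasure lborel (P y) = emeasure lborel (P s)" if y: "y \<in> grid n s" for y
  proof -
    obtain G where G: "G \<in> \<Lambda>" "y = s + (1 / real n) *\<^sub>R G" using y unfolding grid_def by blast
    have "x + (y - s) \<in> P y \<longleftrightarrow> x \<in> P s" for x
    proof -
      have "real n *\<^sub>R (x + (y - s) - s) = real n *\<^sub>R (x - s) + G"
        using G n by (simp add: algebra_simps)
      then have "nearest n s (x + (y - s)) = nearest n s x + (y - s)"
        unfolding nearest_def by (simp add: rep_add[OF G(1)] G(2) scaleR_add_right)
      then show ?thesis by (auto simp: P_def algebra_simps)
    qed
    then have "(\<integral>\<^sup>+x. indicator (P s) x \<partial>lborel) = (\<integral>\<^sup>+x. indicator (P y) (x + (y - s)) \<partial>lborel)"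
      by (intro nn_integral_cong) (simp add: indicator_def)
    then have "emeasure lborel (P s) = (\<integral>\<^sup>+x. indicator (P y) (x + (y - s)) \<partial>lborel)"
      by simp
    also have "\<dots> = emeasure lborel (P y)"
      using nn_integral_lborel_translate[of "indicator (P y)" "y - s"] by simp
    finally show ?thesis ..
  qed
  obtain B where B: "\<And>x. x \<in> D \<Longrightarrow> norm x \<le> B" using cell_bounded bounded_iff by blast
  have "bounded (P s)"
    unfolding bounded_iff
  proof (intro exI ballI)
    fix x assume "x \<in> P s"
    then show "norm x \<le> norm s + B / real n"
      using nearest_dist[OF n B, of x s] norm_triangle_sub[of x s] by (simp add: P_def)
  qed
  then have P_fin: "emeasure lborel (P y) < \<infinity>" if "y \<in> grid n s" for y
    using P_trans[OF that] emeasure_bounded_finite by metis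
  have P_mu: "measure lborel (P y) = \<mu>" if "y \<in> grid n s" for y
    unfolding \<mu>_def measure_def P_trans[OF that] ..
  have main: "(LINT x:D|lborel. g (nearest n s x)) = \<mu> *\<^sub>R (\<Sum>y\<in>grid n s. g y)"
    if [measurable]: "g \<in> borel_measurable borel" and g: "periodic g" for g :: "'a \<Rightarrow> complex"
  proof -
    have "(LINT x:D|lborel. g (nearest n s x)) = (LINT x:D'|lborel. g (nearest n s x))"
      by (rule set_integral_cell_eq[OF lattice_cell_axioms D'])
         (use g n in \<open>auto simp: periodic_def nearest_add\<close>)
    also have "\<dots> = (\<integral>x. (\<Sum>y\<in>grid n s. indicator (P y) x *\<^sub>R g y) \<partial>lborel)"
      unfolding set_lebesgue_integral_def
    proof (rule Bochner_Integration.integral_cong[OF refl])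
      fix x
      have "(\<Sum>y\<in>grid n s. indicator (P y) x *\<^sub>R g y) = (\<Sum>y\<in>grid n s. if y = nearest n s x then g y else 0)"
        by (intro sum.cong) (auto simp: P_def)
      also have "\<dots> = indicator D' x *\<^sub>R g (nearest n s x)"
        using finite_grid[OF n] nearest_in_grid_iff[OF n] by (simp add: D'_def indicator_def)
      finally show "indicator D' x *\<^sub>R g (nearest n s x) = (\<Sum>y\<in>grid n s. indicator (P y) x *\<^sub>R g y)" ..
    qed
    also have "\<dots> = (\<Sum>y\<in>grid n s. \<integral>x. indicator (P y) x *\<^sub>R g y \<partial>lborel)"
      using P_fin by (intro Bochner_Integration.integral_sum integrable_scaleR_left integrable_real_indicator) auto
    also have "\<dots> = (\<Sum>y\<in>grid n s. \<mu> *\<^sub>R g y)"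
    proof (rule sum.cong[OF refl])
      fix y assume y: "y \<in> grid n s"
      then have "integrable lborel (indicator (P y) :: 'a \<Rightarrow> real)"
        using P_fin by (intro integrable_real_indicator) auto
      then show "(\<integral>x. indicator (P y) x *\<^sub>R g y \<partial>lborel) = \<mu> *\<^sub>R g y"
        using P_mu[OF y] by simp
    qed
    finally show ?thesis by (simp add: scaleR_sum_right)
  qed
  \<comment> \<open>The constant function 1 determines the common volume \<open>\<mu>\<close> of the pieces.\<close>
  have "measure lborel D *\<^sub>R (1 :: complex) = (\<mu> * real (card (grid n s))) *\<^sub>R 1"
    using main[of "\<lambda>_. 1"] cell_measure_finite
    by (simp add: periodic_def set_lebesgue_integral_def) (simp add: scaleR_conv_of_real)
  then have "measure lborel D = \<mu> * real (card (grid n s))"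
    by (simp only: scaleR_conv_of_real mult_1_right of_real_eq_iff)
  then show ?thesis
    using main[OF assms(2) f] card_grid_pos[OF n, of s] by (simp add: gavg_def)
qed

text \<open>The majorant \<open>g\<close> is required for \<open>f\<close> at rounded points, since these are the values which enter the averages.\<close>

lemma
  fixes f :: "'a \<Rightarrow> complex" and g :: "'a \<Rightarrow> real"
  assumes f [measurable]: "f \<in> borel_measurable borel" and per: "periodic f"
    and cont: "AE x in lborel. isCont f x"
    and g: "set_integrable lborel D g"
    and dom: "\<And>n. 0 < n \<Longrightarrow> AE x in lborel. x \<in> D \<longrightarrow> norm (f (nearest n s x)) \<le> g x"
  shows grid_limit: "(\<lambda>n. gavg (Suc n) s f) \<longlonglongrightarrow> (1 / measure lborel D) *\<^sub>R (LINT x:D|lborel. f x)"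
    and grid_integrable: "set_integrable lborel D f"
proof -
  obtain B where B: "\<And>x. x \<in> D \<Longrightarrow> norm x \<le> B" using cell_bounded bounded_iff by blast
  have near: "(\<lambda>n. nearest (Suc n) s x) \<longlonglongrightarrow> x" for x
  proof (rule LIM_zero_cancel, rule Lim_null_comparison)
    show "\<forall>\<^sub>F n in sequentially. norm (nearest (Suc n) s x - x) \<le> B / real (Suc n)"
      using nearest_dist[OF _ B, of "Suc _" x s] by (intro always_eventually) (auto simp: norm_minus_commute)
    show "(\<lambda>n. B / real (Suc n)) \<longlonglongrightarrow> 0"
      using tendsto_mult_left[OF LIMSEQ_inverse_real_of_nat, of B] by (simp add: divide_inverse)
  qed
  have 1: "AE x in lborel. (\<lambda>n. indicator D x *\<^sub>R f (nearest (Suc n) s x)) \<longlonglongrightarrow> indicator D x *\<^sub>R f x"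
    using cont by eventually_elim (intro tendsto_intros isCont_tendsto_compose[OF _ near])
  have 2: "AE x in lborel. norm (indicator D x *\<^sub>R f (nearest (Suc n) s x)) \<le> indicator D x *\<^sub>R g x" for n
    using dom[of "Suc n"] by (auto simp: indicator_def)
  note dct = g[unfolded set_integrable_def] 1 2
  have "(\<lambda>n. LINT x:D|lborel. f (nearest (Suc n) s x)) \<longlonglongrightarrow> (LINT x:D|lborel. f x)"
    unfolding set_lebesgue_integral_def
    by (rule integral_dominated_convergence[OF _ _ dct]) measurable
  then have "(\<lambda>n. (1 / measure lborel D) *\<^sub>R (LINT x:D|lborel. f (nearest (Suc n) s x)))
      \<longlonglongrightarrow> (1 / measure lborel D) *\<^sub>R (LINT x:D|lborel. f x)"
    by (intro tendsto_intros)
  then show "(\<lambda>n. gavg (Suc n) s f) \<longlonglongrightarrow> (1 / measure lborel D) *\<^sub>R (LINT x:D|lborel. f x)"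
    using cell_measure_pos by (simp add: integral_nearest[OF _ f per])
  show "set_integrable lborel D f"
    unfolding set_integrable_def
    by (rule integrable_dominated_convergence[OF _ _ dct]) measurable
qed

end

section \<open>Products of lattices\<close>

lemma lattice_cell_Times:
  assumes "lattice_cell \<Lambda>1 D1" "lattice_cell \<Lambda>2 D2"
  shows "lattice_cell (\<Lambda>1 \<times> \<Lambda>2) (D1 \<times> D2)"
proof
  interpret A: lattice_cell \<Lambda>1 D1 by fact
  interpret B: lattice_cell \<Lambda>2 D2 by fact
  show "0 \<in> \<Lambda>1 \<times> \<Lambda>2" by (simp add: A.zero_in B.zero_in zero_prod_def)
  show "x - y \<in> \<Lambda>1 \<times> \<Lambda>2" if "x \<in> \<Lambda>1 \<times> \<Lambda>2" "y \<in> \<Lambda>1 \<times> \<Lambda>2" for x y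
    using that A.diff_in B.diff_in by (auto simp: minus_prod_def)
  show "finite (\<Lambda>1 \<times> \<Lambda>2 \<inter> cball 0 r)" for r
  proof (rule finite_subset)
    show "\<Lambda>1 \<times> \<Lambda>2 \<inter> cball 0 r \<subseteq> (\<Lambda>1 \<inter> cball 0 r) \<times> (\<Lambda>2 \<inter> cball 0 r)"
      by (auto intro: order_trans[OF norm_fst_le] order_trans[OF norm_snd_le])
  qed (intro finite_cartesian_product A.discrete B.discrete)
  show "D1 \<times> D2 \<in> sets borel" by (intro borel_Times) measurable
  show "bounded (D1 \<times> D2)" by (intro bounded_Times A.cell_bounded B.cell_bounded)
  show "\<exists>!R. R \<in> \<Lambda>1 \<times> \<Lambda>2 \<and> x - R \<in> D1 \<times> D2" for x
  proof (rule ex1I[of _ "(A.rep (fst x), B.rep (snd x))"])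
    show "(A.rep (fst x), B.rep (snd x)) \<in> \<Lambda>1 \<times> \<Lambda>2 \<and> x - (A.rep (fst x), B.rep (snd x)) \<in> D1 \<times> D2"
      by (cases x) (auto simp: A.rep_in B.rep_in A.rep_cell B.rep_cell)
    fix R assume "R \<in> \<Lambda>1 \<times> \<Lambda>2 \<and> x - R \<in> D1 \<times> D2"
    then show "R = (A.rep (fst x), B.rep (snd x))"
      by (cases x; cases R) (auto simp: A.rep_unique B.rep_unique)
  qed
qed

lemma grid_Times:
  assumes "lattice_cell \<Lambda>1 D1" "lattice_cell \<Lambda>2 D2"
  shows "lattice_cell.grid (\<Lambda>1 \<times> \<Lambda>2) (D1 \<times> D2) n (s1, s2)
       = lattice_cell.grid \<Lambda>1 D1 n s1 \<times> lattice_cell.grid \<Lambda>2 D2 n s2"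
  using assms lattice_cell_Times[OF assms] by (auto simp: lattice_cell.grid_def)

lemma halving_Times:
  assumes "lattice_cell \<Lambda>1 D1" "lattice_cell \<Lambda>2 D2"
    and E1: "lattice_cell.halving \<Lambda>1 E1" and E2: "lattice_cell.halving \<Lambda>2 E2"
  shows "lattice_cell.halving (\<Lambda>1 \<times> \<Lambda>2) (E1 \<times> E2)"
  unfolding lattice_cell.halving_def[OF lattice_cell_Times[OF assms(1,2)]]
proof (intro conjI ballI)
  show "finite (E1 \<times> E2)" "E1 \<times> E2 \<subseteq> \<Lambda>1 \<times> \<Lambda>2"
    using E1 E2 by (auto simp: lattice_cell.halving_def[OF assms(1)] lattice_cell.halving_def[OF assms(2)])
  fix G assume "G \<in> \<Lambda>1 \<times> \<Lambda>2"
  then obtain G1 G2 where G: "G = (G1, G2)" "G1 \<in> \<Lambda>1" "G2 \<in> \<Lambda>2" by auto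
  have x1: "\<exists>!e. e \<in> E1 \<and> (\<exists>H\<in>\<Lambda>1. G1 = e + 2 *\<^sub>R H)" and x2: "\<exists>!e. e \<in> E2 \<and> (\<exists>H\<in>\<Lambda>2. G2 = e + 2 *\<^sub>R H)"
    using E1 E2 G by (auto simp: lattice_cell.halving_def[OF assms(1)] lattice_cell.halving_def[OF assms(2)])
  then obtain e1 e2 H1 H2 where e: "e1 \<in> E1" "H1 \<in> \<Lambda>1" "G1 = e1 + 2 *\<^sub>R H1" "e2 \<in> E2" "H2 \<in> \<Lambda>2" "G2 = e2 + 2 *\<^sub>R H2"
    by blast
  show "\<exists>!e. e \<in> E1 \<times> E2 \<and> (\<exists>H\<in>\<Lambda>1 \<times> \<Lambda>2. G = e + 2 *\<^sub>R H)"
  proof (rule ex1I[of _ "(e1, e2)"])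
    show "(e1, e2) \<in> E1 \<times> E2 \<and> (\<exists>H\<in>\<Lambda>1 \<times> \<Lambda>2. G = (e1, e2) + 2 *\<^sub>R H)"
      using e G by (intro conjI bexI[of _ "(H1, H2)"]) auto
    fix e assume e': "e \<in> E1 \<times> E2 \<and> (\<exists>H\<in>\<Lambda>1 \<times> \<Lambda>2. G = e + 2 *\<^sub>R H)"
    then obtain a1 a2 K1 K2 where a: "e = (a1, a2)" "a1 \<in> E1" "a2 \<in> E2" "K1 \<in> \<Lambda>1" "K2 \<in> \<Lambda>2"
      "G1 = a1 + 2 *\<^sub>R K1" "G2 = a2 + 2 *\<^sub>R K2" using G by auto
    have "a1 = e1" using x1 a(2,4,6) e(1,2,3) by blast
    moreover have "a2 = e2" using x2 a(3,5,7) e(4,5,6) by blast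
    ultimately show "e = (e1, e2)" by (simp add: a)
  qed
qed

context lattice_cell
begin

section \<open>Distance to a lattice\<close>

lemma min_norm: "\<exists>c>0. \<forall>G\<in>\<Lambda>. G \<noteq> 0 \<longrightarrow> c \<le> norm G"
proof -
  define S where "S = norm ` (\<Lambda> \<inter> cball 0 1 - {0}) \<union> {1}"
  have fin: "finite S" unfolding S_def using discrete by auto
  have "\<forall>G\<in>\<Lambda>. G \<noteq> 0 \<longrightarrow> Min S \<le> norm G"
  proof (intro ballI impI)
    fix G assume G: "G \<in> \<Lambda>" "G \<noteq> 0"
    show "Min S \<le> norm G"
    proof (cases "norm G \<le> 1")
      case True
      then show ?thesis using G fin by (intro Min_le) (auto simp: S_def)
    next
      case False
      have "Min S \<le> 1" using fin by (intro Min_le) (auto simp: S_def)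
      then show ?thesis using False by simp
    qed
  qed
  moreover have "0 < Min S" using fin by (subst Min_gr_iff) (auto simp: S_def)
  ultimately show ?thesis by blast
qed

lemma closed_lattice: "closed \<Lambda>"
proof -
  obtain c where c: "0 < c" "\<And>G. G \<in> \<Lambda> \<Longrightarrow> G \<noteq> 0 \<Longrightarrow> c \<le> norm G" using min_norm by blast
  show ?thesis
    using c(1)
  proof (rule discrete_imp_closed, intro ballI impI)
    fix x y assume "x \<in> \<Lambda>" "y \<in> \<Lambda>" "dist y x < c"
    then show "y = x" using c(2)[of "y - x"] diff_in[of y x] by (force simp: dist_norm)
  qed
qed

abbreviation ldist :: "'a \<Rightarrow> real" where "ldist q \<equiv> infdist q \<Lambda>"

lemma ldist_measurable [measurable]: "ldist \<in> borel_measurable borel"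
  by (intro borel_measurable_continuous_onI continuous_on_infdist continuous_on_id)

lemma ldist_attained: obtains G where "G \<in> \<Lambda>" "ldist q = norm (q - G)"
  using infdist_attains_inf[OF closed_lattice, of q] zero_in by (auto simp: dist_norm)

lemma ldist_le: "G \<in> \<Lambda> \<Longrightarrow> ldist q \<le> norm (q - G)"
  using infdist_le[of G \<Lambda> q] by (simp add: dist_norm)

lemma ldist_le_plus: "G \<in> \<Lambda> \<Longrightarrow> ldist q \<le> norm (q + G)"
  using ldist_le[OF neg_in] by simp

lemma ldist_eq_0_iff: "ldist q = 0 \<longleftrightarrow> q \<in> \<Lambda>"
  using in_closed_iff_infdist_zero[OF closed_lattice] zero_in by blast

lemma ldist_add_le: "ldist (p + v) \<le> ldist p + norm v"
  using infdist_triangle[of "p + v" \<Lambda> p] by (simp add: dist_norm)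

lemma ldist_add: assumes "G \<in> \<Lambda>" shows "ldist (q + G) = ldist q"
proof -
  have "ldist (x + H) \<le> ldist x" if H: "H \<in> \<Lambda>" for x H
  proof -
    obtain K where K: "K \<in> \<Lambda>" "ldist x = norm (x - K)" using ldist_attained by blast
    then show ?thesis using ldist_le[OF add_in[OF K(1) H], of "x + H"] by simp
  qed
  from this[OF assms, of q] this[OF neg_in[OF assms], of "q + G"] show ?thesis by simp
qed

lemma ldist_uminus: "ldist (- q) = ldist q"
proof -
  have "ldist (- x) \<le> ldist x" for x
  proof -
    obtain K where K: "K \<in> \<Lambda>" "ldist x = norm (x - K)" using ldist_attained by blast
    have "ldist (- x) \<le> norm (- x - (- K))" using K neg_in by (intro ldist_le) auto
    also have "- x - (- K) = - (x - K)" by simp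
    also have "norm \<dots> = norm (x - K)" by (rule norm_minus_cancel)
    finally show ?thesis using K by simp
  qed
  from this[of q] this[of "- q"] show ?thesis by simp
qed

text \<open>Mesh points cannot approach the lattice: at most one mesh step is left between them.\<close>

lemma ldist_scaled_lower:
  assumes "0 < n" "real n *\<^sub>R q \<in> \<Lambda>" "q \<notin> \<Lambda>" "\<And>G. G \<in> \<Lambda> \<Longrightarrow> G \<noteq> 0 \<Longrightarrow> c \<le> norm G"
  shows "c / real n \<le> ldist q"
proof -
  obtain G where G: "G \<in> \<Lambda>" "ldist q = norm (q - G)" using ldist_attained by blast
  have "real n *\<^sub>R (q - G) \<in> \<Lambda>" using assms G scale_in diff_in by (simp add: scaleR_diff_right)
  moreover have "real n *\<^sub>R (q - G) \<noteq> 0" using assms G by auto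
  ultimately have "c \<le> norm (real n *\<^sub>R (q - G))" by (rule assms(4))
  then show ?thesis using assms(1) G by (simp add: divide_simps mult.commute)
qed

lemma ldist_bounded: "\<exists>B>0. \<forall>q. ldist q \<le> B"
proof -
  obtain B where B: "0 < B" "\<And>x. x \<in> D \<Longrightarrow> norm x \<le> B" using cell_bounded bounded_pos by blast
  then have "ldist q \<le> B" for q using ldist_le[OF rep_in[of q], of q] rep_cell[of q] by fastforce
  then show ?thesis using B(1) by blast
qed

text \<open>Send a mesh point \<open>q\<close> to \<open>n *\<^sub>R (q - G)\<close>, where \<open>G\<close> is a nearest lattice vector. This map into the lattice
is injective, since different points of the cell are inequivalent, and it multiplies the
distance by \<open>n\<close>. The step \<open>1 / (2 * n)\<close> is that of the refined mesh in \<open>gavg_halve\<close>.\<close>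

lemma grid_sum_decay:
  assumes tail: "\<And>F. finite F \<Longrightarrow> F \<subseteq> \<Lambda> \<Longrightarrow> (\<Sum>G\<in>F. (1 / max 1 (norm G)) ^ m) \<le> C" and n: "0 < n"
  shows "(\<Sum>q\<in>grid n 0. (1 / real (2 * n) / max (1 / real (2 * n)) (ldist q)) ^ m) \<le> C"
proof -
  define cl where "cl q = (SOME G. G \<in> \<Lambda> \<and> ldist q = norm (q - G))" for q
  have cl: "cl q \<in> \<Lambda>" "ldist q = norm (q - cl q)" for q
    using someI_ex[of "\<lambda>G. G \<in> \<Lambda> \<and> ldist q = norm (q - G)"] ldist_attained[of q]
    unfolding cl_def by blast+
  define g where "g q = real n *\<^sub>R (q - cl q)" for q
  have inj: "inj_on g (grid n 0)"
  proof (rule inj_onI)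
    fix x y assume xy: "x \<in> grid n 0" "y \<in> grid n 0" "g x = g y"
    then have "x - cl x = y - cl y" using n by (simp add: g_def)
    then have "y = x + (cl y - cl x)" by (simp add: algebra_simps)
    moreover have "x \<in> D" "y \<in> D" using xy by (auto simp: grid_def)
    ultimately show "x = y"
      using rep_add[OF diff_in[OF cl(1)[of y] cl(1)[of x]], of x] rep_eq_0 by force
  qed
  have sub: "g ` grid n 0 \<subseteq> \<Lambda>"
    using grid_scaled[OF _ n, of _ 0] diff_in scale_in cl(1) by (auto simp: g_def scaleR_diff_right)
  have "(\<Sum>q\<in>grid n 0. (1 / real (2 * n) / max (1 / real (2 * n)) (ldist q)) ^ m)
      \<le> (\<Sum>q\<in>grid n 0. (1 / max 1 (norm (g q))) ^ m)"
  proof (intro sum_mono power_mono)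
    fix q
    have "max 1 (norm (g q)) \<le> max 1 (2 * real n * ldist q)"
      using n infdist_nonneg[of q \<Lambda>] by (simp add: g_def cl(2) mult_right_mono max.coboundedI2)
    also have "\<dots> = max (1 / real (2 * n)) (ldist q) / (1 / real (2 * n))"
      using n by (simp add: max_def field_simps)
    finally have "1 / (max (1 / real (2 * n)) (ldist q) / (1 / real (2 * n))) \<le> 1 / max 1 (norm (g q))"
      by (intro divide_left_mono mult_pos_pos) (use n in \<open>auto simp: less_max_iff_disj\<close>)
    then show "1 / real (2 * n) / max (1 / real (2 * n)) (ldist q) \<le> 1 / max 1 (norm (g q))"
      by (simp add: mult.commute)
    show "0 \<le> 1 / real (2 * n) / max (1 / real (2 * n)) (ldist q)"
      by (simp add: le_max_iff_disj)
  qed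
  also have "\<dots> = (\<Sum>G\<in>g ` grid n 0. (1 / max 1 (norm G)) ^ m)"
    by (simp add: sum.reindex[OF inj])
  also have "\<dots> \<le> C" using finite_grid[OF n] sub by (intro tail) auto
  finally show ?thesis by simp
qed

end

text \<open>Dyadic shells: where the distance is about \<open>B / 2 ^ j\<close>, the integrand is of size \<open>4 ^ j\<close>, and in
dimension three the volume of this region is \<open>O(1 / 8 ^ j)\<close>.\<close>

lemma (in lattice_cell) nn_integral_inverse_square:
  assumes dim: "DIM('a) = 3"
  shows "(\<integral>\<^sup>+x. ennreal (1 / (ldist x)\<^sup>2) * indicator D x \<partial>lborel) < \<infinity>"
proof -
  obtain B where B: "0 < B" "\<And>q. ldist q \<le> B" using ldist_bounded by blast
  obtain B' where B': "0 < B'" "\<And>x. x \<in> D \<Longrightarrow> norm x \<le> B'" using cell_bounded bounded_pos by blast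
  \<comment> \<open>Only finitely many lattice vectors are nearest to some point of the cell.\<close>
  define F where "F = \<Lambda> \<inter> cball 0 (B + B')"
  have F: "finite F" unfolding F_def by (rule discrete)
  define S where "S j = {x \<in> D. ldist x \<le> B / 2 ^ j}" for j :: nat
  have [measurable]: "S j \<in> sets borel" for j unfolding S_def by measurable
  define V where "V = unit_ball_vol (3 :: real)"
  have V: "0 \<le> V" unfolding V_def by (simp add: unit_ball_vol_nonneg)
  have S_measure: "emeasure lborel (S j) \<le> ennreal (real (card F) * V * B ^ 3 / 8 ^ j)" for j
  proof -
    have "S j \<subseteq> (\<Union>G\<in>F. cball G (B / 2 ^ j))"
    proof
      fix x assume x: "x \<in> S j"
      obtain G where G: "G \<in> \<Lambda>" "ldist x = norm (x - G)" using ldist_attained by blast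
      have "norm G \<le> B' + B"
        using B'(2)[of x] B(2)[of x] x G norm_triangle_sub[of G x] by (simp add: S_def norm_minus_commute)
      then show "x \<in> (\<Union>G\<in>F. cball G (B / 2 ^ j))"
        using G x by (auto simp: F_def S_def dist_norm norm_minus_commute add.commute)
    qed
    then have "emeasure lborel (S j) \<le> emeasure lborel (\<Union>G\<in>F. cball G (B / 2 ^ j))"
      using F by (intro emeasure_mono) (auto intro!: sets.finite_UN)
    also have "\<dots> \<le> (\<Sum>G\<in>F. emeasure lborel (cball G (B / 2 ^ j)))"
      using F by (intro emeasure_subadditive_finite) auto
    also have "\<dots> = (\<Sum>G\<in>F. ennreal (V * (B / 2 ^ j) ^ 3))"
      using B by (intro sum.cong) (auto simp: emeasure_cball dim V_def)
    also have "\<dots> = ennreal (real (card F) * (V * (B / 2 ^ j) ^ 3))"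
      using V B by (subst sum_ennreal) auto
    also have "real (card F) * (V * (B / 2 ^ j) ^ 3) = real (card F) * V * B ^ 3 / 8 ^ j"
      by (simp add: power_divide flip: power_mult) (simp add: mult.commute[of _ 3] power_mult)
    finally show ?thesis .
  qed
  have "(\<integral>\<^sup>+x. ennreal (1 / (ldist x)\<^sup>2) * indicator D x \<partial>lborel)
      \<le> (\<integral>\<^sup>+x. (\<Sum>j. ennreal (4 * 4 ^ j / B\<^sup>2) * indicator (S j) x) \<partial>lborel)"
  proof (rule nn_integral_mono)
    fix x
    show "ennreal (1 / (ldist x)\<^sup>2) * indicator D x \<le> (\<Sum>j. ennreal (4 * 4 ^ j / B\<^sup>2) * indicator (S j) x)"
    proof (cases "x \<in> D \<and> ldist x \<noteq> 0")
      case True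
      then have d: "0 < ldist x" using infdist_nonneg[of x \<Lambda>] by linarith
      have "\<exists>j. B / 2 ^ Suc j < ldist x"
      proof -
        obtain j where "B / ldist x < 2 ^ j" using real_arch_pow[of 2 "B / ldist x"] by auto
        then have "B / 2 ^ Suc j < ldist x"
        proof -
          have "B < 2 ^ j * ldist x" using \<open>B / ldist x < 2 ^ j\<close> d by (simp add: pos_divide_less_eq)
          also have "\<dots> \<le> 2 ^ Suc j * ldist x" using d by simp
          finally show ?thesis by (simp add: pos_divide_less_eq mult.commute)
        qed
        then show ?thesis by blast
      qed
      define j where "j = (LEAST j. B / 2 ^ Suc j < ldist x)"
      have j: "B / 2 ^ Suc j < ldist x" unfolding j_def by (rule LeastI_ex) fact
      have "ldist x \<le> B / 2 ^ j"
      proof (cases j)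
        case (Suc i)
        then show ?thesis using not_less_Least[of i "\<lambda>j. B / 2 ^ Suc j < ldist x"] by (simp add: j_def)
      qed (use B in auto)
      then have xS: "x \<in> S j" using True by (simp add: S_def)
      have "(B / 2 ^ Suc j)\<^sup>2 \<le> (ldist x)\<^sup>2" using j B by (intro power_mono) auto
      moreover have "(B / 2 ^ Suc j)\<^sup>2 = B\<^sup>2 / (4 * 4 ^ j)"
        by (simp add: power_divide power_mult_distrib flip: power_mult) (simp add: mult.commute[of _ 2] power_mult)
      ultimately have "1 / (ldist x)\<^sup>2 \<le> 4 * 4 ^ j / B\<^sup>2"
        using d B by (simp add: divide_simps mult.commute)
      then have "ennreal (1 / (ldist x)\<^sup>2) * indicator D x \<le> ennreal (4 * 4 ^ j / B\<^sup>2) * indicator (S j) x"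
        using xS True by (simp add: ennreal_leI)
      also have "\<dots> \<le> (\<Sum>j. ennreal (4 * 4 ^ j / B\<^sup>2) * indicator (S j) x)"
      proof -
        have "f j \<le> (\<Sum>j. f j)" for f :: "nat \<Rightarrow> ennreal"
          using sum_le_suminf[of f "{j}"] by simp
        then show ?thesis .
      qed
      finally show ?thesis .
    qed auto
  qed
  also have "\<dots> = (\<Sum>j. ennreal (4 * 4 ^ j / B\<^sup>2) * emeasure lborel (S j))"
    by (subst nn_integral_suminf) (auto simp: nn_integral_cmult)
  also have "\<dots> \<le> (\<Sum>j. ennreal (4 * real (card F) * V * B * (1 / 2) ^ j))"
  proof (rule suminf_le)
    fix j
    have "ennreal (4 * 4 ^ j / B\<^sup>2) * emeasure lborel (S j)
        \<le> ennreal (4 * 4 ^ j / B\<^sup>2) * ennreal (real (card F) * V * B ^ 3 / 8 ^ j)"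
      by (intro mult_left_mono S_measure) auto
    also have "\<dots> = ennreal (4 * 4 ^ j / B\<^sup>2 * (real (card F) * V * B ^ 3 / 8 ^ j))"
      using V B by (subst ennreal_mult) auto
    also have "4 * 4 ^ j / B\<^sup>2 * (real (card F) * V * B ^ 3 / 8 ^ j) = 4 * real (card F) * V * B * (4 ^ j / 8 ^ j)"
      using B by (simp add: field_simps power2_eq_square power3_eq_cube)
    also have "(4 ^ j / 8 ^ j :: real) = (1 / 2) ^ j" by (simp flip: power_divide)
    finally show "ennreal (4 * 4 ^ j / B\<^sup>2) * emeasure lborel (S j) \<le> ennreal (4 * real (card F) * V * B * (1 / 2) ^ j)" .
  qed auto
  also have "\<dots> = ennreal (\<Sum>j. 4 * real (card F) * V * B * (1 / 2) ^ j)"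
    using V B by (intro suminf_ennreal2) (auto intro!: summable_mult summable_geometric)
  finally show ?thesis by (rule le_less_trans) simp
qed

section \<open>Integer coordinates of a lattice\<close>

definition int_coords :: "(real^3) set \<Rightarrow> (real^3 \<Rightarrow> real^3) \<Rightarrow> bool" where
  "int_coords \<Lambda> \<phi> \<longleftrightarrow> linear \<phi> \<and> bij \<phi> \<and> \<Lambda> = {x. \<forall>j. \<phi> x $ j \<in> \<int>}"

lemma finite_box_vec: "finite S \<Longrightarrow> finite {z :: 'b^'n. \<forall>j. z $ j \<in> S}"
proof -
  assume "finite S"
  then have "finite (vec_lambda ` (PiE (UNIV :: 'n set) (\<lambda>_. S)) :: ('b^'n) set)"
    by (intro finite_imageI finite_PiE) auto
  moreover have "{z :: 'b^'n. \<forall>j. z $ j \<in> S} \<subseteq> vec_lambda ` (PiE (UNIV :: 'n set) (\<lambda>_. S))"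
  proof
    fix z :: "'b^'n" assume "z \<in> {z. \<forall>j. z $ j \<in> S}"
    then show "z \<in> vec_lambda ` (PiE (UNIV :: 'n set) (\<lambda>_. S))"
      by (intro image_eqI[of _ _ "vec_nth z"]) auto
  qed
  ultimately show ?thesis by (rule finite_subset[rotated])
qed

lemma int_coords_bound: "int_coords \<Lambda> \<phi> \<Longrightarrow> \<exists>K>0. \<forall>x. norm (\<phi> x) \<le> K * norm x"
  using linear_bounded_pos unfolding int_coords_def by (metis mult.commute)

lemma int_coords_discrete:
  assumes "int_coords \<Lambda> \<phi>" shows "finite (\<Lambda> \<inter> cball 0 r)"
proof -
  obtain K where K: "0 < K" "\<And>x. norm (\<phi> x) \<le> K * norm x" using int_coords_bound[OF assms] by blast
  have "\<phi> ` (\<Lambda> \<inter> cball 0 r) \<subseteq> {z. \<forall>j. z $ j \<in> {k \<in> \<int>. \<bar>k\<bar> \<le> K * r}}"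
  proof safe
    fix x j assume x: "x \<in> \<Lambda>" "x \<in> cball 0 r"
    then show "\<phi> x $ j \<in> \<int>" using assms by (simp add: int_coords_def)
    have "\<bar>\<phi> x $ j\<bar> \<le> norm (\<phi> x)" by (rule component_le_norm_cart)
    also have "\<dots> \<le> K * norm x" by (rule K)
    also have "\<dots> \<le> K * r" using K x by auto
    finally show "\<bar>\<phi> x $ j\<bar> \<le> K * r" .
  qed
  moreover have "finite {z :: real^3. \<forall>j. z $ j \<in> {k \<in> \<int>. \<bar>k\<bar> \<le> K * r}}"
    by (intro finite_box_vec finite_abs_int_segment)
  moreover have "inj_on \<phi> (\<Lambda> \<inter> cball 0 r)"
    using assms by (auto simp: int_coords_def bij_def intro: inj_on_subset)
  ultimately show ?thesis using finite_imageD finite_subset by blast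
qed

lemma int_coords_cell:
  assumes "int_coords \<Lambda> \<phi>" "D \<in> sets borel" "bounded D" "\<And>x. \<exists>!R. R \<in> \<Lambda> \<and> x - R \<in> D"
  shows "lattice_cell \<Lambda> D"
proof
  show "0 \<in> \<Lambda>" "\<And>x y. x \<in> \<Lambda> \<Longrightarrow> y \<in> \<Lambda> \<Longrightarrow> x - y \<in> \<Lambda>"
    using assms(1) by (auto simp: int_coords_def linear_0 linear_diff)
  show "finite (\<Lambda> \<inter> cball 0 r)" for r using assms(1) by (rule int_coords_discrete)
qed (use assms in auto)

text \<open>The representatives are the lattice vectors with coordinates 0 and 1.\<close>

lemma int_coords_halving:
  assumes "int_coords \<Lambda> \<phi>" "lattice_cell \<Lambda> D"
  shows "\<exists>E. lattice_cell.halving \<Lambda> E"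
proof -
  have lin: "linear \<phi>" and inj: "inj \<phi>" and surj: "surj \<phi>" and L: "\<Lambda> = {x. \<forall>j. \<phi> x $ j \<in> \<int>}"
    using assms by (auto simp: int_coords_def bij_def)
  define E where "E = {x. \<forall>j. \<phi> x $ j \<in> {0, 1}}"
  have "finite (\<phi> ` E)"
    by (rule finite_subset[OF _ finite_box_vec[of "{0, 1}"]]) (auto simp: E_def)
  then have fin: "finite E" using inj finite_imageD inj_on_subset by blast
  have sub: "E \<subseteq> \<Lambda>"
  proof
    fix x assume "x \<in> E"
    then have *: "\<phi> x $ j = 0 \<or> \<phi> x $ j = 1" for j by (auto simp: E_def)
    have "\<phi> x $ j \<in> \<int>" for j using *[of j] by (elim disjE) simp_all
    then show "x \<in> \<Lambda>" unfolding L by simp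
  qed
  have ex: "\<exists>!e. e \<in> E \<and> (\<exists>H\<in>\<Lambda>. G = e + 2 *\<^sub>R H)" if "G \<in> \<Lambda>" for G
  proof -
    obtain z where z: "\<And>j. \<phi> G $ j = real_of_int (z j)"
    proof -
      have "\<forall>j. \<exists>k :: int. \<phi> G $ j = real_of_int k"
        using \<open>G \<in> \<Lambda>\<close> unfolding L by (auto elim: Ints_cases)
      then show ?thesis using that by metis
    qed
    define e where "e = inv \<phi> (\<chi> j. real_of_int (z j mod 2))"
    define H where "H = inv \<phi> (\<chi> j. real_of_int (z j div 2))"
    have e: "\<phi> e = (\<chi> j. real_of_int (z j mod 2))" and H: "\<phi> H = (\<chi> j. real_of_int (z j div 2))"
      unfolding e_def H_def by (rule surj_f_inv_f[OF surj])+
    have "\<phi> (e + 2 *\<^sub>R H) = \<phi> G"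
    proof (simp add: vec_eq_iff linear_add[OF lin] linear_scale[OF lin] e H z, intro allI)
      fix j
      have "real_of_int (z j mod 2 + 2 * (z j div 2)) = real_of_int (z j)" by simp
      then show "real_of_int (z j mod 2) + 2 * real_of_int (z j div 2) = real_of_int (z j)"
        by (simp only: of_int_add of_int_mult of_int_numeral)
    qed
    then have G: "G = e + 2 *\<^sub>R H" by (rule injD[OF inj, symmetric])
    have "H \<in> \<Lambda>" unfolding L using H by simp
    have "e \<in> E"
      unfolding E_def
    proof (intro CollectI allI)
      fix j
      have "z j mod 2 = 0 \<or> z j mod 2 = 1" by auto
      then show "\<phi> e $ j \<in> {0, 1}" by (auto simp: e)
    qed
    show ?thesis
    proof (rule ex1I[of _ e])
      show "e \<in> E \<and> (\<exists>H\<in>\<Lambda>. G = e + 2 *\<^sub>R H)" using \<open>e \<in> E\<close> \<open>H \<in> \<Lambda>\<close> G by blast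
      fix e' assume e': "e' \<in> E \<and> (\<exists>H\<in>\<Lambda>. G = e' + 2 *\<^sub>R H)"
      then obtain H' where H': "H' \<in> \<Lambda>" "G = e' + 2 *\<^sub>R H'" by blast
      have "\<phi> e' $ j = \<phi> e $ j" for j
      proof -
        obtain w where w: "\<phi> H' $ j = real_of_int w" using H'(1) unfolding L by (auto elim: Ints_cases)
        have eq: "\<phi> e' $ j + 2 * real_of_int w = real_of_int (z j)"
          using arg_cong[OF H'(2), of "\<lambda>x. \<phi> x $ j"] z[of j] w
          by (simp add: linear_add[OF lin] linear_scale[OF lin])
        have "\<phi> e' $ j = 0 \<or> \<phi> e' $ j = 1" using e' by (auto simp: E_def)
        then obtain u :: int where u: "\<phi> e' $ j = real_of_int u" "u = 0 \<or> u = 1"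
          using that[of 0] that[of 1] by auto
        with eq have "real_of_int (u + 2 * w) = real_of_int (z j)" by simp
        then have "u + 2 * w = z j" by (simp only: of_int_eq_iff)
        then have "z j mod 2 = u" using u(2) by presburger
        then show ?thesis by (simp add: e u)
      qed
      then have "\<phi> e' = \<phi> e" by (simp add: vec_eq_iff)
      then show "e' = e" by (rule injD[OF inj])
    qed
  qed
  show ?thesis
    unfolding lattice_cell.halving_def[OF assms(2)]
    by (intro exI[of _ E] conjI ballI fin sub ex)
qed

lemma sum_inverse_squares_int:
  "\<exists>C\<ge>0. \<forall>F. finite F \<longrightarrow> (\<Sum>z\<in>F. 1 / (max 1 \<bar>real_of_int z\<bar>)\<^sup>2) \<le> C"
proof -
  define a where "a k = 1 / (max 1 (real k))\<^sup>2" for k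
  have a0: "0 \<le> a k" for k by (simp add: a_def)
  have "summable a"
  proof (rule summable_comparison_test_ev[OF always_eventually[OF allI]])
    show "summable (\<lambda>k. inverse (real (Suc k) ^ 2) * 4)"
      using inverse_power_summable[of 2, where 'a = real] by (intro summable_mult2) (subst summable_Suc_iff, simp)
    show "norm (a k) \<le> inverse (real (Suc k) ^ 2) * 4" for k
    proof -
      have "(real (Suc k))\<^sup>2 \<le> (2 * max 1 (real k))\<^sup>2" by (intro power_mono) auto
      then show ?thesis by (simp add: a_def power_mult_distrib divide_simps del: of_nat_Suc)
    qed
  qed
  then have le: "(\<Sum>k\<in>N. a k) \<le> suminf a" if "finite N" for N
    using that a0 by (intro sum_le_suminf) auto
  have "(\<Sum>z\<in>F. 1 / (max 1 \<bar>real_of_int z\<bar>)\<^sup>2) \<le> 2 * suminf a" if F: "finite F" for F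
  proof -
    define N where "N = (\<lambda>z. nat \<bar>z\<bar>) ` F"
    have N: "finite N" using F by (simp add: N_def)
    have "F \<subseteq> int ` N \<union> (\<lambda>k. - int k) ` N"
    proof
      fix z assume z: "z \<in> F"
      then have "nat \<bar>z\<bar> \<in> N" by (simp add: N_def)
      moreover have "z = int (nat \<bar>z\<bar>) \<or> z = - int (nat \<bar>z\<bar>)" by linarith
      ultimately show "z \<in> int ` N \<union> (\<lambda>k. - int k) ` N" by blast
    qed
    then have "(\<Sum>z\<in>F. 1 / (max 1 \<bar>real_of_int z\<bar>)\<^sup>2)
        \<le> (\<Sum>z\<in>int ` N \<union> (\<lambda>k. - int k) ` N. 1 / (max 1 \<bar>real_of_int z\<bar>)\<^sup>2)"
      using N by (intro sum_mono2) auto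
    also have "\<dots> \<le> (\<Sum>z\<in>int ` N. 1 / (max 1 \<bar>real_of_int z\<bar>)\<^sup>2)
        + (\<Sum>z\<in>(\<lambda>k. - int k) ` N. 1 / (max 1 \<bar>real_of_int z\<bar>)\<^sup>2)"
      using N by (subst sum.union_inter[symmetric]) (auto intro!: sum_nonneg)
    also have "\<dots> = 2 * (\<Sum>k\<in>N. a k)"
      by (simp add: sum.reindex inj_on_def a_def)
    also have "\<dots> \<le> 2 * suminf a" using le[OF N] by simp
    finally show ?thesis .
  qed
  moreover have "0 \<le> 2 * suminf a" using \<open>summable a\<close> a0 by (simp add: suminf_nonneg)
  ultimately show ?thesis by blast
qed

text \<open>Up to a constant, the norm of a lattice vector dominates each of its three integer coordinates.
Its sixth inverse power is therefore dominated by the product of their inverse squares, and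
the sum over the lattice by the third power of a sum over the integers. Any exponent above 3
would do; with six the sum factorizes, and this is why differences of order six are used.\<close>

lemma int_coords_tail:
  assumes \<phi>: "int_coords \<Lambda> \<phi>"
  shows "\<exists>C\<ge>0. \<forall>F. finite F \<longrightarrow> F \<subseteq> \<Lambda> \<longrightarrow> (\<Sum>G\<in>F. (1 / max 1 (norm G)) ^ 6) \<le> C"
proof -
  obtain K0 where K0: "0 < K0" "\<And>x. norm (\<phi> x) \<le> K0 * norm x" using int_coords_bound[OF \<phi>] by blast
  define K where "K = max 1 K0"
  have K: "1 \<le> K" "norm (\<phi> x) \<le> K * norm x" for x
    using K0(2)[of x] mult_right_mono[of K0 K "norm x"] by (auto simp: K_def)
  obtain C where C: "0 \<le> C" "\<And>F. finite F \<Longrightarrow> (\<Sum>z\<in>F. 1 / (max 1 \<bar>real_of_int z\<bar>)\<^sup>2) \<le> C"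
    using sum_inverse_squares_int by blast
  define w where "w z = 1 / (max 1 \<bar>real_of_int z\<bar>)\<^sup>2" for z
  have w0: "0 \<le> w z" for z by (simp add: w_def)
  define \<zeta> where "\<zeta> G = (\<lambda>j. \<lfloor>\<phi> G $ j\<rfloor>)" for G
  have \<zeta>: "real_of_int (\<zeta> G j) = \<phi> G $ j" if "G \<in> \<Lambda>" for G j
    using that \<phi> by (simp add: int_coords_def \<zeta>_def)
  have inj: "inj_on \<zeta> \<Lambda>"
  proof (rule inj_onI)
    fix x y assume xy: "x \<in> \<Lambda>" "y \<in> \<Lambda>" "\<zeta> x = \<zeta> y"
    then have "\<phi> x = \<phi> y" using \<zeta>[of x] \<zeta>[of y] by (metis vec_eq_iff)
    then show "x = y" using \<phi> by (auto simp: int_coords_def bij_def inj_eq)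
  qed
  have "(\<Sum>G\<in>F. (1 / max 1 (norm G)) ^ 6) \<le> K ^ 6 * C ^ 3" if F: "finite F" "F \<subseteq> \<Lambda>" for F
  proof -
    define S where "S = (\<Union>j. (\<lambda>G. \<zeta> G j) ` F)"
    have S: "finite S" using F by (simp add: S_def)
    have pt: "(1 / max 1 (norm G)) ^ 6 \<le> K ^ 6 * (\<Prod>j\<in>UNIV. w (\<zeta> G j))" if G: "G \<in> F" for G
    proof -
      have comp: "1 / (K * max 1 (norm G)) \<le> 1 / max 1 \<bar>real_of_int (\<zeta> G j)\<bar>" for j
      proof -
        have "\<bar>real_of_int (\<zeta> G j)\<bar> \<le> K * norm G"
          using component_le_norm_cart[of "\<phi> G" j] K(2)[of G] \<zeta>[of G j] G F by auto
        also have "\<dots> \<le> K * max 1 (norm G)" using K by (intro mult_left_mono) auto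
        finally have "max 1 \<bar>real_of_int (\<zeta> G j)\<bar> \<le> K * max 1 (norm G)"
          using K mult_mono[of 1 K 1 "max 1 (norm G)"] by simp
        then show ?thesis by (intro divide_left_mono) (use K in \<open>auto intro!: mult_pos_pos\<close>)
      qed
      have "(1 / (K * max 1 (norm G))) ^ 6 = (\<Prod>j\<in>(UNIV :: 3 set). (1 / (K * max 1 (norm G)))\<^sup>2)"
        by (simp flip: power_mult)
      also have "\<dots> \<le> (\<Prod>j\<in>UNIV. w (\<zeta> G j))"
      proof (rule prod_mono, intro conjI)
        fix j :: 3
        have "(1 / (K * max 1 (norm G)))\<^sup>2 \<le> (1 / max 1 \<bar>real_of_int (\<zeta> G j)\<bar>)\<^sup>2"
          using comp K by (intro power_mono) auto
        then show "(1 / (K * max 1 (norm G)))\<^sup>2 \<le> w (\<zeta> G j)" by (simp add: w_def power_divide)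
      qed auto
      finally have "K ^ 6 * (1 / (K * max 1 (norm G))) ^ 6 \<le> K ^ 6 * (\<Prod>j\<in>UNIV. w (\<zeta> G j))"
        using K by (intro mult_left_mono) auto
      then show ?thesis using K by (simp add: power_divide power_mult_distrib)
    qed
    have "(\<Sum>G\<in>F. (1 / max 1 (norm G)) ^ 6) \<le> K ^ 6 * (\<Sum>G\<in>F. \<Prod>j\<in>UNIV. w (\<zeta> G j))"
      unfolding sum_distrib_left by (intro sum_mono pt)
    also have "(\<Sum>G\<in>F. \<Prod>j\<in>UNIV. w (\<zeta> G j)) = (\<Sum>g\<in>\<zeta> ` F. \<Prod>j\<in>UNIV. w (g j))"
      using inj_on_subset[OF inj F(2)] by (simp add: sum.reindex)
    also have "\<dots> \<le> (\<Sum>g\<in>PiE (UNIV :: 3 set) (\<lambda>_. S). \<Prod>j\<in>UNIV. w (g j))"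
    proof (rule sum_mono2)
      show "finite (PiE (UNIV :: 3 set) (\<lambda>_. S))" using S by (intro finite_PiE) auto
      show "\<zeta> ` F \<subseteq> PiE UNIV (\<lambda>_. S)" by (auto simp: S_def)
    qed (auto intro!: prod_nonneg w0)
    also have "\<dots> = (\<Prod>j\<in>(UNIV :: 3 set). \<Sum>z\<in>S. w z)"
      using S by (subst prod_sum_PiE) auto
    also have "\<dots> = (\<Sum>z\<in>S. w z) ^ 3" by simp
    also have "\<dots> \<le> C ^ 3" using C(2)[OF S] w0 by (intro power_mono sum_nonneg) (auto simp: w_def)
    finally show ?thesis using K by simp
  qed
  then show ?thesis using C K by (intro exI[of _ "K ^ 6 * C ^ 3"]) auto
qed

text \<open>The coordinates of \<open>G\<close> are its inner products with a basis of the lattice, divided by \<open>2 * pi\<close>.\<close>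

lemma reciprocal_int_coords:
  assumes "bravais_lattice L" shows "\<exists>\<phi>. int_coords (reciprocal_lattice L) \<phi>"
proof -
  obtain a :: "real^3^3" where a: "invertible a"
    and L: "L = {(\<Sum>j\<in>UNIV. real_of_int (m j) *\<^sub>R a $ j) | m :: 3 \<Rightarrow> int. True}"
    using assms unfolding bravais_lattice_def by blast
  define \<phi> where "\<phi> x = (1 / (2 * pi)) *\<^sub>R (a *v x)" for x
  have comp: "\<phi> x $ j = (x \<bullet> a $ j) / (2 * pi)" for x j
    by (simp add: \<phi>_def matrix_mult_dot row_def inner_commute)
  have lin: "linear \<phi>"
    unfolding \<phi>_def by (intro linear_compose_scale_right matrix_vector_mul_linear)
  have "bij ((*v) a)" using a by (simp add: invertible_eq_bij)
  moreover have "bij (\<lambda>x :: real^3. (1 / (2 * pi)) *\<^sub>R x)"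
    by (rule bij_betw_byWitness[where f' = "\<lambda>x. (2 * pi) *\<^sub>R x"]) auto
  ultimately have "bij ((\<lambda>x :: real^3. (1 / (2 * pi)) *\<^sub>R x) \<circ> (*v) a)" by (rule bij_comp)
  then have bij: "bij \<phi>" unfolding \<phi>_def o_def .
  have "reciprocal_lattice L = {x. \<forall>j. \<phi> x $ j \<in> \<int>}"
  proof (intro set_eqI iffI)
    fix G assume G: "G \<in> reciprocal_lattice L"
    have "\<phi> G $ j \<in> \<int>" for j
    proof -
      have "a $ j = (\<Sum>i\<in>UNIV. real_of_int (if i = j then 1 else 0) *\<^sub>R a $ i)"
      proof -
        have "(\<Sum>i\<in>UNIV. real_of_int (if i = j then 1 else 0) *\<^sub>R a $ i) = (\<Sum>i\<in>UNIV. if i = j then a $ i else 0)"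
          by (intro sum.cong) auto
        then show ?thesis by simp
      qed
      then have "a $ j \<in> L" unfolding L mem_Collect_eq
        by (intro exI[of _ "\<lambda>i. if i = j then 1 else 0"] conjI TrueI)
      then obtain m :: int where "G \<bullet> a $ j = 2 * pi * real_of_int m"
        using G unfolding reciprocal_lattice_def by blast
      then show ?thesis by (simp add: comp)
    qed
    then show "G \<in> {x. \<forall>j. \<phi> x $ j \<in> \<int>}" by simp
  next
    fix G assume "G \<in> {x. \<forall>j. \<phi> x $ j \<in> \<int>}"
    then have "\<forall>j. \<exists>z :: int. \<phi> G $ j = real_of_int z" by (auto elim: Ints_cases)
    then obtain z :: "3 \<Rightarrow> int" where z: "\<And>j. \<phi> G $ j = real_of_int (z j)" by metis
    have z': "G \<bullet> a $ j = 2 * pi * real_of_int (z j)" for j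
      using z[of j] by (simp add: comp field_simps)
    show "G \<in> reciprocal_lattice L"
      unfolding reciprocal_lattice_def L
    proof clarify
      fix m :: "3 \<Rightarrow> int"
      have "G \<bullet> (\<Sum>j\<in>UNIV. real_of_int (m j) *\<^sub>R a $ j) = 2 * pi * real_of_int (\<Sum>j\<in>UNIV. m j * z j)"
        by (simp add: inner_sum_right z' sum_distrib_left mult_ac)
      then show "\<exists>k :: int. G \<bullet> (\<Sum>j\<in>UNIV. real_of_int (m j) *\<^sub>R a $ j) = 2 * pi * real_of_int k" by blast
    qed
  qed
  then show ?thesis using lin bij unfolding int_coords_def by blast
qed

lemma bravais_int_coords:
  assumes "bravais_lattice L" shows "\<exists>\<phi>. int_coords L \<phi>"
proof -
  obtain a :: "real^3^3" where a: "invertible a"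
    and L: "L = {(\<Sum>j\<in>UNIV. real_of_int (m j) *\<^sub>R a $ j) | m :: 3 \<Rightarrow> int. True}"
    using assms unfolding bravais_lattice_def by blast
  have b: "bij ((*v) (transpose a))" unfolding invertible_eq_bij[symmetric] using a
    by (rule transpose_invertible)
  have comb: "transpose a *v x = (\<Sum>j\<in>UNIV. x $ j *\<^sub>R a $ j)" for x
    by (simp add: vec_eq_iff matrix_vector_mult_def transpose_def mult.commute del: transpose_matrix_vector)
  define \<phi> where "\<phi> = inv ((*v) (transpose a))"
  have \<phi>1: "\<phi> (transpose a *v x) = x" for x
    unfolding \<phi>_def by (rule inv_f_f[OF bij_is_inj[OF b]])
  have \<phi>2: "transpose a *v \<phi> x = x" for x
    unfolding \<phi>_def by (rule surj_f_inv_f[OF bij_is_surj[OF b]])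
  have lin: "linear \<phi>"
  proof (rule linearI)
    fix x y and c :: real
    have "\<phi> (transpose a *v (\<phi> x + \<phi> y)) = \<phi> x + \<phi> y" by (rule \<phi>1)
    then show "\<phi> (x + y) = \<phi> x + \<phi> y" by (simp add: matrix_vector_right_distrib \<phi>2 del: transpose_matrix_vector)
    have "\<phi> (transpose a *v (c *\<^sub>R \<phi> x)) = c *\<^sub>R \<phi> x" by (rule \<phi>1)
    then show "\<phi> (c *\<^sub>R x) = c *\<^sub>R \<phi> x"
      by (simp only: linear_scale[OF matrix_vector_mul_linear] \<phi>2)
  qed
  have bij: "bij \<phi>" unfolding \<phi>_def using b by (rule bij_imp_bij_inv)
  have "L = {x. \<forall>j. \<phi> x $ j \<in> \<int>}"
  proof (intro set_eqI iffI)
    fix x assume "x \<in> L"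
    then obtain m :: "3 \<Rightarrow> int" where "x = (\<Sum>j\<in>UNIV. real_of_int (m j) *\<^sub>R a $ j)" unfolding L by blast
    then have "x = transpose a *v (\<chi> j. real_of_int (m j))" unfolding comb by simp
    then show "x \<in> {x. \<forall>j. \<phi> x $ j \<in> \<int>}" by (simp add: \<phi>1 del: transpose_matrix_vector)
  next
    fix x assume "x \<in> {x. \<forall>j. \<phi> x $ j \<in> \<int>}"
    then have "\<forall>j. \<exists>z :: int. \<phi> x $ j = real_of_int z" by (auto elim: Ints_cases)
    then obtain z :: "3 \<Rightarrow> int" where z: "\<And>j. \<phi> x $ j = real_of_int (z j)" by metis
    have "x = (\<Sum>j\<in>UNIV. real_of_int (z j) *\<^sub>R a $ j)" using \<phi>2[of x] unfolding comb z by (rule sym)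
    then show "x \<in> L" unfolding L by blast
  qed
  then show ?thesis using lin bij unfolding int_coords_def by blast
qed

section \<open>Differences of phases and of sums\<close>

lemma norm_exp_i_minus_1_le: "norm (exp (\<i> * of_real t) - 1) \<le> \<bar>t\<bar>" for t :: real
proof -
  have "norm (exp (\<i> * of_real t) - exp (\<i> * of_real 0)) \<le> 1 * norm (t - 0)"
  proof (rule differentiable_bound[of UNIV "\<lambda>t. exp (\<i> * complex_of_real t)" "\<lambda>x h. h *\<^sub>R (\<i> * exp (\<i> * of_real x))"])
    fix x :: real
    have "((\<lambda>t. exp (\<i> * complex_of_real t)) has_vector_derivative \<i> * exp (\<i> * of_real x)) (at x)"
      by (auto intro!: derivative_eq_intros has_vector_derivative_real_field simp: mult.commute)
    then show "((\<lambda>t. exp (\<i> * complex_of_real t)) has_derivative (\<lambda>h. h *\<^sub>R (\<i> * exp (\<i> * of_real x)))) (at x within UNIV)"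
      by (simp add: has_vector_derivative_def)
    show "onorm (\<lambda>h. h *\<^sub>R (\<i> * exp (\<i> * of_real x))) \<le> 1"
      by (rule onorm_bound) (auto simp: norm_mult)
  qed auto
  then show ?thesis by simp
qed

lemma norm_exp_i_diff_le:
  "norm (exp (- \<i> * of_real s) - exp (- \<i> * of_real t)) \<le> \<bar>s - t\<bar>" for s t :: real
proof -
  have "exp (- \<i> * of_real s) - exp (- \<i> * of_real t)
      = exp (- \<i> * of_real t) * (exp (\<i> * of_real (t - s)) - 1)"
    by (simp add: algebra_simps flip: exp_add)
  then show ?thesis
    using norm_exp_i_minus_1_le[of "t - s"] by (simp add: norm_mult abs_minus_commute)
qed

lemma norm_exp_i [simp]: "norm (exp (- \<i> * of_real t)) = 1" for t :: real
  by (simp add: norm_exp_eq_Re)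

text \<open>The phases are the powers of one number \<open>z\<close> of modulus 1, and \<open>\<Delta>\<^sup>i z^j = z^j * (z - 1)^i\<close>.\<close>

lemma dbound_phase:
  assumes "\<bar>\<theta>\<bar> \<le> \<kappa> * h" "1 \<le> \<kappa>" "0 \<le> h"
  shows "dbound m (\<lambda>j. exp (- \<i> * of_real (real j * \<theta>))) (\<kappa> ^ m) h"
proof -
  define z where "z = exp (- \<i> * complex_of_real \<theta>)"
  have zj: "exp (- \<i> * of_real (real j * \<theta>)) = z ^ j" for j
    unfolding z_def by (subst exp_of_nat_mult[symmetric]) (simp add: mult_ac)
  have d: "(fdiff ^^ i) (\<lambda>j. z ^ j) j = z ^ j * (z - 1) ^ i" for i j
    by (induction i arbitrary: j) (simp_all add: fdiff_def algebra_simps)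
  have "norm (z - 1) \<le> \<kappa> * h"
    using norm_exp_i_minus_1_le[of "- \<theta>"] assms(1) by (simp add: z_def)
  then have "dbound m (\<lambda>j. z ^ j) 1 (\<kappa> * h)"
    unfolding dbound_def d by (auto simp: norm_mult norm_power z_def intro!: power_mono)
  then have "dbound m (\<lambda>j. z ^ j) (1 * \<kappa> ^ m) h" using assms by (intro dbound_rescale)
  then show ?thesis unfolding zj by simp
qed

lemma cnj_borel_measurable [measurable]: "cnj \<in> borel_measurable borel"
  by (intro borel_measurable_continuous_onI continuous_intros)

lemma dbound_cnj: "dbound m f C \<delta> \<Longrightarrow> dbound m (\<lambda>j. cnj (f j)) C \<delta>"
proof -
  have "(fdiff ^^ i) (\<lambda>j. cnj (f j)) j = cnj ((fdiff ^^ i) f j)" for i j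
    by (induction i arbitrary: j) (simp_all add: fdiff_def)
  then show "dbound m f C \<delta> \<Longrightarrow> dbound m (\<lambda>j. cnj (f j)) C \<delta>" by (simp add: dbound_def)
qed

text \<open>A common bound of the finite sums of the constants \<open>B\<close> gives absolute convergence of all sums of
differences, so that differences may be taken term by term.\<close>

lemma dbound_infsum:
  fixes P :: "'i \<Rightarrow> nat \<Rightarrow> complex"
  assumes P: "\<And>x. x \<in> I \<Longrightarrow> dbound m (P x) (B x) \<delta>"
    and B: "\<And>F. finite F \<Longrightarrow> F \<subseteq> I \<Longrightarrow> sum B F \<le> K" and \<delta>: "0 \<le> \<delta>"
  shows "dbound m (\<lambda>j. \<Sum>\<^sub>\<infinity>x\<in>I. P x j) K \<delta>"
proof -
  have B0: "0 \<le> B x" if "x \<in> I" for x using P[OF that] dbound_nonneg by blast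
  have Bs: "B summable_on I"
  proof (rule nonneg_bdd_above_summable_on[OF B0])
    show "bdd_above (sum B ` {F. F \<subseteq> I \<and> finite F})"
      by (rule bdd_aboveI[of _ K]) (use B in blast)
  qed
  have BK: "infsum B I \<le> K" using Bs B by (rule infsum_le_finite_sums)
  have abs: "(\<lambda>x. norm ((fdiff ^^ i) (P x) j)) summable_on I" if "i + j \<le> m" for i j
  proof (rule summable_on_comparison_test)
    show "(\<lambda>x. B x * \<delta> ^ i) summable_on I" by (rule summable_on_cmult_left[OF Bs])
    show "norm ((fdiff ^^ i) (P x) j) \<le> B x * \<delta> ^ i" if "x \<in> I" for x
      by (rule dboundD[OF P[OF that] \<open>i + j \<le> m\<close>])
  qed (rule norm_ge_zero)
  have eq: "(fdiff ^^ i) (\<lambda>j. \<Sum>\<^sub>\<infinity>x\<in>I. P x j) j = (\<Sum>\<^sub>\<infinity>x\<in>I. (fdiff ^^ i) (P x) j)" if "i + j \<le> m" for i j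
    using that
  proof (induction i arbitrary: j)
    case (Suc i)
    have 1: "(\<lambda>x. (fdiff ^^ i) (P x) (Suc j)) summable_on I" "(\<lambda>x. (fdiff ^^ i) (P x) j) summable_on I"
      by (rule abs_summable_summable, rule abs, use Suc.prems in simp)+
    have "(fdiff ^^ Suc i) (\<lambda>j. \<Sum>\<^sub>\<infinity>x\<in>I. P x j) j
        = (\<Sum>\<^sub>\<infinity>x\<in>I. (fdiff ^^ i) (P x) (Suc j)) - (\<Sum>\<^sub>\<infinity>x\<in>I. (fdiff ^^ i) (P x) j)"
      using Suc by (simp add: fdiff_def[of "(fdiff ^^ i) _"])
    also have "\<dots> = (\<Sum>\<^sub>\<infinity>x\<in>I. (fdiff ^^ i) (P x) (Suc j) - (fdiff ^^ i) (P x) j)"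
      using infsum_add[OF 1(1) summable_on_uminus[THEN iffD2, OF 1(2)]] by (simp add: infsum_uminus)
    also have "\<dots> = (\<Sum>\<^sub>\<infinity>x\<in>I. (fdiff ^^ Suc i) (P x) j)"
      by (simp add: fdiff_def[of "(fdiff ^^ i) _"])
    finally show ?case .
  qed simp
  show ?thesis
    unfolding dbound_def
  proof (intro allI impI)
    fix i j assume ij: "i + j \<le> m"
    have "norm ((fdiff ^^ i) (\<lambda>j. \<Sum>\<^sub>\<infinity>x\<in>I. P x j) j) \<le> (\<Sum>\<^sub>\<infinity>x\<in>I. norm ((fdiff ^^ i) (P x) j))"
      unfolding eq[OF ij] by (rule norm_infsum_bound[OF abs[OF ij]])
    also have "\<dots> \<le> (\<Sum>\<^sub>\<infinity>x\<in>I. B x * \<delta> ^ i)"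
      by (rule infsum_mono[OF abs[OF ij] summable_on_cmult_left[OF Bs] dboundD[OF P ij]])
    also have "\<dots> = infsum B I * \<delta> ^ i" by (rule infsum_cmult_left[OF Bs])
    also have "\<dots> \<le> K * \<delta> ^ i" using BK \<delta> by (intro mult_right_mono) auto
    finally show "norm ((fdiff ^^ i) (\<lambda>j. \<Sum>\<^sub>\<infinity>x\<in>I. P x j) j) \<le> K * \<delta> ^ i" .
  qed
qed

section \<open>Orbitals along short steps\<close>

lemma smooth_line_derivative:
  assumes "smooth f"
  shows "((\<lambda>t. iter_deriv (replicate i v) f (k + t *\<^sub>R v)) has_vector_derivative
          iter_deriv (replicate (Suc i) v) f (k + t *\<^sub>R v)) (at t)"
proof -
  define g where "g = iter_deriv (replicate i v) f"
  have g: "(g has_derivative frechet_derivative g (at (k + t *\<^sub>R v))) (at (k + t *\<^sub>R v))"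
    using assms unfolding smooth_def g_def frechet_derivative_works[symmetric] by blast
  then have lin: "linear (frechet_derivative g (at (k + t *\<^sub>R v)))" by (rule has_derivative_linear)
  have "((\<lambda>t. k + t *\<^sub>R v) has_derivative (\<lambda>s. s *\<^sub>R v)) (at t)"
    by (auto intro!: derivative_eq_intros)
  from diff_chain_at[OF this g] show ?thesis
    using lin by (simp add: has_vector_derivative_def o_def g_def linear_scale)
qed

locale insulator =
  fixes X :: crystal
  assumes insulating: "insulating_system X"
begin

definition bands :: "nat set" where "bands = occ X \<union> vir X"

lemma finite_bands: "finite bands"
  by (simp add: bands_def occ_def vir_def)

lemma BZ_cell: "lattice_cell (rlattice X) (bz X)" and DC_cell: "lattice_cell (lattice X) (cell X)"
proof -
  have L: "bravais_lattice (lattice X)" and D: "unit_cell (lattice X) (cell X)"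
    and B: "unit_cell (rlattice X) (bz X)"
    using insulating unfolding insulating_system_def by blast+
  obtain \<phi> where "int_coords (rlattice X) \<phi>" using reciprocal_int_coords[OF L] by blast
  then show "lattice_cell (rlattice X) (bz X)"
    by (rule int_coords_cell) (use B in \<open>simp_all add: unit_cell_def\<close>)
  obtain \<phi> where "int_coords (lattice X) \<phi>" using bravais_int_coords[OF L] by blast
  then show "lattice_cell (lattice X) (cell X)"
    by (rule int_coords_cell) (use D in \<open>simp_all add: unit_cell_def\<close>)
qed

end

sublocale insulator \<subseteq> BZ: lattice_cell "rlattice X" "bz X"
  by (rule BZ_cell)

sublocale insulator \<subseteq> DC: lattice_cell "lattice X" "cell X"
  by (rule DC_cell)

context insulator
begin

lemma orbital_measurable: "n \<in> bands \<Longrightarrow> orbital X n k \<in> borel_measurable borel"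
  and orbital_smooth: "n \<in> bands \<Longrightarrow> smooth (\<lambda>k. orbital X n k r)"
  and energy_smooth: "n \<in> bands \<Longrightarrow> smooth (energy X n)"
  using insulating unfolding insulating_system_def smooth_in_k_def bands_def by auto

lemma orbital_deriv_bound:
  "n \<in> bands \<Longrightarrow> \<exists>C. \<forall>k r. norm k \<le> \<rho> \<longrightarrow> norm r \<le> \<rho> \<longrightarrow>
     norm (iter_deriv vs (\<lambda>k. orbital X n k r) k) \<le> C"
  using insulating unfolding insulating_system_def smooth_in_k_def bands_def by blast

lemma orbital_periodic: "n \<in> bands \<Longrightarrow> G \<in> rlattice X \<Longrightarrow> orbital X n (k + G) r = orbital X n k r"
  and energy_periodic: "n \<in> bands \<Longrightarrow> G \<in> rlattice X \<Longrightarrow> energy X n (k + G) = energy X n k"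
  using insulating unfolding insulating_system_def bands_def by auto

lemma orbital_periodic_diff: "n \<in> bands \<Longrightarrow> G \<in> rlattice X \<Longrightarrow> orbital X n (k - G) r = orbital X n k r"
  using orbital_periodic[of n "- G" k r] BZ.neg_in by simp

lemma radius: "\<exists>\<rho>>0. (\<forall>r\<in>cell X. norm r \<le> \<rho>) \<and> (\<forall>k\<in>bz X. norm k \<le> \<rho>)"
proof -
  obtain B B' where "0 < B" "\<forall>r\<in>cell X. norm r \<le> B" "0 < B'" "\<forall>k\<in>bz X. norm k \<le> B'"
    using DC.cell_bounded BZ.cell_bounded unfolding bounded_pos by blast
  then show ?thesis by (intro exI[of _ "max B B'"]) (auto simp: le_max_iff_disj)
qed

text \<open>All that the difference bounds for pair densities use of the smoothness of orbitals: the bound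
is uniform in the position \<open>r\<close>, and no regularity in \<open>r\<close> is involved.\<close>

definition regular_step :: "nat \<Rightarrow> real \<Rightarrow> real \<Rightarrow> real^3 \<Rightarrow> real^3 \<Rightarrow> bool" where
  "regular_step m C h k v \<longleftrightarrow>
     (\<forall>n\<in>bands. \<forall>r\<in>cell X. dbound m (\<lambda>j. orbital X n (k + real j *\<^sub>R v) r) C h)"

lemma uniform_bound:
  assumes "finite I" "\<And>x. x \<in> I \<Longrightarrow> \<exists>C. P x C" "\<And>x C C'. P x C \<Longrightarrow> C \<le> C' \<Longrightarrow> P x C'"
  shows "\<exists>C\<ge>0 :: real. \<forall>x\<in>I. P x C"
proof -
  from assms(2) obtain c where c: "\<And>x. x \<in> I \<Longrightarrow> P x (c x)" by metis
  show ?thesis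
  proof (intro exI conjI ballI)
    show "0 \<le> (\<Sum>x\<in>I. \<bar>c x\<bar>)" by (intro sum_nonneg) auto
    fix x assume x: "x \<in> I"
    have "c x \<le> (\<Sum>x\<in>I. \<bar>c x\<bar>)"
      using member_le_sum[of x I "\<lambda>x. \<bar>c x\<bar>"] x assms(1) by auto
    then show "P x (\<Sum>x\<in>I. \<bar>c x\<bar>)" using c[OF x] assms(3) by blast
  qed
qed

lemma orbital_derivs_bound:
  assumes "finite VS"
  shows "\<exists>C\<ge>0. \<forall>n\<in>bands. \<forall>vs\<in>VS. \<forall>k r. norm k \<le> \<rho> \<longrightarrow> norm r \<le> \<rho> \<longrightarrow>
     norm (iter_deriv vs (\<lambda>k. orbital X n k r) k) \<le> C"
proof -
  have "\<exists>C\<ge>0. \<forall>x\<in>bands \<times> VS. \<forall>k r. norm k \<le> \<rho> \<longrightarrow> norm r \<le> \<rho> \<longrightarrow>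
     norm (iter_deriv (snd x) (\<lambda>k. orbital X (fst x) k r) k) \<le> C"
  proof (rule uniform_bound)
    fix x assume "x \<in> bands \<times> VS"
    then show "\<exists>C. \<forall>k r. norm k \<le> \<rho> \<longrightarrow> norm r \<le> \<rho> \<longrightarrow>
        norm (iter_deriv (snd x) (\<lambda>k. orbital X (fst x) k r) k) \<le> C"
      by (intro orbital_deriv_bound) auto
  qed (use assms finite_bands in \<open>blast, meson order_trans\<close>)
  then show ?thesis by auto
qed

text \<open>By periodicity the starting point may be taken in the Brillouin zone. The steps then stay in a
fixed ball, on which finitely many derivatives in the direction \<open>v\<close> are bounded.\<close>

lemma regular_lattice_step:
  "\<exists>C\<ge>0. \<forall>k h. 0 < h \<longrightarrow> h \<le> 1 \<longrightarrow> regular_step m C h k (h *\<^sub>R v)"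
proof -
  obtain \<rho> where \<rho>: "0 < \<rho>" "\<And>r. r \<in> cell X \<Longrightarrow> norm r \<le> \<rho>" "\<And>k. k \<in> bz X \<Longrightarrow> norm k \<le> \<rho>"
    using radius by blast
  define \<rho>' where "\<rho>' = \<rho> + real m * norm v"
  obtain C where C: "0 \<le> C" "\<And>n i k r. n \<in> bands \<Longrightarrow> i \<le> m \<Longrightarrow> norm k \<le> \<rho>' \<Longrightarrow> norm r \<le> \<rho>' \<Longrightarrow>
     norm (iter_deriv (replicate i v) (\<lambda>k. orbital X n k r) k) \<le> C"
    using orbital_derivs_bound[of "(\<lambda>i. replicate i v) ` {..m}" \<rho>'] by auto
  have "regular_step m C h k (h *\<^sub>R v)" if h: "0 < h" "h \<le> 1" for k h
    unfolding regular_step_def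
  proof (intro ballI)
    fix n r assume n: "n \<in> bands" and r: "r \<in> cell X"
    define k0 where "k0 = k - BZ.rep k"
    have k0: "norm k0 \<le> \<rho>" unfolding k0_def by (intro \<rho> BZ.rep_cell)
    define G where "G i t = iter_deriv (replicate i v) (\<lambda>k. orbital X n k r) (k0 + t *\<^sub>R v)" for i t
    have "dbound m (\<lambda>j. G 0 (real j * h)) C h"
    proof (rule dbound_smooth)
      show "(G i has_vector_derivative G (Suc i) t) (at t)" for i t
        unfolding G_def using orbital_smooth[OF n] by (rule smooth_line_derivative)
      show "norm (G i t) \<le> C" if "i \<le> m" "0 \<le> t" "t \<le> real m * h" for i t
        unfolding G_def
      proof (rule C(2)[OF n that(1)])
        have "t \<le> real m" using that h mult_left_mono[of h 1 "real m"] by simp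
        then have "norm (t *\<^sub>R v) \<le> real m * norm v" using that by (simp add: mult_right_mono)
        then show "norm (k0 + t *\<^sub>R v) \<le> \<rho>'"
          using k0 norm_triangle_ineq[of k0 "t *\<^sub>R v"] by (simp add: \<rho>'_def)
        show "norm r \<le> \<rho>'" using \<rho>(2)[OF r] by (simp add: \<rho>'_def add_increasing2)
      qed
    qed (use h in auto)
    moreover have "G 0 (real j * h) = orbital X n (k + real j *\<^sub>R h *\<^sub>R v) r" for j
      using orbital_periodic_diff[OF n BZ.rep_in, of "k + (real j * h) *\<^sub>R v" k r]
      by (simp add: G_def k0_def algebra_simps)
    ultimately show "dbound m (\<lambda>j. orbital X n (k + real j *\<^sub>R h *\<^sub>R v) r) C h" by simp
  qed
  then show ?thesis using C(1) by blast
qed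

text \<open>For close momenta the derivative is bounded in a ball around the representative of \<open>k\<close> in the
Brillouin zone, for distant ones the values are.\<close>

lemma orbital_Lipschitz:
  "\<exists>C\<ge>1. \<forall>n\<in>bands. \<forall>r\<in>cell X. \<forall>k k'. norm (orbital X n k r) \<le> C \<and>
     norm (orbital X n k' r - orbital X n k r) \<le> C * norm (k' - k)"
proof -
  obtain \<rho> where \<rho>: "0 < \<rho>" "\<And>r. r \<in> cell X \<Longrightarrow> norm r \<le> \<rho>" "\<And>k. k \<in> bz X \<Longrightarrow> norm k \<le> \<rho>"
    using radius by blast
  obtain C where C: "0 \<le> C"
    "\<And>n k r. n \<in> bands \<Longrightarrow> norm k \<le> \<rho> + 1 \<Longrightarrow> norm r \<le> \<rho> + 1 \<Longrightarrow> norm (orbital X n k r) \<le> C"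
    "\<And>n b k r. n \<in> bands \<Longrightarrow> b \<in> Basis \<Longrightarrow> norm k \<le> \<rho> + 1 \<Longrightarrow> norm r \<le> \<rho> + 1 \<Longrightarrow>
       norm (frechet_derivative (\<lambda>k. orbital X n k r) (at k) b) \<le> C"
    using orbital_derivs_bound[of "{[]} \<union> (\<lambda>b. [b]) ` Basis" "\<rho> + 1"] by auto
  \<comment> \<open>The factor 3 is the dimension: a derivative is the sum of three partial ones.\<close>
  define C' where "C' = max 1 (3 * C)"
  show ?thesis
  proof (intro exI[of _ C'] conjI ballI allI)
    fix n k k' r assume n: "n \<in> bands" and r: "r \<in> cell X"
    have r': "norm r \<le> \<rho> + 1" using \<rho>(2)[OF r] by simp
    have val: "norm (orbital X n k r) \<le> C" for k
      using C(2)[OF n _ r', of "k - BZ.rep k"] \<rho>(3)[OF BZ.rep_cell[of k]]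
        orbital_periodic_diff[OF n BZ.rep_in, of k k r] by simp
    then show "norm (orbital X n k r) \<le> C'" using C(1) by (intro order_trans[OF val]) (simp add: C'_def)
    show "norm (orbital X n k' r - orbital X n k r) \<le> C' * norm (k' - k)"
    proof (cases "norm (k' - k) \<le> 1")
      case True
      define k0 where "k0 = k - BZ.rep k"
      have k0: "norm k0 \<le> \<rho>" unfolding k0_def by (intro \<rho> BZ.rep_cell)
      define f where "f = (\<lambda>k. orbital X n k r)"
      have f: "(f has_derivative frechet_derivative f (at x)) (at x)" for x
        using orbital_smooth[OF n, of r] unfolding smooth_def f_def frechet_derivative_works[symmetric]
        by (metis iter_deriv.simps(1))
      have "norm (f (k0 + (k' - k)) - f k0) \<le> C' * norm (k0 + (k' - k) - k0)"
      proof (rule differentiable_bound[of "cball k0 1"])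
        show "(f has_derivative frechet_derivative f (at x)) (at x within cball k0 1)" for x
          using f by (rule has_derivative_at_withinI)
        show "onorm (frechet_derivative f (at x)) \<le> C'" if x: "x \<in> cball k0 1" for x
        proof (rule onorm_bound)
          fix v
          have lin: "linear (frechet_derivative f (at x))" using f has_derivative_linear by blast
          have nx: "norm x \<le> \<rho> + 1"
            using x k0 norm_triangle_sub[of x k0] by (simp add: dist_norm norm_minus_commute)
          have "norm (frechet_derivative f (at x) v) = norm (\<Sum>b\<in>Basis. (v \<bullet> b) *\<^sub>R frechet_derivative f (at x) b)"
            by (subst euclidean_representation[of v, symmetric])
               (simp only: linear_sum[OF lin] linear_scale[OF lin])
          also have "\<dots> \<le> (\<Sum>b\<in>(Basis :: (real^3) set). norm v * C)"
          proof (rule sum_norm_le)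
            fix b :: "real^3" assume b: "b \<in> Basis"
            then show "norm ((v \<bullet> b) *\<^sub>R frechet_derivative f (at x) b) \<le> norm v * C"
              using C(3)[OF n b nx r'] Basis_le_norm[OF b, of v] unfolding f_def[symmetric]
              by (simp add: mult_mono)
          qed
          also have "\<dots> = 3 * C * norm v" by simp
          also have "\<dots> \<le> C' * norm v" by (intro mult_right_mono) (auto simp: C'_def)
          finally show "norm (frechet_derivative f (at x) v) \<le> C' * norm v" .
        qed (auto simp: C'_def)
      qed (use True in \<open>auto simp: dist_norm norm_minus_commute\<close>)
      moreover have "f k0 = orbital X n k r" unfolding f_def k0_def by (rule orbital_periodic_diff[OF n BZ.rep_in])
      moreover have "f (k0 + (k' - k)) = orbital X n k' r"
        using orbital_periodic_diff[OF n BZ.rep_in, of k' k r] by (simp add: f_def k0_def)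
      ultimately show ?thesis by simp
    next
      case False
      have "norm (orbital X n k' r - orbital X n k r) \<le> C + C"
        using val norm_triangle_ineq4 by (meson add_mono order_trans)
      also have "\<dots> \<le> C' * 1" using C(1) by (simp add: C'_def)
      also have "\<dots> \<le> C' * norm (k' - k)" using False by (intro mult_left_mono) (auto simp: C'_def)
      finally show ?thesis .
    qed
  qed (simp add: C'_def)
qed

text \<open>In contrast to \<open>regular_lattice_step\<close> the constant does not depend on the direction of \<open>v\<close>, as is
needed for continuity; order one is enough for that.\<close>

lemma regular_short_step:
  "\<exists>C\<ge>0. \<forall>k v h. 0 \<le> h \<longrightarrow> norm v \<le> \<omega> * h \<longrightarrow> regular_step 1 C h k v"
proof -
  obtain C where C: "1 \<le> C" "\<And>n r k k'. n \<in> bands \<Longrightarrow> r \<in> cell X \<Longrightarrow> norm (orbital X n k r) \<le> C \<and>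
     norm (orbital X n k' r - orbital X n k r) \<le> C * norm (k' - k)"
    using orbital_Lipschitz by metis
  define C' where "C' = C * max 1 \<omega>"
  have C'C: "C \<le> C'" using C(1) mult_left_mono[of 1 "max 1 \<omega>" C] by (simp add: C'_def)
  have "regular_step 1 C' h k v" if h: "0 \<le> h" "norm v \<le> \<omega> * h" for k v h
    unfolding regular_step_def One_nat_def dbound_Suc dbound_0
  proof (intro ballI conjI allI impI)
    fix n r assume n: "n \<in> bands" "r \<in> cell X"
    show "norm (orbital X n (k + real j *\<^sub>R v) r) \<le> C'" for j
      using C(2)[OF n, of "k + real j *\<^sub>R v" k] C'C by simp
    have "norm (orbital X n (k + v) r - orbital X n k r) \<le> C * norm v"
      using C(2)[OF n, of k "k + v"] by simp
    also have "\<dots> \<le> C * (max 1 \<omega> * h)"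
      using C h mult_right_mono[of \<omega> "max 1 \<omega>" h] by (intro mult_left_mono) auto
    finally show "norm (fdiff (\<lambda>j. orbital X n (k + real j *\<^sub>R v) r) 0) \<le> C' * h"
      by (simp add: fdiff_def C'_def mult.assoc)
  qed
  then show ?thesis using C(1) C'C by (intro exI[of _ C']) auto
qed

section \<open>Fourier coefficients on the unit cell\<close>

definition fourier :: "(real^3 \<Rightarrow> complex) \<Rightarrow> real^3 \<Rightarrow> complex" where
  "fourier a \<xi> = (LINT r:cell X|lborel. a r * exp (- \<i> * complex_of_real (\<xi> \<bullet> r)))"

definition vol :: real where "vol = measure lborel (cell X)"

lemma vol_pos: "0 < vol" unfolding vol_def by (rule DC.cell_measure_pos)

lemma cell_integrable:
  fixes f :: "real^3 \<Rightarrow> complex"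
  assumes [measurable]: "f \<in> borel_measurable borel" and "\<And>r. r \<in> cell X \<Longrightarrow> norm (f r) \<le> B"
  shows "set_integrable lborel (cell X) f"
proof (rule set_integrable_bound[where f = "\<lambda>_. B"])
  show "set_integrable lborel (cell X) (\<lambda>_. B)"
    using DC.cell_measure_finite by (simp add: set_integrable_def)
  show "set_borel_measurable lborel (cell X) f" unfolding set_borel_measurable_def by measurable
qed (use assms(2) in \<open>auto intro!: AE_I2 order_trans[OF _ abs_ge_self]\<close>)

lemma norm_cell_integral:
  fixes f :: "real^3 \<Rightarrow> complex"
  assumes [measurable]: "f \<in> borel_measurable borel" and B: "\<And>r. r \<in> cell X \<Longrightarrow> norm (f r) \<le> B"
  shows "norm (LINT r:cell X|lborel. f r) \<le> B * vol"
proof -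
  have "norm (LINT r:cell X|lborel. f r) \<le> (LINT r:cell X|lborel. norm (f r))"
    by (rule set_integral_norm_bound[OF cell_integrable[OF assms]])
  also have "\<dots> \<le> (LINT r:cell X|lborel. B)"
    using DC.cell_measure_finite B
    by (intro set_integral_mono set_integrable_norm cell_integrable[OF assms])
       (auto simp: set_integrable_def)
  also have "\<dots> = B * vol"
    using DC.cell_measure_finite by (simp add: set_lebesgue_integral_def vol_def)
  finally show ?thesis .
qed

lemma cell_integral_sum:
  fixes f :: "'i \<Rightarrow> real^3 \<Rightarrow> complex"
  assumes "\<And>x. x \<in> I \<Longrightarrow> set_integrable lborel (cell X) (f x)"
  shows "(LINT r:cell X|lborel. (\<Sum>x\<in>I. f x r)) = (\<Sum>x\<in>I. LINT r:cell X|lborel. f x r)"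
  using assms unfolding set_lebesgue_integral_def set_integrable_def scaleR_sum_right
  by (rule Bochner_Integration.integral_sum)

text \<open>A translation \<open>v\<close> with \<open>G \<bullet> v = pi\<close> changes the sign of the character and preserves its integral.\<close>

lemma cell_character:
  assumes "G \<in> rlattice X"
  shows "(LINT r:cell X|lborel. exp (- \<i> * complex_of_real (G \<bullet> r))) = (if G = 0 then of_real vol else 0)"
proof (cases "G = 0")
  case True
  then show ?thesis using DC.cell_measure_finite
    by (simp add: set_lebesgue_integral_def vol_def) (simp add: scaleR_conv_of_real)
next
  case False
  define f where "f r = exp (- \<i> * complex_of_real (G \<bullet> r))" for r
  have add: "f (r + v) = f v * f r" for r v
  proof -
    have "- \<i> * complex_of_real (G \<bullet> (r + v)) = (- \<i> * complex_of_real (G \<bullet> v)) + (- \<i> * complex_of_real (G \<bullet> r))"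
      by (simp add: inner_add_right distrib_left)
    then show ?thesis unfolding f_def by (simp only: exp_add)
  qed
  have "f R = 1" if R: "R \<in> lattice X" for R
  proof -
    obtain m :: int where "G \<bullet> R = 2 * pi * real_of_int m"
      using assms R unfolding reciprocal_lattice_def by blast
    then show ?thesis
      unfolding f_def exp_eq_1 by (intro conjI exI[of _ "- m"]) auto
  qed
  then have per: "DC.periodic f" by (simp add: DC.periodic_def add)
  \<comment> \<open>A solution of \<open>G \<bullet> v = pi\<close>, so that the character is \<open>- 1\<close> at \<open>v\<close>.\<close>
  define v where "v = (pi / (norm G)\<^sup>2) *\<^sub>R G"
  have "G \<bullet> v = pi" using False by (simp add: v_def power2_norm_eq_inner)
  then have fv: "f v = - 1" by (simp add: f_def exp_minus mult.commute)
  have [measurable]: "f \<in> borel_measurable borel" unfolding f_def by measurable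
  have "(LINT r:cell X|lborel. f r) = (LINT r:cell X|lborel. f (r + v))"
    by (rule DC.set_integral_translate[symmetric]) (use per in auto)
  also have "\<dots> = - (LINT r:cell X|lborel. f r)" by (simp add: add fv set_lebesgue_integral_def)
  finally have "(LINT r:cell X|lborel. f r) = 0" by simp
  then show ?thesis using False by (simp add: f_def)
qed

text \<open>Let \<open>b\<close> be \<open>a\<close> times the phase of \<open>q\<close>, and let \<open>P\<close> be the trigonometric polynomial with the coefficients of
\<open>b\<close> at the frequencies in \<open>F\<close>. By orthogonality of characters, the inner products of \<open>b\<close> and of \<open>P\<close> with \<open>P\<close>
are \<open>S\<close> and \<open>vol * S\<close>, where \<open>S\<close> is the sum in question. Integrating the inequality
\<open>2 * vol * Re (b * cnj P) \<le> vol\<^sup>2 * |b|\<^sup>2 + |P|\<^sup>2\<close> gives the bound.\<close>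

lemma bessel:
  assumes [measurable]: "a \<in> borel_measurable borel" and A: "\<And>r. r \<in> cell X \<Longrightarrow> norm (a r) \<le> A"
    and F: "finite F" "F \<subseteq> rlattice X"
  shows "(\<Sum>G\<in>F. (norm (fourier a (q + G)))\<^sup>2) \<le> (A * vol)\<^sup>2"
proof -
  define b where "b r = a r * exp (- \<i> * complex_of_real (q \<bullet> r))" for r
  define e where "e G r = exp (- \<i> * complex_of_real (G \<bullet> r))" for G r :: "real^3"
  define c where "c G = fourier a (q + G)" for G
  define P where "P r = (\<Sum>G\<in>F. c G * cnj (e G r))" for r
  define S where "S = (\<Sum>G\<in>F. (norm (c G))\<^sup>2)"
  have [measurable]: "b \<in> borel_measurable borel" "e G \<in> borel_measurable borel" for G
    unfolding b_def e_def by measurable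
  have [measurable]: "P \<in> borel_measurable borel" unfolding P_def by measurable
  have ne: "norm (e G r) = 1" for G r unfolding e_def by (rule norm_exp_i)
  have nb: "norm (b r) \<le> A" if "r \<in> cell X" for r using A[OF that] unfolding b_def norm_mult by (simp only: norm_exp_i)
  have nP: "norm (P r) \<le> (\<Sum>G\<in>F. norm (c G))" for r
    unfolding P_def by (rule sum_norm_le) (simp add: norm_mult ne)
  have c_eq: "c G = (LINT r:cell X|lborel. b r * e G r)" for G
    unfolding c_def fourier_def b_def e_def
    by (simp add: inner_add_left algebra_simps flip: exp_add)
  have ib: "set_integrable lborel (cell X) (\<lambda>r. b r * e G r)" for G
    by (rule cell_integrable[of _ A]) (use nb ne in \<open>auto simp: norm_mult\<close>)
  have ibP: "set_integrable lborel (cell X) (\<lambda>r. b r * cnj (P r))"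
    by (rule cell_integrable[of _ "A * (\<Sum>G\<in>F. norm (c G))"])
       (use nb nP in \<open>auto simp: norm_mult intro!: mult_mono order_trans[OF norm_ge_zero nb]\<close>)
  have iPP: "set_integrable lborel (cell X) (\<lambda>r. P r * cnj (P r))"
    by (rule cell_integrable[of _ "(\<Sum>G\<in>F. norm (c G)) * (\<Sum>G\<in>F. norm (c G))"])
       (use nP in \<open>auto simp: norm_mult intro!: mult_mono sum_nonneg\<close>)
  have "(LINT r:cell X|lborel. b r * cnj (P r)) = (LINT r:cell X|lborel. (\<Sum>G\<in>F. cnj (c G) * (b r * e G r)))"
    by (simp add: P_def sum_distrib_left mult_ac)
  also have "\<dots> = (\<Sum>G\<in>F. cnj (c G) * c G)"
    using ib by (subst cell_integral_sum) (auto simp: c_eq)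
  finally have bP: "(LINT r:cell X|lborel. b r * cnj (P r)) = of_real S"
    unfolding S_def of_real_sum complex_norm_square by (simp add: mult.commute)
  have iPe: "set_integrable lborel (cell X) (\<lambda>r. P r * e G r)" for G
    by (rule cell_integrable[of _ "\<Sum>G\<in>F. norm (c G)"]) (use nP ne in \<open>auto simp: norm_mult\<close>)
  have iee: "set_integrable lborel (cell X) (\<lambda>r. cnj (e H r) * e G r)" for G H
    by (rule cell_integrable[of _ 1]) (use ne in \<open>auto simp: norm_mult\<close>)
  have Pe: "(LINT r:cell X|lborel. P r * e G r) = c G * of_real vol" if G: "G \<in> F" for G
  proof -
    have ee: "(LINT r:cell X|lborel. cnj (e H r) * e G r) = (if H = G then of_real vol else 0)" if H: "H \<in> F" for H
    proof -
      have "cnj (e H r) * e G r = exp (- \<i> * complex_of_real ((G - H) \<bullet> r))" for r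
        by (simp add: e_def exp_cnj inner_diff_left algebra_simps flip: exp_add)
      moreover have "G - H \<in> rlattice X" using G H F(2) by (intro BZ.diff_in) auto
      ultimately show ?thesis using cell_character[of "G - H"] by simp
    qed
    have "(LINT r:cell X|lborel. P r * e G r) = (LINT r:cell X|lborel. (\<Sum>H\<in>F. c H * (cnj (e H r) * e G r)))"
      by (simp add: P_def sum_distrib_left mult_ac)
    also have "\<dots> = (\<Sum>H\<in>F. if H = G then c G * of_real vol else 0)"
      using iee by (subst cell_integral_sum) (auto simp: ee intro!: sum.cong)
    finally show ?thesis using G F(1) by simp
  qed
  have "(LINT r:cell X|lborel. P r * cnj (P r)) = (LINT r:cell X|lborel. (\<Sum>G\<in>F. cnj (c G) * (P r * e G r)))"
    by (subst (2) P_def) (simp add: sum_distrib_left mult_ac)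
  also have "\<dots> = (\<Sum>G\<in>F. cnj (c G) * (c G * of_real vol))"
    using iPe by (subst cell_integral_sum) (auto simp: Pe)
  finally have PP: "(LINT r:cell X|lborel. P r * cnj (P r)) = of_real (vol * S)"
    unfolding S_def of_real_mult of_real_sum complex_norm_square by (simp add: sum_distrib_left mult_ac)
  have Re_set: "(LINT r:cell X|lborel. Re (f r)) = Re (LINT r:cell X|lborel. f r)"
    "set_integrable lborel (cell X) (\<lambda>r. Re (f r))"
    if "set_integrable lborel (cell X) f" for f
    using integral_Re[OF that[unfolded set_integrable_def]] integrable_Re[OF that[unfolded set_integrable_def]]
    by (simp_all add: set_lebesgue_integral_def set_integrable_def)
  have iA: "set_integrable lborel (cell X) (\<lambda>_. vol\<^sup>2 * A\<^sup>2)"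
    using DC.cell_measure_finite by (simp add: set_integrable_def)
  \<comment> \<open>The right-hand side is at most \<open>vol * (vol * A)\<^sup>2 + vol * S\<close>, of which \<open>vol * S\<close> cancels.\<close>
  have "2 * vol * S = (LINT r:cell X|lborel. 2 * vol * Re (b r * cnj (P r)))"
    using Re_set[OF ibP] bP by simp
  also have "\<dots> \<le> (LINT r:cell X|lborel. vol\<^sup>2 * A\<^sup>2 + Re (P r * cnj (P r)))"
  proof (rule set_integral_mono)
    show "set_integrable lborel (cell X) (\<lambda>r. 2 * vol * Re (b r * cnj (P r)))"
      using Re_set(2)[OF ibP] by simp
    show "set_integrable lborel (cell X) (\<lambda>r. vol\<^sup>2 * A\<^sup>2 + Re (P r * cnj (P r)))"
      by (intro set_integral_add(1) iA Re_set(2) iPP)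
    fix r assume r: "r \<in> cell X"
    have "2 * vol * Re (b r * cnj (P r)) \<le> 2 * (vol * norm (b r)) * norm (P r)"
      using complex_Re_le_cmod[of "b r * cnj (P r)"] vol_pos by (simp add: norm_mult)
    also have "\<dots> \<le> (vol * norm (b r))\<^sup>2 + (norm (P r))\<^sup>2" by (rule sum_squares_bound)
    also have "\<dots> \<le> (vol * A)\<^sup>2 + (norm (P r))\<^sup>2"
      using nb[OF r] vol_pos by (intro add_right_mono power_mono mult_left_mono) auto
    also have "(norm (P r))\<^sup>2 = Re (P r * cnj (P r))"
      by (metis Re_complex_of_real complex_norm_square)
    finally show "2 * vol * Re (b r * cnj (P r)) \<le> vol\<^sup>2 * A\<^sup>2 + Re (P r * cnj (P r))"
      by (simp add: power_mult_distrib)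
  qed
  also have "\<dots> = vol * (vol\<^sup>2 * A\<^sup>2) + vol * S"
    using DC.cell_measure_finite
    by (subst set_integral_add(2)[OF iA Re_set(2)[OF iPP]], subst Re_set(1)[OF iPP], subst PP)
       (simp add: set_lebesgue_integral_def vol_def)
  finally have "vol * S \<le> vol * (vol\<^sup>2 * A\<^sup>2)" by (simp add: mult.commute)
  then have "S \<le> vol\<^sup>2 * A\<^sup>2" using vol_pos by (rule mult_left_le_imp_le)
  then show ?thesis by (simp add: S_def c_def power_mult_distrib mult.commute)
qed

end

section \<open>Pair densities along short steps\<close>

text \<open>The quotient \<open>|\<xi> + j w|\<^sup>2 / |\<xi>|\<^sup>2\<close> is a quadratic polynomial in \<open>j \<epsilon>\<close> with \<open>\<epsilon> = |w| / |\<xi>|\<close>, so its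
differences gain powers of \<open>\<epsilon>\<close>. The lower bound on \<open>d\<close> says that \<open>m\<close> steps use up at most half of the
distance from the origin; hence the quotient is at least 1/4 and \<open>dbound_inverse\<close> applies.\<close>

lemma dbound_inverse_square:
  fixes \<omega> :: real
  assumes \<omega>: "0 \<le> \<omega>"
  shows "\<exists>K\<ge>0. \<forall>(\<xi> :: real^3) w h d. 0 < h \<longrightarrow> norm w \<le> \<omega> * h \<longrightarrow>
      (2 * real m * \<omega> + 1) * h \<le> d \<longrightarrow> d \<le> norm \<xi> \<longrightarrow>
      dbound m (\<lambda>j. complex_of_real (1 / (norm (\<xi> + real j *\<^sub>R w))\<^sup>2)) (K / (norm \<xi>)\<^sup>2) (h / d)"
proof -
  define \<kappa> where "\<kappa> = max 1 \<omega>"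
  \<comment> \<open>The bounds 1, 2 and \<open>2 ^ m\<close> belong to the constant, the linear and the quadratic term of \<open>g\<close> below.\<close>
  obtain K where K: "0 \<le> K" "\<And>(g :: nat \<Rightarrow> complex) \<delta>. 0 \<le> \<delta> \<Longrightarrow> dbound m g (1 + 2 + 2 ^ m) \<delta> \<Longrightarrow>
      (\<forall>j\<le>m. 1 / 4 \<le> norm (g j)) \<Longrightarrow> dbound m (\<lambda>j. inverse (g j)) K \<delta>"
    using dbound_inverse[of "1 / 4" m "1 + 2 + 2 ^ m", where 'a = complex] by auto
  show ?thesis
  proof (intro exI[of _ "K * \<kappa> ^ m"] conjI allI impI)
    show "0 \<le> K * \<kappa> ^ m" using K by (simp add: \<kappa>_def)
    fix \<xi> w :: "real^3" and h d :: real
    assume h: "0 < h" and w: "norm w \<le> \<omega> * h" and hd: "(2 * real m * \<omega> + 1) * h \<le> d" and d: "d \<le> norm \<xi>"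
    have "h \<le> (2 * real m * \<omega> + 1) * h" using h \<omega> by simp
    then have d0: "0 < d" using hd h by linarith
    then have \<xi>0: "0 < norm \<xi>" using d by linarith
    have mw: "real m * norm w \<le> norm \<xi> / 2"
    proof -
      have "2 * (real m * norm w) \<le> 2 * (real m * (\<omega> * h))" using w by (intro mult_left_mono) auto
      also have "\<dots> \<le> d" using hd h by (simp add: algebra_simps)
      finally show ?thesis using d by simp
    qed
    define \<epsilon> where "\<epsilon> = norm w / norm \<xi>"
    have "real m * norm w \<le> norm \<xi>" using mw \<xi>0 by linarith
    then have \<epsilon>: "0 \<le> \<epsilon>" "real m * \<epsilon> \<le> 1"
      using \<xi>0 by (auto simp: \<epsilon>_def pos_divide_le_eq)
    define c where "c = (\<xi> \<bullet> w) / (norm \<xi> * norm w)"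
    have c: "\<bar>c\<bar> \<le> 1"
      using Cauchy_Schwarz_ineq2[of \<xi> w] by (auto simp: c_def abs_mult divide_simps)
    have cw: "\<xi> \<bullet> w = c * (norm \<xi> * norm w)" by (cases "w = 0") (use \<xi>0 in \<open>auto simp: c_def\<close>)
    define g where "g j = (1 :: complex) + of_real (2 * c) * of_real (real j * \<epsilon>) + of_real (real j * \<epsilon>) * of_real (real j * \<epsilon>)" for j
    have g_eq: "g j = of_real ((norm (\<xi> + real j *\<^sub>R w))\<^sup>2 / (norm \<xi>)\<^sup>2)" for j
    proof -
      have "(norm (\<xi> + real j *\<^sub>R w))\<^sup>2 = (norm \<xi>)\<^sup>2 + 2 * real j * (c * (norm \<xi> * norm w)) + (real j * norm w)\<^sup>2"
        unfolding cw[symmetric] power2_norm_eq_inner power_mult_distrib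
        by (simp add: inner_add_left inner_add_right inner_commute power2_eq_square)
      also have "\<dots> / (norm \<xi>)\<^sup>2 = 1 + 2 * c * (real j * \<epsilon>) + (real j * \<epsilon>) * (real j * \<epsilon>)"
        using \<xi>0 by (simp add: \<epsilon>_def field_simps power2_eq_square)
      finally show ?thesis unfolding g_def by (simp only: of_real_add of_real_mult of_real_1)
    qed
    have lin: "dbound m (\<lambda>j. complex_of_real (real j * \<epsilon>)) 1 \<epsilon>"
    proof (cases m)
      case 0 then show ?thesis by (simp add: dbound_0)
    next
      case (Suc l)
      have "fdiff (\<lambda>j. complex_of_real (real j * \<epsilon>)) = (\<lambda>_. of_real \<epsilon>)"
        by (auto simp: fdiff_def algebra_simps)
      moreover have "norm (complex_of_real (real j * \<epsilon>)) \<le> 1" if "j \<le> m" for j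
      proof -
        have "real j * \<epsilon> \<le> real m * \<epsilon>" using that \<epsilon> by (intro mult_right_mono) auto
        then show ?thesis using \<epsilon> by (simp add: norm_mult)
      qed
      ultimately show ?thesis using \<epsilon> unfolding Suc dbound_Suc by (auto intro: dbound_const)
    qed
    have "dbound m g (1 + norm (complex_of_real (2 * c)) * 1 + 2 ^ m * 1 * 1) \<epsilon>"
      unfolding g_def by (intro dbound_add dbound_const dbound_cmult dbound_mult lin \<epsilon>) auto
    then have gd: "dbound m g (1 + 2 + 2 ^ m) \<epsilon>"
      by (rule dbound_mono) (use c \<epsilon> in \<open>auto simp: norm_mult abs_mult\<close>)
    have "1 / 4 \<le> norm (g j)" if "j \<le> m" for j
    proof -
      have "real j * norm w \<le> real m * norm w" using that by (intro mult_right_mono) auto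
      then have "norm \<xi> / 2 \<le> norm (\<xi> + real j *\<^sub>R w)"
        using mw norm_diff_ineq[of \<xi> "real j *\<^sub>R w"] by simp
      then have "(norm \<xi> / 2)\<^sup>2 \<le> (norm (\<xi> + real j *\<^sub>R w))\<^sup>2" by (intro power_mono) auto
      then have "1 / 4 \<le> (norm (\<xi> + real j *\<^sub>R w))\<^sup>2 / (norm \<xi>)\<^sup>2"
        using \<xi>0 by (simp add: power_divide pos_le_divide_eq)
      then show ?thesis unfolding g_eq norm_of_real by simp
    qed
    then have "dbound m (\<lambda>j. inverse (g j)) K \<epsilon>" by (intro K \<epsilon> gd) auto
    then have "dbound m (\<lambda>j. inverse (g j)) K (\<kappa> * (h / d))"
    proof (rule dbound_mono)
      have "\<epsilon> \<le> (\<omega> * h) / d" unfolding \<epsilon>_def using w d d0 h \<omega> by (intro frac_le) auto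
      also have "\<dots> \<le> \<kappa> * (h / d)" using h d0 by (simp add: \<kappa>_def divide_right_mono mult_right_mono)
      finally show "\<epsilon> \<le> \<kappa> * (h / d)" .
    qed (use \<epsilon> in auto)
    then have "dbound m (\<lambda>j. inverse (g j)) (K * \<kappa> ^ m) (h / d)"
      by (rule dbound_rescale) (use h d0 in \<open>auto simp: \<kappa>_def\<close>)
    from dbound_cmult[OF this, of "of_real (1 / (norm \<xi>)\<^sup>2)"]
    show "dbound m (\<lambda>j. complex_of_real (1 / (norm (\<xi> + real j *\<^sub>R w))\<^sup>2)) (K * \<kappa> ^ m / (norm \<xi>)\<^sup>2) (h / d)"
      using \<xi>0 by (simp add: g_eq divide_simps norm_power norm_divide)
  qed
qed

context insulator
begin

lemma fdiff_measurable:
  assumes "\<And>j. a j \<in> borel_measurable borel"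
  shows "(\<lambda>r :: real^3. (fdiff ^^ i) (\<lambda>j. a j r :: complex) j) \<in> borel_measurable borel"
proof (induction i arbitrary: j)
  case (Suc i)
  have "(\<lambda>r. (fdiff ^^ Suc i) (\<lambda>j. a j r) j)
      = (\<lambda>r. (fdiff ^^ i) (\<lambda>j. a j r) (Suc j) - (fdiff ^^ i) (\<lambda>j. a j r) j)"
    by (simp add: fdiff_def[of "(fdiff ^^ i) _"])
  then show ?case using Suc.IH[of j] Suc.IH[of "Suc j"] by simp
qed (use assms in simp)

lemma fourier_integrable:
  assumes [measurable]: "a \<in> borel_measurable borel" and A: "\<And>r. r \<in> cell X \<Longrightarrow> norm (a r) \<le> A"
  shows "set_integrable lborel (cell X) (\<lambda>r. a r * exp (- \<i> * complex_of_real (\<xi> \<bullet> r)))"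
  by (rule cell_integrable[where B = A]) (use A in \<open>auto simp: norm_mult norm_exp_i[simplified]\<close>)

lemma fourier_diff:
  assumes "a \<in> borel_measurable borel" "\<And>r. r \<in> cell X \<Longrightarrow> norm (a r) \<le> A"
    "b \<in> borel_measurable borel" "\<And>r. r \<in> cell X \<Longrightarrow> norm (b r) \<le> B"
  shows "fourier a \<xi> - fourier b \<xi> = fourier (\<lambda>r. a r - b r) \<xi>"
  unfolding fourier_def left_diff_distrib
  by (rule set_integral_diff(2)[symmetric]; rule fourier_integrable; fact)

lemma fdiff_fourier:
  assumes a: "\<And>j. a j \<in> borel_measurable borel"
    and bd: "\<And>r. r \<in> cell X \<Longrightarrow> dbound m (\<lambda>j. a j r) K h" and ij: "i + j \<le> m"
  shows "(fdiff ^^ i) (\<lambda>j. fourier (a j) \<xi>) j = fourier (\<lambda>r. (fdiff ^^ i) (\<lambda>j. a j r) j) \<xi>"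
  using ij
proof (induction i arbitrary: j)
  case (Suc i)
  have b: "norm ((fdiff ^^ i) (\<lambda>j. a j r) l) \<le> K * h ^ i" if "r \<in> cell X" "i + l \<le> m" for r l
    using dboundD[OF bd[OF that(1)] that(2)] .
  have "(fdiff ^^ Suc i) (\<lambda>j. fourier (a j) \<xi>) j
      = fourier (\<lambda>r. (fdiff ^^ i) (\<lambda>j. a j r) (Suc j)) \<xi> - fourier (\<lambda>r. (fdiff ^^ i) (\<lambda>j. a j r) j) \<xi>"
    using Suc by (simp add: fdiff_def[of "(fdiff ^^ i) _"])
  also have "\<dots> = fourier (\<lambda>r. (fdiff ^^ i) (\<lambda>j. a j r) (Suc j) - (fdiff ^^ i) (\<lambda>j. a j r) j) \<xi>"
    by (rule fourier_diff[where A = "K * h ^ i" and B = "K * h ^ i"])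
       (use Suc.prems in \<open>auto intro!: fdiff_measurable a b\<close>)
  also have "(\<lambda>r. (fdiff ^^ i) (\<lambda>j. a j r) (Suc j) - (fdiff ^^ i) (\<lambda>j. a j r) j)
      = (\<lambda>r. (fdiff ^^ Suc i) (\<lambda>j. a j r) j)"
    by (simp add: fdiff_def[of "(fdiff ^^ i) _"])
  finally show ?case .
qed simp

abbreviation square_sums :: "(real^3 \<Rightarrow> real) \<Rightarrow> real \<Rightarrow> bool" where
  "square_sums A K \<equiv> \<forall>F. finite F \<longrightarrow> F \<subseteq> rlattice X \<longrightarrow> (\<Sum>G\<in>F. (A G)\<^sup>2) \<le> K"

text \<open>By the inequality of arithmetic and geometric means. The argument \<open>- G\<close> is there because the two pair
densities in an electron repulsion integral carry opposite momenta.\<close>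

lemma cross_sum:
  fixes A A' :: "real^3 \<Rightarrow> real"
  assumes A: "\<And>F. finite F \<Longrightarrow> F \<subseteq> rlattice X \<Longrightarrow> (\<Sum>G\<in>F. (A G)\<^sup>2) \<le> K"
    and A': "\<And>F. finite F \<Longrightarrow> F \<subseteq> rlattice X \<Longrightarrow> (\<Sum>G\<in>F. (A' G)\<^sup>2) \<le> K'"
    and F: "finite F" "F \<subseteq> rlattice X"
  shows "(\<Sum>G\<in>F. A G * A' (- G)) \<le> (K + K') / 2"
proof -
  have "(\<Sum>G\<in>F. A G * A' (- G)) \<le> (\<Sum>G\<in>F. ((A G)\<^sup>2 + (A' (- G))\<^sup>2) / 2)"
  proof (rule sum_mono)
    fix G show "A G * A' (- G) \<le> ((A G)\<^sup>2 + (A' (- G))\<^sup>2) / 2"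
      using sum_squares_bound[of "A G" "A' (- G)"] by simp
  qed
  also have "\<dots> = ((\<Sum>G\<in>F. (A G)\<^sup>2) + (\<Sum>G\<in>uminus ` F. (A' G)\<^sup>2)) / 2"
    by (simp add: sum.reindex sum.distrib flip: sum_divide_distrib)
  also have "\<dots> \<le> (K + K') / 2"
    using A[OF F] A'[of "uminus ` F"] F BZ.neg_in by (intro divide_right_mono add_mono) auto
  finally show ?thesis .
qed

text \<open>Bessel's inequality holds for the transform of each difference \<open>\<Delta>\<^sup>i a j\<close>, normalized by \<open>h ^ i\<close>. The constant
\<open>A G\<close> is the Euclidean norm of all these coefficients: it dominates each of them, and its squares
have a bounded sum.\<close>

lemma fourier_dbound:
  assumes a: "\<And>j. a j \<in> borel_measurable borel"
    and bd: "\<And>r. r \<in> cell X \<Longrightarrow> dbound m (\<lambda>j. a j r) K h" and h: "0 < h"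
  shows "\<exists>A. (\<forall>G. 0 \<le> A G \<and> dbound m (\<lambda>j. fourier (a j) (q + G)) (A G) h) \<and>
      square_sums A ((real (Suc m) * K * vol)\<^sup>2)"
proof -
  define I where "I = {x \<in> {..m} \<times> {..m}. fst x + snd x \<le> m}"
  have I: "finite I" "card I \<le> Suc m * Suc m"
    using card_mono[of "{..m} \<times> {..m}" I] unfolding I_def by auto
  define T where "T x G = norm ((fdiff ^^ fst x) (\<lambda>j. fourier (a j) (q + G)) (snd x)) / h ^ fst x" for x G
  define A where "A G = sqrt (\<Sum>x\<in>I. (T x G)\<^sup>2)" for G
  have A2: "(A G)\<^sup>2 = (\<Sum>x\<in>I. (T x G)\<^sup>2)" for G by (simp add: A_def sum_nonneg)
  have T0: "0 \<le> T x G" for x G using h by (simp add: T_def)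
  have T_le: "T x G \<le> A G" if "x \<in> I" for x G
  proof -
    have "(T x G)\<^sup>2 \<le> (A G)\<^sup>2"
      unfolding A2 using that I by (intro member_le_sum) auto
    then show ?thesis by (rule power2_le_imp_le) (simp add: A_def sum_nonneg)
  qed
  have "dbound m (\<lambda>j. fourier (a j) (q + G)) (A G) h" for G
    unfolding dbound_def
  proof (intro allI impI)
    fix i j assume "i + j \<le> m"
    then have "(i, j) \<in> I" by (auto simp: I_def)
    from T_le[OF this, of G] show "norm ((fdiff ^^ i) (\<lambda>j. fourier (a j) (q + G)) j) \<le> A G * h ^ i"
      using h by (simp add: T_def pos_divide_le_eq)
  qed
  moreover have "(\<Sum>G\<in>F. (A G)\<^sup>2) \<le> (real (Suc m) * K * vol)\<^sup>2" if F: "finite F" "F \<subseteq> rlattice X" for F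
  proof -
    have "(\<Sum>G\<in>F. (T x G)\<^sup>2) \<le> (K * vol)\<^sup>2" if x: "x \<in> I" for x
    proof -
      obtain i j where ij: "x = (i, j)" "i + j \<le> m" using x by (cases x) (auto simp: I_def)
      have "(\<Sum>G\<in>F. (T x G)\<^sup>2) = (\<Sum>G\<in>F. (norm (fourier (\<lambda>r. (fdiff ^^ i) (\<lambda>j. a j r) j) (q + G)))\<^sup>2) / (h ^ i)\<^sup>2"
        unfolding T_def ij(1) fst_conv snd_conv
        by (subst fdiff_fourier[OF a bd ij(2)]) (simp_all add: power_divide sum_divide_distrib)
      also have "\<dots> \<le> (K * h ^ i * vol)\<^sup>2 / (h ^ i)\<^sup>2"
        by (intro divide_right_mono bessel F fdiff_measurable a)
           (use dboundD[OF bd ij(2)] in auto)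
      also have "\<dots> = (K * vol)\<^sup>2" using h by (simp add: power_mult_distrib)
      finally show ?thesis .
    qed
    then have "(\<Sum>x\<in>I. \<Sum>G\<in>F. (T x G)\<^sup>2) \<le> (\<Sum>x\<in>I. (K * vol)\<^sup>2)" by (rule sum_mono)
    also have "\<dots> \<le> real (Suc m * Suc m) * (K * vol)\<^sup>2"
      unfolding sum_constant using I(2) by (intro mult_right_mono) (simp_all only: of_nat_le_iff zero_le_power2)
    also have "\<dots> = (real (Suc m) * K * vol)\<^sup>2" by (simp add: power2_eq_square algebra_simps)
    finally show ?thesis unfolding A2 by (subst sum.swap)
  qed
  moreover have "0 \<le> A G" for G by (simp add: A_def sum_nonneg)
  ultimately show ?thesis by blast
qed

text \<open>Pair densities in terms of the orbitals rather than their periodic parts \<open>u\<close>. This makes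
periodicity in both momenta visible; the frequency becomes \<open>\<xi> = q + G\<close> in place of \<open>G\<close>.\<close>

definition pairint :: "nat \<Rightarrow> nat \<Rightarrow> real^3 \<Rightarrow> real^3 \<Rightarrow> real^3 \<Rightarrow> complex" where
  "pairint n n' k k' \<xi> = fourier (\<lambda>r. cnj (orbital X n k r) * orbital X n' k' r) \<xi>"

abbreviation pair_path :: "nat \<Rightarrow> nat \<Rightarrow> real^3 \<Rightarrow> real^3 \<Rightarrow> real^3 \<Rightarrow> real^3 \<Rightarrow> real^3 \<Rightarrow> nat \<Rightarrow> complex" where
  "pair_path n n' k v k' v' \<xi> \<equiv>
     \<lambda>j. pairint n n' (k + real j *\<^sub>R v) (k' + real j *\<^sub>R v') (\<xi> + real j *\<^sub>R (v' - v))"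

lemma pairint_periodic1: "n \<in> bands \<Longrightarrow> G \<in> rlattice X \<Longrightarrow> pairint n n' (k + G) k' \<xi> = pairint n n' k k' \<xi>"
  and pairint_periodic2: "n' \<in> bands \<Longrightarrow> G \<in> rlattice X \<Longrightarrow> pairint n n' k (k' + G) \<xi> = pairint n n' k k' \<xi>"
  by (simp_all add: pairint_def orbital_periodic)

lemma pair_density_pairint: "pair_density X (m, k) (n, k') G = pairint m n k k' (k' - k + G)"
  unfolding pair_density_def pairint_def fourier_def
proof (rule set_lebesgue_integral_cong; simp?)
  have "cnj (exp (\<i> * complex_of_real (k \<bullet> r))) * exp (\<i> * complex_of_real (k' \<bullet> r)) * exp (- \<i> * complex_of_real ((k' - k + G) \<bullet> r))
      = exp (- \<i> * complex_of_real (G \<bullet> r))" for r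
  proof -
    have "cnj (\<i> * complex_of_real (k \<bullet> r)) + \<i> * complex_of_real (k' \<bullet> r) + - \<i> * complex_of_real ((k' - k + G) \<bullet> r)
      = - \<i> * complex_of_real (G \<bullet> r)"
      by (simp add: inner_add_left inner_diff_left algebra_simps)
    then show ?thesis by (metis exp_add exp_cnj)
  qed
  then show "\<forall>r. r \<in> cell X \<longrightarrow> cnj (bloch_u X m k r) * bloch_u X n k' r * exp (- (\<i> * complex_of_real (G \<bullet> r))) =
      cnj (orbital X m k r) * orbital X n k' r * exp (- (\<i> * complex_of_real ((k' - k + G) \<bullet> r)))"
    unfolding orbital_def by (simp add: mult_ac)
qed

text \<open>By periodicity \<open>k'\<close> may be replaced by \<open>k + \<xi>\<close>. At \<open>\<xi> = 0\<close> the pair density then is the inner product of two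
different bands at the same momentum, which is 0, and it is Lipschitz continuous in \<open>\<xi>\<close>.\<close>

lemma pairint_small:
  assumes n: "n \<in> bands" "n' \<in> bands" "n \<noteq> n'"
  shows "\<exists>C\<ge>0. \<forall>k k' \<xi>. \<xi> - (k' - k) \<in> rlattice X \<longrightarrow> norm (pairint n n' k k' \<xi>) \<le> C * norm \<xi>"
proof -
  obtain \<rho> where \<rho>: "0 < \<rho>" "\<And>r. r \<in> cell X \<Longrightarrow> norm r \<le> \<rho>" using radius by blast
  obtain C where C: "1 \<le> C" "\<And>n r k. n \<in> bands \<Longrightarrow> r \<in> cell X \<Longrightarrow> norm (orbital X n k r) \<le> C"
     "\<And>n r k k'. n \<in> bands \<Longrightarrow> r \<in> cell X \<Longrightarrow> norm (orbital X n k' r - orbital X n k r) \<le> C * norm (k' - k)"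
    using orbital_Lipschitz by metis
  note [measurable] = orbital_measurable[OF n(1)] orbital_measurable[OF n(2)]
  show ?thesis
  proof (intro exI[of _ "C * (C + C * \<rho>) * vol"] conjI allI impI)
    show "0 \<le> C * (C + C * \<rho>) * vol" using C \<rho> vol_pos by simp
    fix k k' \<xi> assume lat: "\<xi> - (k' - k) \<in> rlattice X"
    have 1: "pairint n n' k k' \<xi> = pairint n n' k (k + \<xi>) \<xi>"
      using pairint_periodic2[OF n(2) lat, of n k k' \<xi>] by (simp add: algebra_simps)
    have "pairint n n' k k 0 = pair_density X (n, k) (n', k) 0" by (simp add: pair_density_pairint)
    also have "\<dots> = (LINT r:cell X|lborel. cnj (bloch_u X n k r) * bloch_u X n' k r)"
      by (simp add: pair_density_def)
    also have "\<dots> = 0"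
      using insulating n unfolding insulating_system_def bands_def by simp
    finally have 2: "pairint n n' k k 0 = 0" .
    define e where "e r = exp (- \<i> * complex_of_real (\<xi> \<bullet> r))" for r
    have [measurable]: "e \<in> borel_measurable borel" unfolding e_def by measurable
    have ne: "norm (e r) = 1" for r unfolding e_def by (rule norm_exp_i)
    have "pairint n n' k (k + \<xi>) \<xi> - pairint n n' k k 0
        = (LINT r:cell X|lborel. cnj (orbital X n k r) * orbital X n' (k + \<xi>) r * e r - cnj (orbital X n k r) * orbital X n' k r)"
      unfolding pairint_def fourier_def e_def[symmetric]
      by (subst set_integral_diff(2))
         (use n C(1) in \<open>auto intro!: cell_integrable[where B = "C * C"] mult_mono C(2) simp: norm_mult ne\<close>)
    moreover have "norm (LINT r:cell X|lborel. cnj (orbital X n k r) * orbital X n' (k + \<xi>) r * e r - cnj (orbital X n k r) * orbital X n' k r)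
        \<le> C * ((C + C * \<rho>) * norm \<xi>) * vol"
    proof (rule norm_cell_integral)
      fix r assume r: "r \<in> cell X"
      have "norm (e r - 1) \<le> norm \<xi> * \<rho>"
        using norm_exp_i_minus_1_le[of "- (\<xi> \<bullet> r)"] Cauchy_Schwarz_ineq2[of \<xi> r] \<rho>(2)[OF r]
          mult_left_mono[of "norm r" \<rho> "norm \<xi>"] by (simp add: e_def)
      moreover have "orbital X n' (k + \<xi>) r * e r - orbital X n' k r
          = (orbital X n' (k + \<xi>) r - orbital X n' k r) * e r + orbital X n' k r * (e r - 1)"
        by (simp add: algebra_simps)
      ultimately have "norm (orbital X n' (k + \<xi>) r * e r - orbital X n' k r) \<le> C * norm \<xi> * 1 + C * (norm \<xi> * \<rho>)"
        using C(3)[OF n(2) r, of "k + \<xi>" k] C(2)[OF n(2) r, of k] C(1) ne[of r] \<rho>(1)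
        by (auto simp: norm_mult intro!: norm_triangle_le add_mono mult_mono)
      then have "norm (orbital X n k r) * norm (orbital X n' (k + \<xi>) r * e r - orbital X n' k r)
          \<le> C * ((C + C * \<rho>) * norm \<xi>)"
        using C(2)[OF n(1) r, of k] C(1) by (intro mult_mono) (auto simp: algebra_simps)
      moreover have "cnj (orbital X n k r) * orbital X n' (k + \<xi>) r * e r - cnj (orbital X n k r) * orbital X n' k r
          = cnj (orbital X n k r) * (orbital X n' (k + \<xi>) r * e r - orbital X n' k r)" by (simp add: algebra_simps)
      ultimately show "norm (cnj (orbital X n k r) * orbital X n' (k + \<xi>) r * e r - cnj (orbital X n k r) * orbital X n' k r)
          \<le> C * ((C + C * \<rho>) * norm \<xi>)" by (simp add: norm_mult)
    qed measurable
    ultimately show "norm (pairint n n' k k' \<xi>) \<le> C * (C + C * \<rho>) * vol * norm \<xi>"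
      unfolding 1 2 by (simp add: mult_ac)
  qed
qed

text \<open>The frequency moves along with the momenta, which adds the phase of \<open>real j *\<^sub>R (v' - v)\<close>. The cell is
bounded and \<open>v' - v\<close> is short, so this phase can be included in the amplitude.\<close>

lemma pairint_steps:
  assumes n: "n \<in> bands" "n' \<in> bands" and \<omega>: "0 \<le> \<omega>" and C: "0 \<le> C"
  shows "\<exists>K\<ge>0. \<forall>h k v k' v' q. 0 < h \<longrightarrow> regular_step m C h k v \<longrightarrow> regular_step m C h k' v' \<longrightarrow>
    norm (v' - v) \<le> \<omega> * h \<longrightarrow>
    (\<exists>A. (\<forall>G. 0 \<le> A G \<and>
        dbound m (pair_path n n' k v k' v' (q + G)) (A G) h) \<and>
      square_sums A K)"
proof -
  obtain \<rho> where \<rho>: "0 < \<rho>" "\<And>r. r \<in> cell X \<Longrightarrow> norm r \<le> \<rho>" using radius by blast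
  define \<kappa> where "\<kappa> = max 1 (\<omega> * \<rho>)"
  define K where "K = 2 ^ m * (2 ^ m * C * C) * \<kappa> ^ m"
  note [measurable] = orbital_measurable[OF n(1)] orbital_measurable[OF n(2)]
  show ?thesis
  proof (intro exI[of _ "(real (Suc m) * K * vol)\<^sup>2"] conjI allI impI)
    show "0 \<le> (real (Suc m) * K * vol)\<^sup>2" by simp
    fix h :: real and k v k' v' q :: "real^3"
    assume h: "0 < h" and step: "regular_step m C h k v" "regular_step m C h k' v'" and w: "norm (v' - v) \<le> \<omega> * h"
    define a where "a j r = cnj (orbital X n (k + real j *\<^sub>R v) r) * orbital X n' (k' + real j *\<^sub>R v') r
        * exp (- \<i> * complex_of_real (real j * ((v' - v) \<bullet> r)))" for j r
    have a: "a j \<in> borel_measurable borel" for j unfolding a_def by measurable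
    have bd: "dbound m (\<lambda>j. a j r) K h" if r: "r \<in> cell X" for r
      unfolding a_def K_def
    proof (intro dbound_mult dbound_cnj dbound_phase)
      show "dbound m (\<lambda>j. orbital X n (k + real j *\<^sub>R v) r) C h"
        "dbound m (\<lambda>j. orbital X n' (k' + real j *\<^sub>R v') r) C h"
        using step n r by (auto simp: regular_step_def)
      have "\<bar>(v' - v) \<bullet> r\<bar> \<le> norm (v' - v) * norm r" by (rule Cauchy_Schwarz_ineq2)
      also have "\<dots> \<le> (\<omega> * h) * \<rho>" using w \<rho>(2)[OF r] \<omega> h by (intro mult_mono) auto
      also have "\<dots> \<le> \<kappa> * h" using h by (simp add: \<kappa>_def mult.assoc mult.commute[of h \<rho>] flip: mult.assoc)
      finally show "\<bar>(v' - v) \<bullet> r\<bar> \<le> \<kappa> * h" .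
    qed (use h in \<open>auto simp: \<kappa>_def\<close>)
    have "pair_path n n' k v k' v' (q + G) j = fourier (a j) (q + G)" for j G
    proof -
      have "exp (- \<i> * complex_of_real ((q + G + real j *\<^sub>R (v' - v)) \<bullet> r))
          = exp (- \<i> * complex_of_real (real j * ((v' - v) \<bullet> r))) * exp (- \<i> * complex_of_real ((q + G) \<bullet> r))" for r
        by (subst exp_add[symmetric]) (simp add: inner_add_left distrib_left algebra_simps)
      then show ?thesis unfolding pairint_def fourier_def a_def by (simp add: mult.assoc)
    qed
    then show "\<exists>A. (\<forall>G. 0 \<le> A G \<and>
        dbound m (pair_path n n' k v k' v' (q + G)) (A G) h) \<and>
      square_sums A ((real (Suc m) * K * vol)\<^sup>2)"
      using fourier_dbound[OF a bd h, of q] by simp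
  qed
qed

text \<open>Here the ratio is \<open>h / d\<close>, where \<open>d\<close> is the distance of the momentum transfer from the lattice. For \<open>\<gamma> = 1\<close> this
is \<open>pairint_steps\<close>, as \<open>d\<close> is bounded. For \<open>\<gamma> = 0\<close> a factor \<open>|\<xi>|\<close> is gained, \<open>\<xi> = k' - k + G\<close>. Apart
from at most one \<open>G\<close>, the norm of \<open>\<xi>\<close> is at least \<open>c0\<close>, half the length of a shortest lattice vector,
and the factor costs a constant. For the exceptional \<open>G\<close> the values gain it by \<open>pairint_small\<close>, and the
differences of order \<open>i > 0\<close> because \<open>h ^ i = (h / d) ^ i * d ^ i\<close> and \<open>d \<le> |\<xi>|\<close>.\<close>

lemma pairint_far:
  assumes n: "n \<in> bands" "n' \<in> bands" and \<omega>: "0 \<le> \<omega>" and C: "0 \<le> C"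
    and \<gamma>: "\<gamma> \<le> 1" "\<gamma> = 0 \<Longrightarrow> n \<noteq> n'"
  shows "\<exists>K\<ge>0. \<forall>h k v k' v'. 0 < h \<longrightarrow> regular_step m C h k v \<longrightarrow> regular_step m C h k' v' \<longrightarrow>
    norm (v' - v) \<le> \<omega> * h \<longrightarrow> (2 * real m * \<omega> + 1) * h \<le> BZ.ldist (k' - k) \<longrightarrow>
    (\<exists>A. (\<forall>G\<in>rlattice X. 0 \<le> A G \<and>
        dbound m (pair_path n n' k v k' v' (k' - k + G))
          (A G * norm (k' - k + G) ^ (1 - \<gamma>)) (h / BZ.ldist (k' - k))) \<and>
      square_sums A K)"
proof -
  obtain K0 where K0: "0 \<le> K0" and steps: "\<And>h k v k' v' q. 0 < h \<Longrightarrow> regular_step m C h k v \<Longrightarrow> regular_step m C h k' v' \<Longrightarrow>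
    norm (v' - v) \<le> \<omega> * h \<Longrightarrow>
    (\<exists>A. (\<forall>G. 0 \<le> A G \<and>
        dbound m (pair_path n n' k v k' v' (q + G)) (A G) h) \<and>
      square_sums A K0)"
    using pairint_steps[OF n \<omega> C, of m] by blast
  obtain B where B: "0 < B" "\<And>q. BZ.ldist q \<le> B" using BZ.ldist_bounded by blast
  define \<kappa> where "\<kappa> = max 1 B"
  have \<kappa>: "1 \<le> \<kappa>" by (simp add: \<kappa>_def)
  have rescale: "dbound m f (A * \<kappa> ^ m) (h / d)"
    if f: "dbound m f A h" and hd: "0 < h" "0 < d" "d \<le> B" for f :: "nat \<Rightarrow> complex" and A h d
  proof (rule dbound_rescale[OF _ \<kappa>])
    have "h * d \<le> h * \<kappa>" using hd by (intro mult_left_mono) (auto simp: \<kappa>_def)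
    then show "dbound m f A (\<kappa> * (h / d))"
      by (intro dbound_mono[OF f]) (use hd in \<open>auto simp: field_simps\<close>)
  qed (use hd in auto)
  have dpos: "0 < BZ.ldist q" "h \<le> BZ.ldist q"
    if "0 < h" "(2 * real m * \<omega> + 1) * h \<le> BZ.ldist q" for h q
  proof -
    have "h \<le> (2 * real m * \<omega> + 1) * h" using that \<omega> by simp
    then show "0 < BZ.ldist q" "h \<le> BZ.ldist q" using that by linarith+
  qed
  show ?thesis
  proof (cases "\<gamma> = 1")
    case True
    show ?thesis
    proof (intro exI[of _ "K0 * (\<kappa> ^ m)\<^sup>2"] conjI allI impI)
      show "0 \<le> K0 * (\<kappa> ^ m)\<^sup>2" using K0 by simp
      fix h :: real and k v k' v' :: "real^3"
      assume h: "0 < h" and st: "regular_step m C h k v" "regular_step m C h k' v'" "norm (v' - v) \<le> \<omega> * h"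
        and far: "(2 * real m * \<omega> + 1) * h \<le> BZ.ldist (k' - k)"
      obtain A where A: "\<And>G. 0 \<le> A G"
        "\<And>G. dbound m (pair_path n n' k v k' v' (k' - k + G)) (A G) h"
        "\<And>F. finite F \<Longrightarrow> F \<subseteq> rlattice X \<Longrightarrow> (\<Sum>G\<in>F. (A G)\<^sup>2) \<le> K0"
        using steps[OF h st, of "k' - k"] by blast
      show "\<exists>A. (\<forall>G\<in>rlattice X. 0 \<le> A G \<and>
        dbound m (pair_path n n' k v k' v' (k' - k + G))
          (A G * norm (k' - k + G) ^ (1 - \<gamma>)) (h / BZ.ldist (k' - k))) \<and>
        square_sums A (K0 * (\<kappa> ^ m)\<^sup>2)"
      proof (intro exI[of _ "\<lambda>G. A G * \<kappa> ^ m"] conjI ballI allI impI)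
        fix G
        show "0 \<le> A G * \<kappa> ^ m" using A(1)[of G] \<kappa> by simp
        show "dbound m (pair_path n n' k v k' v' (k' - k + G))
          (A G * \<kappa> ^ m * norm (k' - k + G) ^ (1 - \<gamma>)) (h / BZ.ldist (k' - k))"
          using rescale[OF A(2) h dpos(1)[OF h far] B(2)] True by simp
      next
        fix F :: "(real^3) set" assume F: "finite F" "F \<subseteq> rlattice X"
        show "(\<Sum>G\<in>F. (A G * \<kappa> ^ m)\<^sup>2) \<le> K0 * (\<kappa> ^ m)\<^sup>2"
          unfolding power_mult_distrib[of "A _"] sum_distrib_right[symmetric]
          by (intro mult_right_mono A(3)[OF F]) simp
      qed
    qed
  next
    case False
    then have \<gamma>0: "\<gamma> = 0" using \<gamma>(1) by simp
    obtain CL where CL: "0 \<le> CL" "\<And>k k' \<xi>. \<xi> - (k' - k) \<in> rlattice X \<Longrightarrow> norm (pairint n n' k k' \<xi>) \<le> CL * norm \<xi>"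
      using pairint_small[OF n \<gamma>(2)[OF \<gamma>0]] by blast
    obtain c where c: "0 < c" "\<And>G. G \<in> rlattice X \<Longrightarrow> G \<noteq> 0 \<Longrightarrow> c \<le> norm G" using BZ.min_norm by blast
    \<comment> \<open>At most one of the points \<open>k' - k + G\<close> is within half the length of a shortest lattice vector.\<close>
    define c0 where "c0 = c / 2"
    have c0: "0 < c0" using c by (simp add: c0_def)
    define C1 where "C1 = 2 * CL + sqrt K0 * \<kappa> ^ m"
    have C1: "0 \<le> C1" using CL K0 \<kappa> by (simp add: C1_def)
    show ?thesis
    proof (intro exI[of _ "K0 * (\<kappa> ^ m / c0)\<^sup>2 + C1\<^sup>2"] conjI allI impI)
      show "0 \<le> K0 * (\<kappa> ^ m / c0)\<^sup>2 + C1\<^sup>2" using K0 by simp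
      fix h :: real and k v k' v' :: "real^3"
      assume h: "0 < h" and st: "regular_step m C h k v" "regular_step m C h k' v'" and w: "norm (v' - v) \<le> \<omega> * h"
        and far: "(2 * real m * \<omega> + 1) * h \<le> BZ.ldist (k' - k)"
      define d where "d = BZ.ldist (k' - k)"
      have d: "0 < d" "h \<le> d" "d \<le> B" using dpos[OF h far] B(2) by (auto simp: d_def)
      define f where "f G = (pair_path n n' k v k' v' (k' - k + G))" for G
      obtain A where A: "\<And>G. 0 \<le> A G" "\<And>G. dbound m (f G) (A G) h"
        "\<And>F. finite F \<Longrightarrow> F \<subseteq> rlattice X \<Longrightarrow> (\<Sum>G\<in>F. (A G)\<^sup>2) \<le> K0"
        using steps[OF h st w, of "k' - k"] unfolding f_def by blast
      define A' where "A' G = (if norm (k' - k + G) < c0 then C1 else A G * \<kappa> ^ m / c0)" for G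
      \<comment> \<open>The exceptional \<open>G\<close>: values by \<open>pairint_small\<close>, proper differences by \<open>d \<le> |\<xi>|\<close>.\<close>
      have near: "dbound m (f G) (C1 * norm (k' - k + G)) (h / d)" if G: "G \<in> rlattice X" for G
        unfolding dbound_def
      proof (intro allI impI)
        fix i j assume ij: "i + j \<le> m"
        define \<xi> where "\<xi> = k' - k + G"
        have d\<xi>: "d \<le> norm \<xi>" unfolding d_def \<xi>_def by (rule BZ.ldist_le_plus[OF G])
        show "norm ((fdiff ^^ i) (f G) j) \<le> C1 * norm (k' - k + G) * (h / d) ^ i"
        proof (cases i)
          case 0
          have "norm (f G j) \<le> CL * norm (\<xi> + real j *\<^sub>R (v' - v))"
            unfolding f_def \<xi>_def by (rule CL(2)) (use G in \<open>simp add: algebra_simps\<close>)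
          also have "\<dots> \<le> CL * (2 * norm \<xi>)"
          proof (rule mult_left_mono[OF _ CL(1)])
            have "norm (real j *\<^sub>R (v' - v)) \<le> real m * (\<omega> * h)"
              using ij w by (auto intro!: mult_mono)
            also have "\<dots> \<le> d"
            proof -
              have "real m * (\<omega> * h) \<le> (2 * real m * \<omega> + 1) * h"
                using h \<omega> by (simp add: algebra_simps mult_nonneg_nonneg add_nonneg_nonneg)
              then show ?thesis using far by (simp add: d_def)
            qed
            finally show "norm (\<xi> + real j *\<^sub>R (v' - v)) \<le> 2 * norm \<xi>"
              using d\<xi> norm_triangle_ineq[of \<xi> "real j *\<^sub>R (v' - v)"] by linarith
          qed
          also have "\<dots> \<le> C1 * norm \<xi>"
            using K0 \<kappa> by (simp add: C1_def distrib_right)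
          finally show ?thesis using 0 by (simp add: \<xi>_def)
        next
          case (Suc i')
          have AG: "A G \<le> sqrt K0"
            using A(3)[of "{G}"] G A(1)[of G] by (intro real_le_rsqrt) auto
          have "norm ((fdiff ^^ i) (f G) j) \<le> A G * h ^ i" by (rule dboundD[OF A(2) ij])
          also have "\<dots> = A G * ((h / d) ^ i * (d * d ^ i'))"
            using d by (simp add: Suc power_divide)
          also have "\<dots> \<le> sqrt K0 * ((h / d) ^ i * (norm \<xi> * \<kappa> ^ m))"
          proof (intro mult_mono AG)
            have "d ^ i' \<le> \<kappa> ^ i'" using d by (intro power_mono) (auto simp: \<kappa>_def)
            also have "\<dots> \<le> \<kappa> ^ m" using \<kappa> ij Suc by (intro power_increasing) auto
            finally show "d ^ i' \<le> \<kappa> ^ m" .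
          qed (use d d\<xi> h K0 A(1) in auto)
          also have "\<dots> \<le> C1 * norm \<xi> * (h / d) ^ i"
            using CL(1) h d by (simp add: C1_def algebra_simps)
          finally show ?thesis by (simp add: \<xi>_def)
        qed
      qed
      have bd: "0 \<le> A' G \<and> dbound m (f G) (A' G * norm (k' - k + G) ^ (1 - \<gamma>)) (h / d)" if G: "G \<in> rlattice X" for G
      proof (cases "norm (k' - k + G) < c0")
        case True
        then show ?thesis using near[OF G] C1 \<gamma>0 by (simp add: A'_def)
      next
        case False
        have "dbound m (f G) (A G * \<kappa> ^ m) (h / d)" by (rule rescale[OF A(2) h d(1,3)])
        then have "dbound m (f G) (A' G * norm (k' - k + G)) (h / d)"
        proof (rule dbound_mono)
          have "A G * \<kappa> ^ m * c0 \<le> A G * \<kappa> ^ m * norm (k' - k + G)"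
            using False A(1)[of G] \<kappa> by (intro mult_left_mono) auto
          then show "A G * \<kappa> ^ m \<le> A' G * norm (k' - k + G)"
            using False c0 by (simp add: A'_def field_simps)
        qed (use h d in auto)
        moreover have "0 \<le> A' G" using False A(1)[of G] \<kappa> c0 by (simp add: A'_def)
        ultimately show ?thesis using \<gamma>0 by simp
      qed
      have sum: "(\<Sum>G\<in>F. (A' G)\<^sup>2) \<le> K0 * (\<kappa> ^ m / c0)\<^sup>2 + C1\<^sup>2" if F: "finite F" "F \<subseteq> rlattice X" for F
      proof -
        define S where "S = {G \<in> F. norm (k' - k + G) < c0}"
        have S: "card S \<le> 1"
        proof (rule card_le_Suc0_iff_eq[THEN iffD2, unfolded One_nat_def[symmetric]])
          show "finite S" using F by (simp add: S_def)
          show "\<forall>G\<in>S. \<forall>H\<in>S. G = H"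
          proof (intro ballI, rule ccontr)
            fix G H assume GH: "G \<in> S" "H \<in> S" "G \<noteq> H"
            then have "c \<le> norm (G - H)" using F BZ.diff_in by (intro c) (auto simp: S_def)
            also have "G - H = (k' - k + G) - (k' - k + H)" by simp
            also have "norm \<dots> \<le> norm (k' - k + G) + norm (k' - k + H)" by (rule norm_triangle_ineq4)
            also have "\<dots> < c0 + c0" using GH by (intro add_strict_mono) (auto simp: S_def)
            finally show False by (simp add: c0_def)
          qed
        qed
        have "(\<Sum>G\<in>F. (A' G)\<^sup>2) \<le> (\<Sum>G\<in>F. (A G)\<^sup>2 * (\<kappa> ^ m / c0)\<^sup>2 + (if norm (k' - k + G) < c0 then C1\<^sup>2 else 0))"
          by (intro sum_mono) (auto simp: A'_def power_mult_distrib power_divide)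
        also have "\<dots> = (\<Sum>G\<in>F. (A G)\<^sup>2) * (\<kappa> ^ m / c0)\<^sup>2 + real (card S) * C1\<^sup>2"
          using F by (simp add: sum.distrib sum_distrib_right S_def flip: sum.inter_filter)
        also have "\<dots> \<le> K0 * (\<kappa> ^ m / c0)\<^sup>2 + 1 * C1\<^sup>2"
          using S A(3)[OF F] by (intro add_mono mult_right_mono) auto
        finally show ?thesis by simp
      qed
      show "\<exists>A. (\<forall>G\<in>rlattice X. 0 \<le> A G \<and>
        dbound m (pair_path n n' k v k' v' (k' - k + G))
          (A G * norm (k' - k + G) ^ (1 - \<gamma>)) (h / BZ.ldist (k' - k))) \<and>
        square_sums A (K0 * (\<kappa> ^ m / c0)\<^sup>2 + C1\<^sup>2)"
        using bd sum unfolding f_def d_def by blast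
    qed
  qed
qed

section \<open>Electron repulsion integrals\<close>

text \<open>As \<open>1 / 0 = 0\<close>, the omitted term may be included in the sum.\<close>

lemma eri_eq:
  "eri X (n1, k1) (n2, k2) (n3, k3) (n4, k4) = complex_of_real (4 * pi / vol) *
     (\<Sum>\<^sub>\<infinity>G\<in>rlattice X. complex_of_real (1 / (norm (k3 - k1 + G))\<^sup>2)
        * pairint n1 n3 k1 k3 (k3 - k1 + G) * pairint n2 n4 k2 (k2 - (k3 - k1)) (- (k3 - k1 + G)))"
  unfolding eri_def Let_def vol_def fst_conv snd_conv
proof (rule arg_cong2[where f = "(*)", OF refl], rule infsum_cong_neutral)
  fix G assume "G \<in> {G \<in> rlattice X. k3 - k1 + G \<noteq> 0} \<inter> rlattice X"
  show "complex_of_real (1 / (norm (k3 - k1 + G))\<^sup>2) * pair_density X (n1, k1) (n3, k1 + (k3 - k1)) G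
        * pair_density X (n2, k2) (n4, k2 - (k3 - k1)) (- G)
     = complex_of_real (1 / (norm (k3 - k1 + G))\<^sup>2)
        * pairint n1 n3 k1 k3 (k3 - k1 + G) * pairint n2 n4 k2 (k2 - (k3 - k1)) (- (k3 - k1 + G))"
    unfolding pair_density_pairint by (simp add: algebra_simps)
qed auto

text \<open>With \<open>\<xi> = q + G\<close> and \<open>d\<close> the distance of \<open>q\<close> from the lattice, the inverse square contributes \<open>1 / |\<xi>|\<^sup>2\<close> and each
pair density the factor \<open>|\<xi>| ^ (1 - \<gamma>)\<close>. Their product is at most \<open>(1 / d\<^sup>2) ^ \<gamma>\<close>, uniformly in \<open>G\<close>, and the
remaining constants are summable by \<open>cross_sum\<close>. The fourth momentum \<open>k4 j\<close> is arbitrary because the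
integral determines it from the other three.\<close>

lemma eri_far:
  assumes n: "n1 \<in> bands" "n2 \<in> bands" "n3 \<in> bands" "n4 \<in> bands" and \<omega>: "0 \<le> \<omega>" and C: "0 \<le> C"
    and \<gamma>: "\<gamma> \<le> 1" "\<gamma> = 0 \<Longrightarrow> n1 \<noteq> n3 \<and> n2 \<noteq> n4"
  shows "\<exists>K\<ge>0. \<forall>h k1 k2 k3 v1 v2 v3 k4. 0 < h \<longrightarrow>
    regular_step m C h k1 v1 \<longrightarrow> regular_step m C h k2 v2 \<longrightarrow> regular_step m C h k3 v3 \<longrightarrow>
    regular_step m C h (k2 - (k3 - k1)) (v2 - (v3 - v1)) \<longrightarrow>
    norm (v3 - v1) \<le> \<omega> * h \<longrightarrow> (2 * real m * \<omega> + 1) * h \<le> BZ.ldist (k3 - k1) \<longrightarrow>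
    dbound m (\<lambda>j. eri X (n1, k1 + real j *\<^sub>R v1) (n2, k2 + real j *\<^sub>R v2) (n3, k3 + real j *\<^sub>R v3) (n4, k4 j))
      (K * (1 / (BZ.ldist (k3 - k1))\<^sup>2) ^ \<gamma>) (h / BZ.ldist (k3 - k1))"
proof -
  obtain K1 where K1: "0 \<le> K1" and R1: "\<And>h k v k' v'. 0 < h \<Longrightarrow> regular_step m C h k v \<Longrightarrow> regular_step m C h k' v' \<Longrightarrow>
    norm (v' - v) \<le> \<omega> * h \<Longrightarrow> (2 * real m * \<omega> + 1) * h \<le> BZ.ldist (k' - k) \<Longrightarrow>
    (\<exists>A. (\<forall>G\<in>rlattice X. 0 \<le> A G \<and>
        dbound m (pair_path n1 n3 k v k' v' (k' - k + G))
          (A G * norm (k' - k + G) ^ (1 - \<gamma>)) (h / BZ.ldist (k' - k))) \<and>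
      square_sums A K1)"
    using pairint_far[OF n(1,3) \<omega> C \<gamma>(1), of m] \<gamma>(2) by blast
  obtain K2 where K2: "0 \<le> K2" and R2: "\<And>h k v k' v'. 0 < h \<Longrightarrow> regular_step m C h k v \<Longrightarrow> regular_step m C h k' v' \<Longrightarrow>
    norm (v' - v) \<le> \<omega> * h \<Longrightarrow> (2 * real m * \<omega> + 1) * h \<le> BZ.ldist (k' - k) \<Longrightarrow>
    (\<exists>A. (\<forall>G\<in>rlattice X. 0 \<le> A G \<and>
        dbound m (pair_path n2 n4 k v k' v' (k' - k + G))
          (A G * norm (k' - k + G) ^ (1 - \<gamma>)) (h / BZ.ldist (k' - k))) \<and>
      square_sums A K2)"
    using pairint_far[OF n(2,4) \<omega> C \<gamma>(1), of m] \<gamma>(2) by blast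
  obtain K3 where K3: "0 \<le> K3" and inv: "\<And>(\<xi> :: real^3) w h d. 0 < h \<Longrightarrow> norm w \<le> \<omega> * h \<Longrightarrow>
      (2 * real m * \<omega> + 1) * h \<le> d \<Longrightarrow> d \<le> norm \<xi> \<Longrightarrow>
      dbound m (\<lambda>j. complex_of_real (1 / (norm (\<xi> + real j *\<^sub>R w))\<^sup>2)) (K3 / (norm \<xi>)\<^sup>2) (h / d)"
    using dbound_inverse_square[OF \<omega>, of m] by blast
  define K where "K = (4 * pi / vol) * (4 ^ m * K3 * ((K1 + K2) / 2))"
  show ?thesis
  proof (intro exI[of _ K] conjI allI impI)
    show "0 \<le> K" using K1 K2 K3 vol_pos by (simp add: K_def)
    fix h :: real and k1 k2 k3 v1 v2 v3 :: "real^3" and k4 :: "nat \<Rightarrow> real^3"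
    assume h: "0 < h" and st: "regular_step m C h k1 v1" "regular_step m C h k2 v2" "regular_step m C h k3 v3"
      "regular_step m C h (k2 - (k3 - k1)) (v2 - (v3 - v1))"
      and w: "norm (v3 - v1) \<le> \<omega> * h" and far: "(2 * real m * \<omega> + 1) * h \<le> BZ.ldist (k3 - k1)"
    define q where "q = k3 - k1"
    define d where "d = BZ.ldist q"
    have "h \<le> (2 * real m * \<omega> + 1) * h" using h \<omega> by simp
    then have "0 < d" using far h unfolding d_def q_def by linarith
    then have d: "0 < d" "0 \<le> h / d" using h by auto
    have q2: "k2 - q - k2 = - q" "v2 - (v3 - v1) - v2 = - (v3 - v1)" by simp_all
    obtain A1 where A1: "\<And>G. G \<in> rlattice X \<Longrightarrow> 0 \<le> A1 G"
      "\<And>G. G \<in> rlattice X \<Longrightarrow> dbound m (pair_path n1 n3 k1 v1 k3 v3 (q + G))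
          (A1 G * norm (q + G) ^ (1 - \<gamma>)) (h / d)"
      "\<And>F. finite F \<Longrightarrow> F \<subseteq> rlattice X \<Longrightarrow> (\<Sum>G\<in>F. (A1 G)\<^sup>2) \<le> K1"
      using R1[OF h st(1,3) w far] unfolding q_def[symmetric] d_def[symmetric] by blast
    have w': "norm (v2 - (v3 - v1) - v2) \<le> \<omega> * h" using w by (simp add: norm_minus_commute)
    have far': "(2 * real m * \<omega> + 1) * h \<le> BZ.ldist (k2 - (k3 - k1) - k2)"
      using far BZ.ldist_uminus[of "k3 - k1"] by simp
    obtain A2 where A2: "\<And>G. G \<in> rlattice X \<Longrightarrow> 0 \<le> A2 G"
      "\<And>G. G \<in> rlattice X \<Longrightarrow> dbound m (\<lambda>j. pairint n2 n4 (k2 + real j *\<^sub>R v2) (k2 - q + real j *\<^sub>R (v2 - (v3 - v1))) (- q + G + real j *\<^sub>R (- (v3 - v1))))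
          (A2 G * norm (- q + G) ^ (1 - \<gamma>)) (h / d)"
      "\<And>F. finite F \<Longrightarrow> F \<subseteq> rlattice X \<Longrightarrow> (\<Sum>G\<in>F. (A2 G)\<^sup>2) \<le> K2"
      using R2[OF h st(2,4) w' far'] unfolding q_def[symmetric] q2 BZ.ldist_uminus d_def[symmetric] by blast
    define P where "P G j = complex_of_real (1 / (norm (q + G + real j *\<^sub>R (v3 - v1)))\<^sup>2)
        * pair_path n1 n3 k1 v1 k3 v3 (q + G) j
        * pairint n2 n4 (k2 + real j *\<^sub>R v2) (k2 - q + real j *\<^sub>R (v2 - (v3 - v1))) (- q + - G + real j *\<^sub>R (- (v3 - v1)))" for G j
    define B where "B G = 4 ^ m * K3 * (1 / d\<^sup>2) ^ \<gamma> * (A1 G * A2 (- G))" for G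
    have Pd: "dbound m (P G) (B G) (h / d)" if G: "G \<in> rlattice X" for G
    proof -
      have d\<xi>: "d \<le> norm (q + G)" unfolding d_def by (rule BZ.ldist_le_plus[OF G])
      have nG: "- G \<in> rlattice X" using G by (rule BZ.neg_in)
      have nn: "norm (- q + - G) = norm (q + G)" by (metis minus_add_distrib norm_minus_cancel)
      have "dbound m (P G) (2 ^ m * (2 ^ m * (K3 / (norm (q + G))\<^sup>2) * (A1 G * norm (q + G) ^ (1 - \<gamma>)))
          * (A2 (- G) * norm (- q + - G) ^ (1 - \<gamma>))) (h / d)"
        unfolding P_def
        by (intro dbound_mult A1(2)[OF G] A2(2)[OF nG] inv[OF h w _ d\<xi>] d(2))
           (use far in \<open>simp add: d_def q_def\<close>)
      then show ?thesis
      proof (rule dbound_mono)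
        have e: "2 ^ m * (2 ^ m * (K3 / (norm (q + G))\<^sup>2) * (A1 G * norm (q + G) ^ (1 - \<gamma>)))
          * (A2 (- G) * norm (- q + - G) ^ (1 - \<gamma>))
          = 4 ^ m * K3 * ((norm (q + G) ^ (1 - \<gamma>))\<^sup>2 / (norm (q + G))\<^sup>2) * (A1 G * A2 (- G))"
          unfolding nn by (simp add: power2_eq_square power_mult_distrib[of 2 2, symmetric, simplified] flip: power_mult_distrib)
        have "(norm (q + G) ^ (1 - \<gamma>))\<^sup>2 / (norm (q + G))\<^sup>2 \<le> (1 / d\<^sup>2) ^ \<gamma>"
        proof (cases "\<gamma> = 0")
          case True
          then show ?thesis using d d\<xi> by simp
        next
          case False
          then have "\<gamma> = 1" using \<gamma> by simp
          moreover have "1 / (norm (q + G))\<^sup>2 \<le> 1 / d\<^sup>2"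
          proof (rule divide_left_mono)
            have "0 < norm (q + G)" using d d\<xi> by linarith
            then show "0 < (norm (q + G))\<^sup>2 * d\<^sup>2" using d by simp
          qed (use d d\<xi> in \<open>auto intro!: power_mono\<close>)
          ultimately show ?thesis by simp
        qed
        then show "2 ^ m * (2 ^ m * (K3 / (norm (q + G))\<^sup>2) * (A1 G * norm (q + G) ^ (1 - \<gamma>)))
          * (A2 (- G) * norm (- q + - G) ^ (1 - \<gamma>)) \<le> B G"
          unfolding e B_def using K3 A1(1)[OF G] A2(1)[OF nG]
          by (intro mult_right_mono mult_left_mono) auto
      qed (use d in auto)
    qed
    have Bs: "sum B F \<le> 4 ^ m * K3 * (1 / d\<^sup>2) ^ \<gamma> * ((K1 + K2) / 2)" if F: "finite F" "F \<subseteq> rlattice X" for F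
    proof -
      have "(\<Sum>G\<in>F. A1 G * A2 (- G)) \<le> (K1 + K2) / 2" by (rule cross_sum[OF A1(3) A2(3) F])
      then show ?thesis unfolding B_def sum_distrib_left[symmetric]
        using K3 by (intro mult_left_mono) auto
    qed
    have "dbound m (\<lambda>j. \<Sum>\<^sub>\<infinity>G\<in>rlattice X. P G j) (4 ^ m * K3 * (1 / d\<^sup>2) ^ \<gamma> * ((K1 + K2) / 2)) (h / d)"
      by (rule dbound_infsum[OF Pd Bs d(2)])
    from dbound_cmult[OF this, of "complex_of_real (4 * pi / vol)"]
    have "dbound m (\<lambda>j. complex_of_real (4 * pi / vol) * (\<Sum>\<^sub>\<infinity>G\<in>rlattice X. P G j)) (K * (1 / d\<^sup>2) ^ \<gamma>) (h / d)"
      using vol_pos by (simp add: K_def norm_mult norm_divide mult_ac)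
    moreover have "eri X (n1, k1 + real j *\<^sub>R v1) (n2, k2 + real j *\<^sub>R v2) (n3, k3 + real j *\<^sub>R v3) (n4, k4 j)
        = complex_of_real (4 * pi / vol) * (\<Sum>\<^sub>\<infinity>G\<in>rlattice X. P G j)" for j
    proof -
      have e1: "k3 + real j *\<^sub>R v3 - (k1 + real j *\<^sub>R v1) + G = q + G + real j *\<^sub>R (v3 - v1)" for G
        by (simp add: q_def algebra_simps)
      have e2: "k2 + real j *\<^sub>R v2 - (k3 + real j *\<^sub>R v3 - (k1 + real j *\<^sub>R v1)) = k2 - q + real j *\<^sub>R (v2 - (v3 - v1))"
        by (simp add: q_def algebra_simps)
      have e3: "- (q + G + real j *\<^sub>R (v3 - v1)) = - q + - G + real j *\<^sub>R (- (v3 - v1))" for G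
        by (simp add: algebra_simps)
      show ?thesis unfolding eri_eq e1 e2 e3 P_def ..
    qed
    ultimately show "dbound m (\<lambda>j. eri X (n1, k1 + real j *\<^sub>R v1) (n2, k2 + real j *\<^sub>R v2) (n3, k3 + real j *\<^sub>R v3) (n4, k4 j))
      (K * (1 / (BZ.ldist (k3 - k1))\<^sup>2) ^ \<gamma>) (h / BZ.ldist (k3 - k1))"
      by (simp add: d_def q_def)
  qed
qed

end

lemma dbound_of_real: "dbound m f C \<delta> \<Longrightarrow> dbound m (\<lambda>j. complex_of_real (f j)) C \<delta>"
proof -
  have "(fdiff ^^ i) (\<lambda>j. complex_of_real (f j)) j = of_real ((fdiff ^^ i) f j)" for i j
    by (induction i arbitrary: j) (simp_all add: fdiff_def)
  then show "dbound m f C \<delta> \<Longrightarrow> dbound m (\<lambda>j. complex_of_real (f j)) C \<delta>" by (simp add: dbound_def)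
qed

context insulator
begin

lemma regular_step_mono: "regular_step m C h k v \<Longrightarrow> C \<le> C' \<Longrightarrow> 0 \<le> h \<Longrightarrow> regular_step m C' h k v"
  unfolding regular_step_def using dbound_mono order_refl by blast

lemma regular_no_step: "\<exists>C\<ge>0. \<forall>h k. regular_step 0 C h k 0"
proof -
  obtain C where "1 \<le> C" "\<And>n r k. n \<in> bands \<Longrightarrow> r \<in> cell X \<Longrightarrow> norm (orbital X n k r) \<le> C"
    using orbital_Lipschitz by metis
  then show ?thesis by (intro exI[of _ C]) (auto simp: regular_step_def dbound_0)
qed

definition eri_term :: "nat \<Rightarrow> nat \<Rightarrow> nat \<Rightarrow> nat \<Rightarrow> real^3 \<Rightarrow> real^3 \<Rightarrow> real^3 \<Rightarrow> real^3 \<Rightarrow> complex" where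
  "eri_term n1 n2 n3 n4 k1 k2 k3 G = complex_of_real (1 / (norm (k3 - k1 + G))\<^sup>2)
        * pairint n1 n3 k1 k3 (k3 - k1 + G) * pairint n2 n4 k2 (k2 - (k3 - k1)) (- (k3 - k1 + G))"

lemma eri_eq_sum:
  "eri X (n1, k1) (n2, k2) (n3, k3) (n4, k4)
     = complex_of_real (4 * pi / vol) * (\<Sum>\<^sub>\<infinity>G\<in>rlattice X. eri_term n1 n2 n3 n4 k1 k2 k3 G)"
  unfolding eri_eq eri_term_def ..

text \<open>Off the lattice all \<open>|q + G|\<close> are at least the distance of \<open>q\<close> from it. If \<open>q\<close> is a lattice vector, then the
distance is 0 and \<open>1 / 0 = 0\<close>; now the nonzero \<open>q + G\<close> are bounded below by a shortest lattice vector.\<close>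

lemma eri_term_bound:
  assumes n: "n1 \<in> bands" "n2 \<in> bands" "n3 \<in> bands" "n4 \<in> bands"
  shows "\<exists>K\<ge>0. \<forall>k1 k2 k3. \<exists>B. (\<forall>G\<in>rlattice X. norm (eri_term n1 n2 n3 n4 k1 k2 k3 G) \<le> B G) \<and>
     (\<forall>F. finite F \<longrightarrow> F \<subseteq> rlattice X \<longrightarrow> sum B F \<le> K * (1 + 1 / (BZ.ldist (k3 - k1))\<^sup>2))"
proof -
  obtain C where C: "0 \<le> C" "\<And>h k. regular_step 0 C h k 0" using regular_no_step by blast
  have 0: "norm (0 - 0 :: real^3) \<le> 0 * 1" by simp
  have coeffs: "\<exists>K\<ge>0. \<forall>k k' q. \<exists>A. (\<forall>G. 0 \<le> A G \<and> norm (pairint n n' k k' (q + G)) \<le> A G) \<and>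
      square_sums A K" if n: "n \<in> bands" "n' \<in> bands" for n n'
  proof -
    obtain K where K: "0 \<le> K" "\<And>h k v k' v' q. 0 < h \<Longrightarrow> regular_step 0 C h k v \<Longrightarrow> regular_step 0 C h k' v' \<Longrightarrow>
      norm (v' - v) \<le> 0 * h \<Longrightarrow>
      (\<exists>A. (\<forall>G. 0 \<le> A G \<and>
        dbound 0 (pair_path n n' k v k' v' (q + G)) (A G) h) \<and>
      square_sums A K)"
      using pairint_steps[OF n order_refl C(1), of 0] by blast
    show ?thesis
    proof (intro exI[of _ K] conjI allI K(1))
      fix k k' q
      show "\<exists>A. (\<forall>G. 0 \<le> A G \<and> norm (pairint n n' k k' (q + G)) \<le> A G) \<and>
        square_sums A K"
        using K(2)[OF zero_less_one C(2) C(2) 0, of k k' q] by (simp add: dbound_0)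
    qed
  qed
  obtain K1 where K1: "0 \<le> K1" "\<And>k k' q. \<exists>A. (\<forall>G. 0 \<le> A G \<and> norm (pairint n1 n3 k k' (q + G)) \<le> A G) \<and>
      square_sums A K1" using coeffs[OF n(1,3)] by blast
  obtain K2 where K2: "0 \<le> K2" "\<And>k k' q. \<exists>A. (\<forall>G. 0 \<le> A G \<and> norm (pairint n2 n4 k k' (q + G)) \<le> A G) \<and>
      square_sums A K2" using coeffs[OF n(2,4)] by blast
  obtain c where c: "0 < c" "\<And>G. G \<in> rlattice X \<Longrightarrow> G \<noteq> 0 \<Longrightarrow> c \<le> norm G" using BZ.min_norm by blast
  define \<mu> where "\<mu> = max 1 (1 / c\<^sup>2)"
  show ?thesis
  proof (intro exI[of _ "\<mu> * ((K1 + K2) / 2)"] conjI allI)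
    show "0 \<le> \<mu> * ((K1 + K2) / 2)" using K1(1) K2(1) by (simp add: \<mu>_def)
    fix k1 k2 k3 :: "real^3"
    define q where "q = k3 - k1"
    define d where "d = BZ.ldist q"
    obtain A1 where A1: "\<And>G. 0 \<le> A1 G" "\<And>G. norm (pairint n1 n3 k1 k3 (q + G)) \<le> A1 G"
      "\<And>F. finite F \<Longrightarrow> F \<subseteq> rlattice X \<Longrightarrow> (\<Sum>G\<in>F. (A1 G)\<^sup>2) \<le> K1" using K1(2)[of k1 k3 q] by blast
    obtain A2 where A2: "\<And>G. 0 \<le> A2 G" "\<And>G. norm (pairint n2 n4 k2 (k2 - q) (- q + G)) \<le> A2 G"
      "\<And>F. finite F \<Longrightarrow> F \<subseteq> rlattice X \<Longrightarrow> (\<Sum>G\<in>F. (A2 G)\<^sup>2) \<le> K2" using K2(2)[of k2 "k2 - q" "- q"] by blast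
    define B where "B G = \<mu> * (1 + 1 / d\<^sup>2) * (A1 G * A2 (- G))" for G
    show "\<exists>B. (\<forall>G\<in>rlattice X. norm (eri_term n1 n2 n3 n4 k1 k2 k3 G) \<le> B G) \<and>
     (\<forall>F. finite F \<longrightarrow> F \<subseteq> rlattice X \<longrightarrow> sum B F \<le> \<mu> * ((K1 + K2) / 2) * (1 + 1 / (BZ.ldist (k3 - k1))\<^sup>2))"
    proof (intro exI[of _ B] conjI ballI allI impI)
      fix G assume G: "G \<in> rlattice X"
      \<comment> \<open>The summand 1 takes care of lattice vectors \<open>q\<close>, for which \<open>1 / d\<^sup>2\<close> is 0.\<close>
      have "1 / (norm (q + G))\<^sup>2 \<le> \<mu> * (1 + 1 / d\<^sup>2)"
      proof (cases "q \<in> rlattice X")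
        case True
        have "1 / (norm (q + G))\<^sup>2 \<le> 1 / c\<^sup>2"
        proof (cases "q + G = 0")
          case False
          then have "c \<le> norm (q + G)" using BZ.add_in[OF True G] by (rule c(2)[rotated])
          then have "c\<^sup>2 \<le> (norm (q + G))\<^sup>2" using c by (intro power_mono) auto
          then show ?thesis using c False by (intro divide_left_mono) auto
        qed (use c in simp)
        also have "\<dots> \<le> \<mu> * 1" by (simp add: \<mu>_def)
        also have "\<dots> \<le> \<mu> * (1 + 1 / d\<^sup>2)" by (intro mult_left_mono) (auto simp: \<mu>_def)
        finally show ?thesis .
      next
        case False
        then have "0 < d" using BZ.ldist_eq_0_iff[of q] infdist_nonneg[of q "rlattice X"] unfolding d_def by linarith
        moreover have d\<xi>: "d \<le> norm (q + G)" unfolding d_def by (rule BZ.ldist_le_plus[OF G])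
        ultimately have "0 < norm (q + G)" "d\<^sup>2 \<le> (norm (q + G))\<^sup>2" by (linarith, intro power_mono, auto)
        with \<open>0 < d\<close> have "1 / (norm (q + G))\<^sup>2 \<le> 1 / d\<^sup>2" by (intro divide_left_mono) auto
        also have "\<dots> \<le> 1 * (1 + 1 / d\<^sup>2)" by simp
        also have "\<dots> \<le> \<mu> * (1 + 1 / d\<^sup>2)" by (intro mult_right_mono) (auto simp: \<mu>_def)
        finally show ?thesis .
      qed
      moreover have "norm (pairint n2 n4 k2 (k2 - q) (- (q + G))) \<le> A2 (- G)" using A2(2)[of "- G"] by simp
      ultimately have "1 / (norm (q + G))\<^sup>2 * norm (pairint n1 n3 k1 k3 (q + G)) * norm (pairint n2 n4 k2 (k2 - q) (- (q + G)))
          \<le> \<mu> * (1 + 1 / d\<^sup>2) * A1 G * A2 (- G)"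
        using A1(1)[of G] A1(2)[of G] A2(1)[of "- G"] by (intro mult_mono) (auto simp: \<mu>_def)
      then show "norm (eri_term n1 n2 n3 n4 k1 k2 k3 G) \<le> B G"
        by (simp add: eri_term_def B_def norm_mult norm_divide norm_power q_def mult.assoc)
    next
      fix F assume F: "finite F" "F \<subseteq> rlattice X"
      have "(\<Sum>G\<in>F. A1 G * A2 (- G)) \<le> (K1 + K2) / 2" by (rule cross_sum[OF A1(3) A2(3) F])
      then have "\<mu> * (1 + 1 / d\<^sup>2) * (\<Sum>G\<in>F. A1 G * A2 (- G)) \<le> \<mu> * (1 + 1 / d\<^sup>2) * ((K1 + K2) / 2)"
        by (intro mult_left_mono) (auto simp: \<mu>_def)
      then show "sum B F \<le> \<mu> * ((K1 + K2) / 2) * (1 + 1 / (BZ.ldist (k3 - k1))\<^sup>2)"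
        unfolding B_def sum_distrib_left[symmetric] d_def q_def by (simp only: mult_ac)
    qed
  qed
qed

lemma eri_summable:
  assumes n: "n1 \<in> bands" "n2 \<in> bands" "n3 \<in> bands" "n4 \<in> bands"
  shows "eri_term n1 n2 n3 n4 k1 k2 k3 summable_on rlattice X"
proof -
  obtain K B where B: "\<And>G. G \<in> rlattice X \<Longrightarrow> norm (eri_term n1 n2 n3 n4 k1 k2 k3 G) \<le> B G"
    "\<And>F. finite F \<Longrightarrow> F \<subseteq> rlattice X \<Longrightarrow> sum B F \<le> K"
    using eri_term_bound[OF n] by metis
  have B0: "0 \<le> B G" if "G \<in> rlattice X" for G using B(1)[OF that] norm_ge_zero order_trans by blast
  have "B summable_on rlattice X"
  proof (rule nonneg_bdd_above_summable_on[OF B0])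
    show "bdd_above (sum B ` {F. F \<subseteq> rlattice X \<and> finite F})"
      by (rule bdd_aboveI[of _ K]) (use B(2) in blast)
  qed
  then have "(\<lambda>G. norm (eri_term n1 n2 n3 n4 k1 k2 k3 G)) summable_on rlattice X"
    by (rule summable_on_comparison_test) (use B(1) in auto)
  then show ?thesis by (rule abs_summable_summable)
qed

text \<open>Sizes are bounds on differences of order 0, so for \<open>\<gamma> = 0\<close> this is a case of \<open>eri_far\<close> with zero steps.\<close>

lemma eri_size:
  assumes n: "n1 \<in> bands" "n2 \<in> bands" "n3 \<in> bands" "n4 \<in> bands"
    and \<gamma>: "\<gamma> \<le> 1" "\<gamma> = 0 \<Longrightarrow> n1 \<noteq> n3 \<and> n2 \<noteq> n4"
  shows "\<exists>K\<ge>0. \<forall>k1 k2 k3 k4. norm (eri X (n1, k1) (n2, k2) (n3, k3) (n4, k4))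
     \<le> K * (1 + 1 / (BZ.ldist (k3 - k1))\<^sup>2) ^ \<gamma>"
proof -
  obtain K0 where K0: "0 \<le> K0" and tb: "\<And>k1 k2 k3. \<exists>B. (\<forall>G\<in>rlattice X. norm (eri_term n1 n2 n3 n4 k1 k2 k3 G) \<le> B G) \<and>
     (\<forall>F. finite F \<longrightarrow> F \<subseteq> rlattice X \<longrightarrow> sum B F \<le> K0 * (1 + 1 / (BZ.ldist (k3 - k1))\<^sup>2))"
    using eri_term_bound[OF n] by blast
  define K1 where "K1 = 4 * pi / vol * K0"
  have K1: "0 \<le> K1" using K0 vol_pos by (simp add: K1_def)
  have gen: "norm (eri X (n1, k1) (n2, k2) (n3, k3) (n4, k4)) \<le> K1 * (1 + 1 / (BZ.ldist (k3 - k1))\<^sup>2)" for k1 k2 k3 k4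
  proof -
    obtain B where B: "\<And>G. G \<in> rlattice X \<Longrightarrow> norm (eri_term n1 n2 n3 n4 k1 k2 k3 G) \<le> B G"
      "\<And>F. finite F \<Longrightarrow> F \<subseteq> rlattice X \<Longrightarrow> sum B F \<le> K0 * (1 + 1 / (BZ.ldist (k3 - k1))\<^sup>2)"
      using tb[of k1 k2 k3] by blast
    have "dbound 0 (\<lambda>j. \<Sum>\<^sub>\<infinity>G\<in>rlattice X. eri_term n1 n2 n3 n4 k1 k2 k3 G) (K0 * (1 + 1 / (BZ.ldist (k3 - k1))\<^sup>2)) 1"
      by (rule dbound_infsum[where B = B]) (use B in \<open>auto simp: dbound_0\<close>)
    from dbound_cmult[OF this, of "complex_of_real (4 * pi / vol)"] show ?thesis
      using vol_pos unfolding eri_eq_sum by (simp add: dbound_0 K1_def norm_mult norm_divide mult_ac)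
  qed
  show ?thesis
  proof (cases "\<gamma> = 1")
    case True
    then show ?thesis using gen K1 by auto
  next
    case False
    then have \<gamma>0: "\<gamma> = 0" using \<gamma> by simp
    obtain C where C: "0 \<le> C" "\<And>h k. regular_step 0 C h k 0" using regular_no_step by blast
    obtain K2 where K2: "0 \<le> K2" and far: "\<And>h k1 k2 k3 v1 v2 v3 k4. 0 < h \<Longrightarrow>
      regular_step 0 C h k1 v1 \<Longrightarrow> regular_step 0 C h k2 v2 \<Longrightarrow> regular_step 0 C h k3 v3 \<Longrightarrow>
      regular_step 0 C h (k2 - (k3 - k1)) (v2 - (v3 - v1)) \<Longrightarrow>
      norm (v3 - v1) \<le> 0 * h \<Longrightarrow> (2 * real 0 * 0 + 1) * h \<le> BZ.ldist (k3 - k1) \<Longrightarrow>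
      dbound 0 (\<lambda>j. eri X (n1, k1 + real j *\<^sub>R v1) (n2, k2 + real j *\<^sub>R v2) (n3, k3 + real j *\<^sub>R v3) (n4, k4 j))
      (K2 * (1 / (BZ.ldist (k3 - k1))\<^sup>2) ^ \<gamma>) (h / BZ.ldist (k3 - k1))"
      using eri_far[OF n order_refl C(1) \<gamma>, of 0] by blast
    have "norm (eri X (n1, k1) (n2, k2) (n3, k3) (n4, k4)) \<le> max K1 K2" for k1 k2 k3 k4
    proof (cases "BZ.ldist (k3 - k1) = 0")
      case True
      then show ?thesis using gen[of k1 k2 k3 k4] by simp
    next
      case False
      then have "0 < BZ.ldist (k3 - k1)" using infdist_nonneg[of "k3 - k1" "rlattice X"] by linarith
      then have "dbound 0 (\<lambda>j. eri X (n1, k1 + real j *\<^sub>R 0) (n2, k2 + real j *\<^sub>R 0) (n3, k3 + real j *\<^sub>R 0) (n4, k4))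
        (K2 * (1 / (BZ.ldist (k3 - k1))\<^sup>2) ^ \<gamma>) (BZ.ldist (k3 - k1) / BZ.ldist (k3 - k1))"
        by (rule far) (use C(2) in auto)
      then show ?thesis using \<gamma>0 by (simp add: dbound_0)
    qed
    then show ?thesis using K1 \<gamma>0 by (intro exI[of _ "max K1 K2"]) auto
  qed
qed

text \<open>Up to \<open>2 m \<omega> + 1\<close> steps from the singularity the sizes of the values suffice. They are of order
\<open>(N\<^sup>2) ^ \<gamma>\<close>, because the momentum transfers along the path stay on the mesh, where they either are
lattice vectors or have distance at least \<open>c / N\<close> from the lattice. Beyond that \<open>eri_far\<close> applies.\<close>

lemma eri_lattice_steps:
  assumes n: "n1 \<in> bands" "n2 \<in> bands" "n3 \<in> bands" "n4 \<in> bands"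
    and \<gamma>: "\<gamma> \<le> 1" "\<gamma> = 0 \<Longrightarrow> n1 \<noteq> n3 \<and> n2 \<noteq> n4"
    and u: "u1 \<in> rlattice X" "u3 \<in> rlattice X"
  shows "\<exists>K\<ge>0. \<forall>N k1 k2 k3 k4. 0 < N \<longrightarrow> real N *\<^sub>R (k3 - k1) \<in> rlattice X \<longrightarrow>
    dbound m (\<lambda>j. eri X (n1, k1 + (real j / real N) *\<^sub>R u1) (n2, k2 + (real j / real N) *\<^sub>R u2)
        (n3, k3 + (real j / real N) *\<^sub>R u3) (n4, k4 j))
      (K * ((real N)\<^sup>2) ^ \<gamma>) (1 / real N / max (1 / real N) (BZ.ldist (k3 - k1)))"
proof -
  obtain C1 where C1: "0 \<le> C1" "\<And>k h. 0 < h \<Longrightarrow> h \<le> 1 \<Longrightarrow> regular_step m C1 h k (h *\<^sub>R u1)"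
    using regular_lattice_step by blast
  obtain C2 where C2: "0 \<le> C2" "\<And>k h. 0 < h \<Longrightarrow> h \<le> 1 \<Longrightarrow> regular_step m C2 h k (h *\<^sub>R u2)"
    using regular_lattice_step by blast
  obtain C3 where C3: "0 \<le> C3" "\<And>k h. 0 < h \<Longrightarrow> h \<le> 1 \<Longrightarrow> regular_step m C3 h k (h *\<^sub>R u3)"
    using regular_lattice_step by blast
  obtain C4 where C4: "0 \<le> C4" "\<And>k h. 0 < h \<Longrightarrow> h \<le> 1 \<Longrightarrow> regular_step m C4 h k (h *\<^sub>R (u2 - (u3 - u1)))"
    using regular_lattice_step by blast
  define C where "C = C1 + C2 + C3 + C4"
  have C: "0 \<le> C" using C1 C2 C3 C4 by (simp add: C_def)
  define \<omega> where "\<omega> = norm (u3 - u1)"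
  have \<omega>: "0 \<le> \<omega>" by (simp add: \<omega>_def)
  define \<tau> where "\<tau> = 2 * real m * \<omega> + 1"
  have \<tau>: "1 \<le> \<tau>" using \<omega> by (simp add: \<tau>_def)
  obtain Kf where Kf: "0 \<le> Kf" and far: "\<And>h k1 k2 k3 v1 v2 v3 k4. 0 < h \<Longrightarrow>
      regular_step m C h k1 v1 \<Longrightarrow> regular_step m C h k2 v2 \<Longrightarrow> regular_step m C h k3 v3 \<Longrightarrow>
      regular_step m C h (k2 - (k3 - k1)) (v2 - (v3 - v1)) \<Longrightarrow>
      norm (v3 - v1) \<le> \<omega> * h \<Longrightarrow> \<tau> * h \<le> BZ.ldist (k3 - k1) \<Longrightarrow>
      dbound m (\<lambda>j. eri X (n1, k1 + real j *\<^sub>R v1) (n2, k2 + real j *\<^sub>R v2) (n3, k3 + real j *\<^sub>R v3) (n4, k4 j))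
      (Kf * (1 / (BZ.ldist (k3 - k1))\<^sup>2) ^ \<gamma>) (h / BZ.ldist (k3 - k1))"
    using eri_far[OF n \<omega> C \<gamma>, of m] unfolding \<tau>_def by blast
  obtain Ks where Ks: "0 \<le> Ks" and size: "\<And>k1 k2 k3 k4. norm (eri X (n1, k1) (n2, k2) (n3, k3) (n4, k4))
     \<le> Ks * (1 + 1 / (BZ.ldist (k3 - k1))\<^sup>2) ^ \<gamma>" using eri_size[OF n \<gamma>] by blast
  obtain c where c: "0 < c" "\<And>G. G \<in> rlattice X \<Longrightarrow> G \<noteq> 0 \<Longrightarrow> c \<le> norm G" using BZ.min_norm by blast
  define Kn where "Kn = 2 ^ m * (Ks * (1 + 1 / c\<^sup>2) ^ \<gamma>) / (1 / \<tau>) ^ m"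
  have Kn: "0 \<le> Kn" using Ks c \<tau> by (simp add: Kn_def)
  show ?thesis
  proof (intro exI[of _ "max Kf Kn"] conjI allI impI)
    show "0 \<le> max Kf Kn" using Kf by simp
    fix N :: nat and k1 k2 k3 :: "real^3" and k4 :: "nat \<Rightarrow> real^3"
    assume N: "0 < N" and lat: "real N *\<^sub>R (k3 - k1) \<in> rlattice X"
    define h where "h = 1 / real N"
    have h: "0 < h" "h \<le> 1" using N by (auto simp: h_def)
    have h\<tau>: "h \<le> \<tau> * h" using \<tau> h by simp
    define d where "d = BZ.ldist (k3 - k1)"
    have jN: "(real j / real N) *\<^sub>R u = real j *\<^sub>R (h *\<^sub>R u)" for j and u :: "real^3"
      by (simp only: scaleR_scaleR h_def times_divide_eq_right mult_1_right)
    have N2: "1 \<le> ((real N)\<^sup>2) ^ \<gamma>" using N by (intro one_le_power) simp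
    show "dbound m (\<lambda>j. eri X (n1, k1 + (real j / real N) *\<^sub>R u1) (n2, k2 + (real j / real N) *\<^sub>R u2)
        (n3, k3 + (real j / real N) *\<^sub>R u3) (n4, k4 j))
      (max Kf Kn * ((real N)\<^sup>2) ^ \<gamma>) (1 / real N / max (1 / real N) (BZ.ldist (k3 - k1)))"
    \<comment> \<open>Far from the singularity and close to it, respectively.\<close>
    proof (cases "\<tau> * h \<le> d")
      case True
      have hd: "h \<le> d" using True h\<tau> by linarith
      have dv: "h *\<^sub>R u3 - h *\<^sub>R u1 = h *\<^sub>R (u3 - u1)" by (simp add: scaleR_diff_right)
      have "dbound m (\<lambda>j. eri X (n1, k1 + real j *\<^sub>R (h *\<^sub>R u1)) (n2, k2 + real j *\<^sub>R (h *\<^sub>R u2)) (n3, k3 + real j *\<^sub>R (h *\<^sub>R u3)) (n4, k4 j))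
        (Kf * (1 / (BZ.ldist (k3 - k1))\<^sup>2) ^ \<gamma>) (h / BZ.ldist (k3 - k1))"
      proof (rule far[OF h(1)])
        show "regular_step m C h k1 (h *\<^sub>R u1)" "regular_step m C h k2 (h *\<^sub>R u2)" "regular_step m C h k3 (h *\<^sub>R u3)"
          by (rule regular_step_mono[OF C1(2)[OF h]] regular_step_mono[OF C2(2)[OF h]] regular_step_mono[OF C3(2)[OF h]],
              use C1 C2 C3 C4 h in \<open>simp_all add: C_def\<close>)+
        have "h *\<^sub>R u2 - (h *\<^sub>R u3 - h *\<^sub>R u1) = h *\<^sub>R (u2 - (u3 - u1))" by (simp add: scaleR_diff_right)
        then show "regular_step m C h (k2 - (k3 - k1)) (h *\<^sub>R u2 - (h *\<^sub>R u3 - h *\<^sub>R u1))"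
          using regular_step_mono[OF C4(2)[OF h], of C] C1 C2 C3 h by (simp add: C_def)
        show "norm (h *\<^sub>R u3 - h *\<^sub>R u1) \<le> \<omega> * h" unfolding dv using h by (simp add: \<omega>_def)
      qed (use True in \<open>simp add: d_def\<close>)
      then show ?thesis
        unfolding jN h_def[symmetric]
      proof (rule dbound_mono)
        have "1 / (BZ.ldist (k3 - k1))\<^sup>2 \<le> (real N)\<^sup>2"
        proof -
          have "1 / d\<^sup>2 \<le> 1 / h\<^sup>2" using hd h by (intro divide_left_mono power_mono) auto
          then show ?thesis using N by (simp add: h_def d_def power_divide)
        qed
        then have "(1 / (BZ.ldist (k3 - k1))\<^sup>2) ^ \<gamma> \<le> ((real N)\<^sup>2) ^ \<gamma>" by (intro power_mono) auto
        then show "Kf * (1 / (BZ.ldist (k3 - k1))\<^sup>2) ^ \<gamma> \<le> max Kf Kn * ((real N)\<^sup>2) ^ \<gamma>"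
          using Kf by (intro mult_mono) auto
        show "h / BZ.ldist (k3 - k1) \<le> h / max h (BZ.ldist (k3 - k1))"
          using hd by (simp add: d_def max_def)
        show "0 \<le> h / BZ.ldist (k3 - k1)" using h by (intro divide_nonneg_nonneg infdist_nonneg) auto
      qed
    next
      case False
      have val: "norm (eri X (n1, k1 + (real j / real N) *\<^sub>R u1) (n2, k2 + (real j / real N) *\<^sub>R u2)
        (n3, k3 + (real j / real N) *\<^sub>R u3) (n4, k4 j)) \<le> Ks * (1 + 1 / c\<^sup>2) ^ \<gamma> * ((real N)\<^sup>2) ^ \<gamma>" for j
      proof -
        define q where "q = k3 + (real j / real N) *\<^sub>R u3 - (k1 + (real j / real N) *\<^sub>R u1)"
        have "real N *\<^sub>R q = real N *\<^sub>R (k3 - k1) + real j *\<^sub>R (u3 - u1)"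
          using N by (simp add: q_def algebra_simps)
        then have qL: "real N *\<^sub>R q \<in> rlattice X"
          using lat BZ.add_in BZ.scale_in[OF BZ.diff_in[OF u(2,1)], of j] by simp
        have "1 / (BZ.ldist q)\<^sup>2 \<le> (real N)\<^sup>2 / c\<^sup>2"
        proof (cases "q \<in> rlattice X")
          case True
          then have "BZ.ldist q = 0" by (simp only: BZ.ldist_eq_0_iff)
          then show ?thesis by simp
        next
          case False
          have cd: "c / real N \<le> BZ.ldist q" by (rule BZ.ldist_scaled_lower[OF N qL False c(2)])
          then have "1 / (BZ.ldist q)\<^sup>2 \<le> 1 / (c / real N)\<^sup>2"
          proof (intro divide_left_mono power_mono)
            have "0 < c / real N" using c N by simp
            then show "0 < (BZ.ldist q)\<^sup>2 * (c / real N)\<^sup>2" using cd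
              by (intro mult_pos_pos zero_less_power) linarith+
          qed (use c in auto)
          then show ?thesis by (simp add: power_divide)
        qed
        moreover have "1 \<le> (real N)\<^sup>2" using N by simp
        ultimately have "1 + 1 / (BZ.ldist q)\<^sup>2 \<le> (1 + 1 / c\<^sup>2) * (real N)\<^sup>2"
          by (simp add: distrib_right)
        then have "(1 + 1 / (BZ.ldist q)\<^sup>2) ^ \<gamma> \<le> ((1 + 1 / c\<^sup>2) * (real N)\<^sup>2) ^ \<gamma>"
          by (intro power_mono) (auto intro: add_nonneg_nonneg)
        then have "Ks * (1 + 1 / (BZ.ldist q)\<^sup>2) ^ \<gamma> \<le> Ks * ((1 + 1 / c\<^sup>2) ^ \<gamma> * ((real N)\<^sup>2) ^ \<gamma>)"
          using Ks by (intro mult_left_mono) (auto simp: power_mult_distrib)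
        then show ?thesis using size unfolding q_def by (smt (verit) mult.assoc)
      qed
      have \<delta>: "1 / \<tau> \<le> h / max h d"
      proof -
        have "max h d \<le> \<tau> * h" using False h\<tau> by auto
        then show ?thesis using \<tau> h by (simp add: field_simps less_max_iff_disj)
      qed
      have "dbound m (\<lambda>j. eri X (n1, k1 + (real j / real N) *\<^sub>R u1) (n2, k2 + (real j / real N) *\<^sub>R u2)
        (n3, k3 + (real j / real N) *\<^sub>R u3) (n4, k4 j))
        (2 ^ m * (Ks * (1 + 1 / c\<^sup>2) ^ \<gamma> * ((real N)\<^sup>2) ^ \<gamma>) / (1 / \<tau>) ^ m) (h / max h d)"
        by (rule dbound_crude[OF val _ _ \<delta>]) (use \<tau> in auto)
      also have "2 ^ m * (Ks * (1 + 1 / c\<^sup>2) ^ \<gamma> * ((real N)\<^sup>2) ^ \<gamma>) / (1 / \<tau>) ^ m = Kn * ((real N)\<^sup>2) ^ \<gamma>"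
        by (simp add: Kn_def)
      finally show ?thesis
        unfolding h_def[symmetric] d_def[symmetric]
      proof (rule dbound_mono)
        show "Kn * ((real N)\<^sup>2) ^ \<gamma> \<le> max Kf Kn * ((real N)\<^sup>2) ^ \<gamma>" by (intro mult_right_mono) auto
      qed (use h in \<open>auto intro!: divide_nonneg_nonneg simp: le_max_iff_disj\<close>)
    qed
  qed
qed

text \<open>This is \<open>eri_far\<close> for first differences, where \<open>\<omega> = 2\<close> and \<open>2 * 1 * \<omega> + 1 = 5\<close>. It yields
continuity off the singular set.\<close>

lemma eri_modulus:
  assumes n: "n1 \<in> bands" "n2 \<in> bands" "n3 \<in> bands" "n4 \<in> bands"
  shows "\<exists>K\<ge>0. \<forall>h k1 k2 k3 v1 v2 v3 k4 k4'. 0 < h \<longrightarrow> norm v1 \<le> h \<longrightarrow> norm v2 \<le> h \<longrightarrow> norm v3 \<le> h \<longrightarrow>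
     5 * h \<le> BZ.ldist (k3 - k1) \<longrightarrow>
     norm (eri X (n1, k1 + v1) (n2, k2 + v2) (n3, k3 + v3) (n4, k4') - eri X (n1, k1) (n2, k2) (n3, k3) (n4, k4))
       \<le> K * (1 / (BZ.ldist (k3 - k1))\<^sup>2) * (h / BZ.ldist (k3 - k1))"
proof -
  obtain C where C: "0 \<le> C" "\<And>k v h. 0 \<le> h \<Longrightarrow> norm v \<le> 3 * h \<Longrightarrow> regular_step 1 C h k v"
    using regular_short_step by blast
  have 2: "(0 :: real) \<le> 2" by simp
  obtain K where K: "0 \<le> K" and far: "\<And>h k1 k2 k3 v1 v2 v3 k4. 0 < h \<Longrightarrow>
      regular_step 1 C h k1 v1 \<Longrightarrow> regular_step 1 C h k2 v2 \<Longrightarrow> regular_step 1 C h k3 v3 \<Longrightarrow>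
      regular_step 1 C h (k2 - (k3 - k1)) (v2 - (v3 - v1)) \<Longrightarrow>
      norm (v3 - v1) \<le> 2 * h \<Longrightarrow> (2 * real 1 * 2 + 1) * h \<le> BZ.ldist (k3 - k1) \<Longrightarrow>
      dbound 1 (\<lambda>j. eri X (n1, k1 + real j *\<^sub>R v1) (n2, k2 + real j *\<^sub>R v2) (n3, k3 + real j *\<^sub>R v3) (n4, k4 j))
      (K * (1 / (BZ.ldist (k3 - k1))\<^sup>2) ^ 1) (h / BZ.ldist (k3 - k1))"
    using eri_far[OF n 2 C(1), of 1 1] by auto
  show ?thesis
  proof (intro exI[of _ K] conjI allI impI K)
    fix h :: real and k1 k2 k3 v1 v2 v3 k4 k4' :: "real^3"
    assume h: "0 < h" and v: "norm v1 \<le> h" "norm v2 \<le> h" "norm v3 \<le> h" and d: "5 * h \<le> BZ.ldist (k3 - k1)"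
    have v31: "norm (v3 - v1) \<le> 2 * h" using norm_triangle_ineq4[of v3 v1] v by simp
    have v4: "norm (v2 - (v3 - v1)) \<le> 3 * h" using norm_triangle_ineq4[of v2 "v3 - v1"] v v31 by simp
    \<comment> \<open>A path along which the fourth momentum changes as well.\<close>
    define k4s where "k4s j = (if j = 0 then k4 else k4')" for j :: nat
    have "dbound 1 (\<lambda>j. eri X (n1, k1 + real j *\<^sub>R v1) (n2, k2 + real j *\<^sub>R v2) (n3, k3 + real j *\<^sub>R v3) (n4, k4s j))
      (K * (1 / (BZ.ldist (k3 - k1))\<^sup>2) ^ 1) (h / BZ.ldist (k3 - k1))"
    proof (rule far[OF h])
      show "regular_step 1 C h k1 v1" "regular_step 1 C h k2 v2" "regular_step 1 C h k3 v3"
        "regular_step 1 C h (k2 - (k3 - k1)) (v2 - (v3 - v1))"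
        by (rule C(2), use h v v4 in simp, use h v v4 in simp)+
    qed (use v31 d in auto)
    from dboundD[OF this, of 1 0]
    show "norm (eri X (n1, k1 + v1) (n2, k2 + v2) (n3, k3 + v3) (n4, k4') - eri X (n1, k1) (n2, k2) (n3, k3) (n4, k4))
       \<le> K * (1 / (BZ.ldist (k3 - k1))\<^sup>2) * (h / BZ.ldist (k3 - k1))"
      by (simp add: fdiff_def k4s_def)
  qed
qed

lemma pairint_modulus:
  assumes n: "n \<in> bands" "n' \<in> bands"
  shows "\<exists>K\<ge>0. \<forall>k k' \<xi> l l' \<eta>. norm (pairint n n' l l' \<eta> - pairint n n' k k' \<xi>)
     \<le> K * (norm (l - k) + norm (l' - k') + norm (\<eta> - \<xi>))"
proof -
  obtain \<rho> where \<rho>: "0 < \<rho>" "\<And>r. r \<in> cell X \<Longrightarrow> norm r \<le> \<rho>" using radius by blast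
  obtain C where C: "1 \<le> C" "\<And>n r k. n \<in> bands \<Longrightarrow> r \<in> cell X \<Longrightarrow> norm (orbital X n k r) \<le> C"
     "\<And>n r k k'. n \<in> bands \<Longrightarrow> r \<in> cell X \<Longrightarrow> norm (orbital X n k' r - orbital X n k r) \<le> C * norm (k' - k)"
    using orbital_Lipschitz by metis
  note [measurable] = orbital_measurable[OF n(1)] orbital_measurable[OF n(2)]
  define K where "K = C * C * max 1 \<rho>"
  have K0: "0 \<le> K" using C \<rho> by (simp add: K_def)
  show ?thesis
  proof (intro exI[of _ "K * vol"] conjI allI)
    show "0 \<le> K * vol" using K0 vol_pos by simp
    fix k k' \<xi> l l' \<eta> :: "real^3"
    define e where "e \<zeta> r = exp (- \<i> * complex_of_real (\<zeta> \<bullet> r))" for \<zeta> r :: "real^3"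
    have [measurable]: "e \<zeta> \<in> borel_measurable borel" for \<zeta> unfolding e_def by measurable
    have ne: "norm (e \<zeta> r) = 1" for \<zeta> r unfolding e_def by (rule norm_exp_i)
    define S where "S = norm (l - k) + norm (l' - k') + norm (\<eta> - \<xi>)"
    have int: "set_integrable lborel (cell X) (\<lambda>r. cnj (orbital X n k r) * orbital X n' k' r * e \<xi> r)" for k k' \<xi>
      by (rule cell_integrable[where B = "C * C"]) (use n C(1) in \<open>auto intro!: mult_mono C(2) simp: norm_mult ne\<close>)
    have "pairint n n' l l' \<eta> - pairint n n' k k' \<xi>
        = (LINT r:cell X|lborel. cnj (orbital X n l r) * orbital X n' l' r * e \<eta> r - cnj (orbital X n k r) * orbital X n' k' r * e \<xi> r)"
      unfolding pairint_def fourier_def e_def[symmetric] by (rule set_integral_diff(2)[OF int int, symmetric])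
    moreover have "norm (LINT r:cell X|lborel. cnj (orbital X n l r) * orbital X n' l' r * e \<eta> r - cnj (orbital X n k r) * orbital X n' k' r * e \<xi> r)
        \<le> (K * S) * vol"
    proof (rule norm_cell_integral)
      fix r assume r: "r \<in> cell X"
      define a a' b b' where "a = cnj (orbital X n l r)" and "a' = cnj (orbital X n k r)"
        and "b = orbital X n' l' r" and "b' = orbital X n' k' r"
      have ab: "norm a \<le> C" "norm a' \<le> C" "norm b \<le> C" "norm b' \<le> C"
        using C(2) n r by (auto simp: a_def a'_def b_def b'_def)
      have da: "norm (a - a') \<le> C * norm (l - k)" "norm (b - b') \<le> C * norm (l' - k')"
        using C(3)[OF n(1) r, of l k] C(3)[OF n(2) r, of l' k'] unfolding a_def a'_def b_def b'_def
        by (simp_all flip: complex_cnj_diff)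
      have de: "norm (e \<eta> r - e \<xi> r) \<le> \<rho> * norm (\<eta> - \<xi>)"
      proof -
        have "norm (e \<eta> r - e \<xi> r) \<le> \<bar>\<eta> \<bullet> r - \<xi> \<bullet> r\<bar>" unfolding e_def by (rule norm_exp_i_diff_le)
        also have "\<dots> \<le> norm (\<eta> - \<xi>) * norm r" using Cauchy_Schwarz_ineq2[of "\<eta> - \<xi>" r] by (simp add: inner_diff_left)
        also have "\<dots> \<le> norm (\<eta> - \<xi>) * \<rho>" using \<rho>(2)[OF r] by (intro mult_left_mono) auto
        finally show ?thesis by (simp add: mult.commute)
      qed
      have "a * b * e \<eta> r - a' * b' * e \<xi> r = (a - a') * b * e \<eta> r + a' * (b - b') * e \<eta> r + a' * b' * (e \<eta> r - e \<xi> r)"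
        by (simp add: algebra_simps)
      then have "norm (a * b * e \<eta> r - a' * b' * e \<xi> r)
          \<le> norm ((a - a') * b * e \<eta> r) + norm (a' * (b - b') * e \<eta> r) + norm (a' * b' * (e \<eta> r - e \<xi> r))"
        by (metis norm_triangle_ineq norm_triangle_mono order_refl)
      also have "\<dots> \<le> (C * norm (l - k)) * C + C * (C * norm (l' - k')) + C * C * (\<rho> * norm (\<eta> - \<xi>))"
        using ab da de C(1) by (auto simp: norm_mult ne intro!: add_mono mult_mono)
      also have "\<dots> = C * C * (1 * norm (l - k) + 1 * norm (l' - k') + \<rho> * norm (\<eta> - \<xi>))" by (simp add: algebra_simps)
      also have "\<dots> \<le> C * C * (max 1 \<rho> * norm (l - k) + max 1 \<rho> * norm (l' - k') + max 1 \<rho> * norm (\<eta> - \<xi>))"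
        using C(1) by (intro mult_left_mono add_mono mult_right_mono) auto
      also have "\<dots> = K * S" by (simp add: K_def S_def algebra_simps)
      finally show "norm (cnj (orbital X n l r) * orbital X n' l' r * e \<eta> r - cnj (orbital X n k r) * orbital X n' k' r * e \<xi> r) \<le> K * S"
        by (simp add: a_def b_def a'_def b'_def)
    qed measurable
    ultimately show "norm (pairint n n' l l' \<eta> - pairint n n' k k' \<xi>)
       \<le> K * vol * (norm (l - k) + norm (l' - k') + norm (\<eta> - \<xi>))"
      by (simp add: S_def mult_ac)
  qed
qed

lemma continuous_pairint:
  fixes f g e :: "'v::topological_space \<Rightarrow> real^3"
  assumes n: "n \<in> bands" "n' \<in> bands"
    and cont: "continuous_on UNIV f" "continuous_on UNIV g" "continuous_on UNIV e"
  shows "continuous_on UNIV (\<lambda>p. pairint n n' (f p) (g p) (e p))"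
  unfolding continuous_on_def
proof
  fix x :: 'v
  obtain K where K: "0 \<le> K" "\<And>k k' \<xi> l l' \<eta>. norm (pairint n n' l l' \<eta> - pairint n n' k k' \<xi>)
     \<le> K * (norm (l - k) + norm (l' - k') + norm (\<eta> - \<xi>))" using pairint_modulus[OF n] by blast
  have t: "(f \<longlongrightarrow> f x) (at x)" "(g \<longlongrightarrow> g x) (at x)" "(e \<longlongrightarrow> e x) (at x)"
    using cont by (auto simp: continuous_on_def)
  have "((\<lambda>y. K * (norm (f y - f x) + norm (g y - g x) + norm (e y - e x))) \<longlongrightarrow>
      K * (norm (f x - f x) + norm (g x - g x) + norm (e x - e x))) (at x)"
    by (intro tendsto_intros t)
  then have "((\<lambda>y. K * (norm (f y - f x) + norm (g y - g x) + norm (e y - e x))) \<longlongrightarrow> 0) (at x)" by simp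
  then have "((\<lambda>y. pairint n n' (f y) (g y) (e y) - pairint n n' (f x) (g x) (e x)) \<longlongrightarrow> 0) (at x)"
    by (rule Lim_null_comparison[rotated]) (use K(2) in \<open>auto intro!: always_eventually\<close>)
  then show "((\<lambda>p. pairint n n' (f p) (g p) (e p)) \<longlongrightarrow> pairint n n' (f x) (g x) (e x)) (at x within UNIV)"
    by (rule LIM_zero_cancel)
qed

text \<open>A limit along a sequence, in contrast to one along the finite subsets, preserves measurability.\<close>

lemma infsum_lattice_limit:
  assumes "(f :: real^3 \<Rightarrow> complex) summable_on rlattice X"
  shows "(\<lambda>N. \<Sum>G\<in>rlattice X \<inter> cball 0 (real N). f G) \<longlonglongrightarrow> infsum f (rlattice X)"
proof -
  have "filterlim (\<lambda>N. rlattice X \<inter> cball 0 (real N)) (finite_subsets_at_top (rlattice X)) sequentially"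
    unfolding filterlim_finite_subsets_at_top
  proof (intro allI impI)
    fix S assume S: "finite S \<and> S \<subseteq> rlattice X"
    obtain N0 :: nat where N0: "Max (insert 0 (norm ` S)) \<le> real N0" using real_arch_simple by blast
    show "\<forall>\<^sub>F N in sequentially. finite (rlattice X \<inter> cball 0 (real N)) \<and> S \<subseteq> rlattice X \<inter> cball 0 (real N) \<and>
        rlattice X \<inter> cball 0 (real N) \<subseteq> rlattice X"
      using eventually_ge_at_top[of N0]
    proof eventually_elim
      case (elim N)
      have "norm x \<le> real N" if "x \<in> S" for x
      proof -
        have "norm x \<le> Max (insert 0 (norm ` S))" using S that by (intro Max_ge) auto
        then show ?thesis using N0 elim by (simp add: order_trans)
      qed
      then show ?case using S BZ.discrete by auto
    qed
  qed
  moreover have "(sum f \<longlongrightarrow> infsum f (rlattice X)) (finite_subsets_at_top (rlattice X))"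
    using has_sum_infsum[OF assms] by (simp add: has_sum_def)
  ultimately show ?thesis by (rule filterlim_compose[rotated])
qed

lemma eri_measurable:
  fixes f1 f2 f3 f4 :: "'v::second_countable_topology \<Rightarrow> real^3"
  assumes n: "n1 \<in> bands" "n2 \<in> bands" "n3 \<in> bands" "n4 \<in> bands"
    and cont: "continuous_on UNIV f1" "continuous_on UNIV f2" "continuous_on UNIV f3"
  shows "(\<lambda>p. eri X (n1, f1 p) (n2, f2 p) (n3, f3 p) (n4, f4 p)) \<in> borel_measurable borel"
  unfolding eri_eq_sum
proof (intro borel_measurable_times borel_measurable_const)
  have "(\<lambda>p. pairint n1 n3 (f1 p) (f3 p) (f3 p - f1 p + G)) \<in> borel_measurable borel"
    "(\<lambda>p. pairint n2 n4 (f2 p) (f2 p - (f3 p - f1 p)) (- (f3 p - f1 p + G))) \<in> borel_measurable borel" for G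
    by (intro borel_measurable_continuous_onI continuous_pairint n continuous_intros cont)+
  moreover have "(\<lambda>p. norm (f3 p - f1 p + G)) \<in> borel_measurable borel" for G
    by (intro borel_measurable_continuous_onI continuous_intros cont)
  ultimately have "(\<lambda>p. \<Sum>G\<in>rlattice X \<inter> cball 0 (real N). eri_term n1 n2 n3 n4 (f1 p) (f2 p) (f3 p) G) \<in> borel_measurable borel" for N
    unfolding eri_term_def by measurable
  then show "(\<lambda>p. \<Sum>\<^sub>\<infinity>G\<in>rlattice X. eri_term n1 n2 n3 n4 (f1 p) (f2 p) (f3 p) G) \<in> borel_measurable borel"
    by (rule borel_measurable_LIMSEQ_metric) (rule infsum_lattice_limit[OF eri_summable[OF n]])
qed

text \<open>A translation of the momenta changes the momentum transfer by a lattice vector, which the sum over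
\<open>G\<close> absorbs.\<close>

lemma eri_periodic:
  assumes n: "n1 \<in> bands" "n2 \<in> bands" "n3 \<in> bands" "n4 \<in> bands"
    and G: "G1 \<in> rlattice X" "G2 \<in> rlattice X" "G3 \<in> rlattice X"
  shows "eri X (n1, k1 + G1) (n2, k2 + G2) (n3, k3 + G3) (n4, k4') = eri X (n1, k1) (n2, k2) (n3, k3) (n4, k4)"
proof -
  define H where "H = G3 - G1"
  have H: "H \<in> rlattice X" unfolding H_def using G by (intro BZ.diff_in)
  have "eri_term n1 n2 n3 n4 (k1 + G1) (k2 + G2) (k3 + G3) G = eri_term n1 n2 n3 n4 k1 k2 k3 (G + H)" for G
  proof -
    have e: "k3 + G3 - (k1 + G1) + G = k3 - k1 + (G + H)"
      "k2 + G2 - (k3 + G3 - (k1 + G1)) = k2 - (k3 - k1) + (G2 - H)"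
      by (simp_all add: H_def algebra_simps)
    have "G2 - H \<in> rlattice X" using G H BZ.diff_in by blast
    then show ?thesis unfolding eri_term_def e
      by (simp add: pairint_periodic1 pairint_periodic2 n G)
  qed
  then have "(\<Sum>\<^sub>\<infinity>G\<in>rlattice X. eri_term n1 n2 n3 n4 (k1 + G1) (k2 + G2) (k3 + G3) G)
      = (\<Sum>\<^sub>\<infinity>G\<in>rlattice X. eri_term n1 n2 n3 n4 k1 k2 k3 (G + H))" by simp
  also have "\<dots> = (\<Sum>\<^sub>\<infinity>G\<in>rlattice X. eri_term n1 n2 n3 n4 k1 k2 k3 G)"
  proof (rule infsum_reindex_bij_betw)
    show "bij_betw (\<lambda>G. G + H) (rlattice X) (rlattice X)"
      by (rule bij_betw_byWitness[where f' = "\<lambda>G. G - H"]) (use H BZ.add_in BZ.diff_in in auto)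
  qed
  finally show ?thesis unfolding eri_eq_sum by simp
qed

end

section \<open>Energy denominators\<close>

lemma smooth_continuous: "smooth f \<Longrightarrow> continuous_on UNIV (iter_deriv vs f)"
  unfolding smooth_def continuous_on_eq_continuous_at[OF open_UNIV]
  using differentiable_imp_continuous_within by blast

context insulator
begin

lemma energy_continuous: "n \<in> bands \<Longrightarrow> continuous_on UNIV (energy X n)"
  using smooth_continuous[OF energy_smooth, of n "[]"] by simp

lemma energy_periodic_diff: "n \<in> bands \<Longrightarrow> G \<in> rlattice X \<Longrightarrow> energy X n (k - G) = energy X n k"
  using energy_periodic[of n "- G" k] BZ.neg_in by simp

text \<open>As for orbitals, but the bounds on the derivatives come from compactness.\<close>

lemma energy_steps:
  assumes n: "n \<in> bands"
  shows "\<exists>C\<ge>0. \<forall>k N. 0 < N \<longrightarrow> dbound m (\<lambda>j. energy X n (k + (real j / real N) *\<^sub>R u)) C (1 / real N)"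
proof -
  obtain \<rho> where \<rho>: "0 < \<rho>" "\<And>k. k \<in> bz X \<Longrightarrow> norm k \<le> \<rho>" using radius by blast
  define \<rho>' where "\<rho>' = \<rho> + real m * norm u"
  have "\<exists>C\<ge>0. \<forall>i\<in>{..m}. \<forall>k\<in>cball 0 \<rho>'. norm (iter_deriv (replicate i u) (energy X n) k) \<le> C"
  proof (rule uniform_bound)
    fix i
    have "compact (iter_deriv (replicate i u) (energy X n) ` cball 0 \<rho>')"
      using smooth_continuous[OF energy_smooth[OF n]]
      by (intro compact_continuous_image compact_cball) (auto intro: continuous_on_subset)
    then show "\<exists>C. \<forall>k\<in>cball 0 \<rho>'. norm (iter_deriv (replicate i u) (energy X n) k) \<le> C"
      by (auto dest!: compact_imp_bounded simp: bounded_iff)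
  qed (auto intro: order_trans)
  then obtain C where C: "0 \<le> C" "\<And>i k. i \<le> m \<Longrightarrow> norm k \<le> \<rho>' \<Longrightarrow> norm (iter_deriv (replicate i u) (energy X n) k) \<le> C"
    by auto
  have "dbound m (\<lambda>j. energy X n (k + (real j / real N) *\<^sub>R u)) C (1 / real N)" if N: "0 < N" for k N
  proof -
    define h where "h = 1 / real N"
    have h: "0 < h" "h \<le> 1" using N by (auto simp: h_def)
    define k0 where "k0 = k - BZ.rep k"
    have k0: "norm k0 \<le> \<rho>" unfolding k0_def by (intro \<rho> BZ.rep_cell)
    define G where "G i t = iter_deriv (replicate i u) (energy X n) (k0 + t *\<^sub>R u)" for i t
    have "dbound m (\<lambda>j. G 0 (real j * h)) C h"
    proof (rule dbound_smooth)
      show "(G i has_vector_derivative G (Suc i) t) (at t)" for i t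
        unfolding G_def using energy_smooth[OF n] by (rule smooth_line_derivative)
      show "norm (G i t) \<le> C" if "i \<le> m" "0 \<le> t" "t \<le> real m * h" for i t
        unfolding G_def
      proof (rule C(2)[OF that(1)])
        have "t \<le> real m" using that h mult_left_mono[of h 1 "real m"] by simp
        then have "norm (t *\<^sub>R u) \<le> real m * norm u" using that by (simp add: mult_right_mono)
        then show "norm (k0 + t *\<^sub>R u) \<le> \<rho>'"
          using k0 norm_triangle_ineq[of k0 "t *\<^sub>R u"] by (simp add: \<rho>'_def)
      qed
    qed (use h in auto)
    moreover have "G 0 (real j * h) = energy X n (k + (real j / real N) *\<^sub>R u)" for j
      using energy_periodic_diff[OF n BZ.rep_in, of "k + (real j * h) *\<^sub>R u" k]
      by (simp add: G_def k0_def h_def algebra_simps)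
    ultimately show ?thesis by (simp add: h_def)
  qed
  then show ?thesis using C(1) by blast
qed

lemma occ_band: "n \<in> occ X \<Longrightarrow> n \<in> bands" and vir_band: "n \<in> vir X \<Longrightarrow> n \<in> bands"
  by (auto simp: bands_def)

lemma occ_vir_distinct: "i \<in> occ X \<Longrightarrow> a \<in> vir X \<Longrightarrow> i \<noteq> a"
  by (auto simp: occ_def vir_def)

text \<open>The denominator is continuous, periodic and never 0, and balls are compact.\<close>

lemma denom_lower:
  assumes "i \<in> occ X" "j \<in> occ X" "a \<in> vir X" "b \<in> vir X"
  shows "\<exists>c>0. \<forall>k1 k2 k3. c \<le> \<bar>denom X (i, k1) (j, k2) (a, k3) (b, k1 + k2 - k3)\<bar>"
proof -
  note bd = occ_band[OF assms(1)] occ_band[OF assms(2)] vir_band[OF assms(3)] vir_band[OF assms(4)]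
  obtain \<rho> where \<rho>: "0 < \<rho>" "\<And>k. k \<in> bz X \<Longrightarrow> norm k \<le> \<rho>" using radius by blast
  define g where "g p = (case p of (k1, k2, k3) \<Rightarrow> \<bar>denom X (i, k1) (j, k2) (a, k3) (b, k1 + k2 - k3)\<bar>)"
    for p :: "(real^3) \<times> (real^3) \<times> (real^3)"
  define S where "S = cball (0 :: real^3) \<rho> \<times> cball (0 :: real^3) \<rho> \<times> cball (0 :: real^3) \<rho>"
  have e: "continuous_on S (\<lambda>p. energy X n (f p))" if "n \<in> bands" "continuous_on S f" for n f
    using continuous_on_compose2[OF energy_continuous[OF that(1)] that(2)] by simp
  have "continuous_on S g"
    unfolding g_def denom_def orb_energy_def case_prod_beta fst_conv snd_conv
    by (intro continuous_intros e bd)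
  moreover have "compact S" unfolding S_def by (intro compact_Times compact_cball)
  moreover have "S \<noteq> {}" using \<rho>(1) by (auto simp: S_def intro!: exI[of _ 0])
  ultimately obtain x where x: "x \<in> S" "\<And>y. y \<in> S \<Longrightarrow> g x \<le> g y"
    using continuous_attains_inf by metis
  have nz: "0 < g p" for p
  proof -
    obtain k1 k2 k3 where p: "p = (k1, k2, k3)" by (cases p)
    have "k1 + k2 - k3 - (k1 + k2 - k3) \<in> rlattice X" using BZ.zero_in by simp
    then have "denom X (i, k1) (j, k2) (a, k3) (b, k1 + k2 - k3) \<noteq> 0"
      using insulating assms unfolding insulating_system_def by blast
    then show ?thesis by (simp add: g_def p)
  qed
  have "g x \<le> \<bar>denom X (i, k1) (j, k2) (a, k3) (b, k1 + k2 - k3)\<bar>" for k1 k2 k3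
  proof -
    define l1 l2 l3 where "l1 = k1 - BZ.rep k1" and "l2 = k2 - BZ.rep k2" and "l3 = k3 - BZ.rep k3"
    have "(l1, l2, l3) \<in> S" unfolding S_def l1_def l2_def l3_def using \<rho>(2) BZ.rep_cell by auto
    then have "g x \<le> g (l1, l2, l3)" by (rule x(2))
    have "l1 + l2 - l3 = k1 + k2 - k3 - (BZ.rep k1 + BZ.rep k2 - BZ.rep k3)"
      by (simp add: l1_def l2_def l3_def)
    moreover have "BZ.rep k1 + BZ.rep k2 - BZ.rep k3 \<in> rlattice X"
      by (intro BZ.diff_in BZ.add_in BZ.rep_in)
    ultimately have "energy X b (l1 + l2 - l3) = energy X b (k1 + k2 - k3)"
      by (simp only: energy_periodic_diff[OF bd(4)])
    moreover have "energy X i l1 = energy X i k1" "energy X j l2 = energy X j k2" "energy X a l3 = energy X a k3"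
      unfolding l1_def l2_def l3_def using energy_periodic_diff bd BZ.rep_in by blast+
    ultimately show ?thesis using \<open>g x \<le> g (l1, l2, l3)\<close>
      by (simp add: g_def denom_def orb_energy_def)
  qed
  then show ?thesis using nz by blast
qed

end

section \<open>Momenta and their transfers\<close>

text \<open>The external momenta \<open>k\<^sub>i\<close>, \<open>k\<^sub>j\<close>, \<open>k\<^sub>a\<close> and the free intermediate momentum \<open>k\<close>. The latter is a factor of
its own, because it is averaged over first.\<close>

type_synonym mom4 = "((real^3) \<times> (real^3) \<times> (real^3)) \<times> (real^3)"

context insulator
begin

definition lattice4 :: "mom4 set" where
  "lattice4 = (rlattice X \<times> rlattice X \<times> rlattice X) \<times> rlattice X"

definition cell4 :: "mom4 set" where "cell4 = (bz X \<times> bz X \<times> bz X) \<times> bz X"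

lemma VV_cell: "lattice_cell lattice4 cell4"
  unfolding lattice4_def cell4_def by (intro lattice_cell_Times BZ_cell)

end

sublocale insulator \<subseteq> VV: lattice_cell "insulator.lattice4 X" "insulator.cell4 X"
  by (rule VV_cell)

definition kI :: "mom4 \<Rightarrow> real^3" where "kI p = fst (fst p)"
definition kJ :: "mom4 \<Rightarrow> real^3" where "kJ p = fst (snd (fst p))"
definition kA :: "mom4 \<Rightarrow> real^3" where "kA p = snd (snd (fst p))"
definition kK :: "mom4 \<Rightarrow> real^3" where "kK p = snd p"

lemmas mom_defs = kI_def kJ_def kA_def kK_def

text \<open>The momentum transfers, up to sign, of the electron repulsion integrals which may be unbounded
at lattice vectors.\<close>

definition poles :: "(mom4 \<Rightarrow> real^3) set" where
  "poles = {\<lambda>p. kK p - kI p, \<lambda>p. kK p - kJ p, \<lambda>p. kK p - kA p}"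

text \<open>Those of all electron repulsion integrals in the two energies: the three additional ones occur only
where the integral is bounded, but not continuous.\<close>

definition transfers :: "(mom4 \<Rightarrow> real^3) set" where
  "transfers = poles \<union> {\<lambda>p. kA p - kI p, \<lambda>p. kJ p - kA p, \<lambda>p. kK p + kA p - kI p - kJ p}"

lemma finite_transfers: "finite transfers" "finite poles" and poles_sub: "poles \<subseteq> transfers"
  by (auto simp: transfers_def poles_def)

context insulator
begin

definition mom_map :: "(mom4 \<Rightarrow> real^3) \<Rightarrow> bool" where
  "mom_map f \<longleftrightarrow> linear f \<and> (\<forall>G\<in>lattice4. f G \<in> rlattice X)"

lemma mom_map_basic: "mom_map kI" "mom_map kJ" "mom_map kA" "mom_map kK"
  unfolding mom_map_def mom_defs lattice4_def
  by (auto intro!: linearI)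

lemma mom_map_add: "mom_map f \<Longrightarrow> mom_map g \<Longrightarrow> mom_map (\<lambda>p. f p + g p)"
  and mom_map_diff: "mom_map f \<Longrightarrow> mom_map g \<Longrightarrow> mom_map (\<lambda>p. f p - g p)"
  unfolding mom_map_def using linear_compose_add linear_compose_sub BZ.add_in BZ.diff_in by blast+

lemmas mom_map_intros = mom_map_basic mom_map_add mom_map_diff

lemma mom_map_transfers: "Q \<in> transfers \<Longrightarrow> mom_map Q"
  unfolding transfers_def poles_def by (auto intro!: mom_map_intros)

lemma mom_map_continuous: "mom_map f \<Longrightarrow> continuous_on UNIV f"
  unfolding mom_map_def by (simp add: linear_continuous_on linear_linear)

lemma mom_map_line: "mom_map f \<Longrightarrow> f (p + t *\<^sub>R u) = f p + t *\<^sub>R f u"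
  unfolding mom_map_def by (simp add: linear_add linear_scale)

lemma mom_map_plus: "mom_map f \<Longrightarrow> f (p + u) = f p + f u"
  unfolding mom_map_def by (simp add: linear_add)

lemma mom_map_lattice: "mom_map f \<Longrightarrow> G \<in> lattice4 \<Longrightarrow> f G \<in> rlattice X"
  unfolding mom_map_def by blast

lemma mom_map_bound: "mom_map f \<Longrightarrow> \<exists>B>0. \<forall>v. norm (f v) \<le> B * norm v"
  unfolding mom_map_def using linear_bounded_pos by metis

text \<open>Dominates, up to a constant, a product with one unbounded electron repulsion integral; finite everywhere, as \<open>1 / 0 = 0\<close>.\<close>

definition weight :: "mom4 \<Rightarrow> real" where
  "weight p = 1 + (\<Sum>Q\<in>poles. 1 / (BZ.ldist (Q p))\<^sup>2)"

text \<open>The quotient \<open>h / max h d\<close> of the step \<open>h = 1 / N\<close> and the distance \<open>d\<close> from the singularities.\<close>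

definition proximity :: "nat \<Rightarrow> mom4 \<Rightarrow> real" where
  "proximity N p = (MAX Q\<in>transfers. 1 / real N / max (1 / real N) (BZ.ldist (Q p)))"

lemma weight_ge_1: "1 \<le> weight p"
  unfolding weight_def by (simp add: sum_nonneg)

lemma weight_pole: "Q \<in> poles \<Longrightarrow> 1 + 1 / (BZ.ldist (Q p))\<^sup>2 \<le> weight p"
  unfolding weight_def using finite_transfers(2)
  by (intro add_left_mono member_le_sum) auto

lemma proximity_transfer: "Q \<in> transfers \<Longrightarrow> 1 / real N / max (1 / real N) (BZ.ldist (Q p)) \<le> proximity N p"
  unfolding proximity_def using finite_transfers by (intro Max_ge) auto

section \<open>Tame functions\<close>

text \<open>The momentum transfers of \<open>p\<close> lie on a mesh through 0. This holds at points of a product of four equal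
meshes with any offset, because transfers of the offset vanish.\<close>

abbreviation on_mesh :: "nat \<Rightarrow> mom4 \<Rightarrow> bool" where
  "on_mesh N p \<equiv> \<forall>Q\<in>transfers. real N *\<^sub>R Q p \<in> rlattice X"

text \<open>Functions with singularities of order \<open>\<gamma>\<close>, that is, of size \<open>weight ^ \<gamma>\<close>, which are regular in the sense of
differences. The directions \<open>u\<close> are lattice vectors because \<open>gavg_halve\<close> compares a mesh with its
translates by such vectors divided by \<open>2 n\<close>. Orders add up in products, and \<open>(N\<^sup>2) ^ \<gamma>\<close> is the size of
\<open>weight ^ \<gamma>\<close> on a mesh.\<close>

definition tame :: "nat \<Rightarrow> (mom4 \<Rightarrow> complex) \<Rightarrow> bool" where
  "tame \<gamma> P \<longleftrightarrow>
     VV.periodic P \<and> P \<in> borel_measurable borel \<and>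
     (\<forall>p. (\<forall>Q\<in>transfers. Q p \<notin> rlattice X) \<longrightarrow> isCont P p) \<and>
     (\<exists>C\<ge>0. \<forall>p. norm (P p) \<le> C * weight p ^ \<gamma>) \<and>
     (\<forall>u\<in>lattice4. \<exists>C\<ge>0. \<forall>N p. 0 < N \<longrightarrow> on_mesh N p \<longrightarrow>
        dbound 6 (\<lambda>j. P (p + (real j / real N) *\<^sub>R u)) (C * ((real N)\<^sup>2) ^ \<gamma>) (proximity N p))"

lemma proximity_nonneg: "0 \<le> proximity N p"
proof -
  obtain Q where "Q \<in> transfers" by (auto simp: transfers_def)
  have "0 \<le> 1 / real N / max (1 / real N) (BZ.ldist (Q p))" by (simp add: le_max_iff_disj)
  then show ?thesis using proximity_transfer[OF \<open>Q \<in> transfers\<close>, of N p] by linarith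
qed

lemma tame_measurable: "tame \<gamma> P \<Longrightarrow> P \<in> borel_measurable borel"
  and tame_periodic: "tame \<gamma> P \<Longrightarrow> VV.periodic P"
  and tame_isCont: "tame \<gamma> P \<Longrightarrow> (\<And>Q. Q \<in> transfers \<Longrightarrow> Q p \<notin> rlattice X) \<Longrightarrow> isCont P p"
  and tame_size: "tame \<gamma> P \<Longrightarrow> \<exists>C\<ge>0. \<forall>p. norm (P p) \<le> C * weight p ^ \<gamma>"
  unfolding tame_def by blast+

lemma tame_weight:
  assumes P: "tame \<gamma> P" and \<gamma>: "\<gamma> \<le> 1"
  shows "\<exists>C\<ge>0. \<forall>p. norm (P p) \<le> C * weight p"
proof -
  obtain C where C: "0 \<le> C" "\<And>p. norm (P p) \<le> C * weight p ^ \<gamma>" using tame_size[OF P] by blast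
  have CP: "norm (P p) \<le> C * weight p" for p
  proof -
    have "weight p ^ \<gamma> \<le> weight p ^ 1" using \<gamma> weight_ge_1[of p] by (intro power_increasing) auto
    then show ?thesis using C(2)[of p] mult_left_mono[OF _ C(1), of "weight p ^ \<gamma>" "weight p"] by simp
  qed
  then show ?thesis using C(1) by blast
qed

lemma tame_mult:
  assumes "tame \<gamma> P" "tame \<gamma>' R" shows "tame (\<gamma> + \<gamma>') (\<lambda>p. P p * R p)"
  unfolding tame_def
proof (intro conjI allI impI ballI)
  show "VV.periodic (\<lambda>p. P p * R p)" using assms by (simp add: tame_def VV.periodic_def)
  show "(\<lambda>p. P p * R p) \<in> borel_measurable borel"
    using assms unfolding tame_def by (intro borel_measurable_times) blast+
  show "isCont (\<lambda>p. P p * R p) p" if "\<forall>Q\<in>transfers. Q p \<notin> rlattice X" for p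
    using tame_isCont[OF assms(1), of p] tame_isCont[OF assms(2), of p] that by (intro continuous_mult) auto
  obtain C C' where C: "0 \<le> C" "\<And>p. norm (P p) \<le> C * weight p ^ \<gamma>" "0 \<le> C'" "\<And>p. norm (R p) \<le> C' * weight p ^ \<gamma>'"
    using assms unfolding tame_def by blast
  have "norm (P p * R p) \<le> (C * C') * weight p ^ (\<gamma> + \<gamma>')" for p
  proof -
    have "norm (P p) * norm (R p) \<le> (C * weight p ^ \<gamma>) * (C' * weight p ^ \<gamma>')"
      using C weight_ge_1[of p] by (intro mult_mono) auto
    then show ?thesis by (simp add: norm_mult power_add mult_ac)
  qed
  then show "\<exists>C\<ge>0. \<forall>p. norm (P p * R p) \<le> C * weight p ^ (\<gamma> + \<gamma>')" using C by (meson mult_nonneg_nonneg)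
  fix u assume u: "u \<in> lattice4"
  obtain D where D: "0 \<le> D" "\<And>N p. 0 < N \<Longrightarrow> on_mesh N p \<Longrightarrow>
        dbound 6 (\<lambda>j. P (p + (real j / real N) *\<^sub>R u)) (D * ((real N)\<^sup>2) ^ \<gamma>) (proximity N p)"
    using assms(1) u unfolding tame_def by blast
  obtain D' where D': "0 \<le> D'" "\<And>N p. 0 < N \<Longrightarrow> on_mesh N p \<Longrightarrow>
        dbound 6 (\<lambda>j. R (p + (real j / real N) *\<^sub>R u)) (D' * ((real N)\<^sup>2) ^ \<gamma>') (proximity N p)"
    using assms(2) u unfolding tame_def by blast
  show "\<exists>C\<ge>0. \<forall>N p. 0 < N \<longrightarrow> on_mesh N p \<longrightarrow>
        dbound 6 (\<lambda>j. P (p + (real j / real N) *\<^sub>R u) * R (p + (real j / real N) *\<^sub>R u))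
          (C * ((real N)\<^sup>2) ^ (\<gamma> + \<gamma>')) (proximity N p)"
  proof (intro exI[of _ "2 ^ 6 * D * D'"] conjI allI impI)
    show "0 \<le> 2 ^ 6 * D * D'" using D D' by simp
    fix N :: nat and p :: mom4
    assume "0 < N" "on_mesh N p"
    from dbound_mult[OF D(2)[OF this] D'(2)[OF this] proximity_nonneg]
    show "dbound 6 (\<lambda>j. P (p + (real j / real N) *\<^sub>R u) * R (p + (real j / real N) *\<^sub>R u))
          (2 ^ 6 * D * D' * ((real N)\<^sup>2) ^ (\<gamma> + \<gamma>')) (proximity N p)"
      by (simp add: power_add mult_ac)
  qed
qed

lemma tame_add:
  assumes "tame \<gamma> P" "tame \<gamma> R" shows "tame \<gamma> (\<lambda>p. P p + R p)"
  unfolding tame_def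
proof (intro conjI allI impI ballI)
  show "VV.periodic (\<lambda>p. P p + R p)" using assms by (simp add: tame_def VV.periodic_def)
  show "(\<lambda>p. P p + R p) \<in> borel_measurable borel"
    using assms unfolding tame_def by (intro borel_measurable_add) blast+
  show "isCont (\<lambda>p. P p + R p) p" if "\<forall>Q\<in>transfers. Q p \<notin> rlattice X" for p
    using tame_isCont[OF assms(1), of p] tame_isCont[OF assms(2), of p] that by (intro continuous_add) auto
  obtain C C' where C: "0 \<le> C" "\<And>p. norm (P p) \<le> C * weight p ^ \<gamma>" "0 \<le> C'" "\<And>p. norm (R p) \<le> C' * weight p ^ \<gamma>"
    using assms unfolding tame_def by blast
  have "norm (P p + R p) \<le> (C + C') * weight p ^ \<gamma>" for p
    unfolding distrib_right by (rule norm_triangle_mono[OF C(2,4)])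
  then show "\<exists>C\<ge>0. \<forall>p. norm (P p + R p) \<le> C * weight p ^ \<gamma>" using C(1,3) by (meson add_nonneg_nonneg)
  fix u assume u: "u \<in> lattice4"
  obtain D where D: "0 \<le> D" "\<And>N p. 0 < N \<Longrightarrow> on_mesh N p \<Longrightarrow>
        dbound 6 (\<lambda>j. P (p + (real j / real N) *\<^sub>R u)) (D * ((real N)\<^sup>2) ^ \<gamma>) (proximity N p)"
    using assms(1) u unfolding tame_def by blast
  obtain D' where D': "0 \<le> D'" "\<And>N p. 0 < N \<Longrightarrow> on_mesh N p \<Longrightarrow>
        dbound 6 (\<lambda>j. R (p + (real j / real N) *\<^sub>R u)) (D' * ((real N)\<^sup>2) ^ \<gamma>) (proximity N p)"
    using assms(2) u unfolding tame_def by blast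
  show "\<exists>C\<ge>0. \<forall>N p. 0 < N \<longrightarrow> on_mesh N p \<longrightarrow>
        dbound 6 (\<lambda>j. P (p + (real j / real N) *\<^sub>R u) + R (p + (real j / real N) *\<^sub>R u))
          (C * ((real N)\<^sup>2) ^ \<gamma>) (proximity N p)"
  proof (intro exI[of _ "D + D'"] conjI allI impI)
    show "0 \<le> D + D'" using D D' by simp
    fix N :: nat and p :: mom4
    assume "0 < N" "on_mesh N p"
    from dbound_add[OF D(2)[OF this] D'(2)[OF this]]
    show "dbound 6 (\<lambda>j. P (p + (real j / real N) *\<^sub>R u) + R (p + (real j / real N) *\<^sub>R u))
          ((D + D') * ((real N)\<^sup>2) ^ \<gamma>) (proximity N p)"
      by (simp add: distrib_right)
  qed
qed

lemma tame_const: "tame 0 (\<lambda>_. c)"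
  unfolding tame_def
  by (auto simp: VV.periodic_def intro!: exI[of _ "norm c"] dbound_const proximity_nonneg)

text \<open>Multiplication with 1, which is tame of every order.\<close>

lemma tame_mono:
  assumes "tame \<gamma> P" "\<gamma> \<le> \<gamma>'" shows "tame \<gamma>' P"
proof -
  have one: "tame \<gamma>'' (\<lambda>_. 1)" for \<gamma>''
    unfolding tame_def
  proof (intro conjI allI impI ballI)
    show "\<exists>C\<ge>0. \<forall>p. norm (1 :: complex) \<le> C * weight p ^ \<gamma>''"
      using weight_ge_1 by (intro exI[of _ 1]) (auto intro: one_le_power)
    show "\<exists>C\<ge>0. \<forall>N p. 0 < N \<longrightarrow> on_mesh N p \<longrightarrow>
        dbound 6 (\<lambda>j. 1 :: complex) (C * ((real N)\<^sup>2) ^ \<gamma>'') (proximity N p)"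
      by (intro exI[of _ 1]) (auto intro!: dbound_const proximity_nonneg one_le_power)
  qed (auto simp: VV.periodic_def)
  show ?thesis using tame_mult[OF assms(1) one[of "\<gamma>' - \<gamma>"]] assms(2) by simp
qed

lemma tame_sum: "(\<And>x. x \<in> S \<Longrightarrow> tame \<gamma> (P x)) \<Longrightarrow> tame \<gamma> (\<lambda>p. \<Sum>x\<in>S. P x p)"
proof (induction S rule: infinite_finite_induct)
  case (insert x S)
  then show ?case using tame_add[of \<gamma> "P x" "\<lambda>p. \<Sum>x\<in>S. P x p"] by simp
qed (use tame_mono[OF tame_const] in auto)

lemma tame_cmult: "tame \<gamma> P \<Longrightarrow> tame \<gamma> (\<lambda>p. c * P p)"
  using tame_mult[OF tame_const, of \<gamma> P c] by simp

lemma tame_diff: "tame \<gamma> P \<Longrightarrow> tame \<gamma> R \<Longrightarrow> tame \<gamma> (\<lambda>p. P p - R p)"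
  using tame_add[of \<gamma> P "\<lambda>p. - 1 * R p"] tame_cmult[of \<gamma> R "- 1"] by simp

lemma tame_eri:
  assumes n: "n1 \<in> bands" "n2 \<in> bands" "n3 \<in> bands" "n4 \<in> bands"
    and \<gamma>: "\<gamma> \<le> 1" "\<gamma> = 0 \<Longrightarrow> n1 \<noteq> n3 \<and> n2 \<noteq> n4"
    and f: "mom_map f1" "mom_map f2" "mom_map f3"
    and Q: "Q \<in> transfers" "\<gamma> = 1 \<Longrightarrow> Q \<in> poles"
    and q: "(\<forall>p. f3 p - f1 p = Q p) \<or> (\<forall>p. f3 p - f1 p = - Q p)"
  shows "tame \<gamma> (\<lambda>p. eri X (n1, f1 p) (n2, f2 p) (n3, f3 p) (n4, f4 p))"
proof -
  have qd: "BZ.ldist (f3 p - f1 p) = BZ.ldist (Q p)" for p using q BZ.ldist_uminus by metis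
  have qL: "t *\<^sub>R (f3 p - f1 p) \<in> rlattice X \<longleftrightarrow> t *\<^sub>R Q p \<in> rlattice X" for t p
    using q BZ.neg_in_iff[of "t *\<^sub>R Q p"] by (metis scaleR_minus_right)
  show ?thesis
    unfolding tame_def
  proof (intro conjI allI impI ballI)
    show "VV.periodic (\<lambda>p. eri X (n1, f1 p) (n2, f2 p) (n3, f3 p) (n4, f4 p))"
      unfolding VV.periodic_def by (simp add: mom_map_plus f mom_map_lattice eri_periodic[OF n])
    show "(\<lambda>p. eri X (n1, f1 p) (n2, f2 p) (n3, f3 p) (n4, f4 p)) \<in> borel_measurable borel"
      by (intro eri_measurable n mom_map_continuous f)
    show "\<exists>C\<ge>0. \<forall>p. norm (eri X (n1, f1 p) (n2, f2 p) (n3, f3 p) (n4, f4 p)) \<le> C * weight p ^ \<gamma>"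
    proof -
      obtain K where K: "0 \<le> K" "\<And>k1 k2 k3 k4. norm (eri X (n1, k1) (n2, k2) (n3, k3) (n4, k4))
        \<le> K * (1 + 1 / (BZ.ldist (k3 - k1))\<^sup>2) ^ \<gamma>" using eri_size[OF n \<gamma>] by blast
      have "(1 + 1 / (BZ.ldist (Q p))\<^sup>2) ^ \<gamma> \<le> weight p ^ \<gamma>" for p
      proof (cases "\<gamma> = 0")
        case False
        then have "\<gamma> = 1" using \<gamma>(1) by simp
        then show ?thesis using weight_pole[OF Q(2), of p] by simp
      qed simp
      then have "norm (eri X (n1, f1 p) (n2, f2 p) (n3, f3 p) (n4, f4 p)) \<le> K * weight p ^ \<gamma>" for p
        using K(2)[of "f1 p" "f2 p" "f3 p" "f4 p"] mult_left_mono[OF _ K(1)] order_trans unfolding qd by blast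
      then show ?thesis using K(1) by blast
    qed
    show "\<exists>C\<ge>0. \<forall>N p. 0 < N \<longrightarrow> on_mesh N p \<longrightarrow>
        dbound 6 (\<lambda>j. eri X (n1, f1 (p + (real j / real N) *\<^sub>R u)) (n2, f2 (p + (real j / real N) *\<^sub>R u))
          (n3, f3 (p + (real j / real N) *\<^sub>R u)) (n4, f4 (p + (real j / real N) *\<^sub>R u)))
          (C * ((real N)\<^sup>2) ^ \<gamma>) (proximity N p)" if u: "u \<in> lattice4" for u
    proof -
      obtain K where K: "0 \<le> K" "\<And>N k1 k2 k3 k4. 0 < N \<Longrightarrow> real N *\<^sub>R (k3 - k1) \<in> rlattice X \<Longrightarrow>
        dbound 6 (\<lambda>j. eri X (n1, k1 + (real j / real N) *\<^sub>R f1 u) (n2, k2 + (real j / real N) *\<^sub>R f2 u)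
          (n3, k3 + (real j / real N) *\<^sub>R f3 u) (n4, k4 j))
        (K * ((real N)\<^sup>2) ^ \<gamma>) (1 / real N / max (1 / real N) (BZ.ldist (k3 - k1)))"
        using eri_lattice_steps[OF n \<gamma> mom_map_lattice[OF f(1) u] mom_map_lattice[OF f(3) u], of 6 "f2 u"] by blast
      show ?thesis
      proof (intro exI[of _ K] conjI allI impI K(1))
        fix N :: nat and p assume N: "0 < N" and lat: "on_mesh N p"
        have "real N *\<^sub>R (f3 p - f1 p) \<in> rlattice X" unfolding qL using lat Q(1) by blast
        from K(2)[OF N this, of "f2 p" "\<lambda>j. f4 (p + (real j / real N) *\<^sub>R u)"]
        show "dbound 6 (\<lambda>j. eri X (n1, f1 (p + (real j / real N) *\<^sub>R u)) (n2, f2 (p + (real j / real N) *\<^sub>R u))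
          (n3, f3 (p + (real j / real N) *\<^sub>R u)) (n4, f4 (p + (real j / real N) *\<^sub>R u)))
          (K * ((real N)\<^sup>2) ^ \<gamma>) (proximity N p)"
          unfolding mom_map_line[OF f(1)] mom_map_line[OF f(2)] mom_map_line[OF f(3)] qd
          by (rule dbound_mono) (use proximity_transfer[OF Q(1)] in \<open>auto simp: le_max_iff_disj\<close>)
      qed
    qed
    show "isCont (\<lambda>p. eri X (n1, f1 p) (n2, f2 p) (n3, f3 p) (n4, f4 p)) p"
      if p: "\<forall>Q\<in>transfers. Q p \<notin> rlattice X" for p
    proof -
      obtain K where K: "0 \<le> K" "\<And>h k1 k2 k3 v1 v2 v3 k4 k4'. 0 < h \<Longrightarrow> norm v1 \<le> h \<Longrightarrow> norm v2 \<le> h \<Longrightarrow> norm v3 \<le> h \<Longrightarrow>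
        5 * h \<le> BZ.ldist (k3 - k1) \<Longrightarrow>
        norm (eri X (n1, k1 + v1) (n2, k2 + v2) (n3, k3 + v3) (n4, k4') - eri X (n1, k1) (n2, k2) (n3, k3) (n4, k4))
        \<le> K * (1 / (BZ.ldist (k3 - k1))\<^sup>2) * (h / BZ.ldist (k3 - k1))"
        using eri_modulus[OF n] by blast
      obtain B1 B2 B3 where B: "0 < B1" "\<And>v. norm (f1 v) \<le> B1 * norm v" "0 < B2" "\<And>v. norm (f2 v) \<le> B2 * norm v"
        "0 < B3" "\<And>v. norm (f3 v) \<le> B3 * norm v" using f mom_map_bound by metis
      define B where "B = B1 + B2 + B3"
      have B0: "0 < B" using B by (simp add: B_def)
      have fB: "norm (f1 v) \<le> B * norm v" "norm (f2 v) \<le> B * norm v" "norm (f3 v) \<le> B * norm v" for v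
        using B(2,4,6)[of v] B(1,3,5) norm_ge_zero[of v] by (simp_all add: B_def distrib_right add_increasing add_increasing2)
      define d where "d = BZ.ldist (f3 p - f1 p)"
      have "d \<noteq> 0" unfolding d_def qd using p Q(1) BZ.ldist_eq_0_iff by blast
      then have d: "0 < d" using infdist_nonneg[of "f3 p - f1 p" "rlattice X"] unfolding d_def by linarith
      define F where "F = (\<lambda>p. eri X (n1, f1 p) (n2, f2 p) (n3, f3 p) (n4, f4 p))"
      have est: "norm (F y - F p) \<le> K * (1 / d\<^sup>2) * (B * norm (y - p) / d)" if y: "y \<noteq> p" "5 * (B * norm (y - p)) \<le> d" for y
      proof -
        have "f (p + (y - p)) = f p + f (y - p)" if "mom_map f" for f using mom_map_plus[OF that] by blast
        then have fy: "f1 y = f1 p + f1 (y - p)" "f2 y = f2 p + f2 (y - p)" "f3 y = f3 p + f3 (y - p)"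
          using f by force+
        show ?thesis unfolding F_def fy d_def
          by (rule K(2)) (use y B0 fB in \<open>auto simp: d_def\<close>)
      qed
      have ev: "\<forall>\<^sub>F y in at p. norm (F y - F p) \<le> K * (1 / d\<^sup>2) * (B * norm (y - p) / d)"
        unfolding eventually_at
      proof (intro exI[of _ "d / (5 * B)"] conjI ballI impI)
        show "0 < d / (5 * B)" using d B0 by simp
        fix y assume y: "y \<noteq> p \<and> dist y p < d / (5 * B)"
        then have "5 * (B * norm (y - p)) \<le> d" using B0 by (simp add: dist_norm pos_less_divide_eq mult_ac)
        then show "norm (F y - F p) \<le> K * (1 / d\<^sup>2) * (B * norm (y - p) / d)" using y est by blast
      qed
      have "((\<lambda>y. K * (1 / d\<^sup>2) * (B * norm (y - p) / d)) \<longlongrightarrow> K * (1 / d\<^sup>2) * (B * norm (p - p) / d)) (at p)"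
        by (intro tendsto_intros) (use d in auto)
      then have "((\<lambda>y. K * (1 / d\<^sup>2) * (B * norm (y - p) / d)) \<longlongrightarrow> 0) (at p)" by simp
      from Lim_null_comparison[OF ev this] have "(F \<longlongrightarrow> F p) (at p)" by (rule LIM_zero_cancel)
      then show ?thesis unfolding F_def isCont_def .
    qed
  qed
qed

text \<open>Distances from the lattice are bounded; therefore functions without singularities satisfy the
difference bounds of tame functions.\<close>

lemma inverse_step_proximity: "\<exists>\<kappa>\<ge>1. \<forall>N p. 0 < N \<longrightarrow> 1 / real N \<le> \<kappa> * proximity N p"
proof -
  obtain B where B: "0 < B" "\<And>q. BZ.ldist q \<le> B" using BZ.ldist_bounded by blast
  obtain Q where Q: "Q \<in> transfers" by (auto simp: transfers_def)
  show ?thesis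
  proof (intro exI[of _ "max 1 B"] conjI allI impI)
    fix N :: nat and p assume N: "0 < N"
    have "1 / real N \<le> 1" using N by simp
    then have "max (1 / real N) (BZ.ldist (Q p)) \<le> max 1 B" using B(2)[of "Q p"] by linarith
    moreover have "0 < max (1 / real N) (BZ.ldist (Q p))" using N by (simp add: less_max_iff_disj)
    ultimately have "1 / real N \<le> max 1 B * (1 / real N / max (1 / real N) (BZ.ldist (Q p)))"
      using N by (simp add: divide_simps)
    also have "\<dots> \<le> max 1 B * proximity N p" using proximity_transfer[OF Q] by (intro mult_left_mono) auto
    finally show "1 / real N \<le> max 1 B * proximity N p" .
  qed simp
qed

lemma tame_inverse_denom:
  assumes b: "i \<in> occ X" "j \<in> occ X" "a \<in> vir X" "b \<in> vir X"
    and f: "mom_map f1" "mom_map f2" "mom_map f3" "\<And>p. f4 p = f1 p + f2 p - f3 p"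
  shows "tame 0 (\<lambda>p. inverse (complex_of_real (denom X (i, f1 p) (j, f2 p) (a, f3 p) (b, f4 p))))"
proof -
  have "f4 = (\<lambda>p. f1 p + f2 p - f3 p)" using f(4) by (rule ext)
  then have f4: "mom_map f4" using mom_map_diff[OF mom_map_add[OF f(1,2)] f(3)] by (simp only:)
  note bd = occ_band[OF b(1)] occ_band[OF b(2)] vir_band[OF b(3)] vir_band[OF b(4)]
  obtain c where c: "0 < c" "\<And>k1 k2 k3. c \<le> \<bar>denom X (i, k1) (j, k2) (a, k3) (b, k1 + k2 - k3)\<bar>"
    using denom_lower[OF b] by blast
  define g where "g p = complex_of_real (denom X (i, f1 p) (j, f2 p) (a, f3 p) (b, f4 p))" for p
  have gc: "c \<le> norm (g p)" for p unfolding g_def f(4) norm_of_real by (rule c(2))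
  then have g0: "g p \<noteq> 0" for p using c(1) by (metis norm_zero not_less)
  have cont: "continuous_on UNIV (\<lambda>p. energy X n (h p))" if "n \<in> bands" "mom_map h" for n h
    using continuous_on_compose2[OF energy_continuous[OF that(1)] mom_map_continuous[OF that(2)]] by simp
  have gcont: "continuous_on UNIV g"
    unfolding g_def denom_def orb_energy_def fst_conv snd_conv
    by (intro continuous_intros cont bd f f4)
  then have icont: "continuous_on UNIV (\<lambda>p. inverse (g p))" using g0 by (intro continuous_intros) auto
  have "tame 0 (\<lambda>p. inverse (g p))"
    unfolding tame_def
  proof (intro conjI allI impI ballI)
    show "VV.periodic (\<lambda>p. inverse (g p))"
      unfolding VV.periodic_def g_def denom_def orb_energy_def
      by (simp add: mom_map_plus f(1-3) f4 mom_map_lattice energy_periodic bd)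
    show "(\<lambda>p. inverse (g p)) \<in> borel_measurable borel" using icont by (rule borel_measurable_continuous_onI)
    show "isCont (\<lambda>p. inverse (g p)) p" for p using icont continuous_on_eq_continuous_at[OF open_UNIV] by blast
    show "\<exists>C\<ge>0. \<forall>p. norm (inverse (g p)) \<le> C * weight p ^ 0"
      using gc c(1) by (intro exI[of _ "inverse c"]) (auto simp: norm_inverse intro!: le_imp_inverse_le)
    fix u :: mom4
    have es: "\<exists>C\<ge>0. \<forall>k N. 0 < N \<longrightarrow> dbound 6 (\<lambda>j. complex_of_real (energy X n (k + (real j / real N) *\<^sub>R v))) C (1 / real N)"
      if n: "n \<in> bands" for n v
      using energy_steps[OF n, of 6 v] dbound_of_real by blast
    obtain C1 where C1: "\<And>k N. 0 < N \<Longrightarrow> dbound 6 (\<lambda>l. complex_of_real (energy X i (k + (real l / real N) *\<^sub>R f1 u))) C1 (1 / real N)"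
      using es[OF bd(1)] by blast
    obtain C2 where C2: "\<And>k N. 0 < N \<Longrightarrow> dbound 6 (\<lambda>l. complex_of_real (energy X j (k + (real l / real N) *\<^sub>R f2 u))) C2 (1 / real N)"
      using es[OF bd(2)] by blast
    obtain C3 where C3: "\<And>k N. 0 < N \<Longrightarrow> dbound 6 (\<lambda>l. complex_of_real (energy X a (k + (real l / real N) *\<^sub>R f3 u))) C3 (1 / real N)"
      using es[OF bd(3)] by blast
    obtain C4 where C4: "\<And>k N. 0 < N \<Longrightarrow> dbound 6 (\<lambda>l. complex_of_real (energy X b (k + (real l / real N) *\<^sub>R f4 u))) C4 (1 / real N)"
      using es[OF bd(4)] by blast
    define C where "C = C1 + C2 + norm (- 1 :: complex) * C3 + norm (- 1 :: complex) * C4"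
    obtain K where K: "0 \<le> K" "\<And>(h :: nat \<Rightarrow> complex) \<delta>. 0 \<le> \<delta> \<Longrightarrow> dbound 6 h C \<delta> \<Longrightarrow> (\<forall>l\<le>6. c \<le> norm (h l)) \<Longrightarrow>
        dbound 6 (\<lambda>l. inverse (h l)) K \<delta>"
      using dbound_inverse[OF c(1), of 6 C, where 'a = complex] by blast
    obtain \<kappa> where \<kappa>: "1 \<le> \<kappa>" "\<And>N p. 0 < N \<Longrightarrow> 1 / real N \<le> \<kappa> * proximity N p" using inverse_step_proximity by blast
    show "\<exists>C\<ge>0. \<forall>N p. 0 < N \<longrightarrow> on_mesh N p \<longrightarrow>
        dbound 6 (\<lambda>l. inverse (g (p + (real l / real N) *\<^sub>R u))) (C * ((real N)\<^sup>2) ^ 0) (proximity N p)"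
    proof (intro exI[of _ "K * \<kappa> ^ 6"] conjI allI impI)
      show "0 \<le> K * \<kappa> ^ 6" using K \<kappa> by simp
      fix N :: nat and p :: mom4 assume N: "0 < N"
      have g_eq: "g (p + (real l / real N) *\<^sub>R u) =
        complex_of_real (energy X i (f1 p + (real l / real N) *\<^sub>R f1 u)) + complex_of_real (energy X j (f2 p + (real l / real N) *\<^sub>R f2 u))
        + - 1 * complex_of_real (energy X a (f3 p + (real l / real N) *\<^sub>R f3 u)) + - 1 * complex_of_real (energy X b (f4 p + (real l / real N) *\<^sub>R f4 u))" for l
        unfolding g_def denom_def orb_energy_def mom_map_line[OF f(1)] mom_map_line[OF f(2)] mom_map_line[OF f(3)] mom_map_line[OF f4]
        by simp
      have "dbound 6 (\<lambda>l. g (p + (real l / real N) *\<^sub>R u)) C (1 / real N)"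
        unfolding g_eq C_def by (intro dbound_add dbound_cmult C1 C2 C3 C4 N)
      then have "dbound 6 (\<lambda>l. inverse (g (p + (real l / real N) *\<^sub>R u))) K (1 / real N)"
        by (intro K) (use gc in auto)
      then have "dbound 6 (\<lambda>l. inverse (g (p + (real l / real N) *\<^sub>R u))) K (\<kappa> * proximity N p)"
        by (rule dbound_mono) (use \<kappa>(2)[OF N] in auto)
      from dbound_rescale[OF this \<kappa>(1) proximity_nonneg]
      show "dbound 6 (\<lambda>l. inverse (g (p + (real l / real N) *\<^sub>R u))) (K * \<kappa> ^ 6 * ((real N)\<^sup>2) ^ 0) (proximity N p)"
        by simp
    qed
  qed
  then show ?thesis unfolding g_def .
qed

end

section \<open>Quadrature error of tame functions\<close>

text \<open>The points with coordinates \<open>f j / n\<close>, \<open>f j < n\<close>, are inequivalent modulo the lattice.\<close>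

lemma int_coords_card_grid:
  assumes \<phi>: "int_coords \<Lambda> \<phi>" and L: "lattice_cell \<Lambda> D" and n: "0 < n"
  shows "n ^ 3 \<le> card (lattice_cell.grid \<Lambda> D n 0)"
proof -
  interpret lattice_cell \<Lambda> D by fact
  have lin: "linear \<phi>" and bij: "bij \<phi>" and \<Lambda>: "\<Lambda> = {x. \<forall>j. \<phi> x $ j \<in> \<int>}"
    using \<phi> by (auto simp: int_coords_def)
  define I where "I = PiE (UNIV :: 3 set) (\<lambda>_. {..<n})"
  define x where "x f = inv \<phi> (\<chi> j. real (f j))" for f :: "3 \<Rightarrow> nat"
  have \<phi>x: "\<phi> (x f) = (\<chi> j. real (f j))" for f
    unfolding x_def by (rule surj_f_inv_f[OF bij_is_surj[OF bij]])
  have xL: "x f \<in> \<Lambda>" for f unfolding \<Lambda> by (simp add: \<phi>x)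
  define g where "g f = (1 / real n) *\<^sub>R x f - rep ((1 / real n) *\<^sub>R x f)" for f
  have "card (g ` I) \<le> card (grid n 0)"
  proof (rule card_mono[OF finite_grid[OF n]])
    show "g ` I \<subseteq> grid n 0"
      unfolding g_def using grid_reduce[OF n, of "(1 / real n) *\<^sub>R x _" 0] xL n by auto
  qed
  moreover have "inj_on g I"
  proof (rule inj_onI)
    fix f f' assume f: "f \<in> I" "f' \<in> I" "g f = g f'"
    define H where "H = rep ((1 / real n) *\<^sub>R x f) - rep ((1 / real n) *\<^sub>R x f')"
    have H: "H \<in> \<Lambda>" unfolding H_def by (intro diff_in rep_in)
    have "(1 / real n) *\<^sub>R x f - (1 / real n) *\<^sub>R x f' = H"
      using f(3) by (simp add: g_def H_def algebra_simps)
    then have "real n *\<^sub>R ((1 / real n) *\<^sub>R (x f - x f')) = real n *\<^sub>R H" by (simp only: scaleR_diff_right)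
    then have "x f - x f' = real n *\<^sub>R H" using n by simp
    then have eq: "\<phi> (x f) - \<phi> (x f') = real n *\<^sub>R \<phi> H" by (metis linear_diff[OF lin] linear_scale[OF lin])
    show "f = f'"
    proof
      fix j
      have "\<phi> H $ j \<in> \<int>" using H unfolding \<Lambda> by blast
      then obtain m :: int where m: "\<phi> H $ j = real_of_int m" by (elim Ints_cases)
      \<comment> \<open>The difference of two coordinates is a multiple of \<open>n\<close> and smaller than \<open>n\<close>.\<close>
      have "real (f j) - real (f' j) = real n * real_of_int m"
        using arg_cong[OF eq, of "\<lambda>v. v $ j"] m by (simp add: \<phi>x)
      then have "real_of_int (int (f j) - int (f' j)) = real_of_int (int n * m)" by simp
      then have "int (f j) - int (f' j) = int n * m" by (simp only: of_int_eq_iff)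
      moreover have "f j < n" "f' j < n" using f(1,2) by (auto simp: I_def PiE_iff)
      then have "\<bar>int (f j) - int (f' j)\<bar> < int n" by linarith
      ultimately have "\<bar>int n * m\<bar> < int n" by simp
      then have "\<bar>m\<bar> < 1" using n by (simp add: abs_mult)
      then show "f j = f' j" using \<open>int (f j) - int (f' j) = int n * m\<close> by simp
    qed
  qed
  then have "card (g ` I) = n ^ 3" by (simp add: card_image I_def card_PiE)
  ultimately show ?thesis by simp
qed

lemma sum_Times: "(\<Sum>p\<in>S \<times> T. f p) = (\<Sum>x\<in>S. \<Sum>y\<in>T. f (x, y))"
  using sum.cartesian_product[of "\<lambda>x y. f (x, y)" T S] by simp

context insulator
begin

lemma BZ_coords: "\<exists>\<phi>. int_coords (rlattice X) \<phi>"
proof -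
  have "bravais_lattice (lattice X)" using insulating unfolding insulating_system_def by blast
  then show ?thesis by (rule reciprocal_int_coords)
qed

lemma card_mesh: "0 < n \<Longrightarrow> n ^ 3 \<le> card (BZ.grid n s)"
  using int_coords_card_grid[OF _ BZ_cell] BZ_coords BZ.card_grid_translate[of n 0 s] by auto

lemma VV_halving: "\<exists>E. VV.halving E"
proof -
  obtain E where E: "BZ.halving E" using BZ_coords int_coords_halving[OF _ BZ_cell] by blast
  have "VV.halving ((E \<times> E \<times> E) \<times> E)"
    unfolding lattice4_def cell4_def
    by (rule halving_Times[OF lattice_cell_Times[OF BZ_cell lattice_cell_Times[OF BZ_cell BZ_cell]] BZ_cell
          halving_Times[OF BZ_cell lattice_cell_Times[OF BZ_cell BZ_cell] E halving_Times[OF BZ_cell BZ_cell E E]] E])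
  then show ?thesis by blast
qed

lemma grid4: "VV.grid n ((s, s, s), s) = (BZ.grid n s \<times> BZ.grid n s \<times> BZ.grid n s) \<times> BZ.grid n s"
  unfolding lattice4_def cell4_def
  by (simp add: grid_Times lattice_cell_Times BZ_cell)

lemma sum4: "(\<Sum>p\<in>VV.grid n ((s, s, s), s). f p)
   = (\<Sum>i\<in>BZ.grid n s. \<Sum>j\<in>BZ.grid n s. \<Sum>a\<in>BZ.grid n s. \<Sum>k\<in>BZ.grid n s. f ((i, j, a), k))"
  unfolding grid4 sum_Times ..

lemma grid_sum_recenter:
  assumes n: "0 < n" and \<phi>: "BZ.periodic \<phi>" and c: "real n *\<^sub>R (s + c) \<in> rlattice X"
  shows "(\<Sum>k\<in>BZ.grid n s. \<phi> (k + c)) = (\<Sum>q\<in>BZ.grid n 0. \<phi> q)"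
proof -
  have "BZ.grid n (0 + (1 / real n) *\<^sub>R (real n *\<^sub>R (s + c))) = BZ.grid n 0" by (rule BZ.grid_shift[OF n c])
  then show ?thesis using n by (simp add: BZ.grid_sum_translate[OF n \<phi>])
qed

text \<open>Every transfer contains some of the four momenta with coefficient 1, and its coefficients add up to 0.
When the others are fixed and this momentum runs through the mesh, the transfer runs through the
mesh with offset 0, modulo the lattice.\<close>

lemma transfer_sum:
  fixes \<phi> :: "real^3 \<Rightarrow> real"
  assumes n: "0 < n" and \<phi>: "BZ.periodic \<phi>" and Q: "Q \<in> transfers"
  shows "(\<Sum>p\<in>VV.grid n ((s, s, s), s). \<phi> (Q p)) = real (card (BZ.grid n s)) ^ 3 * (\<Sum>q\<in>BZ.grid n 0. \<phi> q)"
proof -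
  define K where "K = BZ.grid n s"
  define S where "S = (\<Sum>q\<in>BZ.grid n 0. \<phi> q)"
  have K: "real n *\<^sub>R (k - s) \<in> rlattice X" if "k \<in> K" for k
    using BZ.grid_scaled[OF _ n] that unfolding K_def by blast
  have K': "real n *\<^sub>R (s - k) \<in> rlattice X" if "k \<in> K" for k
    using BZ.neg_in[OF K[OF that]] by (simp add: algebra_simps)
  have rec: "(\<Sum>k\<in>K. \<phi> (k - x)) = S" if "x \<in> K" for x
    using grid_sum_recenter[OF n \<phi>, of s "- x"] K'[OF that] by (simp add: K_def S_def)
  have rec4: "(\<Sum>k\<in>K. \<phi> (k + a - i - j)) = S" if "a \<in> K" "i \<in> K" "j \<in> K" for a i j
  proof -
    have "real n *\<^sub>R (s + (a - i - j)) = real n *\<^sub>R (a - s) + real n *\<^sub>R (s - i) + real n *\<^sub>R (s - j)"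
      by (simp add: algebra_simps)
    then have "real n *\<^sub>R (s + (a - i - j)) \<in> rlattice X"
      using K[OF that(1)] K'[OF that(2)] K'[OF that(3)] BZ.add_in by simp
    from grid_sum_recenter[OF n \<phi> this] show ?thesis by (simp add: K_def S_def add_diff_eq)
  qed
  have "(\<Sum>i\<in>K. \<Sum>j\<in>K. \<Sum>a\<in>K. \<Sum>k\<in>K. \<phi> (Q ((i, j, a), k))) = real (card K) ^ 3 * S"
  proof -
    consider "Q = (\<lambda>p. kK p - kI p)" | "Q = (\<lambda>p. kK p - kJ p)" | "Q = (\<lambda>p. kK p - kA p)"
      | "Q = (\<lambda>p. kA p - kI p)" | "Q = (\<lambda>p. kJ p - kA p)" | "Q = (\<lambda>p. kK p + kA p - kI p - kJ p)"
      using Q by (auto simp: transfers_def poles_def)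
    then show ?thesis
    proof cases
      case 4
      then have "(\<Sum>i\<in>K. \<Sum>j\<in>K. \<Sum>a\<in>K. \<Sum>k\<in>K. \<phi> (Q ((i, j, a), k))) = (\<Sum>i\<in>K. \<Sum>j\<in>K. real (card K) * (\<Sum>a\<in>K. \<phi> (a - i)))"
        by (simp add: mom_defs sum_distrib_left)
      then show ?thesis by (simp add: rec power3_eq_cube)
    next
      case 5
      then have "(\<Sum>i\<in>K. \<Sum>j\<in>K. \<Sum>a\<in>K. \<Sum>k\<in>K. \<phi> (Q ((i, j, a), k))) = (\<Sum>i\<in>K. \<Sum>a\<in>K. real (card K) * (\<Sum>j\<in>K. \<phi> (j - a)))"
        by (subst (2) sum.swap) (simp add: mom_defs sum_distrib_left)
      then show ?thesis by (simp add: rec power3_eq_cube)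
    qed (simp_all add: mom_defs rec rec4 power3_eq_cube)
  qed
  then show ?thesis unfolding sum4 K_def S_def .
qed

lemma card_grid4: "real (card (VV.grid n ((s, s, s), s))) = real (card (BZ.grid n s)) ^ 4"
  unfolding grid4 by (simp add: card_cartesian_product power4_eq_xxxx)

text \<open>The sixth power of the proximity is at most the sum of those for the single transfers. By
\<open>transfer_sum\<close> its average is one over a three-dimensional mesh, which has at least \<open>n ^ 3\<close> points, and
\<open>grid_sum_decay\<close> bounds the sum.\<close>

lemma proximity_average:
  "\<exists>C\<ge>0. \<forall>n s. 0 < n \<longrightarrow> VV.gavg n ((s, s, s), s) (\<lambda>p. proximity (2 * n) p ^ 6) \<le> C / real n ^ 3"
proof -
  obtain \<phi> where \<phi>: "int_coords (rlattice X) \<phi>" using BZ_coords by blast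
  obtain C where C: "0 \<le> C" "\<And>F. finite F \<Longrightarrow> F \<subseteq> rlattice X \<Longrightarrow> (\<Sum>G\<in>F. (1 / max 1 (norm G)) ^ 6) \<le> C"
    using int_coords_tail[OF \<phi>] by blast
  define M where "M = real (card transfers)"
  show ?thesis
  proof (intro exI[of _ "M * C"] conjI allI impI)
    show "0 \<le> M * C" using C by (simp add: M_def)
    fix n :: nat and s assume n: "0 < n"
    define \<psi> where "\<psi> q = (1 / real (2 * n) / max (1 / real (2 * n)) (BZ.ldist q)) ^ 6" for q
    have \<psi>: "BZ.periodic \<psi>" by (simp add: BZ.periodic_def \<psi>_def BZ.ldist_add)
    have \<psi>0: "0 \<le> \<psi> q" for q by (simp add: \<psi>_def le_max_iff_disj)
    define N where "N = real (card (BZ.grid n s))"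
    have N: "0 < N" "real n ^ 3 \<le> N"
      using BZ.card_grid_pos[OF n, of s] card_mesh[OF n, of s] unfolding N_def
      by (auto simp flip: of_nat_power)
    have pr: "proximity (2 * n) p ^ 6 \<le> (\<Sum>Q\<in>transfers. \<psi> (Q p))" for p
    proof -
      have ne: "transfers \<noteq> {}" by (auto simp: transfers_def)
      have "proximity (2 * n) p \<in> (\<lambda>Q. 1 / real (2 * n) / max (1 / real (2 * n)) (BZ.ldist (Q p))) ` transfers"
        unfolding proximity_def using finite_transfers ne by (intro Max_in) auto
      then obtain Q where Q: "Q \<in> transfers" "proximity (2 * n) p ^ 6 = \<psi> (Q p)" by (auto simp: \<psi>_def)
      then show ?thesis using finite_transfers(1) \<psi>0 member_le_sum[of Q transfers "\<lambda>Q. \<psi> (Q p)"] by simp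
    qed
    have "(\<Sum>p\<in>VV.grid n ((s, s, s), s). proximity (2 * n) p ^ 6) \<le> (\<Sum>p\<in>VV.grid n ((s, s, s), s). \<Sum>Q\<in>transfers. \<psi> (Q p))"
      by (intro sum_mono pr)
    also have "\<dots> = (\<Sum>Q\<in>transfers. \<Sum>p\<in>VV.grid n ((s, s, s), s). \<psi> (Q p))" by (rule sum.swap)
    also have "\<dots> = (\<Sum>Q\<in>transfers. N ^ 3 * (\<Sum>q\<in>BZ.grid n 0. \<psi> q))"
      by (intro sum.cong refl) (simp add: transfer_sum[OF n \<psi>] N_def)
    also have "\<dots> \<le> (\<Sum>Q\<in>transfers. N ^ 3 * C)"
      using BZ.grid_sum_decay[OF C(2) n] N by (intro sum_mono mult_left_mono) (auto simp: \<psi>_def)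
    also have "\<dots> = N ^ 3 * (M * C)" by (simp add: M_def)
    finally have "(\<Sum>p\<in>VV.grid n ((s, s, s), s). proximity (2 * n) p ^ 6) \<le> N ^ 3 * (M * C)" .
    then have "VV.gavg n ((s, s, s), s) (\<lambda>p. proximity (2 * n) p ^ 6) \<le> (1 / N ^ 4) * (N ^ 3 * (M * C))"
      unfolding VV.gavg_def card_grid4 N_def[symmetric] using N by (simp add: mult_left_mono divide_right_mono)
    also have "\<dots> = M * C / N" using N by (simp add: field_simps power_eq_if)
    also have "\<dots> \<le> M * C / real n ^ 3"
      using N n C by (intro divide_left_mono) (auto simp: M_def)
    finally show "VV.gavg n ((s, s, s), s) (\<lambda>p. proximity (2 * n) p ^ 6) \<le> M * C / real n ^ 3" .
  qed
qed

lemma transfers_balanced: "Q \<in> transfers \<Longrightarrow> Q ((s, s, s), s) = 0"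
  by (auto simp: transfers_def poles_def mom_defs)

lemma transfer_grid:
  assumes Q: "Q \<in> transfers" and n: "0 < n" and p: "real n *\<^sub>R (p - ((s, s, s), s)) \<in> lattice4"
  shows "real n *\<^sub>R Q p \<in> rlattice X"
proof -
  have lin: "linear Q" using mom_map_transfers[OF Q] by (simp add: mom_map_def)
  have "real n *\<^sub>R Q p = Q (real n *\<^sub>R (p - ((s, s, s), s)))"
    by (simp only: linear_scale[OF lin] linear_diff[OF lin] transfers_balanced[OF Q] diff_zero)
  then show ?thesis using mom_map_lattice[OF mom_map_transfers[OF Q] p] by simp
qed

text \<open>This is \<open>gavg_halve\<close> for differences of order six, whose average is bounded by \<open>proximity_average\<close>. The size
of a singularity on the mesh costs \<open>n ^ (2 * \<gamma>)\<close>.\<close>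

lemma tame_halving:
  assumes P: "tame \<gamma> P" and \<gamma>: "\<gamma> \<le> 1"
  shows "\<exists>C\<ge>0. \<forall>n s. 0 < n \<longrightarrow>
    norm (VV.gavg n ((s, s, s), s) P - VV.gavg (2 * n) ((s, s, s), s) P) \<le> C / real n ^ (3 - 2 * \<gamma>)"
proof -
  obtain E where E: "VV.halving E" using VV_halving by blast
  have Efin: "finite E" and EL: "\<And>e. e \<in> E \<Longrightarrow> e \<in> lattice4" using E unfolding VV.halving_def by auto
  have "\<exists>C\<ge>0. \<forall>e\<in>E. \<forall>N p. 0 < N \<longrightarrow> on_mesh N p \<longrightarrow>
        dbound 6 (\<lambda>j. P (p + (real j / real N) *\<^sub>R e)) (C * ((real N)\<^sup>2) ^ \<gamma>) (proximity N p)"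
  proof (rule uniform_bound[OF Efin])
    fix e assume "e \<in> E"
    then show "\<exists>C. \<forall>N p. 0 < N \<longrightarrow> on_mesh N p \<longrightarrow>
        dbound 6 (\<lambda>j. P (p + (real j / real N) *\<^sub>R e)) (C * ((real N)\<^sup>2) ^ \<gamma>) (proximity N p)"
      using P EL unfolding tame_def by blast
  next
    fix e and C C' :: real
    assume C: "\<forall>N p. 0 < N \<longrightarrow> on_mesh N p \<longrightarrow>
        dbound 6 (\<lambda>j. P (p + (real j / real N) *\<^sub>R e)) (C * ((real N)\<^sup>2) ^ \<gamma>) (proximity N p)" and le: "C \<le> C'"
    show "\<forall>N p. 0 < N \<longrightarrow> on_mesh N p \<longrightarrow>
        dbound 6 (\<lambda>j. P (p + (real j / real N) *\<^sub>R e)) (C' * ((real N)\<^sup>2) ^ \<gamma>) (proximity N p)"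
    proof (intro allI impI)
      fix N :: nat and p assume a: "0 < N" "on_mesh N p"
      show "dbound 6 (\<lambda>j. P (p + (real j / real N) *\<^sub>R e)) (C' * ((real N)\<^sup>2) ^ \<gamma>) (proximity N p)"
        by (rule dbound_mono[OF C[rule_format, OF a(1) bspec[OF a(2)]]])
           (use le in \<open>auto intro!: mult_right_mono proximity_nonneg\<close>)
    qed
  qed
  then obtain C where C: "0 \<le> C" "\<And>e N p. e \<in> E \<Longrightarrow> 0 < N \<Longrightarrow> on_mesh N p \<Longrightarrow>
        dbound 6 (\<lambda>j. P (p + (real j / real N) *\<^sub>R e)) (C * ((real N)\<^sup>2) ^ \<gamma>) (proximity N p)" by blast
  obtain A where A: "0 \<le> A" "\<And>n s. 0 < n \<Longrightarrow> VV.gavg n ((s, s, s), s) (\<lambda>p. proximity (2 * n) p ^ 6) \<le> A / real n ^ 3"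
    using proximity_average by blast
  show ?thesis
  proof (intro exI[of _ "C * 4 ^ \<gamma> * A"] conjI allI impI)
    show "0 \<le> C * 4 ^ \<gamma> * A" using C A by simp
    fix n :: nat and s assume n: "0 < n"
    define w where "w p = C * ((real (2 * n))\<^sup>2) ^ \<gamma> * proximity (2 * n) p ^ 6" for p
    have "norm (VV.gavg n ((s, s, s), s) P - VV.gavg (2 * n) ((s, s, s), s) P) \<le> VV.gavg n ((s, s, s), s) w"
    \<comment> \<open>The order of the difference is \<open>Suc 5\<close>, the largest one in \<open>tame\<close>.\<close>
    proof (rule VV.gavg_halve[OF n E tame_periodic[OF P], where m = 5])
      fix p e assume p: "p \<in> VV.grid n ((s, s, s), s)" and e: "e \<in> E"
      have "on_mesh (2 * n) p"
      proof
        fix Q assume Q: "Q \<in> transfers"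
        have "real n *\<^sub>R Q p \<in> rlattice X" by (rule transfer_grid[OF Q n VV.grid_scaled[OF p n]])
        from BZ.scale_in[OF this, of 2] show "real (2 * n) *\<^sub>R Q p \<in> rlattice X" by simp
      qed
      then have "dbound 6 (\<lambda>j. P (p + (real j / real (2 * n)) *\<^sub>R e)) (C * ((real (2 * n))\<^sup>2) ^ \<gamma>) (proximity (2 * n) p)"
        using n e by (intro C(2)) auto
      from dboundD[OF this, of 6 0]
      show "norm ((fdiff ^^ Suc 5) (\<lambda>j. P (p + (real j / real (2 * n)) *\<^sub>R e)) 0) \<le> w p"
        by (simp add: w_def eval_nat_numeral)
    qed
    also have "VV.gavg n ((s, s, s), s) w = C * ((real (2 * n))\<^sup>2) ^ \<gamma> * VV.gavg n ((s, s, s), s) (\<lambda>p. proximity (2 * n) p ^ 6)"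
      unfolding VV.gavg_def w_def sum_distrib_left[symmetric] by simp
    also have "\<dots> \<le> C * ((real (2 * n))\<^sup>2) ^ \<gamma> * (A / real n ^ 3)"
      using C(1) A(2)[OF n] by (intro mult_left_mono) auto
    also have "\<dots> = C * 4 ^ \<gamma> * A / real n ^ (3 - 2 * \<gamma>)"
    proof -
      have "((real (2 * n))\<^sup>2) ^ \<gamma> = 4 ^ \<gamma> * real n ^ (2 * \<gamma>)"
        by (simp add: power_mult_distrib power_mult)
      moreover have "real n ^ 3 = real n ^ (2 * \<gamma>) * real n ^ (3 - 2 * \<gamma>)"
        using \<gamma> by (simp flip: power_add)
      ultimately show ?thesis using n by simp
    qed
    finally show "norm (VV.gavg n ((s, s, s), s) P - VV.gavg (2 * n) ((s, s, s), s) P)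
      \<le> C * 4 ^ \<gamma> * A / real n ^ (3 - 2 * \<gamma>)" .
  qed
qed

lemma pole_slice_nn_integral:
  "(\<integral>\<^sup>+k. ennreal (1 / (BZ.ldist (k - c))\<^sup>2) * indicator (bz X) k \<partial>lborel)
     = (\<integral>\<^sup>+k. ennreal (1 / (BZ.ldist k)\<^sup>2) * indicator (bz X) k \<partial>lborel)"
  using BZ.nn_integral_translate[of "\<lambda>k. ennreal (1 / (BZ.ldist k)\<^sup>2)" "- c"]
  by (simp add: BZ.periodic_def BZ.ldist_add)

definition externals :: "((real^3) \<times> (real^3) \<times> (real^3)) set" where
  "externals = bz X \<times> bz X \<times> bz X"

lemma externals_cell: "lattice_cell (rlattice X \<times> rlattice X \<times> rlattice X) externals"
  unfolding externals_def by (intro lattice_cell_Times BZ_cell)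

lemma externals_borel [measurable]: "externals \<in> sets borel"
  using lattice_cell.cell_borel[OF externals_cell] .

lemma cell4_externals: "cell4 = externals \<times> bz X"
  by (simp add: cell4_def externals_def)

text \<open>Each pole contains the free momentum with coefficient 1. So for fixed external momenta it differs
from the free momentum by a translation.\<close>

lemma pole_affine:
  assumes "Q \<in> poles"
  shows "\<exists>c\<in>borel_measurable borel. \<forall>x k. Q (x, k) = k - c x"
proof -
  have m: "(\<lambda>x. kI (x, 0)) \<in> borel_measurable borel" "(\<lambda>x. kJ (x, 0)) \<in> borel_measurable borel"
    "(\<lambda>x. kA (x, 0)) \<in> borel_measurable borel"
    unfolding mom_defs by (intro borel_measurable_continuous_onI continuous_intros)+
  consider "Q = (\<lambda>p. kK p - kI p)" | "Q = (\<lambda>p. kK p - kJ p)" | "Q = (\<lambda>p. kK p - kA p)"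
    using assms by (auto simp: poles_def)
  then show ?thesis
  proof cases
    case 1 show ?thesis by (rule bexI[OF _ m(1)]) (simp add: 1 mom_defs)
  next
    case 2 show ?thesis by (rule bexI[OF _ m(2)]) (simp add: 2 mom_defs)
  next
    case 3 show ?thesis by (rule bexI[OF _ m(3)]) (simp add: 3 mom_defs)
  qed
qed

lemma pole_slice_integrable:
  assumes "Q \<in> poles"
  shows "set_integrable lborel (bz X) (\<lambda>k. 1 / (BZ.ldist (Q (x, k)))\<^sup>2)"
proof -
  obtain c where [measurable]: "c \<in> borel_measurable borel" and c: "\<forall>x k. Q (x, k) = k - c x"
    using pole_affine[OF assms] by (elim bexE)
  have "(\<integral>\<^sup>+k. ennreal (norm (indicator (bz X) k *\<^sub>R (1 / (BZ.ldist (k - c x))\<^sup>2))) \<partial>lborel)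
     = (\<integral>\<^sup>+k. ennreal (1 / (BZ.ldist (k - c x))\<^sup>2) * indicator (bz X) k \<partial>lborel)"
    by (intro nn_integral_cong) (auto split: split_indicator)
  also have "\<dots> < \<infinity>" unfolding pole_slice_nn_integral by (rule BZ.nn_integral_inverse_square) simp
  finally show ?thesis
    unfolding set_integrable_def c[rule_format] by (intro integrableI_bounded) auto
qed

lemma weight_slice_integrable: "set_integrable lborel (bz X) (\<lambda>k. weight (x, k))"
proof -
  have "set_integrable lborel (bz X) (\<lambda>k. 1 :: real)"
    using BZ.cell_measure_finite by (simp add: set_integrable_def)
  moreover have "set_integrable lborel (bz X) (\<lambda>k. \<Sum>Q\<in>poles. 1 / (BZ.ldist (Q (x, k)))\<^sup>2)"
    using pole_slice_integrable unfolding set_integrable_def scaleR_sum_right by (intro Bochner_Integration.integrable_sum)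
  ultimately show ?thesis unfolding weight_def by (rule set_integral_add(1))
qed

lemma weight_integrable: "set_integrable lborel cell4 weight"
proof -
  have one: "set_integrable lborel cell4 (\<lambda>p. 1 :: real)"
    using VV.cell_measure_finite by (simp add: set_integrable_def)
  have pole: "set_integrable lborel cell4 (\<lambda>p. 1 / (BZ.ldist (Q p))\<^sup>2)" if Q: "Q \<in> poles" for Q
  proof -
    obtain c where [measurable]: "c \<in> borel_measurable borel" and c: "\<forall>x k. Q (x, k) = k - c x"
      using pole_affine[OF Q] by (elim bexE)
    have [measurable]: "Q \<in> borel_measurable borel"
      using mom_map_continuous[OF mom_map_transfers] poles_sub Q by (intro borel_measurable_continuous_onI) auto
    define I where "I = (\<integral>\<^sup>+k. ennreal (1 / (BZ.ldist k)\<^sup>2) * indicator (bz X) k \<partial>lborel)"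
    have "(\<integral>\<^sup>+p. ennreal (norm (indicator cell4 p *\<^sub>R (1 / (BZ.ldist (Q p))\<^sup>2))) \<partial>(lborel \<Otimes>\<^sub>M lborel))
       = (\<integral>\<^sup>+x. \<integral>\<^sup>+k. ennreal (norm (indicator cell4 (x, k) *\<^sub>R (1 / (BZ.ldist (Q (x, k)))\<^sup>2))) \<partial>lborel \<partial>lborel)"
      by (rule lborel.nn_integral_fst[symmetric]) (simp add: lborel_prod)
    also have "\<dots> = (\<integral>\<^sup>+x. indicator externals x * I \<partial>lborel)"
    proof (rule nn_integral_cong)
      fix x
      have "(\<integral>\<^sup>+k. ennreal (norm (indicator cell4 (x, k) *\<^sub>R (1 / (BZ.ldist (Q (x, k)))\<^sup>2))) \<partial>lborel)
         = (\<integral>\<^sup>+k. indicator externals x * (ennreal (1 / (BZ.ldist (k - c x))\<^sup>2) * indicator (bz X) k) \<partial>lborel)"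
        unfolding cell4_externals c[rule_format] by (intro nn_integral_cong) (auto split: split_indicator)
      also have "\<dots> = indicator externals x * I"
        by (subst nn_integral_cmult) (auto simp: pole_slice_nn_integral I_def)
      finally show "(\<integral>\<^sup>+k. ennreal (norm (indicator cell4 (x, k) *\<^sub>R (1 / (BZ.ldist (Q (x, k)))\<^sup>2))) \<partial>lborel)
         = indicator externals x * I" .
    qed
    also have "\<dots> = emeasure lborel externals * I" by (subst nn_integral_multc) auto
    also have "\<dots> < \<infinity>"
    proof -
      have "I < \<infinity>" unfolding I_def by (rule BZ.nn_integral_inverse_square) simp
      then show ?thesis using lattice_cell.cell_measure_finite[OF externals_cell]
        by (simp add: ennreal_mult_less_top)
    qed
    finally have "(\<integral>\<^sup>+p. ennreal (norm (indicator cell4 p *\<^sub>R (1 / (BZ.ldist (Q p))\<^sup>2))) \<partial>lborel) < \<infinity>"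
      unfolding lborel_prod .
    then show ?thesis unfolding set_integrable_def by (intro integrableI_bounded) auto
  qed
  have "set_integrable lborel cell4 (\<lambda>p. \<Sum>Q\<in>poles. 1 / (BZ.ldist (Q p))\<^sup>2)"
    using pole unfolding set_integrable_def scaleR_sum_right by (intro Bochner_Integration.integrable_sum)
  from set_integral_add(1)[OF one this] show ?thesis by (simp add: weight_def[abs_def])
qed

text \<open>The set where a transfer takes a given value lies in a hyperplane, and the lattice is countable.\<close>

lemma transfers_AE: "AE p in lborel. \<forall>Q\<in>transfers. Q p \<notin> rlattice X"
proof -
  have "AE p in lborel. Q p \<notin> rlattice X" if Q: "Q \<in> transfers" for Q
  proof -
    have lin: "linear Q" using mom_map_transfers[OF Q] by (simp add: mom_map_def)
    define b :: "real^3" where "b = axis 1 1"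
    define a where "a = adjoint Q b"
    have ab: "a \<bullet> p = b \<bullet> Q p" for p
      unfolding a_def using adjoint_works[OF lin, of p b] by (simp add: inner_commute)
    \<comment> \<open>One of the momenta enters with coefficient 1.\<close>
    have "Q ((0, 0, 0), b) = b \<or> Q ((0, 0, b), 0) = b \<or> Q ((0, b, 0), 0) = b"
      using Q unfolding transfers_def poles_def mom_defs by (elim UnE insertE emptyE) simp_all
    then obtain p where "Q p = b" by blast
    then have "a \<bullet> p = b \<bullet> b" using ab[of p] by simp
    moreover have "b \<bullet> b = 1" by (simp add: b_def inner_axis_axis)
    ultimately have a0: "a \<noteq> 0" by auto
    have Qc: "continuous_on UNIV Q" by (rule mom_map_continuous[OF mom_map_transfers[OF Q]])
    have cl: "closed {p. Q p = G}" for G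
      using closed_Collect_eq[OF Qc continuous_on_const] .
    have "{p. Q p = G} \<in> null_sets lborel" for G
    proof -
      have "negligible {p. Q p = G}"
      proof (rule negligible_subset)
        show "negligible {p. a \<bullet> p = b \<bullet> G}" using a0 by (intro negligible_hyperplane) simp
        show "{p. Q p = G} \<subseteq> {p. a \<bullet> p = b \<bullet> G}" unfolding ab by blast
      qed
      then have "{p. Q p = G} \<in> null_sets lebesgue" by (simp add: negligible_iff_null_sets)
      then show ?thesis using cl[of G] by (subst (asm) null_sets_completion_iff) auto
    qed
    then have "(\<Union>G\<in>rlattice X. {p. Q p = G}) \<in> null_sets lborel"
      by (intro null_sets_UN' BZ.countable_lattice)
    then show ?thesis by (rule AE_I') blast
  qed
  then show ?thesis using finite_transfers(1) by (simp add: AE_ball_countable countable_finite)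
qed

text \<open>Rounding to the mesh moves a transfer by \<open>O(1 / n)\<close>, and afterwards it is either a lattice vector, with
\<open>1 / 0 = 0\<close>, or at distance at least \<open>c / n\<close> from the lattice. In both cases its inverse square distance
has increased at most by a constant factor. This provides the integrable majorant for the
convergence of mesh averages.\<close>

lemma weight_nearest:
  "\<exists>M\<ge>0. \<forall>n p s. 0 < n \<longrightarrow> (\<forall>Q\<in>transfers. Q p \<notin> rlattice X) \<longrightarrow>
    weight (VV.nearest n ((s, s, s), s) p) \<le> M * weight p"
proof -
  obtain c where c: "0 < c" "\<And>G. G \<in> rlattice X \<Longrightarrow> G \<noteq> 0 \<Longrightarrow> c \<le> norm G" using BZ.min_norm by blast
  obtain B where B: "0 < B" "\<And>p. p \<in> cell4 \<Longrightarrow> norm p \<le> B" using VV.cell_bounded bounded_pos by blast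
  have "\<exists>L\<ge>0. \<forall>Q\<in>poles. \<forall>v. norm (Q v) \<le> L * norm v"
  proof (rule uniform_bound[OF finite_transfers(2)])
    fix Q assume "Q \<in> poles"
    then show "\<exists>L. \<forall>v. norm (Q v) \<le> L * norm v"
      using mom_map_bound[OF mom_map_transfers] poles_sub by blast
  qed (meson mult_right_mono norm_ge_zero order_trans)
  then obtain L where L: "0 \<le> L" "\<And>Q v. Q \<in> poles \<Longrightarrow> norm (Q v) \<le> L * norm v" by blast
  define M where "M = 1 + L * B / c"
  have M: "1 \<le> M" using L B c by (simp add: M_def)
  have "weight (VV.nearest n ((s, s, s), s) p) \<le> M\<^sup>2 * weight p"
    if n: "0 < n" and p: "\<forall>Q\<in>transfers. Q p \<notin> rlattice X" for n p s
  proof -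
    define y where "y = VV.nearest n ((s, s, s), s) p"
    have each: "1 / (BZ.ldist (Q y))\<^sup>2 \<le> M\<^sup>2 * (1 / (BZ.ldist (Q p))\<^sup>2)" if Q: "Q \<in> poles" for Q
    proof (cases "Q y \<in> rlattice X")
      case True
      then have "BZ.ldist (Q y) = 0" by (simp only: BZ.ldist_eq_0_iff)
      then show ?thesis by simp
    next
      case False
      have Qt: "Q \<in> transfers" using Q poles_sub by blast
      have lat: "real n *\<^sub>R Q y \<in> rlattice X"
        unfolding y_def by (rule transfer_grid[OF Qt n VV.nearest_scaled[OF n]])
      have cy: "c / real n \<le> BZ.ldist (Q y)" by (rule BZ.ldist_scaled_lower[OF n lat False c(2)])
      have "Q p = Q y + Q (p - y)" using mom_map_plus[OF mom_map_transfers[OF Qt], of y "p - y"] by simp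
      then have "BZ.ldist (Q p) \<le> BZ.ldist (Q y) + norm (Q (p - y))" using BZ.ldist_add_le by metis
      also have "norm (Q (p - y)) \<le> L * (B / real n)"
        using L(2)[OF Q, of "p - y"] VV.nearest_dist[OF n B(2), of p "((s, s, s), s)"] mult_left_mono[OF _ L(1)]
        unfolding y_def by (meson order_trans)
      also have "L * (B / real n) = L * B / c * (c / real n)" using c by simp
      also have "\<dots> \<le> L * B / c * BZ.ldist (Q y)" using cy L B c by (intro mult_left_mono) auto
      finally have le: "BZ.ldist (Q p) \<le> M * BZ.ldist (Q y)" by (simp add: M_def distrib_right)
      have "BZ.ldist (Q p) \<noteq> 0" using p Qt BZ.ldist_eq_0_iff by blast
      then have dp: "0 < BZ.ldist (Q p)" using infdist_nonneg[of "Q p" "rlattice X"] by linarith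
      have "0 < c / real n" using c n by simp
      then have dy: "0 < BZ.ldist (Q y)" using cy by linarith
      have "(BZ.ldist (Q p))\<^sup>2 \<le> (M * BZ.ldist (Q y))\<^sup>2" using le dp by (intro power_mono) auto
      then show ?thesis using dp dy by (simp add: power_mult_distrib divide_simps)
    qed
    have "weight y \<le> M\<^sup>2 * 1 + (\<Sum>Q\<in>poles. M\<^sup>2 * (1 / (BZ.ldist (Q p))\<^sup>2))"
      unfolding weight_def using M by (intro add_mono sum_mono each) (auto simp: one_le_power)
    also have "\<dots> = M\<^sup>2 * weight p" by (simp add: weight_def sum_distrib_left distrib_left)
    finally show ?thesis by (simp add: y_def)
  qed
  then show ?thesis by (intro exI[of _ "M\<^sup>2"]) auto
qed

lemma
  assumes P: "tame \<gamma> P" and \<gamma>: "\<gamma> \<le> 1"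
  shows tame_grid_limit: "(\<lambda>n. VV.gavg (Suc n) ((s, s, s), s) P) \<longlonglongrightarrow> (1 / measure lborel cell4) *\<^sub>R (LINT p:cell4|lborel. P p)"
    and tame_integrable: "set_integrable lborel cell4 P"
proof -
  obtain C where C: "0 \<le> C" and CP: "\<And>p. norm (P p) \<le> C * weight p" using tame_weight[OF P \<gamma>] by blast
  obtain M where M: "0 \<le> M" "\<And>n p s. 0 < n \<Longrightarrow> (\<forall>Q\<in>transfers. Q p \<notin> rlattice X) \<Longrightarrow>
    weight (VV.nearest n ((s, s, s), s) p) \<le> M * weight p" using weight_nearest by blast
  have cont: "AE p in lborel. isCont P p"
    using transfers_AE by eventually_elim (rule tame_isCont[OF P], blast)
  have g: "set_integrable lborel cell4 (\<lambda>p. C * (M * weight p))"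
    using weight_integrable by (intro set_integrable_mult_right) auto
  have dom: "AE p in lborel. p \<in> cell4 \<longrightarrow> norm (P (VV.nearest n ((s, s, s), s) p)) \<le> C * (M * weight p)" if "0 < n" for n
    using transfers_AE
  proof eventually_elim
    case (elim p)
    then have "C * weight (VV.nearest n ((s, s, s), s) p) \<le> C * (M * weight p)"
      using M(2)[OF that] by (intro mult_left_mono C) blast
    then show ?case using CP[of "VV.nearest n ((s, s, s), s) p"] by simp
  qed
  show "(\<lambda>n. VV.gavg (Suc n) ((s, s, s), s) P) \<longlonglongrightarrow> (1 / measure lborel cell4) *\<^sub>R (LINT p:cell4|lborel. P p)"
    by (rule VV.grid_limit[OF tame_measurable[OF P] tame_periodic[OF P] cont g dom])
  show "set_integrable lborel cell4 P"
    by (rule VV.grid_integrable[OF tame_measurable[OF P] tame_periodic[OF P] cont g dom])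
qed

lemma tame_quadrature:
  assumes P: "tame \<gamma> P" and \<gamma>: "\<gamma> \<le> 1"
  shows "\<exists>C\<ge>0. \<forall>n s. 0 < n \<longrightarrow>
    norm (VV.gavg n ((s, s, s), s) P - (1 / measure lborel cell4) *\<^sub>R (LINT p:cell4|lborel. P p)) \<le> C / real n ^ (3 - 2 * \<gamma>)"
proof -
  obtain C where C: "0 \<le> C" "\<And>n s. 0 < n \<Longrightarrow>
    norm (VV.gavg n ((s, s, s), s) P - VV.gavg (2 * n) ((s, s, s), s) P) \<le> C / real n ^ (3 - 2 * \<gamma>)"
    using tame_halving[OF P \<gamma>] by blast
  have "norm (VV.gavg n ((s, s, s), s) P - (1 / measure lborel cell4) *\<^sub>R (LINT p:cell4|lborel. P p))
    \<le> 2 * C / real n ^ (3 - 2 * \<gamma>)" if "0 < n" for n s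
    by (rule VV.gavg_error[OF C(2) tame_grid_limit[OF P \<gamma>]]) (use \<gamma> that in auto)
  then show ?thesis using C(1) by (intro exI[of _ "2 * C"]) auto
qed

lemma tame_slice_integrable:
  assumes P: "tame \<gamma> P" and \<gamma>: "\<gamma> \<le> 1"
  shows "set_integrable lborel (bz X) (\<lambda>k. P (x, k))"
proof -
  obtain C where C: "0 \<le> C" and CP: "\<And>p. norm (P p) \<le> C * weight p" using tame_weight[OF P \<gamma>] by blast
  have [measurable]: "(\<lambda>k. P (x, k)) \<in> borel_measurable borel"
    using measurable_compose[OF _ tame_measurable[OF P], of "\<lambda>k. (x, k)" borel]
    by (simp add: borel_measurable_continuous_onI continuous_intros)
  show ?thesis
  proof (rule set_integrable_bound)
    show "set_integrable lborel (bz X) (\<lambda>k. C * weight (x, k))"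
      using weight_slice_integrable by (intro set_integrable_mult_right) auto
    show "set_borel_measurable lborel (bz X) (\<lambda>k. P (x, k))" unfolding set_borel_measurable_def by measurable
    show "AE k in lborel. k \<in> bz X \<longrightarrow> norm (P (x, k)) \<le> norm (C * weight (x, k))"
    proof (intro AE_I2 impI)
      fix k show "norm (P (x, k)) \<le> norm (C * weight (x, k))"
        using CP[of "(x, k)"] abs_ge_self[of "C * weight (x, k)"] unfolding real_norm_def by linarith
    qed
  qed
qed

lemma tame_fubini:
  assumes P: "tame \<gamma> P" and \<gamma>: "\<gamma> \<le> 1"
  shows "(LINT x:externals|lborel. LINT k:bz X|lborel. P (x, k)) = (LINT p:cell4|lborel. P p)"
proof -
  have int: "integrable (lborel \<Otimes>\<^sub>M lborel) (\<lambda>p. indicator cell4 p *\<^sub>R P p)"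
    using tame_integrable[OF P \<gamma>] by (simp add: set_integrable_def lborel_prod)
  have "(LINT x:externals|lborel. LINT k:bz X|lborel. P (x, k))
      = (\<integral>x. \<integral>k. indicator cell4 (x, k) *\<^sub>R P (x, k) \<partial>lborel \<partial>lborel)"
    unfolding set_lebesgue_integral_def
    by (simp add: cell4_externals indicator_times flip: scaleR_scaleR)
  also have "\<dots> = (\<integral>p. indicator cell4 p *\<^sub>R P p \<partial>(lborel \<Otimes>\<^sub>M lborel))"
    by (rule lborel_pair.integral_fst'[OF int])
  finally show ?thesis by (simp add: lborel_prod set_lebesgue_integral_def)
qed

lemma measure_cell4: "measure lborel cell4 = measure lborel (bz X) ^ 4"
proof -
  have Times: "measure lborel (A \<times> B) = measure lborel A * measure lborel B"
    if "A \<in> sets borel" "B \<in> sets borel" for A :: "'a::euclidean_space set" and B :: "'b::euclidean_space set"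
    using that by (simp add: measure_def lborel.emeasure_pair_measure_Times enn2real_mult flip: lborel_prod)
  show ?thesis
    unfolding cell4_def by (simp add: Times borel_Times power4_eq_xxxx)
qed

end

section \<open>The energies as averages over four momenta\<close>

text \<open>What averages over meshes and over the Brillouin zone have in common. The set \<open>F\<close> is there for
integrability; for meshes it contains all functions.\<close>

definition averaging :: "((real^3 \<Rightarrow> complex) \<Rightarrow> complex) \<Rightarrow> (real^3 \<Rightarrow> complex) set \<Rightarrow> bool" where
  "averaging avg F \<longleftrightarrow>
     (\<forall>f\<in>F. \<forall>g\<in>F. (\<lambda>k. f k + g k) \<in> F \<and> avg (\<lambda>k. f k + g k) = avg f + avg g) \<and>
     (\<forall>c. \<forall>f\<in>F. (\<lambda>k. c * f k) \<in> F \<and> avg (\<lambda>k. c * f k) = c * avg f) \<and>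
     (\<forall>c. (\<lambda>k. c) \<in> F \<and> avg (\<lambda>k. c) = c)"

lemma averaging_add: "averaging avg F \<Longrightarrow> f \<in> F \<Longrightarrow> g \<in> F \<Longrightarrow> (\<lambda>k. f k + g k) \<in> F"
  "averaging avg F \<Longrightarrow> f \<in> F \<Longrightarrow> g \<in> F \<Longrightarrow> avg (\<lambda>k. f k + g k) = avg f + avg g"
  and averaging_cmult: "averaging avg F \<Longrightarrow> f \<in> F \<Longrightarrow> (\<lambda>k. c * f k) \<in> F"
  "averaging avg F \<Longrightarrow> f \<in> F \<Longrightarrow> avg (\<lambda>k. c * f k) = c * avg f"
  and averaging_const: "averaging avg F \<Longrightarrow> (\<lambda>k. c) \<in> F" "averaging avg F \<Longrightarrow> avg (\<lambda>k. c) = c"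
  unfolding averaging_def by blast+

lemma averaging_sum:
  assumes avg: "averaging avg F"
  shows "finite S \<Longrightarrow> (\<And>x. x \<in> S \<Longrightarrow> f x \<in> F) \<Longrightarrow>
    (\<lambda>k. \<Sum>x\<in>S. f x k) \<in> F \<and> avg (\<lambda>k. \<Sum>x\<in>S. f x k) = (\<Sum>x\<in>S. avg (f x))"
proof (induction S rule: finite_induct)
  case empty
  then show ?case using averaging_const[OF avg, of 0] by simp
next
  case (insert x S)
  then have fx: "f x \<in> F" and IH: "(\<lambda>k. \<Sum>x\<in>S. f x k) \<in> F" "avg (\<lambda>k. \<Sum>x\<in>S. f x k) = (\<Sum>x\<in>S. avg (f x))" by auto
  show ?case
    using averaging_add[OF avg fx IH(1)] insert.hyps by (simp add: IH(2))
qed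

lemma averaging_mesh: "finite K \<Longrightarrow> K \<noteq> {} \<Longrightarrow> averaging (mesh_avg K) UNIV"
  unfolding averaging_def mesh_avg_def
  by (auto simp: sum.distrib add_divide_distrib sum_distrib_left card_gt_0_iff)

text \<open>The terms of the MP3 amplitude before averaging, as functions of the free momentum \<open>k\<close>.\<close>

definition hole_ladder :: "crystal \<Rightarrow> bandk \<Rightarrow> bandk \<Rightarrow> bandk \<Rightarrow> bandk \<Rightarrow> real^3 \<Rightarrow> complex" where
  "hole_ladder X I J A B k = (\<Sum>k'\<in>occ X. \<Sum>l\<in>occ X.
     eri X (k', k) (l, snd I + snd J - k) I J * mp2_amp X (k', k) (l, snd I + snd J - k) A B)"

definition particle_ladder :: "crystal \<Rightarrow> bandk \<Rightarrow> bandk \<Rightarrow> bandk \<Rightarrow> bandk \<Rightarrow> real^3 \<Rightarrow> complex" where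
  "particle_ladder X I J A B k = (\<Sum>c\<in>vir X. \<Sum>d\<in>vir X.
     eri X A B (c, k) (d, snd I + snd J - k) * mp2_amp X I J (c, k) (d, snd I + snd J - k))"

definition ring_integrand :: "crystal \<Rightarrow> bandk \<Rightarrow> bandk \<Rightarrow> bandk \<Rightarrow> bandk \<Rightarrow> real^3 \<Rightarrow> complex" where
  "ring_integrand X I J A B k = (\<Sum>k'\<in>occ X. \<Sum>c\<in>vir X.
     (2 * eri X A (k', k) I (c, snd A + k - snd I) - eri X A (k', k) (c, snd A + k - snd I) I)
        * mp2_amp X (k', k) J (c, snd A + k - snd I) B
      - eri X A (k', k) I (c, snd A + k - snd I) * mp2_amp X (k', k) J B (c, snd A + k - snd I)
      - eri X A (k', k) (c, snd A + k - snd J) J * mp2_amp X (k', k) I B (c, snd A + k - snd J))"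

definition mp3_numerator :: "crystal \<Rightarrow> bandk \<Rightarrow> bandk \<Rightarrow> bandk \<Rightarrow> bandk \<Rightarrow> real^3 \<Rightarrow> complex" where
  "mp3_numerator X I J A B k = eri X A B I J + hole_ladder X I J A B k + particle_ladder X I J A B k
     + (ring_integrand X I J A B k + ring_integrand X J I B A k)"

lemma mp3_amp_average:
  assumes avg: "averaging avg F"
    and F: "hole_ladder X I J A B \<in> F" "particle_ladder X I J A B \<in> F"
      "ring_integrand X I J A B \<in> F" "ring_integrand X J I B A \<in> F"
  shows "mp3_numerator X I J A B \<in> F"
    "mp3_amp X avg I J A B = avg (mp3_numerator X I J A B) / complex_of_real (denom X I J A B)"
proof -
  have "mp3_numerator X I J A B \<in> F \<and> avg (mp3_numerator X I J A B) = eri X A B I J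
     + avg (hole_ladder X I J A B) + avg (particle_ladder X I J A B)
     + (avg (ring_integrand X I J A B) + avg (ring_integrand X J I B A))"
    unfolding mp3_numerator_def[abs_def]
    using F by (simp add: averaging_add[OF avg] averaging_const[OF avg])
  then show "mp3_numerator X I J A B \<in> F"
    "mp3_amp X avg I J A B = avg (mp3_numerator X I J A B) / complex_of_real (denom X I J A B)"
    by (simp_all add: mp3_amp_def mp3_ring_def hole_ladder_def[abs_def] particle_ladder_def[abs_def]
        ring_integrand_def[abs_def] Let_def)
qed

context insulator
begin

definition kB :: "mom4 \<Rightarrow> real^3" where "kB p = kI p + kJ p - kA p"

lemma mom_map_kB: "mom_map kB"
  unfolding kB_def by (intro mom_map_intros)

lemma occ_finite: "finite (occ X)" and vir_finite: "finite (vir X)"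
  by (simp_all add: occ_def vir_def)

lemma tame_eri_regular:
  assumes "n1 \<in> bands" "n2 \<in> bands" "n3 \<in> bands" "n4 \<in> bands" "n1 \<noteq> n3" "n2 \<noteq> n4"
    "mom_map f1" "mom_map f2" "mom_map f3" "Q \<in> transfers"
    "(\<forall>p. f3 p - f1 p = Q p) \<or> (\<forall>p. f3 p - f1 p = - Q p)"
  shows "tame 0 (\<lambda>p. eri X (n1, f1 p) (n2, f2 p) (n3, f3 p) (n4, f4 p))"
  using assms by (intro tame_eri) auto

lemma tame_eri_singular:
  assumes "n1 \<in> bands" "n2 \<in> bands" "n3 \<in> bands" "n4 \<in> bands"
    "mom_map f1" "mom_map f2" "mom_map f3" "Q \<in> poles"
    "(\<forall>p. f3 p - f1 p = Q p) \<or> (\<forall>p. f3 p - f1 p = - Q p)"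
  shows "tame 1 (\<lambda>p. eri X (n1, f1 p) (n2, f2 p) (n3, f3 p) (n4, f4 p))"
  using assms poles_sub by (intro tame_eri) auto

text \<open>The integral in an amplitude pairs virtual with occupied bands, hence its order is 0.\<close>

lemma tame_mp2:
  assumes b: "i \<in> occ X" "j \<in> occ X" "a \<in> vir X" "b \<in> vir X"
    and f: "mom_map f1" "mom_map f2" "mom_map f3" "\<And>p. f4 p = f1 p + f2 p - f3 p"
    and Q: "Q \<in> transfers" "(\<forall>p. f1 p - f3 p = Q p) \<or> (\<forall>p. f1 p - f3 p = - Q p)"
  shows "tame 0 (\<lambda>p. mp2_amp X (i, f1 p) (j, f2 p) (a, f3 p) (b, f4 p))"
proof -
  have "f4 = (\<lambda>p. f1 p + f2 p - f3 p)" using f(4) by (rule ext)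
  then have f4: "mom_map f4" using mom_map_diff[OF mom_map_add[OF f(1,2)] f(3)] by (simp only:)
  have "tame 0 (\<lambda>p. eri X (a, f3 p) (b, f4 p) (i, f1 p) (j, f2 p))"
    using b occ_vir_distinct[OF b(1,3)] occ_vir_distinct[OF b(2,4)]
    by (intro tame_eri_regular[OF _ _ _ _ _ _ f(3) f4 f(1) Q]) (auto intro: occ_band vir_band)
  from tame_mult[OF this tame_inverse_denom[OF b f]] show ?thesis
    by (simp add: mp2_amp_def divide_inverse)
qed

lemma tame_product:
  assumes "tame \<gamma> P" "tame 0 R" "\<gamma> \<le> 1" shows "tame 1 (\<lambda>p. P p * R p)"
  using tame_mono[OF tame_mult[OF assms(1,2)], of 1] assms(3) by simp

lemma poles_mem: "(\<lambda>p. kK p - kI p) \<in> poles" "(\<lambda>p. kK p - kJ p) \<in> poles" "(\<lambda>p. kK p - kA p) \<in> poles"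
  by (auto simp: poles_def)

lemma transfers_mem: "(\<lambda>p. kK p - kI p) \<in> transfers" "(\<lambda>p. kK p - kJ p) \<in> transfers" "(\<lambda>p. kK p - kA p) \<in> transfers"
  "(\<lambda>p. kA p - kI p) \<in> transfers" "(\<lambda>p. kJ p - kA p) \<in> transfers" "(\<lambda>p. kK p + kA p - kI p - kJ p) \<in> transfers"
  by (auto simp: transfers_def poles_def)

context
  fixes i j a b :: nat
  assumes b: "i \<in> occ X" "j \<in> occ X" "a \<in> vir X" "b \<in> vir X"
begin

lemma tame_W: "tame 0 (\<lambda>p. W X (i, kI p) (j, kJ p) (a, kA p) (b, kB p))"
proof -
  have "tame 0 (\<lambda>p. eri X (i, kI p) (j, kJ p) (a, kA p) (b, kB p))"
    by (rule tame_eri_regular[OF _ _ _ _ _ _ mom_map_basic(1,2,3) transfers_mem(4)])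
       (use b occ_vir_distinct in \<open>auto intro: occ_band vir_band\<close>)
  moreover have "tame 0 (\<lambda>p. eri X (i, kI p) (j, kJ p) (b, kB p) (a, kA p))"
    by (rule tame_eri_regular[OF _ _ _ _ _ _ mom_map_basic(1,2) mom_map_kB transfers_mem(5)])
       (use b occ_vir_distinct in \<open>auto intro: occ_band vir_band simp: kB_def\<close>)
  ultimately show ?thesis unfolding W_def by (intro tame_diff tame_cmult)
qed

lemma tame_driver: "tame 0 (\<lambda>p. eri X (a, kA p) (b, kB p) (i, kI p) (j, kJ p))"
  by (rule tame_eri_regular[OF _ _ _ _ _ _ mom_map_basic(3) mom_map_kB mom_map_basic(1) transfers_mem(4)])
     (use b occ_vir_distinct in \<open>auto intro: occ_band vir_band\<close>)

lemma tame_mp2_base: "tame 0 (\<lambda>p. mp2_amp X (i, kI p) (j, kJ p) (a, kA p) (b, kB p))"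
  by (rule tame_mp2[OF b mom_map_basic(1,2,3) _ transfers_mem(4)]) (auto simp: kB_def)

text \<open>In the ladder terms the integral pairs bands of the same kind, so that it may be unbounded; the
amplitude is always of order 0.\<close>

lemma tame_hole_ladder:
  "tame 1 (\<lambda>p. hole_ladder X (i, kI p) (j, kJ p) (a, kA p) (b, kB p) (kK p))"
  unfolding hole_ladder_def snd_conv
proof (intro tame_sum)
  fix k' l assume k: "k' \<in> occ X" "l \<in> occ X"
  have m: "mom_map (\<lambda>p. kI p + kJ p - kK p)" by (intro mom_map_intros)
  show "tame 1 (\<lambda>p. eri X (k', kK p) (l, kI p + kJ p - kK p) (i, kI p) (j, kJ p)
      * mp2_amp X (k', kK p) (l, kI p + kJ p - kK p) (a, kA p) (b, kB p))"
  proof (rule tame_product[OF _ _ order_refl])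
    show "tame 1 (\<lambda>p. eri X (k', kK p) (l, kI p + kJ p - kK p) (i, kI p) (j, kJ p))"
      by (rule tame_eri_singular[OF _ _ _ _ mom_map_basic(4) m mom_map_basic(1) poles_mem(1)])
         (use b k in \<open>auto intro: occ_band\<close>)
    show "tame 0 (\<lambda>p. mp2_amp X (k', kK p) (l, kI p + kJ p - kK p) (a, kA p) (b, kB p))"
      by (rule tame_mp2[OF k b(3,4) mom_map_basic(4) m mom_map_basic(3) _ transfers_mem(3)]) (auto simp: kB_def)
  qed
qed

lemma tame_particle_ladder:
  "tame 1 (\<lambda>p. particle_ladder X (i, kI p) (j, kJ p) (a, kA p) (b, kB p) (kK p))"
  unfolding particle_ladder_def snd_conv
proof (intro tame_sum)
  fix c d assume c: "c \<in> vir X" "d \<in> vir X"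
  show "tame 1 (\<lambda>p. eri X (a, kA p) (b, kB p) (c, kK p) (d, kI p + kJ p - kK p)
      * mp2_amp X (i, kI p) (j, kJ p) (c, kK p) (d, kI p + kJ p - kK p))"
  proof (rule tame_product[OF _ _ order_refl])
    show "tame 1 (\<lambda>p. eri X (a, kA p) (b, kB p) (c, kK p) (d, kI p + kJ p - kK p))"
      by (rule tame_eri_singular[OF _ _ _ _ mom_map_basic(3) mom_map_kB mom_map_basic(4) poles_mem(3)])
         (use b c in \<open>auto intro: vir_band\<close>)
    show "tame 0 (\<lambda>p. mp2_amp X (i, kI p) (j, kJ p) (c, kK p) (d, kI p + kJ p - kK p))"
      by (rule tame_mp2[OF b(1,2) c mom_map_basic(1,2,4) _ transfers_mem(1)]) auto
  qed
qed

text \<open>Of the integrals in the ring terms, those which pair \<open>A\<close> with \<open>C\<close> may be unbounded. The external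
momenta are left open in order to cover the exchange of \<open>(I, A)\<close> and \<open>(J, B)\<close> as well.\<close>

lemma tame_ring:
  assumes f: "mom_map fI" "mom_map fJ" "mom_map fA" "mom_map fB" "\<And>p. fB p = fI p + fJ p - fA p"
    and QA: "QA \<in> transfers" "(\<forall>p. fI p - fA p = QA p) \<or> (\<forall>p. fI p - fA p = - QA p)"
    and QB: "QB \<in> transfers" "\<forall>p. kK p - fB p = QB p"
    and QI: "(\<lambda>p. kK p - fI p) \<in> poles" and QJ: "(\<lambda>p. kK p - fJ p) \<in> poles"
  shows "tame 1 (\<lambda>p. ring_integrand X (i, fI p) (j, fJ p) (a, fA p) (b, fB p) (kK p))"
  unfolding ring_integrand_def snd_conv
proof (intro tame_sum)
  fix k' c assume k: "k' \<in> occ X" and c: "c \<in> vir X"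
  define fC fC' where "fC p = fA p + kK p - fI p" and "fC' p = fA p + kK p - fJ p" for p
  have mC: "mom_map fC" "mom_map fC'" unfolding fC_def fC'_def by (intro mom_map_intros f)+
  note bd = occ_band[OF b(1)] occ_band[OF b(2)] vir_band[OF b(3)] vir_band[OF b(4)] occ_band[OF k] vir_band[OF c]
  have ne: "a \<noteq> i" "k' \<noteq> c" using occ_vir_distinct b k c by blast+
  have e1: "tame 0 (\<lambda>p. eri X (a, fA p) (k', kK p) (i, fI p) (c, fC p))"
    by (rule tame_eri_regular[OF bd(3,5,1,6) ne f(3) mom_map_basic(4) f(1) QA])
  have e2: "tame 1 (\<lambda>p. eri X (a, fA p) (k', kK p) (c, fC p) (i, fI p))"
    by (rule tame_eri_singular[OF bd(3,5,6,1) f(3) mom_map_basic(4) mC(1) QI]) (simp add: fC_def)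
  have e3: "tame 1 (\<lambda>p. eri X (a, fA p) (k', kK p) (c, fC' p) (j, fJ p))"
    by (rule tame_eri_singular[OF bd(3,5,6,2) f(3) mom_map_basic(4) mC(2) QJ]) (simp add: fC'_def)
  have t1: "tame 0 (\<lambda>p. mp2_amp X (k', kK p) (j, fJ p) (c, fC p) (b, fB p))"
    by (rule tame_mp2[OF k b(2) c b(4) mom_map_basic(4) f(2) mC(1) _ QA(1)])
       (use QA(2) in \<open>auto simp: fC_def f(5)\<close>)
  have t2: "tame 0 (\<lambda>p. mp2_amp X (k', kK p) (j, fJ p) (b, fB p) (c, fC p))"
    by (rule tame_mp2[OF k b(2,4) c mom_map_basic(4) f(2,4) _ QB(1)])
       (use QB(2) in \<open>auto simp: fC_def f(5)\<close>)
  have t3: "tame 0 (\<lambda>p. mp2_amp X (k', kK p) (i, fI p) (b, fB p) (c, fC' p))"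
    by (rule tame_mp2[OF k b(1,4) c mom_map_basic(4) f(1,4) _ QB(1)])
       (use QB(2) in \<open>auto simp: fC'_def f(5)\<close>)
  have e12: "tame 1 (\<lambda>p. 2 * eri X (a, fA p) (k', kK p) (i, fI p) (c, fC p) - eri X (a, fA p) (k', kK p) (c, fC p) (i, fI p))"
    using tame_mono[OF e1, of 1] e2 by (intro tame_diff tame_cmult) auto
  show "tame 1 (\<lambda>p. (2 * eri X (a, fA p) (k', kK p) (i, fI p) (c, fA p + kK p - fI p)
          - eri X (a, fA p) (k', kK p) (c, fA p + kK p - fI p) (i, fI p))
        * mp2_amp X (k', kK p) (j, fJ p) (c, fA p + kK p - fI p) (b, fB p)
      - eri X (a, fA p) (k', kK p) (i, fI p) (c, fA p + kK p - fI p) * mp2_amp X (k', kK p) (j, fJ p) (b, fB p) (c, fA p + kK p - fI p)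
      - eri X (a, fA p) (k', kK p) (c, fA p + kK p - fJ p) (j, fJ p) * mp2_amp X (k', kK p) (i, fI p) (b, fB p) (c, fA p + kK p - fJ p))"
    unfolding fC_def[symmetric] fC'_def[symmetric]
    by (intro tame_diff tame_product[OF e12 t1] tame_product[OF e1 t2] tame_product[OF e3 t3]) auto
qed

end

lemma tame_ring_direct:
  assumes b: "i \<in> occ X" "j \<in> occ X" "a \<in> vir X" "b \<in> vir X"
  shows "tame 1 (\<lambda>p. ring_integrand X (i, kI p) (j, kJ p) (a, kA p) (b, kB p) (kK p))"
  by (rule tame_ring[OF b mom_map_basic(1,2,3) mom_map_kB _ transfers_mem(4) _ transfers_mem(6) _ poles_mem(1,2)])
     (auto simp: kB_def)

lemma tame_ring_exchanged:
  assumes b: "i \<in> occ X" "j \<in> occ X" "a \<in> vir X" "b \<in> vir X"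
  shows "tame 1 (\<lambda>p. ring_integrand X (j, kJ p) (i, kI p) (b, kB p) (a, kA p) (kK p))"
  by (rule tame_ring[OF b(2,1,4,3) mom_map_basic(2,1) mom_map_kB mom_map_basic(3) _ transfers_mem(4) _ transfers_mem(3) _ poles_mem(2,1)])
     (auto simp: kB_def)

lemma tame_mp3_numerator:
  assumes b: "i \<in> occ X" "j \<in> occ X" "a \<in> vir X" "b \<in> vir X"
  shows "tame 1 (\<lambda>p. mp3_numerator X (i, kI p) (j, kJ p) (a, kA p) (b, kB p) (kK p))"
  unfolding mp3_numerator_def
  using tame_mono[OF tame_driver[OF b], of 1]
  by (intro tame_add tame_hole_ladder tame_particle_ladder tame_ring_direct tame_ring_exchanged b) auto

definition mp2_integrand :: "mom4 \<Rightarrow> complex" where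
  "mp2_integrand p = (\<Sum>i\<in>occ X. \<Sum>j\<in>occ X. \<Sum>a\<in>vir X. \<Sum>b\<in>vir X.
     W X (i, kI p) (j, kJ p) (a, kA p) (b, kB p) * mp2_amp X (i, kI p) (j, kJ p) (a, kA p) (b, kB p))"

definition mp3_integrand :: "mom4 \<Rightarrow> complex" where
  "mp3_integrand p = (\<Sum>i\<in>occ X. \<Sum>j\<in>occ X. \<Sum>a\<in>vir X. \<Sum>b\<in>vir X.
     W X (i, kI p) (j, kJ p) (a, kA p) (b, kB p)
       * inverse (complex_of_real (denom X (i, kI p) (j, kJ p) (a, kA p) (b, kB p)))
       * mp3_numerator X (i, kI p) (j, kJ p) (a, kA p) (b, kB p) (kK p))"

lemma tame_mp2_integrand: "tame 0 mp2_integrand"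
proof -
  have "tame 0 (\<lambda>p. W X (i, kI p) (j, kJ p) (a, kA p) (b, kB p) * mp2_amp X (i, kI p) (j, kJ p) (a, kA p) (b, kB p))"
    if b: "i \<in> occ X" "j \<in> occ X" "a \<in> vir X" "b \<in> vir X" for i j a b
    using tame_mult[OF tame_W[OF b] tame_mp2_base[OF b]] by simp
  then show ?thesis unfolding mp2_integrand_def[abs_def] by (intro tame_sum)
qed

lemma tame_mp3_integrand: "tame 1 mp3_integrand"
proof -
  have "tame 1 (\<lambda>p. W X (i, kI p) (j, kJ p) (a, kA p) (b, kB p)
       * inverse (complex_of_real (denom X (i, kI p) (j, kJ p) (a, kA p) (b, kB p)))
       * mp3_numerator X (i, kI p) (j, kJ p) (a, kA p) (b, kB p) (kK p))"
    if b: "i \<in> occ X" "j \<in> occ X" "a \<in> vir X" "b \<in> vir X" for i j a b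
    using tame_mult[OF tame_mult[OF tame_W[OF b] tame_inverse_denom[OF b mom_map_basic(1,2,3) kB_def]] tame_mp3_numerator[OF b]]
    by simp
  then show ?thesis unfolding mp3_integrand_def[abs_def] by (intro tame_sum)
qed

lemma averaging_bz: "averaging (bz_avg X) {f. set_integrable lborel (bz X) f}"
  unfolding averaging_def bz_avg_def
proof (intro conjI allI ballI)
  fix c :: complex
  show "(\<lambda>k. c) \<in> {f. set_integrable lborel (bz X) f}"
    using BZ.cell_measure_finite by (simp add: set_integrable_def)
  show "(LINT k:bz X|lborel. c) / complex_of_real (measure lborel (bz X)) = c"
    using BZ.cell_measure_finite BZ.cell_measure_pos
    by (simp add: set_lebesgue_integral_def scaleR_conv_of_real)
qed (auto simp: add_divide_distrib)

text \<open>The integrand is constant in the free momentum.\<close>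

lemma energy_summand_mp2:
  assumes "averaging avg F"
  shows "energy_summand X (mp2_amp X) ki kj ka = avg (\<lambda>k. mp2_integrand ((ki, kj, ka), k))"
  by (simp add: energy_summand_def mp2_integrand_def mom_defs kB_def Let_def averaging_const[OF assms])

text \<open>The average in the amplitude is linear, so it can be moved to the front of the sum over bands.\<close>

lemma energy_summand_mp3:
  assumes avg: "averaging avg F" and F: "\<And>P. tame 1 P \<Longrightarrow> (\<lambda>k. P ((ki, kj, ka), k)) \<in> F"
  shows "energy_summand X (mp3_amp X avg) ki kj ka = avg (\<lambda>k. mp3_integrand ((ki, kj, ka), k))"
proof -
  define kb where "kb = ki + kj - ka"
  have mom: "kI ((ki, kj, ka), k) = ki" "kJ ((ki, kj, ka), k) = kj" "kA ((ki, kj, ka), k) = ka"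
    "kK ((ki, kj, ka), k) = k" "kB ((ki, kj, ka), k) = kb" for k
    by (simp_all add: mom_defs kB_def kb_def)
  define w where "w i j a b = W X (i, ki) (j, kj) (a, ka) (b, kb) * inverse (complex_of_real (denom X (i, ki) (j, kj) (a, ka) (b, kb)))" for i j a b
  have summand: "mp3_numerator X (i, ki) (j, kj) (a, ka) (b, kb) \<in> F \<and>
      W X (i, ki) (j, kj) (a, ka) (b, kb) * mp3_amp X avg (i, ki) (j, kj) (a, ka) (b, kb)
      = avg (\<lambda>k. w i j a b * mp3_numerator X (i, ki) (j, kj) (a, ka) (b, kb) k)"
    if b: "i \<in> occ X" "j \<in> occ X" "a \<in> vir X" "b \<in> vir X" for i j a b
  proof -
    have "hole_ladder X (i, ki) (j, kj) (a, ka) (b, kb) \<in> F" "particle_ladder X (i, ki) (j, kj) (a, ka) (b, kb) \<in> F"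
      "ring_integrand X (i, ki) (j, kj) (a, ka) (b, kb) \<in> F" "ring_integrand X (j, kj) (i, ki) (b, kb) (a, ka) \<in> F"
      using F[OF tame_hole_ladder[OF b]] F[OF tame_particle_ladder[OF b]] F[OF tame_ring_direct[OF b]] F[OF tame_ring_exchanged[OF b]]
      by (simp_all add: mom)
    note amp = mp3_amp_average[OF avg this]
    have "avg (\<lambda>k. w i j a b * mp3_numerator X (i, ki) (j, kj) (a, ka) (b, kb) k)
        = w i j a b * avg (mp3_numerator X (i, ki) (j, kj) (a, ka) (b, kb))"
      by (rule averaging_cmult(2)[OF avg amp(1)])
    then show ?thesis using amp(1) by (simp only: amp(2)) (simp add: w_def divide_inverse mult_ac)
  qed
  \<comment> \<open>The sums over \<open>b\<close>, \<open>a\<close>, \<open>j\<close> and \<open>i\<close> are exchanged with the average one after the other.\<close>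
  have s4: "(\<lambda>k. \<Sum>b\<in>vir X. w i j a b * mp3_numerator X (i, ki) (j, kj) (a, ka) (b, kb) k) \<in> F \<and>
      avg (\<lambda>k. \<Sum>b\<in>vir X. w i j a b * mp3_numerator X (i, ki) (j, kj) (a, ka) (b, kb) k)
      = (\<Sum>b\<in>vir X. W X (i, ki) (j, kj) (a, ka) (b, kb) * mp3_amp X avg (i, ki) (j, kj) (a, ka) (b, kb))"
    if "i \<in> occ X" "j \<in> occ X" "a \<in> vir X" for i j a
    using averaging_sum[OF avg vir_finite, of "\<lambda>b k. w i j a b * mp3_numerator X (i, ki) (j, kj) (a, ka) (b, kb) k"]
      averaging_cmult(1)[OF avg] summand[OF that] by simp
  have s3: "(\<lambda>k. \<Sum>a\<in>vir X. \<Sum>b\<in>vir X. w i j a b * mp3_numerator X (i, ki) (j, kj) (a, ka) (b, kb) k) \<in> F \<and>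
      avg (\<lambda>k. \<Sum>a\<in>vir X. \<Sum>b\<in>vir X. w i j a b * mp3_numerator X (i, ki) (j, kj) (a, ka) (b, kb) k)
      = (\<Sum>a\<in>vir X. \<Sum>b\<in>vir X. W X (i, ki) (j, kj) (a, ka) (b, kb) * mp3_amp X avg (i, ki) (j, kj) (a, ka) (b, kb))"
    if "i \<in> occ X" "j \<in> occ X" for i j
    using averaging_sum[OF avg vir_finite, of "\<lambda>a k. \<Sum>b\<in>vir X. w i j a b * mp3_numerator X (i, ki) (j, kj) (a, ka) (b, kb) k"]
      s4[OF that] by simp
  have s2: "(\<lambda>k. \<Sum>j\<in>occ X. \<Sum>a\<in>vir X. \<Sum>b\<in>vir X. w i j a b * mp3_numerator X (i, ki) (j, kj) (a, ka) (b, kb) k) \<in> F \<and>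
      avg (\<lambda>k. \<Sum>j\<in>occ X. \<Sum>a\<in>vir X. \<Sum>b\<in>vir X. w i j a b * mp3_numerator X (i, ki) (j, kj) (a, ka) (b, kb) k)
      = (\<Sum>j\<in>occ X. \<Sum>a\<in>vir X. \<Sum>b\<in>vir X. W X (i, ki) (j, kj) (a, ka) (b, kb) * mp3_amp X avg (i, ki) (j, kj) (a, ka) (b, kb))"
    if "i \<in> occ X" for i
    using averaging_sum[OF avg occ_finite, of "\<lambda>j k. \<Sum>a\<in>vir X. \<Sum>b\<in>vir X. w i j a b * mp3_numerator X (i, ki) (j, kj) (a, ka) (b, kb) k"]
      s3[OF that] by simp
  have "avg (\<lambda>k. \<Sum>i\<in>occ X. \<Sum>j\<in>occ X. \<Sum>a\<in>vir X. \<Sum>b\<in>vir X. w i j a b * mp3_numerator X (i, ki) (j, kj) (a, ka) (b, kb) k)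
      = (\<Sum>i\<in>occ X. \<Sum>j\<in>occ X. \<Sum>a\<in>vir X. \<Sum>b\<in>vir X. W X (i, ki) (j, kj) (a, ka) (b, kb) * mp3_amp X avg (i, ki) (j, kj) (a, ka) (b, kb))"
    using averaging_sum[OF avg occ_finite, of "\<lambda>i k. \<Sum>j\<in>occ X. \<Sum>a\<in>vir X. \<Sum>b\<in>vir X. w i j a b * mp3_numerator X (i, ki) (j, kj) (a, ka) (b, kb) k"]
      s2 by simp
  then show ?thesis
    unfolding mp3_integrand_def energy_summand_def Let_def mom kb_def[symmetric] w_def[symmetric] by simp
qed

lemma mesh_eq_grid: "mesh X n s = BZ.grid n s"
  by (simp add: mesh_def BZ.grid_def)

lemma mesh_energy_average:
  assumes n: "0 < n"
    and T: "\<And>ki kj ka. energy_summand X T ki kj ka = mesh_avg (mesh X n s) (\<lambda>k. P ((ki, kj, ka), k))"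
  shows "mesh_energy X (mesh X n s) T = VV.gavg n ((s, s, s), s) P"
proof -
  define N where "N = card (BZ.grid n s)"
  have "mesh_energy X (mesh X n s) T
      = (\<Sum>i\<in>BZ.grid n s. \<Sum>j\<in>BZ.grid n s. \<Sum>a\<in>BZ.grid n s. \<Sum>k\<in>BZ.grid n s. P ((i, j, a), k)) / of_nat N / of_nat N ^ 3"
    unfolding mesh_energy_def T mesh_avg_def mesh_eq_grid N_def by (simp add: sum_divide_distrib)
  also have "\<dots> = VV.gavg n ((s, s, s), s) P"
    unfolding VV.gavg_def card_grid4 N_def[symmetric] sum4[symmetric]
    by (simp add: scaleR_conv_of_real power4_eq_xxxx power3_eq_cube)
  finally show ?thesis .
qed

lemma tdl_energy_average:
  assumes P: "tame \<gamma> P" "\<gamma> \<le> 1"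
    and T: "\<And>ki kj ka. energy_summand X T ki kj ka = bz_avg X (\<lambda>k. P ((ki, kj, ka), k))"
  shows "tdl_energy X T = (1 / measure lborel cell4) *\<^sub>R (LINT p:cell4|lborel. P p)"
proof -
  define V where "V = complex_of_real (measure lborel (bz X))"
  have "tdl_energy X T = (LINT x:externals|lborel. (LINT k:bz X|lborel. P (x, k)) / V) / V ^ 3"
    unfolding tdl_energy_def T bz_avg_def externals_def V_def by (simp add: case_prod_unfold)
  also have "\<dots> = (LINT p:cell4|lborel. P p) / V ^ 4"
    using tame_fubini[OF P] by (simp add: power4_eq_xxxx power3_eq_cube)
  also have "\<dots> = (1 / measure lborel cell4) *\<^sub>R (LINT p:cell4|lborel. P p)"
    by (simp add: measure_cell4 V_def scaleR_conv_of_real)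
  finally show ?thesis .
qed

lemma tame_slices: "tame 1 P \<Longrightarrow> (\<lambda>k. P (x, k)) \<in> {f. set_integrable lborel (bz X) f}"
  using tame_slice_integrable by blast

lemma averaging_grid: "0 < n \<Longrightarrow> averaging (mesh_avg (mesh X n s)) UNIV"
  unfolding mesh_eq_grid by (intro averaging_mesh BZ.finite_grid BZ.grid_nonempty)

section \<open>Finite-size errors\<close>

theorem mp2_error:
  "\<exists>C. \<forall>n s. 0 < n \<longrightarrow> cmod (mp2_energy_tdl X - mp2_energy X (mesh X n s)) \<le> C / real n ^ 3"
proof -
  obtain C where C: "\<And>n s. 0 < n \<Longrightarrow> norm (VV.gavg n ((s, s, s), s) mp2_integrand
      - (1 / measure lborel cell4) *\<^sub>R (LINT p:cell4|lborel. mp2_integrand p)) \<le> C / real n ^ (3 - 2 * 0)"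
    using tame_quadrature[OF tame_mp2_integrand] by blast
  have "mp2_energy_tdl X = (1 / measure lborel cell4) *\<^sub>R (LINT p:cell4|lborel. mp2_integrand p)"
    unfolding mp2_energy_tdl_def
    by (rule tdl_energy_average[OF tame_mp2_integrand _ energy_summand_mp2[OF averaging_bz]]) simp
  moreover have "mp2_energy X (mesh X n s) = VV.gavg n ((s, s, s), s) mp2_integrand" if "0 < n" for n s
    unfolding mp2_energy_def by (rule mesh_energy_average[OF that energy_summand_mp2[OF averaging_grid[OF that]]])
  ultimately show ?thesis using C by (intro exI[of _ C]) (simp add: norm_minus_commute)
qed

theorem mp3_error:
  "\<exists>C. \<forall>n s. 0 < n \<longrightarrow> cmod (mp3_energy_tdl X - mp3_energy X (mesh X n s)) \<le> C / real n"
proof -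
  obtain C where C: "\<And>n s. 0 < n \<Longrightarrow> norm (VV.gavg n ((s, s, s), s) mp3_integrand
      - (1 / measure lborel cell4) *\<^sub>R (LINT p:cell4|lborel. mp3_integrand p)) \<le> C / real n ^ (3 - 2 * 1)"
    using tame_quadrature[OF tame_mp3_integrand order_refl] by blast
  have "mp3_energy_tdl X = (1 / measure lborel cell4) *\<^sub>R (LINT p:cell4|lborel. mp3_integrand p)"
    unfolding mp3_energy_tdl_def
    by (rule tdl_energy_average[OF tame_mp3_integrand order_refl energy_summand_mp3[OF averaging_bz tame_slices]])
  moreover have "mp3_energy X (mesh X n s) = VV.gavg n ((s, s, s), s) mp3_integrand" if "0 < n" for n s
    unfolding mp3_energy_def
    by (rule mesh_energy_average[OF that energy_summand_mp3[OF averaging_grid[OF that]]]) simp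
  ultimately show ?thesis using C by (intro exI[of _ C]) (simp add: norm_minus_commute)
qed

end

theorem corollary2:
  fixes X :: crystal and s :: "nat \<Rightarrow> real^3"
  assumes "insulating_system X"
  shows "(\<lambda>n. cmod (mp2_energy_tdl X - mp2_energy X (mesh X n (s n))))
           \<in> O(\<lambda>n. real (n ^ 3) powr (- 1))
       \<and> (\<lambda>n. cmod (mp3_energy_tdl X - mp3_energy X (mesh X n (s n))))
           \<in> O(\<lambda>n. real (n ^ 3) powr (- 1 / 3))"
proof
  interpret insulator X by unfold_locales (rule assms)
  obtain C2 where C2: "\<And>n s. 0 < n \<Longrightarrow> cmod (mp2_energy_tdl X - mp2_energy X (mesh X n s)) \<le> C2 / real n ^ 3"
    using mp2_error by blast
  obtain C3 where C3: "\<And>n s. 0 < n \<Longrightarrow> cmod (mp3_energy_tdl X - mp3_energy X (mesh X n s)) \<le> C3 / real n"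
    using mp3_error by blast
  show "(\<lambda>n. cmod (mp2_energy_tdl X - mp2_energy X (mesh X n (s n)))) \<in> O(\<lambda>n. real (n ^ 3) powr (- 1))"
  proof (rule bigoI)
    show "\<forall>\<^sub>F n in sequentially. norm (cmod (mp2_energy_tdl X - mp2_energy X (mesh X n (s n))))
        \<le> C2 * norm (real (n ^ 3) powr (- 1))"
      using eventually_gt_at_top[of 0]
    proof eventually_elim
      case (elim n)
      then have "norm (real (n ^ 3) powr (- 1)) = 1 / real n ^ 3" by (simp add: powr_neg_one)
      then show ?case using C2[OF elim, of "s n"] by simp
    qed
  qed
  show "(\<lambda>n. cmod (mp3_energy_tdl X - mp3_energy X (mesh X n (s n)))) \<in> O(\<lambda>n. real (n ^ 3) powr (- 1 / 3))"
  proof (rule bigoI)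
    show "\<forall>\<^sub>F n in sequentially. norm (cmod (mp3_energy_tdl X - mp3_energy X (mesh X n (s n))))
        \<le> C3 * norm (real (n ^ 3) powr (- 1 / 3))"
      using eventually_gt_at_top[of 0]
    proof eventually_elim
      case (elim n)
      have "real (n ^ 3) = real n powr 3" using elim by (simp add: powr_numeral)
      then have "real (n ^ 3) powr (- 1 / 3) = real n powr (3 * (- 1 / 3))" by (simp only: powr_powr)
      also have "\<dots> = 1 / real n" using elim powr_neg_one[of "real n"] by simp
      finally show ?case using C3[OF elim, of "s n"] by simp
    qed
  qed
qed

end
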